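(* For $m\ge1$ let $f_{\mathbb{I}}(m)$ be the number of similarity submodules of the icosian ring $\mathbb{I}$ of index $m^2$, and let $\tau=(1+\sqrt5)/2$. For $x\to\infty$, the asymptotic behaviour of the coefficients $f_{\mathbb{I}}(m)$ is $$\sum_{m\le x}f_{\mathbb{I}}(m)\;\sim\;\frac{6(\log(\tau))^2}{5\sqrt5}\,x^2\log(x)\;\simeq\;0.124271\,x^2\log(x).$$
   Context: $\mathbb{R}^4$ is identified with the real quaternions via the standard basis $1,i,j,k$ ($i^2=j^2=k^2=ijk=-1$). With $\tau=(1+\sqrt5)/2$, let $I$ be the group of 120 quaternions obtained from $(1,0,0,0)$, $\tfrac12(1,1,1,1)$, $\tfrac12(\tau,1,-1/\tau,0)$ by all even permutations of coordinates and arbitrary sign flips; the icosian ring $\mathbb{I}$ is the $\mathbb{Z}$-span of $I$. A subset $M\subset\mathbb{I}$ is a similarity submodule of $\mathbb{I}$ if there are $\alpha\in\mathbb{R}\setminus\{0\}$ and $R\in\mathrm{O}(4)$ with $M=\alpha R(\mathbb{I})\subset\mathbb{I}$. Its index is the group index $[\mathbb{I}:M]$. Similarity submodules are counted as subsets. $A(x)\sim B(x)$ means $A(x)/B(x)\to1$; "$\simeq$" indicates the approximate numerical value of the constant. *)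

theory Defs
  imports "HOL-Analysis.Analysis" "HOL-Library.Landau_Symbols"
begin

definition golden :: real where
  "golden = (1 + sqrt 5) / 2"

text \<open>
  Quaternions are vectors in \<open>real ^ 4\<close>, with coordinates \<open>1, 2, 3, 4\<close> taken with respect to
  the basis \<open>1, i, j, k\<close>.  Only the additive, metric and scalar structure occurs in the notions
  below.
\<close>

definition icosian_seeds :: "(real ^ 4) set" where
  "icosian_seeds =
     {vector [1, 0, 0, 0],
      vector [1/2, 1/2, 1/2, 1/2],
      vector [golden / 2, 1/2, - (1 / golden) / 2, 0]}"

definition icosian_group :: "(real ^ 4) set" where
  "icosian_group =
     {(\<chi> i. \<epsilon> i * v $ \<pi> i) | \<epsilon> v \<pi>.
        v \<in> icosian_seeds \<and> \<pi> permutes UNIV \<and> evenperm \<pi> \<and> (\<forall>i. \<epsilon> i \<in> {1, -1})}"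

definition icosian_ring :: "(real ^ 4) set" where
  "icosian_ring = module.span (\<lambda>(k::int) x. of_int k *\<^sub>R x) icosian_group"

text \<open>
  The number of cosets \<open>x + M\<close> with \<open>x \<in> A\<close>; by the convention for \<open>card\<close>, an infinite index
  becomes 0.
\<close>

definition group_index :: "'a::ab_group_add set \<Rightarrow> 'a set \<Rightarrow> nat" where
  "group_index A M = card {(+) x ` M | x. x \<in> A}"

definition similarity_submodule :: "(real ^ 4) set \<Rightarrow> bool" where
  "similarity_submodule M \<longleftrightarrow>
     M \<subseteq> icosian_ring \<and>
     (\<exists>\<alpha> R. \<alpha> \<noteq> 0 \<and> orthogonal_transformation R \<and> M = (\<lambda>x. \<alpha> *\<^sub>R R x) ` icosian_ring)"

definition f_icosian :: "nat \<Rightarrow> nat" where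
  "f_icosian m = card {M. similarity_submodule M \<and> group_index icosian_ring M = m\<^sup>2}"

lemma vector_4_nth:
  "(vector [a, b, c, d] :: 'a::zero ^ 4) $ 1 = a"
  "(vector [a, b, c, d] :: 'a::zero ^ 4) $ 2 = b"
  "(vector [a, b, c, d] :: 'a::zero ^ 4) $ 3 = c"
  "(vector [a, b, c, d] :: 'a::zero ^ 4) $ 4 = d"
  by (simp_all add: vector_def)

text \<open>Makes the locale facts about \<open>module.span\<close> available for the \<open>\<int>\<close>-span above.\<close>

lemma int_scaleR_module: "module (\<lambda>(k::int) (x::'a::real_vector). of_int k *\<^sub>R x)"
  by unfold_locales (simp_all add: algebra_simps)

end

theory Submission
  imports Defs "HOL-Number_Theory.Number_Theory" "HOL-Real_Asymp.Real_Asymp"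
begin

text \<open>
  Identify the icosian ring with a rank 4 module over \<open>o = \<int>[\<tau>]\<close>.  It is right Euclidean for the norm:
  modulo 2 its coordinates form the extended Hamming code of length 8, whose covering radius is 2.  Hence all
  one-sided ideals are principal, and the similarity submodules are the sets \<open>c a \<I> b\<close> with \<open>c \<in> o\<close> and
  \<open>a\<close>, \<open>b\<close> primitive, the ideals \<open>c o\<close>, \<open>a \<I>\<close> and \<open>\<I> b\<close> being determined by the submodule.

  Counting right ideals by the Hecke recursion at each prime of \<open>o\<close> gives the Dirichlet series
  \<open>\<zeta>(s) \<zeta>(s - 1)\<close> of \<open>K = \<rat>(\<surd>5)\<close> for all right ideals, so \<open>\<zeta>(s) \<zeta>(s - 1) / \<zeta>(2 s)\<close> for the primitive ones
  and \<open>(\<zeta>(s) \<zeta>(s - 1))\<^sup>2 / \<zeta>(2 s)\<close> for the similarity submodules.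

  The sequence is thus a Dirichlet convolution of the coefficients of \<open>\<zeta>(s - 1)\<^sup>2\<close>, whose summatory function is
  asymptotic to \<open>\<rho>\<^sup>2 / 2 * x\<^sup>2 * ln x\<close> with \<open>\<rho> = L(1, \<chi>) = 2 * ln \<tau> / \<surd>5\<close>, and those of
  \<open>\<zeta>(s)\<^sup>2 / \<zeta>(2 s)\<close>, which converges absolutely at \<open>s = 2\<close> with value \<open>3 / \<surd>5\<close>.  There the values
  \<open>L(2, \<chi>)\<close> and \<open>L(4, \<chi>)\<close> come from the reflection formula of the polygamma functions.
\<close>

subsection \<open>The integers of the golden field\<close>

text \<open>The Euclidean step is tight: rounding into the Hamming lattice leaves a square sum of at
  most 7/2, and the norm is at most 5/64 of its square, which gives 245/256 < 1. The trace pairing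
  of the icosian ring is unimodular over \<open>zt\<close>, as its integral dual basis shows. So no
  prime is exceptional, neither 2 nor the divisor of 5, and the local count can be made on the
  quadric \<open>p dvd nr x\<close> modulo \<open>p\<close> without splitting the algebra into
  matrices. Two-term recursions at irreducible elements replace Euler products: right ideals are
  compared with divisor sums, and ideals of \<open>zt\<close> with the character modulo 5. On the
  analytic side limits are taken against harmonic numbers, because these are themselves summatory
  functions and fit summation by parts; \<open>ln\<close> returns only at the end. Dividing by
  zeta(2 s) needs absolute convergence of 1 / zeta at 4. It follows from zeta(2) \<le> 2 for the
  golden field, by bounding the Dirichlet inverse recursively.\<close>

datatype zt = ZT (zfst: int) (zsnd: int)

instantiation zt :: comm_ring_1
begin
definition "0 = ZT 0 0"
definition "1 = ZT 1 0"
definition "x + y = ZT (zfst x + zfst y) (zsnd x + zsnd y)"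
definition "x - y = ZT (zfst x - zfst y) (zsnd x - zsnd y)"
definition "- x = ZT (- zfst x) (- zsnd x)"
definition "x * y = ZT (zfst x * zfst y + zsnd x * zsnd y)
  (zfst x * zsnd y + zsnd x * zfst y + zsnd x * zsnd y)"
instance
  by standard
    (simp_all add: zero_zt_def one_zt_def plus_zt_def minus_zt_def uminus_zt_def times_zt_def
      algebra_simps zt.expand)
end

lemma zt_sel [simp]:
  "zfst 0 = 0" "zsnd 0 = 0" "zfst 1 = 1" "zsnd 1 = 0"
  "zfst (x + y) = zfst x + zfst y" "zsnd (x + y) = zsnd x + zsnd y"
  "zfst (x - y) = zfst x - zfst y" "zsnd (x - y) = zsnd x - zsnd y"
  "zfst (- x) = - zfst x" "zsnd (- x) = - zsnd x"
  "zfst (x * y) = zfst x * zfst y + zsnd x * zsnd y"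
  "zsnd (x * y) = zfst x * zsnd y + zsnd x * zfst y + zsnd x * zsnd y"
  by (simp_all add: zero_zt_def one_zt_def plus_zt_def minus_zt_def uminus_zt_def times_zt_def)

lemma zt_eq_iff: "x = y \<longleftrightarrow> zfst x = zfst y \<and> zsnd x = zsnd y"
  by (cases x; cases y) simp

lemma zt_of_nat [simp]: "zfst (of_nat n) = int n" "zsnd (of_nat n) = 0"
  by (induction n) simp_all

lemma zt_of_int [simp]: "zfst (of_int n) = n" "zsnd (of_int n) = 0"
  by (cases n; simp)+

lemma zt_numeral [simp]: "zfst (numeral n) = numeral n" "zsnd (numeral n) = 0"
  using zt_of_int[of "numeral n"] by simp_all

definition tau :: zt where "tau = ZT 0 1"

lemma tau_sel [simp]: "zfst tau = 0" "zsnd tau = 1"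
  by (simp_all add: tau_def)

lemma tau_sq: "tau * tau = tau + 1"
  by (simp add: zt_eq_iff)

definition zcnj :: "zt \<Rightarrow> zt" where "zcnj x = ZT (zfst x + zsnd x) (- zsnd x)"

definition znorm :: "zt \<Rightarrow> int" where
  "znorm x = zfst x * zfst x + zfst x * zsnd x - zsnd x * zsnd x"

lemma zcnj_sel [simp]: "zfst (zcnj x) = zfst x + zsnd x" "zsnd (zcnj x) = - zsnd x"
  by (simp_all add: zcnj_def)

lemma zcnj_simps [simp]:
  "zcnj 0 = 0" "zcnj 1 = 1" "zcnj (x + y) = zcnj x + zcnj y" "zcnj (x - y) = zcnj x - zcnj y"
  "zcnj (- x) = - zcnj x" "zcnj (x * y) = zcnj x * zcnj y" "zcnj (zcnj x) = x"
  "zcnj (of_int k) = of_int k"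
  by (simp_all add: zt_eq_iff algebra_simps)

lemma znorm_mult: "znorm (x * y) = znorm x * znorm y"
  by (simp add: znorm_def algebra_simps)

lemma mult_zcnj: "x * zcnj x = of_int (znorm x)"
  by (simp add: zt_eq_iff znorm_def algebra_simps)

lemma znorm_simps [simp]: "znorm 0 = 0" "znorm 1 = 1" "znorm (of_int k) = k\<^sup>2"
    "znorm (of_nat n) = (int n)\<^sup>2" "znorm (- x) = znorm x" "znorm (zcnj x) = znorm x"
  by (simp_all add: znorm_def power2_eq_square algebra_simps)

text \<open>For nonzero \<open>n\<close> the exponent of 5 is even on the left and odd on the right:
  the irrationality of the square root of 5.\<close>

lemma five_sq_eq_sq:
  assumes "(m::int)\<^sup>2 = 5 * n\<^sup>2"
  shows "n = 0"
proof (rule ccontr)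
  assume n: "n \<noteq> 0"
  then have m: "m \<noteq> 0" using assms by auto
  have p: "prime (5::int)" by simp
  have "multiplicity 5 (m\<^sup>2) = 2 * multiplicity 5 m"
    using m p by (simp add: prime_elem_multiplicity_power_distrib)
  moreover have "multiplicity 5 (5 * n\<^sup>2) = 1 + 2 * multiplicity 5 n"
    using n p by (simp add: prime_elem_multiplicity_mult_distrib prime_elem_multiplicity_power_distrib)
  ultimately show False unfolding assms by presburger
qed

lemma znorm_eq_0_iff [simp]: "znorm x = 0 \<longleftrightarrow> x = 0"
proof
  assume "znorm x = 0"
  moreover have "(2 * zfst x + zsnd x)\<^sup>2 - 5 * (zsnd x)\<^sup>2 = 4 * znorm x"
    by (simp add: znorm_def power2_eq_square algebra_simps)
  ultimately have "(2 * zfst x + zsnd x)\<^sup>2 = 5 * (zsnd x)\<^sup>2" by simp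
  then have b: "zsnd x = 0" by (rule five_sq_eq_sq)
  with \<open>znorm x = 0\<close> have "zfst x = 0" by (simp add: znorm_def)
  with b show "x = 0" by (simp add: zt_eq_iff)
qed simp

instance zt :: idom
proof
  fix a b :: zt
  assume "a \<noteq> 0" "b \<noteq> 0"
  then have "znorm (a * b) \<noteq> 0" by (simp add: znorm_mult)
  then show "a * b \<noteq> 0" by auto
qed

text \<open>Only exact quotients carry meaning. The instance makes the library facts about units and
  divisibility in \<open>algebraic_semidom\<close> available.\<close>

instantiation zt :: idom_divide
begin
definition "x div y = (if y = 0 then 0 else SOME q. x = q * (y::zt))"
instance by standard (auto simp: divide_zt_def)
end

instance zt :: algebraic_semidom ..

instance zt :: ring_char_0
  by standard (auto simp: inj_def zt_eq_iff)

text \<open>One of the two real embeddings; the other is \<open>zreal\<close> after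
  \<open>zcnj\<close>.\<close>

definition zreal :: "zt \<Rightarrow> real" where "zreal x = of_int (zfst x) + of_int (zsnd x) * golden"

lemma golden_sq: "golden * golden = golden + 1"
  by (simp add: golden_def field_simps)

lemma golden_gt_1: "golden > 1"
proof -
  have "sqrt 5 > 1" by simp
  then show ?thesis by (simp add: golden_def)
qed

lemma zreal_simps [simp]:
  "zreal 0 = 0" "zreal 1 = 1" "zreal (x + y) = zreal x + zreal y" "zreal (x - y) = zreal x - zreal y"
  "zreal (- x) = - zreal x" "zreal (x * y) = zreal x * zreal y" "zreal tau = golden"
  "zreal (of_int k) = of_int k" "zreal (numeral w) = numeral w"
proof -
  show "zreal (x * y) = zreal x * zreal y"
  proof -
    have "zreal (x * y) = of_int (zfst x) * of_int (zfst y) + of_int (zsnd x) * of_int (zsnd y) * (golden * golden)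
       + (of_int (zfst x) * of_int (zsnd y) + of_int (zsnd x) * of_int (zfst y)) * golden"
      by (simp add: zreal_def golden_sq algebra_simps)
    then show ?thesis by (simp add: zreal_def algebra_simps)
  qed
qed (simp_all add: zreal_def algebra_simps)

lemma zreal_eq_0_iff [simp]: "zreal x = 0 \<longleftrightarrow> x = 0"
proof
  assume "zreal x = 0"
  then have "zreal (x * zcnj x) = 0" by simp
  then have "znorm x = 0" by (simp only: mult_zcnj zreal_simps of_int_eq_0_iff)
  then show "x = 0" by simp
qed simp

lemma zreal_inj [simp]: "zreal x = zreal y \<longleftrightarrow> x = y"
  using zreal_eq_0_iff[of "x - y"] by simp

text \<open>For nonzero \<open>x\<close> this is the index of the ideal generated by
  \<open>x\<close>, see \<open>idx_zt\<close>.\<close>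

definition znm :: "zt \<Rightarrow> nat" where "znm x = nat \<bar>znorm x\<bar>"

lemma znm_mult: "znm (x * y) = znm x * znm y"
  by (simp add: znm_def znorm_mult abs_mult nat_mult_distrib)

lemma znm_eq_0_iff [simp]: "znm x = 0 \<longleftrightarrow> x = 0"
  by (simp add: znm_def)

lemma znm_simps [simp]: "znm 0 = 0" "znm 1 = 1" "znm (zcnj x) = znm x" "znm (- x) = znm x"
    "znm (of_nat n) = n\<^sup>2"
  by (simp_all add: znm_def nat_power_eq)

lemma znm_dvd: "x dvd y \<Longrightarrow> znm x dvd znm y"
  by (auto simp: znm_mult)

lemma dvd_znm: "x dvd of_nat (znm x)"
proof -
  have "of_nat (znm x) = (of_int \<bar>znorm x\<bar> :: zt)" by (simp add: znm_def)
  moreover have "x dvd of_int (znorm x)" unfolding mult_zcnj[symmetric] by (rule dvd_triv_left)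
  ultimately show ?thesis by (cases "znorm x \<ge> 0") simp_all
qed

lemma znm_eq_1_iff: "znm x = 1 \<longleftrightarrow> is_unit x"
proof
  assume "znm x = 1"
  then show "is_unit x" using dvd_znm[of x] by simp
next
  assume "is_unit x"
  then have "znm x dvd znm 1" by (rule znm_dvd)
  then show "znm x = 1" by simp
qed

lemma znm_gt_1: "(x::zt) \<noteq> 0 \<Longrightarrow> \<not> is_unit x \<Longrightarrow> znm x > 1"
  using znm_eq_0_iff[of x] znm_eq_1_iff[of x] by linarith

text \<open>Rounding both coordinates of \<open>x * zcnj y / znorm y\<close> leaves errors of at
  most 1/2, on which the norm form is at most 3/4 in absolute value.\<close>

lemma zt_division:
  assumes "y \<noteq> 0"
  shows "\<exists>q. znm (x - q * y) < znm y"
proof -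
  define N where "N = znorm y"
  define z where "z = x * zcnj y"
  have N: "N \<noteq> 0" using assms by (simp add: N_def)
  define r where "r = (\<lambda>k::int. round (real_of_int k / of_int N))"
  have r: "\<bar>of_int k / of_int N - of_int (r k)\<bar> \<le> (1/2::real)" for k
    using of_int_round_abs_le[of "real_of_int k / of_int N"] by (simp add: r_def abs_minus_commute)
  define q where "q = ZT (r (zfst z)) (r (zsnd z))"
  define u where "u = real_of_int (zfst z) / of_int N - of_int (r (zfst z))"
  define v where "v = real_of_int (zsnd z) / of_int N - of_int (r (zsnd z))"
  have uv: "\<bar>u\<bar> \<le> 1/2" "\<bar>v\<bar> \<le> 1/2" using r by (simp_all add: u_def v_def)
  define e where "e = z - q * of_int N"
  have e: "of_int (zfst e) = u * of_int N" "of_int (zsnd e) = v * of_int N"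
    using N by (simp_all add: e_def q_def u_def v_def field_simps)
  have "real_of_int (znorm e) = (u * u + u * v - v * v) * (of_int N)\<^sup>2"
    by (simp add: znorm_def e power2_eq_square algebra_simps)
  moreover have "\<bar>u * u + u * v - v * v\<bar> < 1"
  proof -
    have "\<bar>u * u\<bar> \<le> 1/2 * (1/2)" "\<bar>u * v\<bar> \<le> 1/2 * (1/2)" "\<bar>v * v\<bar> \<le> 1/2 * (1/2)"
      unfolding abs_mult using uv by (intro mult_mono; simp)+
    then show ?thesis by linarith
  qed
  ultimately have "real_of_int \<bar>znorm e\<bar> < (of_int N)\<^sup>2"
    using N by (simp add: abs_mult)
  then have "\<bar>znorm e\<bar> < N\<^sup>2" by (metis of_int_less_iff of_int_power)
  moreover have "e = (x - q * y) * zcnj y"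
  proof -
    have "of_int N = y * zcnj y" by (simp add: N_def mult_zcnj)
    then show ?thesis by (simp add: e_def z_def algebra_simps)
  qed
  then have "\<bar>znorm e\<bar> = \<bar>znorm (x - q * y)\<bar> * \<bar>N\<bar>"
    by (simp add: znorm_mult abs_mult N_def)
  ultimately have "\<bar>znorm (x - q * y)\<bar> * \<bar>N\<bar> < \<bar>N\<bar> * \<bar>N\<bar>"
    by (simp add: power2_eq_square abs_mult_self_eq)
  then have "\<bar>znorm (x - q * y)\<bar> < \<bar>N\<bar>" by (metis abs_ge_zero mult_right_less_imp_less)
  then show ?thesis by (auto simp: znm_def N_def)
qed

lemma zt_ideal_principal:
  assumes "\<And>x y. x \<in> J \<Longrightarrow> y \<in> J \<Longrightarrow> x - y \<in> J" "\<And>x r. x \<in> J \<Longrightarrow> r * x \<in> J" "(0::zt) \<in> J"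
  shows "\<exists>g \<in> J. \<forall>x \<in> J. g dvd x"
proof (cases "J = {0}")
  case False
  with assms(3) have ex: "\<exists>g. g \<in> J \<and> g \<noteq> 0" by blast
  obtain g where g: "g \<in> J" "g \<noteq> 0" "\<And>h. h \<in> J \<Longrightarrow> h \<noteq> 0 \<Longrightarrow> znm g \<le> znm h"
    using ex_has_least_nat[of "\<lambda>g. g \<in> J \<and> g \<noteq> 0" _ znm] ex by (metis (no_types, lifting))
  have "g dvd x" if x: "x \<in> J" for x
  proof -
    obtain q where q: "znm (x - q * g) < znm g" using zt_division[OF g(2)] by blast
    have "x - q * g \<in> J" using assms x g by blast
    then have "x - q * g = 0" using g(3) q by force
    then show ?thesis by (simp add: dvd_def mult.commute)
  qed
  then show ?thesis using g by blast
qed auto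

lemma zt_bezout: "\<exists>g s t. g = s * x + t * y \<and> g dvd x \<and> g dvd (y::zt)"
proof -
  let ?J = "{s * x + t * y | s t. True}"
  have "\<exists>g \<in> ?J. \<forall>x \<in> ?J. g dvd x"
  proof (rule zt_ideal_principal)
    fix u v assume "u \<in> ?J" "v \<in> ?J"
    then obtain s t s' t' where "u = s * x + t * y" "v = s' * x + t' * y" by blast
    then have "u - v = (s - s') * x + (t - t') * y" by (simp add: algebra_simps)
    then show "u - v \<in> ?J" by blast
  next
    fix u r assume "u \<in> ?J"
    then obtain s t where "u = s * x + t * y" by blast
    then have "r * u = (r * s) * x + (r * t) * y" by (simp add: algebra_simps)
    then show "r * u \<in> ?J" by blast
  next
    have "0 = 0 * x + 0 * y" by simp
    then show "0 \<in> ?J" by blast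
  qed
  then obtain g where g: "g \<in> ?J" "\<forall>x \<in> ?J. g dvd x" by blast
  have "x = 1 * x + 0 * y" "y = 0 * x + 1 * y" by simp_all
  then have "x \<in> ?J" "y \<in> ?J" by blast+
  with g show ?thesis by blast
qed

lemma irreducible_imp_coprime_bezout:
  assumes "irreducible (p::zt)" "\<not> p dvd x"
  shows "\<exists>s t. s * p + t * x = 1"
proof -
  obtain g s t where g: "g = s * p + t * x" "g dvd p" "g dvd x" using zt_bezout by blast
  have "is_unit g"
  proof (rule ccontr)
    assume ng: "\<not> is_unit g"
    obtain h where h: "p = g * h" using g by blast
    then have "is_unit h" using assms(1) ng irreducibleD by blast
    then have "p dvd g" using h by (metis dvd_mult_unit_iff dvd_refl)
    then show False using g assms dvd_trans by blast
  qed
  then obtain u where "1 = g * u" by blast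
  then have "(s * u) * p + (t * u) * x = 1" using g(1) by (simp add: algebra_simps)
  then show ?thesis by blast
qed

lemma irreducible_prime_dvd:
  assumes "irreducible (p::zt)" "p dvd x * y"
  shows "p dvd x \<or> p dvd y"
proof (rule ccontr)
  assume c: "\<not> (p dvd x \<or> p dvd y)"
  then obtain s t where st: "s * p + t * x = 1" using irreducible_imp_coprime_bezout assms by blast
  obtain k where k: "x * y = p * k" using assms(2) by blast
  have "y = (s * p + t * x) * y" by (simp add: st)
  also have "\<dots> = p * (s * y) + t * (x * y)" by (simp add: algebra_simps)
  also have "\<dots> = p * (s * y + t * k)" unfolding k by (simp add: algebra_simps)
  finally have "p dvd y" by (rule dvdI)
  with c show False by blast
qed

lemma exists_irreducible_divisor:
  assumes "(x::zt) \<noteq> 0" "\<not> is_unit x"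
  shows "\<exists>p. irreducible p \<and> p dvd x"
  using assms
proof (induction "znm x" arbitrary: x rule: less_induct)
  case less
  show ?case
  proof (cases "irreducible x")
    case False
    then obtain a b where ab: "x = a * b" "\<not> is_unit a" "\<not> is_unit b"
      using less.prems by (auto simp: irreducible_def)
    have "a \<noteq> 0" "b \<noteq> 0" using ab less.prems by auto
    then have "znm a > 0" "znm b > 1" using ab znm_gt_1[of b] znm_eq_0_iff[of a] by linarith+
    then have "znm a < znm x" by (simp add: ab znm_mult)
    from less.hyps[OF this \<open>a \<noteq> 0\<close> ab(2)] obtain p where "irreducible p" "p dvd a" by blast
    then show ?thesis unfolding ab(1) using dvd_mult2 by blast
  qed (use dvd_refl in blast)
qed

subsection \<open>The icosian ring and its one-sided ideals\<close>

text \<open>Coordinates over \<open>\<int>[\<tau>]\<close> with respect to the basis \<open>1\<close>, \<open>i\<close>, \<open>h\<close>, \<open>i h\<close> of the icosian ring,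
  where \<open>h = (\<tau> + i + (\<tau> - 1) j) / 2\<close>.\<close>

datatype ico = Ico (q0: zt) (q1: zt) (q2: zt) (q3: zt)

instantiation ico :: ring_1
begin
definition "0 = Ico 0 0 0 0"
definition "1 = Ico 1 0 0 0"
definition "x + y = Ico (q0 x + q0 y) (q1 x + q1 y) (q2 x + q2 y) (q3 x + q3 y)"
definition "x - y = Ico (q0 x - q0 y) (q1 x - q1 y) (q2 x - q2 y) (q3 x - q3 y)"
definition "- x = Ico (- q0 x) (- q1 x) (- q2 x) (- q3 x)"
text \<open>The table determined by i^2 = -1, h^2 = \<open>tau\<close> h - 1 and h i = -1 +
  \<open>tau\<close> i - i h.\<close>

definition "x * y = Ico
  (q0 x * q0 y - q1 x * q1 y - (q2 x + tau * q3 x) * q1 y - (q2 x * q2 y + q3 x * q3 y))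
  (q0 x * q1 y + q1 x * q0 y + (tau * q2 x - q3 x) * q1 y - (q3 x * q2 y - q2 x * q3 y))
  (q0 x * q2 y - q1 x * q3 y + q2 x * q0 y + q3 x * q1 y + tau * (q2 x * q2 y + q3 x * q3 y)
    - (q2 x + tau * q3 x) * q3 y)
  (q0 x * q3 y + q1 x * q2 y + q3 x * q0 y - q2 x * q1 y + tau * (q3 x * q2 y - q2 x * q3 y)
    + (tau * q2 x - q3 x) * q3 y)"
instance
  by standard
    (simp_all add: zero_ico_def one_ico_def plus_ico_def minus_ico_def uminus_ico_def times_ico_def
      algebra_simps ico.expand)
end

lemma ico_sel [simp]:
  "q0 0 = 0" "q1 0 = 0" "q2 0 = 0" "q3 0 = 0" "q0 1 = 1" "q1 1 = 0" "q2 1 = 0" "q3 1 = 0"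
  "q0 (x + y) = q0 x + q0 y" "q1 (x + y) = q1 x + q1 y"
  "q2 (x + y) = q2 x + q2 y" "q3 (x + y) = q3 x + q3 y"
  "q0 (x - y) = q0 x - q0 y" "q1 (x - y) = q1 x - q1 y"
  "q2 (x - y) = q2 x - q2 y" "q3 (x - y) = q3 x - q3 y"
  "q0 (- x) = - q0 x" "q1 (- x) = - q1 x" "q2 (- x) = - q2 x" "q3 (- x) = - q3 x"
  by (simp_all add: zero_ico_def one_ico_def plus_ico_def minus_ico_def uminus_ico_def)

lemma ico_mult_sel:
  "q0 (x * y) = q0 x * q0 y - q1 x * q1 y - (q2 x + tau * q3 x) * q1 y - (q2 x * q2 y + q3 x * q3 y)"
  "q1 (x * y) = q0 x * q1 y + q1 x * q0 y + (tau * q2 x - q3 x) * q1 y - (q3 x * q2 y - q2 x * q3 y)"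
  "q2 (x * y) = q0 x * q2 y - q1 x * q3 y + q2 x * q0 y + q3 x * q1 y
    + tau * (q2 x * q2 y + q3 x * q3 y) - (q2 x + tau * q3 x) * q3 y"
  "q3 (x * y) = q0 x * q3 y + q1 x * q2 y + q3 x * q0 y - q2 x * q1 y
    + tau * (q3 x * q2 y - q2 x * q3 y) + (tau * q2 x - q3 x) * q3 y"
  by (simp_all add: times_ico_def)

lemma ico_eq_iff: "x = y \<longleftrightarrow> q0 x = q0 y \<and> q1 x = q1 y \<and> q2 x = q2 y \<and> q3 x = q3 y"
  by (cases x; cases y) simp

definition sc :: "zt \<Rightarrow> ico" where "sc a = Ico a 0 0 0"

lemma sc_sel [simp]: "q0 (sc a) = a" "q1 (sc a) = 0" "q2 (sc a) = 0" "q3 (sc a) = 0"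
  by (simp_all add: sc_def)

lemma sc_mult_sel [simp]:
  "q0 (sc a * x) = a * q0 x" "q1 (sc a * x) = a * q1 x"
  "q2 (sc a * x) = a * q2 x" "q3 (sc a * x) = a * q3 x"
  by (simp_all add: ico_mult_sel)

lemma sc_simps [simp]:
  "sc 0 = 0" "sc 1 = 1" "sc (- a) = - sc a" "sc a = sc b \<longleftrightarrow> a = b"
  by (auto simp: ico_eq_iff)

lemma sc_eq_0_iff [simp]: "sc a = 0 \<longleftrightarrow> a = 0"
  by (simp add: ico_eq_iff)

lemma sc_mult: "sc (a * b) = sc a * sc b"
  by (simp add: ico_eq_iff)

lemma sc_comm: "x * sc a = sc a * x"
  by (simp add: ico_eq_iff ico_mult_sel algebra_simps)

lemma sc_left_comm: "x * (sc a * y) = sc a * (x * y)"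
  by (simp only: mult.assoc[symmetric] sc_comm)

definition cnj :: "ico \<Rightarrow> ico" where
  "cnj x = Ico (q0 x + tau * q2 x - q3 x) (- q1 x) (- q2 x) (- q3 x)"

definition trc :: "ico \<Rightarrow> zt" where "trc x = 2 * q0 x + tau * q2 x - q3 x"

definition nr :: "ico \<Rightarrow> zt" where
  "nr x = q0 x * q0 x + q1 x * q1 x + q2 x * q2 x + q3 x * q3 x
    + tau * (q0 x * q2 x) - q0 x * q3 x + q1 x * q2 x + tau * (q1 x * q3 x)"

lemma cnj_sel [simp]: "q0 (cnj x) = q0 x + tau * q2 x - q3 x"
  "q1 (cnj x) = - q1 x" "q2 (cnj x) = - q2 x" "q3 (cnj x) = - q3 x"
  by (simp_all add: cnj_def)

lemma cnj_simps [simp]: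
  "cnj 0 = 0" "cnj 1 = 1" "cnj (x + y) = cnj x + cnj y" "cnj (x - y) = cnj x - cnj y"
  "cnj (- x) = - cnj x" "cnj (sc a) = sc a" "cnj (cnj x) = x"
  by (simp_all add: ico_eq_iff algebra_simps)

lemma cnj_mult [simp]: "cnj (x * y) = cnj y * cnj x"
  unfolding ico_eq_iff ico_mult_sel cnj_sel by (simp add: algebra_simps)

lemma mult_cnj: "x * cnj x = sc (nr x)" and cnj_mult_self: "cnj x * x = sc (nr x)"
  unfolding ico_eq_iff ico_mult_sel cnj_sel sc_sel nr_def by (simp_all add: algebra_simps)

lemma cnj_eq_trc: "cnj x = sc (trc x) - x"
  by (simp add: ico_eq_iff trc_def algebra_simps)

lemma cnj_inj [simp]: "cnj x = cnj y \<longleftrightarrow> x = y"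
  by (metis cnj_simps(7))

lemma nr_mult: "nr (x * y) = nr x * nr y"
proof -
  have "sc (nr (x * y)) = x * (y * cnj y) * cnj x"
    unfolding mult_cnj[symmetric] by (simp add: mult.assoc)
  also have "\<dots> = sc (nr y) * (x * cnj x)"
    by (simp only: mult_cnj[of y] sc_comm[of x] mult.assoc)
  also have "\<dots> = sc (nr x * nr y)"
    by (simp only: mult_cnj sc_mult[symmetric] mult.commute)
  finally show ?thesis by simp
qed

lemma nr_simps [simp]: "nr 0 = 0" "nr 1 = 1" "nr (sc a) = a * a" "nr (cnj x) = nr x" "nr (- x) = nr x"
  by (simp_all add: nr_def algebra_simps)

lemma trc_simps [simp]: "trc 0 = 0" "trc 1 = 2" "trc (x + y) = trc x + trc y" "trc (x - y) = trc x - trc y"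
  "trc (- x) = - trc x" "trc (sc a * x) = a * trc x" "trc (sc a) = 2 * a" "trc (cnj x) = trc x"
  by (simp_all add: trc_def algebra_simps)

lemma trc_mult_comm: "trc (x * y) = trc (y * x)"
  by (simp add: trc_def ico_mult_sel algebra_simps)

text \<open>Polarisation: \<open>trc (cnj x * y)\<close> is the bilinear form belonging to
  \<open>nr\<close>.\<close>

lemma nr_add: "nr (x + y) = nr x + nr y + trc (cnj x * y)"
  by (simp add: nr_def trc_def ico_mult_sel algebra_simps)

text \<open>Twice the quaternion coordinates: \<open>2 x = Y1 x + Y2 x i + Y3 x j + Y4 x k\<close>.\<close>

definition Y1 :: "ico \<Rightarrow> zt" where "Y1 x = 2 * q0 x + tau * q2 x - q3 x"
definition Y2 :: "ico \<Rightarrow> zt" where "Y2 x = 2 * q1 x + q2 x + tau * q3 x"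
definition Y3 :: "ico \<Rightarrow> zt" where "Y3 x = (tau - 1) * q2 x"
definition Y4 :: "ico \<Rightarrow> zt" where "Y4 x = (tau - 1) * q3 x"

lemmas Y_defs = Y1_def Y2_def Y3_def Y4_def

lemma Y_nr: "4 * nr x = Y1 x * Y1 x + Y2 x * Y2 x + Y3 x * Y3 x + Y4 x * Y4 x"
proof -
  have t': "tau * (tau * x) = (tau + 1) * x" for x by (simp add: tau_sq flip: mult.assoc)
  show ?thesis by (simp add: nr_def Y_defs algebra_simps t' tau_sq)
qed

lemma Y_eq_iff: "x = y \<longleftrightarrow> Y1 x = Y1 y \<and> Y2 x = Y2 y \<and> Y3 x = Y3 y \<and> Y4 x = Y4 y"
proof -
  have "tau - 1 \<noteq> 0" by (simp add: zt_eq_iff)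
  then show ?thesis by (auto simp: ico_eq_iff Y_defs)
qed

lemma tau_inv: "(tau - 1) * (tau * x) = x"
proof -
  have "(tau - 1) * (tau * x) = (tau * tau - tau) * x" by (simp add: algebra_simps)
  then show ?thesis by (simp add: tau_sq)
qed

text \<open>Two congruences modulo 2 cut the icosian ring out of the half-integral coordinates. Read
  bit by bit they become the four parity checks of \<open>e8_exists\<close>.\<close>

lemma Y_exists:
  assumes "2 dvd y1 - (tau + 1) * y3 + tau * y4" "2 dvd y2 - tau * y3 - (tau + 1) * y4"
  shows "\<exists>x. Y1 x = y1 \<and> Y2 x = y2 \<and> Y3 x = y3 \<and> Y4 x = y4"
proof -
  obtain a b where a: "y1 - (tau + 1) * y3 + tau * y4 = 2 * a" and b: "y2 - tau * y3 - (tau + 1) * y4 = 2 * b"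
    using assms by (auto elim!: dvdE)
  have t: "tau * (tau * x) = (tau + 1) * x" for x by (simp add: tau_sq flip: mult.assoc)
  have "Y1 (Ico a b (tau * y3) (tau * y4)) = y1" "Y2 (Ico a b (tau * y3) (tau * y4)) = y2"
    by (simp_all add: Y_defs flip: a b) (simp_all add: t algebra_simps tau_sq)
  moreover have "Y3 (Ico a b (tau * y3) (tau * y4)) = y3" "Y4 (Ico a b (tau * y3) (tau * y4)) = y4"
    by (simp_all add: Y_defs tau_inv)
  ultimately show ?thesis by blast
qed

text \<open>The norm is the product of the two real embeddings, and each of them maps the expression
  to a sum of real squares.\<close>

lemma sum_squares_zt_nonneg:
  "znorm (a * a + b * b + c * c + d * d) \<ge> 0"
  and sum_squares_zt_eq_0: "a * a + b * b + c * c + d * d = 0 \<Longrightarrow> a = 0 \<and> b = 0 \<and> c = 0 \<and> d = (0::zt)"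
proof -
  let ?s = "\<lambda>a b c d. zreal (a * a + b * b + c * c + d * d :: zt)"
  have "of_int (znorm (a * a + b * b + c * c + d * d)) = ?s a b c d * ?s (zcnj a) (zcnj b) (zcnj c) (zcnj d)"
    using arg_cong[OF mult_zcnj[of "a * a + b * b + c * c + d * d"], of zreal] by simp
  also have "\<dots> \<ge> 0" by (intro mult_nonneg_nonneg) simp_all
  finally show "znorm (a * a + b * b + c * c + d * d) \<ge> 0" by simp
  assume "a * a + b * b + c * c + d * d = 0"
  then have "?s a b c d = 0" by (metis zreal_simps(1))
  then have "zreal a * zreal a + zreal b * zreal b + zreal c * zreal c + zreal d * zreal d = 0" by simp
  then have "zreal a = 0 \<and> zreal b = 0 \<and> zreal c = 0 \<and> zreal d = 0"
    by (simp add: add_nonneg_eq_0_iff)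
  then show "a = 0 \<and> b = 0 \<and> c = 0 \<and> d = 0" by simp
qed

lemma nr_eq_0_iff [simp]: "nr x = 0 \<longleftrightarrow> x = 0"
proof
  assume "nr x = 0"
  then have "Y1 x * Y1 x + Y2 x * Y2 x + Y3 x * Y3 x + Y4 x * Y4 x = 0" using Y_nr[of x] by simp
  then have "Y1 x = 0 \<and> Y2 x = 0 \<and> Y3 x = 0 \<and> Y4 x = 0" by (rule sum_squares_zt_eq_0)
  then show "x = 0" by (subst Y_eq_iff) (simp add: Y_defs)
qed simp

instance ico :: ring_1_no_zero_divisors
proof
  fix a b :: ico
  assume "a \<noteq> 0" "b \<noteq> 0"
  then have "nr (a * b) \<noteq> 0" by (simp add: nr_mult)
  then show "a * b \<noteq> 0" by auto
qed


section \<open>Dual bases for the trace pairing\<close>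

definition bas1 :: ico where "bas1 = Ico 0 1 0 0"
definition bas2 :: ico where "bas2 = Ico 0 0 1 0"
definition bas3 :: ico where "bas3 = Ico 0 0 0 1"
text \<open>The basis dual to 1, \<open>bas1\<close>, \<open>bas2\<close>, \<open>bas3\<close> under
  the pairing \<open>trc (x * y)\<close>. That it is integral expresses unimodularity of the
  pairing.\<close>

definition dual0 :: ico where "dual0 = Ico (- 1 - 2 * tau) 0 (1 + 2 * tau) (- 1 - tau)"
definition dual1 :: ico where "dual1 = Ico 0 (- 2 - 2 * tau) (1 + tau) (1 + 2 * tau)"
definition dual2 :: ico where "dual2 = Ico (1 + 2 * tau) (1 + tau) (- 2 - 2 * tau) 0"
definition dual3 :: ico where "dual3 = Ico (- 1 - tau) (1 + 2 * tau) 0 (- 2 - 2 * tau)"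

text \<open>A Casimir identity: it places \<open>sc (trc x)\<close> in the two-sided ideal generated
  by \<open>x\<close>.\<close>

lemma dual_basis_trc: "1 * x * dual0 + bas1 * x * dual1 + bas2 * x * dual2 + bas3 * x * dual3 = sc (trc x)"
proof -
  have t: "tau * tau = tau + 1" by (rule tau_sq)
  have t': "tau * (tau * x) = (tau + 1) * x" for x by (simp add: tau_sq flip: mult.assoc)
  show ?thesis
    unfolding ico_eq_iff ico_mult_sel ico_sel sc_sel bas1_def bas2_def bas3_def dual0_def dual1_def dual2_def dual3_def trc_def
    by (simp add: algebra_simps t t')
qed

lemma dual_basis_expand:
  "x = sc (trc (x * dual0)) + sc (trc (x * dual1)) * bas1 + sc (trc (x * dual2)) * bas2 + sc (trc (x * dual3)) * bas3"
proof -
  have t: "tau * tau = tau + 1" by (rule tau_sq)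
  have t': "tau * (tau * x) = (tau + 1) * x" for x by (simp add: tau_sq flip: mult.assoc)
  show ?thesis
    unfolding ico_eq_iff ico_mult_sel ico_sel sc_sel bas1_def bas2_def bas3_def dual0_def dual1_def dual2_def dual3_def trc_def
    by (simp add: algebra_simps t t')
qed

text \<open>The extended Hamming code of length 8 has covering radius 2.\<close>

lemma hamming_covering:
  "\<exists>F\<subseteq>{..<8::nat}. card F \<le> 2 \<and>
     s1 = ((0 \<in> F) \<noteq> ((1 \<in> F) \<noteq> ((4 \<in> F) \<noteq> (7 \<in> F)))) \<and>
     s2 = ((1 \<in> F) \<noteq> ((4 \<in> F) \<noteq> ((5 \<in> F) \<noteq> (6 \<in> F)))) \<and>
     s3 = ((2 \<in> F) \<noteq> ((3 \<in> F) \<noteq> ((5 \<in> F) \<noteq> (6 \<in> F)))) \<and>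
     s4 = ((3 \<in> F) \<noteq> ((4 \<in> F) \<noteq> ((6 \<in> F) \<noteq> (7 \<in> F))))"
  apply (cases s1; cases s2; cases s3; cases s4)
  apply (rule exI[of _ "{0, 6}"], simp)
  apply (rule exI[of _ "{0, 5}"], simp)
  apply (rule exI[of _ "{4}"], simp)
  apply (rule exI[of _ "{1}"], simp)
  apply (rule exI[of _ "{0, 3}"], simp)
  apply (rule exI[of _ "{0, 2}"], simp)
  apply (rule exI[of _ "{7}"], simp)
  apply (rule exI[of _ "{0}"], simp)
  apply (rule exI[of _ "{6}"], simp)
  apply (rule exI[of _ "{5}"], simp)
  apply (rule exI[of _ "{0, 4}"], simp)
  apply (rule exI[of _ "{0, 1}"], simp)
  apply (rule exI[of _ "{3}"], simp)
  apply (rule exI[of _ "{2}"], simp)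
  apply (rule exI[of _ "{0, 7}"], simp)
  apply (rule exI[of _ "{}"], simp)
  done

text \<open>Rounding costs at most 1/4 in each of eight coordinates. At most two coordinates are
  then moved to the neighbouring integer on the other side of \<open>y\<close>, so as to cancel the
  syndrome; this raises their error to at most 1, that is by 3/4 each, and 2 + 2 * 3/4 =
  7/2.\<close>

lemma hamming_lattice_covering:
  fixes y :: "nat \<Rightarrow> real"
  shows "\<exists>R :: nat \<Rightarrow> int. (\<Sum>k<8. (y k - R k)\<^sup>2) \<le> 7/2 \<and>
    even (R 0 + R 1 + R 4 + R 7) \<and> even (R 1 + R 4 + R 5 + R 6) \<and>
    even (R 2 + R 3 + R 5 + R 6) \<and> even (R 3 + R 4 + R 6 + R 7)"
proof -
  define r where "r k = round (y k)" for k
  define d :: "nat \<Rightarrow> int" where "d k = (if y k \<ge> r k then 1 else -1)" for k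
  have rd: "\<bar>y k - r k\<bar> \<le> 1/2" "\<bar>y k - (r k + d k)\<bar> \<le> 1" "odd (d k)" for k
  proof -
    show 1: "\<bar>y k - r k\<bar> \<le> 1/2"
      using of_int_round_abs_le[of "y k"] by (simp add: r_def abs_minus_commute)
    show "odd (d k)" by (simp add: d_def)
    show "\<bar>y k - (r k + d k)\<bar> \<le> 1"
    proof (cases "y k \<ge> r k")
      case True
      then have "real_of_int (d k) = 1" by (simp add: d_def)
      then show ?thesis using 1 True by linarith
    next
      case False
      then have "real_of_int (d k) = -1" by (simp add: d_def)
      then show ?thesis using 1 False by linarith
    qed
  qed
  obtain F where F: "F \<subseteq> {..<8::nat}" "card F \<le> 2"
     "odd (r 0 + r 1 + r 4 + r 7) = ((0 \<in> F) \<noteq> ((1 \<in> F) \<noteq> ((4 \<in> F) \<noteq> (7 \<in> F))))"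
     "odd (r 1 + r 4 + r 5 + r 6) = ((1 \<in> F) \<noteq> ((4 \<in> F) \<noteq> ((5 \<in> F) \<noteq> (6 \<in> F))))"
     "odd (r 2 + r 3 + r 5 + r 6) = ((2 \<in> F) \<noteq> ((3 \<in> F) \<noteq> ((5 \<in> F) \<noteq> (6 \<in> F))))"
     "odd (r 3 + r 4 + r 6 + r 7) = ((3 \<in> F) \<noteq> ((4 \<in> F) \<noteq> ((6 \<in> F) \<noteq> (7 \<in> F))))"
    using hamming_covering[of "odd (r 0 + r 1 + r 4 + r 7)" "odd (r 1 + r 4 + r 5 + r 6)"
      "odd (r 2 + r 3 + r 5 + r 6)" "odd (r 3 + r 4 + r 6 + r 7)"] by blast
  define R where "R k = r k + (if k \<in> F then d k else 0)" for k
  have ev: "even (R k) = (even (r k) \<noteq> (k \<in> F))" for k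
    using rd(3)[of k] by (simp add: R_def)
  have le: "(y k - R k)\<^sup>2 \<le> 1/4 + (if k \<in> F then 3/4 else 0)" for k
  proof -
    have "\<bar>y k - R k\<bar> \<le> (if k \<in> F then 1 else 1/2)"
      using rd(1,2)[of k] by (simp add: R_def)
    then have "\<bar>y k - R k\<bar>\<^sup>2 \<le> (if k \<in> F then 1 else 1/2)\<^sup>2"
      by (rule power_mono) simp
    then show ?thesis by (cases "k \<in> F") (simp_all add: power2_eq_square)
  qed
  have "(\<Sum>k<8. (y k - R k)\<^sup>2) \<le> (\<Sum>k<8. 1/4 + (if k \<in> F then 3/4 else 0))"
    by (intro sum_mono le)
  also have "\<dots> = 2 + real (card F) * (3/4)"
    unfolding sum.distrib using F(1) by (simp add: sum.If_cases Int_absorb1)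
  also have "\<dots> \<le> 7/2" using F(2) by simp
  finally have "(\<Sum>k<8. (y k - R k)\<^sup>2) \<le> 7/2" .
  moreover have "even (R 0 + R 1 + R 4 + R 7) \<and> even (R 1 + R 4 + R 5 + R 6) \<and>
    even (R 2 + R 3 + R 5 + R 6) \<and> even (R 3 + R 4 + R 6 + R 7)"
    using F(3-6) unfolding even_add ev by argo
  ultimately show ?thesis by blast
qed

lemma zt_two_dvd: "2 dvd (x::zt) \<longleftrightarrow> even (zfst x) \<and> even (zsnd x)"
proof
  assume "even (zfst x) \<and> even (zsnd x)"
  then obtain a b where "zfst x = 2 * a" "zsnd x = 2 * b" by (auto elim!: evenE)
  then have "x = 2 * ZT a b" by (simp add: zt_eq_iff)
  then show "2 dvd x" by (rule dvdI)
qed (auto elim!: dvdE)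

text \<open>For y = a + b \<open>tau\<close> the pair a + b, b satisfies (a + b)^2 + b^2 =
  \<open>zfst (y * y) + zsnd (y * y)\<close>. So the sum of the eight squares is a linear form in
  the coordinates of \<open>4 * nr x\<close>.\<close>

definition e8 :: "nat \<Rightarrow> ico \<Rightarrow> int" where
  "e8 k x = [zfst (Y1 x) + zsnd (Y1 x), zsnd (Y1 x), zfst (Y2 x) + zsnd (Y2 x), zsnd (Y2 x),
    zfst (Y3 x) + zsnd (Y3 x), zsnd (Y3 x), zfst (Y4 x) + zsnd (Y4 x), zsnd (Y4 x)] ! k"

lemma lessThan_8: "{..<8::nat} = {0, 1, 2, 3, 4, 5, 6, 7}" by auto

lemma e8_exists:
  assumes "even (R 0 + R 1 + R 4 + R 7)" "even (R 1 + R 4 + R 5 + R 6)"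
    "even (R 2 + R 3 + R 5 + R 6)" "even (R 3 + R 4 + R 6 + R 7)"
  shows "\<exists>x. \<forall>k<8. e8 k x = R k"
proof -
  have "\<exists>x. Y1 x = ZT (R 0 - R 1) (R 1) \<and> Y2 x = ZT (R 2 - R 3) (R 3) \<and>
    Y3 x = ZT (R 4 - R 5) (R 5) \<and> Y4 x = ZT (R 6 - R 7) (R 7)"
  proof (rule Y_exists)
    show "2 dvd ZT (R 0 - R 1) (R 1) - (tau + 1) * ZT (R 4 - R 5) (R 5) + tau * ZT (R 6 - R 7) (R 7)"
      using assms unfolding zt_two_dvd by (simp; argo)
    show "2 dvd ZT (R 2 - R 3) (R 3) - tau * ZT (R 4 - R 5) (R 5) - (tau + 1) * ZT (R 6 - R 7) (R 7)"
      using assms unfolding zt_two_dvd by (simp; argo)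
  qed
  then obtain x where "Y1 x = ZT (R 0 - R 1) (R 1)" "Y2 x = ZT (R 2 - R 3) (R 3)"
    "Y3 x = ZT (R 4 - R 5) (R 5)" "Y4 x = ZT (R 6 - R 7) (R 7)" by blast
  then have "\<forall>k\<in>{..<8}. e8 k x = R k" unfolding lessThan_8 by (simp add: e8_def)
  then show ?thesis by auto
qed

lemma e8_diff: "k < 8 \<Longrightarrow> e8 k (x - sc (of_int m) * y) = e8 k x - m * e8 k y"
proof -
  have "\<forall>k\<in>{..<8}. e8 k (x - sc (of_int m) * y) = e8 k x - m * e8 k y"
    unfolding lessThan_8 by (simp add: e8_def Y_defs algebra_simps)
  then show "k < 8 \<Longrightarrow> e8 k (x - sc (of_int m) * y) = e8 k x - m * e8 k y" by auto
qed

text \<open>If \<open>4 * nr x\<close> is s + t \<open>tau\<close>, the square sum is E = s + t, and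
  four times the norm of s + t \<open>tau\<close> is 5 E^2 - (s + 3 t)^2. The factor 64 is 4 times
  the norm 16 of 4.\<close>

lemma znorm_nr_e8: "64 * \<bar>znorm (nr x)\<bar> \<le> 5 * (\<Sum>k<8. (e8 k x)\<^sup>2)\<^sup>2"
proof -
  define S where "S = Y1 x * Y1 x + Y2 x * Y2 x + Y3 x * Y3 x + Y4 x * Y4 x"
  define E where "E = (\<Sum>k<8. (e8 k x)\<^sup>2)"
  have E: "E = zfst S + zsnd S"
    unfolding E_def S_def lessThan_8 by (simp add: e8_def power2_eq_square algebra_simps)
  have "4 * nr x = S" by (simp add: S_def Y_nr)
  then have "znorm (4 * nr x) = znorm S" by simp
  then have n: "16 * znorm (nr x) = znorm S" by (simp add: znorm_def algebra_simps)
  have "znorm S \<ge> 0" unfolding S_def by (rule sum_squares_zt_nonneg)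
  have "4 * znorm S + (zfst S + 3 * zsnd S)\<^sup>2 = 5 * E\<^sup>2"
    unfolding E znorm_def power2_eq_square by (simp add: algebra_simps)
  then have "4 * znorm S \<le> 5 * E\<^sup>2" by (smt (verit) zero_le_power2)
  then show ?thesis using n \<open>znorm S \<ge> 0\<close> by (simp add: E_def)
qed

text \<open>The covering bound 7/2 meets the factor 5/64: 5/64 * (7/2)^2 = 245/256, just below
  1.\<close>

lemma ico_approx:
  assumes "m \<noteq> 0"
  shows "\<exists>q. \<bar>znorm (nr (z - sc (of_int m) * q))\<bar> < m ^ 4"
proof -
  obtain R :: "nat \<Rightarrow> int" where R: "(\<Sum>k<8. (e8 k z / m - R k)\<^sup>2) \<le> 7/2"
    "even (R 0 + R 1 + R 4 + R 7)" "even (R 1 + R 4 + R 5 + R 6)"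
    "even (R 2 + R 3 + R 5 + R 6)" "even (R 3 + R 4 + R 6 + R 7)"
    using hamming_lattice_covering[of "\<lambda>k. e8 k z / m"] by auto
  obtain q where q: "\<And>k. k < 8 \<Longrightarrow> e8 k q = R k" using e8_exists[OF R(2-5)] by blast
  define E where "E = (\<Sum>k<8. (e8 k (z - sc (of_int m) * q))\<^sup>2)"
  have "real_of_int E = (\<Sum>k<8. m\<^sup>2 * (e8 k z / m - R k)\<^sup>2)"
    unfolding E_def of_int_sum
  proof (rule sum.cong)
    fix k :: nat assume "k \<in> {..<8}"
    then have "e8 k (z - sc (of_int m) * q) = e8 k z - m * R k" using e8_diff q by simp
    then have "real_of_int (e8 k (z - sc (of_int m) * q)) = real_of_int (e8 k z) - real_of_int m * R k"
      by (simp only: of_int_diff of_int_mult)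
    also have "\<dots> = m * (e8 k z / m - R k)" using assms by (simp add: field_simps)
    finally have "real_of_int (e8 k (z - sc (of_int m) * q)) = m * (e8 k z / m - R k)" .
    then show "real_of_int ((e8 k (z - sc (of_int m) * q))\<^sup>2) = m\<^sup>2 * (e8 k z / m - R k)\<^sup>2"
      by (simp only: of_int_power power_mult_distrib)
  qed simp
  also have "\<dots> = m\<^sup>2 * (\<Sum>k<8. (e8 k z / m - R k)\<^sup>2)" by (simp add: sum_distrib_left)
  also have "\<dots> \<le> m\<^sup>2 * (7/2)" using R(1) by (intro mult_left_mono) auto
  finally have "2 * E \<le> 7 * m\<^sup>2" by linarith
  moreover have "E \<ge> 0" by (simp add: E_def sum_nonneg)
  ultimately have "(2 * E)\<^sup>2 \<le> (7 * m\<^sup>2)\<^sup>2" by (intro power_mono) auto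
  then have "4 * E\<^sup>2 \<le> 49 * m ^ 4" by (simp add: power2_eq_square power4_eq_xxxx)
  moreover have "64 * \<bar>znorm (nr (z - sc (of_int m) * q))\<bar> \<le> 5 * E\<^sup>2"
    unfolding E_def by (rule znorm_nr_e8)
  moreover have "m ^ 4 > 0" using assms by simp
  ultimately have "\<bar>znorm (nr (z - sc (of_int m) * q))\<bar> < m ^ 4" by linarith
  then show ?thesis by blast
qed

text \<open>Multiplication by \<open>sc (zcnj n) * cnj y\<close> turns \<open>y\<close> into the
  rational integer \<open>m\<close>, the case of \<open>ico_approx\<close>. It scales the norm of
  the remainder by \<open>m ^ 3\<close>, which cancels against \<open>m ^ 4\<close>.\<close>

lemma ico_division:
  assumes "y \<noteq> 0"
  shows "\<exists>q. znm (nr (x - y * q)) < znm (nr y)"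
proof -
  define n where "n = nr y"
  have n: "n \<noteq> 0" using assms by (simp add: n_def)
  define m where "m = znorm n"
  have m: "m \<noteq> 0" using n by (simp add: m_def)
  obtain q where q: "\<bar>znorm (nr (sc (zcnj n) * (cnj y * x) - sc (of_int m) * q))\<bar> < m ^ 4"
    using ico_approx[OF m] by blast
  have "of_int m = zcnj n * n" using mult_zcnj[of n] by (simp add: m_def mult.commute)
  then have "sc (of_int m) * q = sc (zcnj n) * (cnj y * (y * q))"
    by (simp only: n_def sc_mult mult.assoc cnj_mult_self[symmetric])
  then have "sc (zcnj n) * (cnj y * x) - sc (of_int m) * q = sc (zcnj n) * (cnj y * (x - y * q))"
    by (simp only: right_diff_distrib)
  then have "\<bar>znorm (zcnj n * zcnj n * (n * nr (x - y * q)))\<bar> < m ^ 4"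
    using q by (simp only: nr_mult nr_simps n_def)
  moreover have "znorm (zcnj n * zcnj n * (n * nr (x - y * q))) = m * m * (m * znorm (nr (x - y * q)))"
    by (simp only: znorm_mult znorm_simps m_def)
  ultimately have "\<bar>m * m * (m * znorm (nr (x - y * q)))\<bar> < m ^ 4" by simp
  moreover have "m ^ 4 = \<bar>m\<bar> ^ 3 * \<bar>m\<bar>"
    by (cases "m \<ge> 0") (simp_all add: power3_eq_cube power4_eq_xxxx)
  moreover have "\<bar>m * m * (m * znorm (nr (x - y * q)))\<bar> = \<bar>m\<bar> ^ 3 * \<bar>znorm (nr (x - y * q))\<bar>"
    by (simp only: abs_mult power3_eq_cube mult.assoc)
  ultimately have "\<bar>m\<bar> ^ 3 * \<bar>znorm (nr (x - y * q))\<bar> < \<bar>m\<bar> ^ 3 * \<bar>m\<bar>" by simp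
  then have "\<bar>znorm (nr (x - y * q))\<bar> < \<bar>m\<bar>"
    by (rule mult_left_less_imp_less) simp
  then show ?thesis unfolding znm_def m_def n_def by auto
qed

definition rideal :: "ico set \<Rightarrow> bool" where
  "rideal J \<longleftrightarrow> 0 \<in> J \<and> (\<forall>x\<in>J. \<forall>y\<in>J. x - y \<in> J) \<and> (\<forall>x\<in>J. \<forall>r. x * r \<in> J)"

lemma rideal_principal:
  assumes "rideal J"
  shows "\<exists>g. J = range ((*) g)"
proof (cases "J = {0}")
  case True
  have "{0} = range ((*) (0::ico))" by auto
  then show ?thesis using True by blast
next
  case False
  with assms have ex: "\<exists>g. g \<in> J \<and> g \<noteq> 0" by (auto simp: rideal_def)
  obtain g where g: "g \<in> J" "g \<noteq> 0" "\<And>h. h \<in> J \<Longrightarrow> h \<noteq> 0 \<Longrightarrow> znm (nr g) \<le> znm (nr h)"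
    using ex_has_least_nat[of "\<lambda>g. g \<in> J \<and> g \<noteq> 0" _ "\<lambda>g. znm (nr g)"] ex by (metis (no_types, lifting))
  have "\<exists>q. x = g * q" if x: "x \<in> J" for x
  proof -
    obtain q where q: "znm (nr (x - g * q)) < znm (nr g)" using ico_division[OF g(2)] by blast
    have "x - g * q \<in> J" using assms x g by (simp add: rideal_def)
    then have "x - g * q = 0" using g(3) q by force
    then show ?thesis by auto
  qed
  then have "J = range ((*) g)" using assms g(1) by (auto simp: rideal_def)
  then show ?thesis by blast
qed

section \<open>Indices of subgroups and of principal ideals\<close>

definition subgrp :: "'a::ab_group_add set \<Rightarrow> bool" where
  "subgrp M \<longleftrightarrow> 0 \<in> M \<and> (\<forall>x\<in>M. \<forall>y\<in>M. x - y \<in> M)"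

lemma subgrpD: "subgrp M \<Longrightarrow> 0 \<in> M" "subgrp M \<Longrightarrow> x \<in> M \<Longrightarrow> y \<in> M \<Longrightarrow> x - y \<in> M"
  "subgrp M \<Longrightarrow> x \<in> M \<Longrightarrow> - x \<in> M" "subgrp M \<Longrightarrow> x \<in> M \<Longrightarrow> y \<in> M \<Longrightarrow> x + y \<in> M"
proof -
  show 1: "subgrp M \<Longrightarrow> 0 \<in> M" "subgrp M \<Longrightarrow> x \<in> M \<Longrightarrow> y \<in> M \<Longrightarrow> x - y \<in> M" for x y
    by (auto simp: subgrp_def)
  show 2: "subgrp M \<Longrightarrow> x \<in> M \<Longrightarrow> - x \<in> M" for x using 1(2)[of 0 x] 1(1) by simp
  show "subgrp M \<Longrightarrow> x \<in> M \<Longrightarrow> y \<in> M \<Longrightarrow> x + y \<in> M" using 1(2)[of x "- y"] 2[of y] by simp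
qed

lemma coset_eq_iff:
  assumes "subgrp M"
  shows "(+) x ` M = (+) y ` M \<longleftrightarrow> x - y \<in> M"
proof
  assume "(+) x ` M = (+) y ` M"
  moreover have "x \<in> (+) x ` M" using subgrpD(1)[OF assms] by force
  ultimately show "x - y \<in> M" by auto
next
  have "(+) x ` M \<subseteq> (+) y ` M" if "x - y \<in> M" for x y
  proof
    fix z assume "z \<in> (+) x ` M"
    then obtain m where "m \<in> M" "z = x + m" by blast
    then have "z = y + ((x - y) + m)" "(x - y) + m \<in> M"
      using subgrpD(4)[OF assms that] by auto
    then show "z \<in> (+) y ` M" by blast
  qed
  moreover assume "x - y \<in> M"
  moreover have "y - x \<in> M" using subgrpD(3)[OF assms \<open>x - y \<in> M\<close>] by simp
  ultimately show "(+) x ` M = (+) y ` M" by blast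
qed

lemma group_index_eq: "group_index A M = card ((\<lambda>x. (+) x ` M) ` A)"
  unfolding group_index_def by (rule arg_cong[of _ _ card]) auto

text \<open>Used to trade a count of cosets or submodules for a count of their invariants.\<close>

lemma card_image_cong:
  assumes "\<And>x y. x \<in> A \<Longrightarrow> y \<in> A \<Longrightarrow> f x = f y \<longleftrightarrow> g x = g y"
  shows "card (f ` A) = card (g ` A)"
proof (rule bij_betw_same_card)
  show "bij_betw (\<lambda>z. g (inv_into A f z)) (f ` A) (g ` A)"
    unfolding bij_betw_def
  proof
    show "inj_on (\<lambda>z. g (inv_into A f z)) (f ` A)"
    proof (rule inj_onI)
      fix z w assume zw: "z \<in> f ` A" "w \<in> f ` A" "g (inv_into A f z) = g (inv_into A f w)"
      then have "f (inv_into A f z) = f (inv_into A f w)" using assms by (simp add: inv_into_into)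
      then show "z = w" using zw by (simp add: f_inv_into_f)
    qed
    have "g (inv_into A f (f x)) = g x" if "x \<in> A" for x
      using assms[of "inv_into A f (f x)" x] that by (simp add: inv_into_into f_inv_into_f)
    then show "(\<lambda>z. g (inv_into A f z)) ` f ` A = g ` A"
      by (simp add: image_image cong: image_cong)
  qed
qed

text \<open>The isomorphism theorem for indices; \<open>h\<close> has to reach every element of
  \<open>A'\<close> modulo \<open>M'\<close> only.\<close>

lemma group_index_hom:
  assumes h: "\<And>x y. h (x - y) = h x - h y" and M: "subgrp M'"
    and A: "h ` A \<subseteq> A'" "\<And>a'. a' \<in> A' \<Longrightarrow> \<exists>a\<in>A. a' - h a \<in> M'" "subgrp A"
  shows "group_index A {a \<in> A. h a \<in> M'} = group_index A' M'"
proof -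
  have h0: "h 0 = 0" using h[of 0 0] by simp
  have K: "subgrp {a \<in> A. h a \<in> M'}"
    using subgrpD[OF M] subgrpD[OF A(3)] h h0 by (auto simp: subgrp_def)
  have "(\<lambda>x. (+) x ` M') ` A' = (\<lambda>a. (+) (h a) ` M') ` A"
  proof (intro equalityI subsetI)
    fix z assume "z \<in> (\<lambda>x. (+) x ` M') ` A'"
    then obtain a' where a': "a' \<in> A'" "z = (+) a' ` M'" by blast
    then obtain a where "a \<in> A" "a' - h a \<in> M'" using A(2) by blast
    then show "z \<in> (\<lambda>a. (+) (h a) ` M') ` A" using a' coset_eq_iff[OF M, of a' "h a"] by blast
  qed (use A(1) in blast)
  moreover have "card ((\<lambda>x. (+) x ` {a \<in> A. h a \<in> M'}) ` A) = card ((\<lambda>a. (+) (h a) ` M') ` A)"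
    by (rule card_image_cong) (use subgrpD[OF A(3)] h in \<open>simp add: coset_eq_iff[OF K] coset_eq_iff[OF M]\<close>)
  ultimately show ?thesis by (simp add: group_index_eq)
qed

lemma group_index_inj_hom:
  assumes "\<And>x y. h (x - y) = h x - h y" "inj h" "subgrp A" "subgrp M" "M \<subseteq> A"
  shows "group_index (h ` A) (h ` M) = group_index A M"
proof -
  have "h 0 = 0" using assms(1)[of 0 0] by simp
  have hM: "subgrp (h ` M)"
    unfolding subgrp_def
  proof (intro conjI ballI)
    show "0 \<in> h ` M" using \<open>h 0 = 0\<close> subgrpD(1)[OF assms(4)] by force
    show "x - y \<in> h ` M" if "x \<in> h ` M" "y \<in> h ` M" for x y
      using that subgrpD(2)[OF assms(4)] by (auto simp flip: assms(1))
  qed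
  have "group_index A {a \<in> A. h a \<in> h ` M} = group_index (h ` A) (h ` M)"
    by (rule group_index_hom[OF assms(1) hM _ _ assms(3)]) (use subgrpD(1)[OF hM] in force)+
  moreover have "{a \<in> A. h a \<in> h ` M} = M" using assms(2,5) by (auto dest: injD)
  ultimately show ?thesis by simp
qed

text \<open>With a representative chosen in each coset of \<open>B\<close>, the cosets of
  \<open>C\<close> are pairs. As this is a bijection with a product, infinite indices, counted as 0,
  are covered as well.\<close>

lemma group_index_tower:
  assumes "subgrp A" "subgrp B" "subgrp C" "C \<subseteq> B" "B \<subseteq> A"
  shows "group_index A C = group_index A B * group_index B C"
proof -
  define X where "X = (\<lambda>x. (+) x ` B) ` A"
  define Z where "Z = (\<lambda>x. (+) x ` C) ` B"
  define \<rho> where "\<rho> = inv_into A (\<lambda>x. (+) x ` B)"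
  have \<rho>: "\<rho> K \<in> A" "(+) (\<rho> K) ` B = K" if "K \<in> X" for K
    using that f_inv_into_f[of K "\<lambda>x. (+) x ` B" A] by (auto simp: X_def \<rho>_def inv_into_into)
  define F where "F = (\<lambda>(K, L). (+) (\<rho> K) ` L)"
  have F: "F (K, (+) b ` C) = (+) (\<rho> K + b) ` C" for K b
    by (simp add: F_def image_image add.assoc)
  have "bij_betw F (X \<times> Z) ((\<lambda>x. (+) x ` C) ` A)"
    unfolding bij_betw_def
  proof
    show "inj_on F (X \<times> Z)"
    proof (rule inj_onI)
      fix p p' assume "p \<in> X \<times> Z" "p' \<in> X \<times> Z" and eq: "F p = F p'"
      then obtain K b K' b' where p: "p = (K, (+) b ` C)" "p' = (K', (+) b' ` C)"
        "K \<in> X" "K' \<in> X" "b \<in> B" "b' \<in> B" by (auto simp: Z_def)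
      have 1: "\<rho> K + b - (\<rho> K' + b') \<in> C" using eq coset_eq_iff[OF assms(3)] by (simp add: p F)
      then have "\<rho> K + b - (\<rho> K' + b') - (b - b') \<in> B"
        using assms(4) p subgrpD(2)[OF assms(2)] by blast
      then have "\<rho> K - \<rho> K' \<in> B" by (simp add: algebra_simps)
      then have "K = K'" using \<rho>(2)[OF p(3)] \<rho>(2)[OF p(4)] coset_eq_iff[OF assms(2)] by metis
      then show "p = p'" using 1 coset_eq_iff[OF assms(3), of b b'] p by simp
    qed
    show "F ` (X \<times> Z) = (\<lambda>x. (+) x ` C) ` A"
    proof (intro equalityI subsetI)
      fix z assume "z \<in> F ` (X \<times> Z)"
      then obtain K b where "K \<in> X" "b \<in> B" "z = (+) (\<rho> K + b) ` C" by (auto simp: Z_def F)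
      then show "z \<in> (\<lambda>x. (+) x ` C) ` A" using \<rho>(1) assms(5) subgrpD(4)[OF assms(1)] by blast
    next
      fix z assume "z \<in> (\<lambda>x. (+) x ` C) ` A"
      then obtain a where a: "a \<in> A" "z = (+) a ` C" by blast
      define K where "K = (+) a ` B"
      have K: "K \<in> X" using a by (auto simp: X_def K_def)
      have "a - \<rho> K \<in> B" using \<rho>(2)[OF K] coset_eq_iff[OF assms(2)] K_def by metis
      then have "(K, (+) (a - \<rho> K) ` C) \<in> X \<times> Z" using K by (auto simp: Z_def)
      moreover have "F (K, (+) (a - \<rho> K) ` C) = z" unfolding F by (simp add: a)
      ultimately show "z \<in> F ` (X \<times> Z)" by (metis imageI)
    qed
  qed
  then have "card ((\<lambda>x. (+) x ` C) ` A) = card (X \<times> Z)" by (simp add: bij_betw_same_card)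
  then show ?thesis by (simp add: group_index_eq X_def Z_def card_cartesian_product)
qed

lemma subgrp_UNIV [simp]: "subgrp UNIV" by (simp add: subgrp_def)

lemma subgrp_range_mult [simp]: "subgrp (range ((*) (a::'a::ring)))"
  unfolding subgrp_def
proof (intro conjI ballI)
  show "0 \<in> range ((*) a)" by (metis mult_zero_right rangeI)
  show "x - y \<in> range ((*) a)" if "x \<in> range ((*) a)" "y \<in> range ((*) a)" for x y
    using that by (auto simp flip: right_diff_distrib)
qed

definition idx :: "'a::ring_1 \<Rightarrow> nat" where "idx a = group_index UNIV (range ((*) a))"

lemma group_index_mult_image:
  assumes "(a::'a::ring_1_no_zero_divisors) \<noteq> 0"
  shows "group_index (range ((*) a)) (range ((*) (a * b))) = idx b"
proof -
  have "range ((*) (a * b)) = (*) a ` range ((*) b)" by (auto simp: image_image mult.assoc)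
  moreover have "inj ((*) a)" using assms by (simp add: inj_def)
  ultimately show ?thesis
    using group_index_inj_hom[of "(*) a" UNIV "range ((*) b)"] by (simp add: right_diff_distrib idx_def)
qed

lemma idx_mult:
  assumes "(a::'a::ring_1_no_zero_divisors) \<noteq> 0"
  shows "idx (a * b) = idx a * idx b"
proof -
  have "range ((*) (a * b)) \<subseteq> range ((*) a)" by (auto simp: mult.assoc)
  then have "idx (a * b) = idx a * group_index (range ((*) a)) (range ((*) (a * b)))"
    unfolding idx_def by (intro group_index_tower) auto
  then show ?thesis using group_index_mult_image[OF assms] by simp
qed

lemma idx_auto:
  assumes "\<And>x y. h (x - y) = h x - h y" "bij h" "h ` range ((*) a) = range ((*) b)"
  shows "idx a = idx b"
proof -
  have "group_index (h ` UNIV) (h ` range ((*) a)) = group_index UNIV (range ((*) a))"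
    using assms by (intro group_index_inj_hom) (auto simp: bij_def)
  then show ?thesis using assms(2,3) by (simp add: idx_def bij_def)
qed

lemma zt_of_nat_dvd_iff: "of_nat k dvd (x::zt) \<longleftrightarrow> int k dvd zfst x \<and> int k dvd zsnd x"
proof
  assume "int k dvd zfst x \<and> int k dvd zsnd x"
  then obtain a b where "zfst x = int k * a" "zsnd x = int k * b" by (auto elim!: dvdE)
  then have "x = of_nat k * ZT a b" by (simp add: zt_eq_iff)
  then show "of_nat k dvd x" by (rule dvdI)
qed (auto elim!: dvdE)

lemma int_mod_eq_iff_dvd: "(a::int) mod m = b mod m \<longleftrightarrow> m dvd a - b"
  by (rule mod_eq_dvd_iff)

lemma idx_zt_of_nat: "idx (of_nat k :: zt) = k ^ 2" if "k > 0"
proof -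
  define f where "f = (\<lambda>x. (zfst x mod int k, zsnd x mod int k))"
  have "idx (of_nat k :: zt) = card ((\<lambda>x. (+) x ` range ((*) (of_nat k :: zt))) ` UNIV)"
    by (simp add: idx_def group_index_eq)
  also have "\<dots> = card (f ` UNIV)"
  proof (rule card_image_cong)
    fix x y :: zt
    have "x - y \<in> range ((*) (of_nat k)) \<longleftrightarrow> of_nat k dvd x - y" by (auto simp: dvd_def)
    then show "(+) x ` range ((*) (of_nat k)) = (+) y ` range ((*) (of_nat k)) \<longleftrightarrow> f x = f y"
      by (subst coset_eq_iff) (simp_all add: f_def zt_of_nat_dvd_iff int_mod_eq_iff_dvd)
  qed
  also have "f ` UNIV = {0..<int k} \<times> {0..<int k}"
  proof (intro equalityI subsetI)
    fix p assume "p \<in> {0..<int k} \<times> {0..<int k}"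
    then have "f (ZT (fst p) (snd p)) = p" by (auto simp: f_def)
    then show "p \<in> f ` UNIV" by (metis UNIV_I imageI)
  qed (use that in \<open>auto simp: f_def\<close>)
  finally show ?thesis by (simp add: power2_eq_square)
qed

lemma znm_mult_self: "of_nat (znm n) = n * zcnj n \<or> of_nat (znm n) = n * (- zcnj n)"
proof -
  have "of_nat (znm n) = (of_int \<bar>znorm n\<bar> :: zt)" by (simp add: znm_def)
  then show ?thesis using mult_zcnj[of n] by (cases "znorm n \<ge> 0") auto
qed

lemma range_mult_uminus: "range ((*) (- a :: 'a::ring_1)) = range ((*) a)"
proof -
  have "- a * x = a * - x" "a * x = - a * - x" for x by simp_all
  then show ?thesis by (metis (no_types, opaque_lifting) image_subset_iff rangeI subset_antisym)
qed

lemma idx_uminus: "idx (- a) = idx a" by (simp only: idx_def range_mult_uminus)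

text \<open>The automorphism \<open>zcnj\<close> gives \<open>n\<close> and its conjugate the same
  index, and up to sign their product is the rational integer \<open>znm n\<close>, whose index is a
  square.\<close>

lemma idx_zt: "idx (n::zt) = znm n" if "n \<noteq> 0"
proof -
  have "idx (zcnj n) = idx n"
  proof (rule idx_auto[of zcnj])
    show "bij zcnj" by (rule bijI') (metis zcnj_simps(7))+
    show "zcnj ` range ((*) (zcnj n)) = range ((*) n)"
      by (auto simp: image_image) (metis rangeI zcnj_simps(7))
  qed simp
  then have "idx (of_nat (znm n) :: zt) = idx n * idx n"
    using znm_mult_self[of n] idx_mult[OF that] by (metis idx_uminus)
  moreover have "znm n > 0" using that by (simp add: znm_eq_0_iff zero_less_iff_neq_zero)
  ultimately have "idx n ^ 2 = znm n ^ 2" by (simp add: idx_zt_of_nat power2_eq_square)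
  then show ?thesis by (metis power2_eq_iff_nonneg zero_le)
qed

definition sdvd :: "zt \<Rightarrow> ico \<Rightarrow> bool" where "sdvd n x \<longleftrightarrow> x \<in> range ((*) (sc n))"

lemma sdvd_iff: "sdvd n x \<longleftrightarrow> n dvd q0 x \<and> n dvd q1 x \<and> n dvd q2 x \<and> n dvd q3 x"
proof
  assume "n dvd q0 x \<and> n dvd q1 x \<and> n dvd q2 x \<and> n dvd q3 x"
  then obtain a b c d where "q0 x = n * a" "q1 x = n * b" "q2 x = n * c" "q3 x = n * d"
    by (auto elim!: dvdE)
  then have "x = sc n * Ico a b c d" by (simp add: ico_eq_iff)
  then show "sdvd n x" by (auto simp: sdvd_def)
qed (auto simp: sdvd_def)

lemma idx_ico_of_nat: "idx (sc (of_nat k)) = k ^ 8" if "k > 0"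
proof -
  define g where "g = (\<lambda>x. (zfst x mod int k, zsnd x mod int k))"
  define f where "f = (\<lambda>x. (g (q0 x), g (q1 x), g (q2 x), g (q3 x)))"
  have g: "g x = g y \<longleftrightarrow> of_nat k dvd x - y" for x y
    by (simp add: g_def zt_of_nat_dvd_iff int_mod_eq_iff_dvd)
  have gU: "g ` UNIV = {0..<int k} \<times> {0..<int k}"
  proof (intro equalityI subsetI)
    fix p assume "p \<in> {0..<int k} \<times> {0..<int k}"
    then have "g (ZT (fst p) (snd p)) = p" by (auto simp: g_def)
    then show "p \<in> g ` UNIV" by (metis UNIV_I imageI)
  qed (use that in \<open>auto simp: g_def\<close>)
  have "idx (sc (of_nat k)) = card ((\<lambda>x. (+) x ` range ((*) (sc (of_nat k)))) ` UNIV)"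
    by (simp add: idx_def group_index_eq)
  also have "\<dots> = card (f ` UNIV)"
  proof (rule card_image_cong)
    fix x y :: ico
    have "x - y \<in> range ((*) (sc (of_nat k))) \<longleftrightarrow> sdvd (of_nat k) (x - y)" by (simp add: sdvd_def)
    then show "(+) x ` range ((*) (sc (of_nat k))) = (+) y ` range ((*) (sc (of_nat k))) \<longleftrightarrow> f x = f y"
      by (subst coset_eq_iff) (simp_all add: f_def g sdvd_iff)
  qed
  also have "f ` UNIV = g ` UNIV \<times> g ` UNIV \<times> g ` UNIV \<times> g ` UNIV"
  proof (intro equalityI subsetI)
    fix p assume "p \<in> g ` UNIV \<times> g ` UNIV \<times> g ` UNIV \<times> g ` UNIV"
    then obtain a b c d where "p = (g a, g b, g c, g d)" by auto
    then have "p = f (Ico a b c d)" by (simp add: f_def)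
    then show "p \<in> f ` UNIV" by blast
  qed (auto simp: f_def)
  finally show ?thesis unfolding gU by (simp add: card_cartesian_product numeral_eq_Suc)
qed

lemma idx_sc: "idx (sc n) = znm n ^ 4" if "n \<noteq> 0"
proof -
  \<comment> \<open>Coefficientwise conjugation is not a ring automorphism of \<open>ico\<close>,
    but it is semilinear over scalars, and that is enough to carry the ideal of
    \<open>sc (zcnj n)\<close> to that of \<open>sc n\<close>.\<close>
  define h where "h x = Ico (zcnj (q0 x)) (zcnj (q1 x)) (zcnj (q2 x)) (zcnj (q3 x))" for x
  have hh: "h (h x) = x" for x by (simp add: h_def)
  have h: "h (sc a * x) = sc (zcnj a) * h x" for a x by (simp add: h_def ico_eq_iff)
  have "idx (sc (zcnj n)) = idx (sc n)"
  proof (rule idx_auto[of h])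
    show "bij h" by (rule bijI') (metis hh)+
    show "h ` range ((*) (sc (zcnj n))) = range ((*) (sc n))"
      by (auto simp: image_image h) (metis hh rangeI)
  qed (simp add: h_def ico_eq_iff)
  then have "idx (sc (of_nat (znm n))) = idx (sc n) * idx (sc n)"
    using znm_mult_self[of n] idx_mult[of "sc n"] that by (metis idx_uminus sc_eq_0_iff sc_mult sc_simps(3))
  moreover have "znm n > 0" using that by (simp add: zero_less_iff_neq_zero)
  ultimately have "idx (sc n) ^ 2 = (znm n ^ 4) ^ 2"
    by (simp add: idx_ico_of_nat power2_eq_square flip: power_add)
  then show ?thesis by (metis power2_eq_iff_nonneg zero_le)
qed

lemma idx_pos: "idx (a::ico) > 0" if "a \<noteq> 0"
proof -
  have "idx a * idx (cnj a) = idx (sc (nr a))" using idx_mult[OF that, of "cnj a"] by (simp add: mult_cnj)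
  also have "\<dots> > 0" using that by (simp add: idx_sc zero_less_iff_neq_zero)
  finally show ?thesis by simp
qed

text \<open>A commutator \<open>t = a x - x a\<close> satisfies \<open>t a = cnj a t\<close>, which makes left multiplication by
  \<open>a\<close> and by \<open>cnj a\<close> equivalent up to the factor \<open>t\<close>.\<close>

lemma idx_cnj: "idx (cnj a) = idx a"
proof (cases "a = 0 \<or> (\<forall>x. a * x = x * a)")
  case True
  \<comment> \<open>A central \<open>a\<close> can be pulled out of every summand of
    \<open>dual_basis_trc\<close>, which gives \<open>sc (trc a) = a + a\<close> and so
    \<open>cnj a = a\<close>.\<close>
  then have "sc (trc a) = a * sc (trc 1)"
  proof
    assume "\<forall>x. a * x = x * a"
    then have "b * a * d = a * (b * 1 * d)" for b d by (simp add: mult.assoc)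
    then show ?thesis
      using dual_basis_trc[of a] dual_basis_trc[of 1] by (metis (no_types, lifting) distrib_left)
  qed simp
  moreover have "a * sc (trc 1) = a + a" by (simp add: ico_eq_iff ico_mult_sel)
  ultimately have "cnj a = a" by (simp add: cnj_eq_trc)
  then show ?thesis by simp
next
  case False
  then obtain x where x: "a * x \<noteq> x * a" by blast
  define t where "t = a * x - x * a"
  have t: "t \<noteq> 0" using x by (simp add: t_def)
  have "trc (x * a) = trc (a * x)" by (rule trc_mult_comm)
  then have "cnj t = - t" using cnj_eq_trc[of t] by (simp add: t_def)
  moreover have "trc (t * a) = 0"
    using trc_mult_comm[of "x * a" a] by (simp add: t_def left_diff_distrib mult.assoc)
  then have "cnj (t * a) = - (t * a)" using cnj_eq_trc[of "t * a"] by simp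
  ultimately have "t * a = cnj a * t" by simp
  then have "idx t * idx a = idx (cnj a) * idx t" using idx_mult t False by (metis cnj_inj cnj_simps(1))
  then show ?thesis using idx_pos[OF t] by simp
qed

text \<open>By \<open>idx_cnj\<close> the factors \<open>a\<close> and \<open>cnj a\<close>
  contribute equally to the index of \<open>sc (nr a)\<close>, which is a fourth power.\<close>

theorem idx_ico: "idx (a::ico) = znm (nr a) ^ 2" if "a \<noteq> 0"
proof -
  have "idx a * idx (cnj a) = idx (sc (nr a))" using idx_mult[OF that, of "cnj a"] by (simp add: mult_cnj)
  then have "idx a ^ 2 = (znm (nr a) ^ 2) ^ 2"
    using that by (simp add: idx_cnj idx_sc power2_eq_square power4_eq_xxxx mult.assoc)
  then show ?thesis by (metis power2_eq_iff_nonneg zero_le)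
qed

section \<open>Principal right ideals and their norms\<close>

abbreviation coset :: "'a::ab_group_add set \<Rightarrow> 'a \<Rightarrow> 'a set" where "coset B x \<equiv> (+) x ` B"

definition asc :: "zt \<Rightarrow> zt \<Rightarrow> bool" where "asc x y \<longleftrightarrow> x dvd y \<and> y dvd x"

lemma asc_refl [simp]: "asc x x" and asc_sym: "asc x y \<Longrightarrow> asc y x"
  by (simp_all add: asc_def)

lemma asc_trans: "asc x y \<Longrightarrow> asc y z \<Longrightarrow> asc x z"
  unfolding asc_def by (meson dvd_trans)

lemma asc_mult: "asc x y \<Longrightarrow> asc z w \<Longrightarrow> asc (x * z) (y * w)"
  by (simp add: asc_def mult_dvd_mono)

lemma asc_cancel: "n \<noteq> 0 \<Longrightarrow> asc (n * x) (n * y) \<longleftrightarrow> asc x y"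
  by (simp add: asc_def)

lemma asc_cancel2:
  assumes "n \<noteq> 0" "asc n m" "asc (n * x) (m * y)"
  shows "asc x y"
proof -
  have "asc (m * y) (n * y)" using asc_mult[OF asc_sym[OF assms(2)] asc_refl] .
  with assms(3) have "asc (n * x) (n * y)" by (rule asc_trans)
  then show ?thesis using assms(1) asc_cancel by blast
qed

lemma asc_unit_mult: "is_unit u \<Longrightarrow> asc (x * u) x" "is_unit u \<Longrightarrow> asc (u * x) x"
  by (simp_all add: asc_def mult_unit_dvd_iff mult_unit_dvd_iff')

lemma asc_znm: "asc x y \<Longrightarrow> znm x = znm y"
  by (simp add: asc_def znm_dvd dvd_antisym)

lemma asc_0: "asc x 0 \<longleftrightarrow> x = 0" "asc 0 x \<longleftrightarrow> x = 0" by (auto simp: asc_def)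

lemma dvd_znm_asc:
  assumes "x dvd y" "znm x = znm y" "y \<noteq> 0"
  shows "asc x y"
proof -
  obtain k where k: "y = x * k" using assms(1) by blast
  then have "znm k = 1" using assms by (simp add: znm_mult)
  then have "is_unit k" by (simp only: znm_eq_1_iff)
  then show ?thesis using asc_unit_mult(1)[of k x] k asc_sym by simp
qed

abbreviation rid :: "ico \<Rightarrow> ico set" where "rid c \<equiv> range ((*) c)"

lemma rid_subset_iff: "rid a \<subseteq> rid b \<longleftrightarrow> a \<in> rid b"
proof
  assume "rid a \<subseteq> rid b"
  moreover have "a * 1 \<in> rid a" by (rule rangeI)
  ultimately show "a \<in> rid b" by auto
next
  assume "a \<in> rid b"
  then obtain x where "a = b * x" by blast
  then show "rid a \<subseteq> rid b" by (auto simp: mult.assoc)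
qed

lemma mem_rid_dvd: "a \<in> rid b \<Longrightarrow> nr b dvd nr a"
  by (auto simp: nr_mult)

lemma sc_mem_rid:
  assumes "nr c dvd n"
  shows "sc n \<in> rid c"
proof -
  obtain k where "n = nr c * k" using assms by blast
  then have "sc n = c * (cnj c * sc k)" by (simp only: sc_mult mult_cnj[symmetric] mult.assoc)
  then show ?thesis by blast
qed

text \<open>The cofactor has unit norm and is therefore invertible, its inverse being a scalar
  multiple of its conjugate.\<close>

lemma rid_eqI:
  assumes "a \<in> rid b" "asc (nr a) (nr b)" "a \<noteq> 0"
  shows "rid a = rid b"
proof -
  obtain x where x: "a = b * x" using assms(1) by blast
  have "nr b \<noteq> 0" using assms x by auto
  then have "is_unit (nr x)" using assms(2) by (simp add: x nr_mult asc_def)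
  then obtain u where u: "nr x * u = 1" by (metis dvdE)
  have "a * (cnj x * sc u) = b * (x * cnj x * sc u)" by (simp add: x mult.assoc)
  also have "\<dots> = b * (sc (nr x * u))" by (simp only: mult_cnj sc_mult)
  also have "\<dots> = b" by (simp add: u)
  finally have "b = a * (cnj x * sc u)" by simp
  then have "b \<in> rid a" by (rule range_eqI)
  with assms(1) have "rid a \<subseteq> rid b" "rid b \<subseteq> rid a" by (simp_all only: rid_subset_iff)
  then show ?thesis by (rule subset_antisym)
qed

lemma mem_rid_self [simp]: "a \<in> rid a"
  using rid_subset_iff[of a a] by simp

lemma rid_eq_asc:
  assumes "rid a = rid b"
  shows "asc (nr a) (nr b)"
proof -
  have "a \<in> rid b" "b \<in> rid a" using mem_rid_self[of a] mem_rid_self[of b] assms by simp_all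
  then show ?thesis by (simp add: asc_def mem_rid_dvd)
qed

definition rids :: "zt \<Rightarrow> ico set set" where "rids n = {rid c | c. asc (nr c) n}"

lemma mem_rids: "asc (nr c) n \<Longrightarrow> rid c \<in> rids n" by (auto simp: rids_def)

lemma rids_mem_iff: "rid c \<in> rids n \<longleftrightarrow> asc (nr c) n"
proof
  assume "rid c \<in> rids n"
  then obtain c' where "rid c = rid c'" "asc (nr c') n" by (auto simp: rids_def)
  then show "asc (nr c) n" using rid_eq_asc asc_trans by blast
qed (rule mem_rids)

text \<open>A group containing \<open>B\<close> is a union of cosets of \<open>B\<close>, so it is
  determined by a subset of a finite set.\<close>

lemma finite_supergroups:
  assumes "subgrp B" "group_index UNIV B > 0"
  shows "finite {D. B \<subseteq> D \<and> subgrp D}"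
proof -
  have fin: "finite (coset B ` UNIV)"
    using assms(2) unfolding group_index_eq by (rule card_ge_0_finite)
  have D: "\<Union> (coset B ` D) = D" if "B \<subseteq> D" "subgrp D" for D
  proof (intro equalityI subsetI)
    fix x assume "x \<in> D"
    moreover have "x \<in> coset B x" using subgrpD(1)[OF assms(1)] by force
    ultimately show "x \<in> \<Union> (coset B ` D)" by blast
  qed (use that subgrpD(4)[OF that(2)] in blast)
  have "inj_on (\<lambda>D. coset B ` D) {D. B \<subseteq> D \<and> subgrp D}"
    by (rule inj_onI) (metis (mono_tags, lifting) D mem_Collect_eq)
  moreover have "finite ((\<lambda>D. coset B ` D) ` {D. B \<subseteq> D \<and> subgrp D})"
    by (rule finite_subset[OF _ finite_Pow_iff[THEN iffD2, OF fin]]) auto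
  ultimately show ?thesis by (rule finite_imageD[rotated])
qed

lemma finite_rids:
  assumes "n \<noteq> 0"
  shows "finite (rids n)"
proof (rule finite_subset)
  show "rids n \<subseteq> {D. rid (sc n) \<subseteq> D \<and> subgrp D}"
  proof
    fix D assume "D \<in> rids n"
    then obtain c where c: "D = rid c" "nr c dvd n" by (auto simp: rids_def asc_def)
    then have "rid (sc n) \<subseteq> D" using rid_subset_iff sc_mem_rid by simp
    then show "D \<in> {D. rid (sc n) \<subseteq> D \<and> subgrp D}" using c by simp
  qed
  show "finite {D. rid (sc n) \<subseteq> D \<and> subgrp D}"
    using idx_pos[of "sc n"] assms by (intro finite_supergroups) (simp_all add: idx_def)
qed

section \<open>Ideals of irreducible norm and isotropic vectors modulo p\<close>

lemma sdvd_mult: "sdvd p x \<Longrightarrow> sdvd p (x * y)" "sdvd p x \<Longrightarrow> sdvd p (y * x)"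
  by (auto simp: sdvd_def mult.assoc sc_left_comm)

lemma sdvd_add: "sdvd p x \<Longrightarrow> sdvd p y \<Longrightarrow> sdvd p (x + y)"
  by (auto simp: sdvd_iff)

lemma sdvd_sc_mult: "p dvd a \<Longrightarrow> sdvd p (sc a * x)"
  by (auto simp: sdvd_iff)

lemma sdvd_cnj [simp]: "sdvd p (cnj x) \<longleftrightarrow> sdvd p x"
proof -
  have "sdvd p (cnj x)" if "sdvd p x" for x using that by (auto simp: sdvd_iff)
  from this[of x] this[of "cnj x"] show ?thesis by auto
qed

lemma sdvd_trc: "sdvd p x \<Longrightarrow> p dvd trc x" by (auto simp: sdvd_iff trc_def)

lemma sdvd_nr: "sdvd p x \<Longrightarrow> p * p dvd nr x"
  by (auto simp: sdvd_def nr_mult)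

text \<open>By \<open>dual_basis_expand\<close> the coordinates of \<open>a\<close> are themselves
  traces \<open>trc (a * y)\<close>.\<close>

lemma sdvd_nondegenerate:
  assumes "\<And>y. p dvd trc (a * y)"
  shows "sdvd p a"
  by (subst dual_basis_expand, simp only: sdvd_iff ico_sel sc_sel sc_mult_sel, intro conjI)
    (use assms in simp_all)

text \<open>Modulo \<open>p\<close> the ideal \<open>rid c\<close> is the kernel of left
  multiplication by \<open>cnj c\<close>.\<close>

lemma mem_rid_iff_cnj:
  assumes "p \<noteq> 0" "asc (nr c) p"
  shows "w \<in> rid c \<longleftrightarrow> sdvd p (cnj c * w)"
proof
  assume "w \<in> rid c"
  then obtain y where "w = c * y" by blast
  then have "cnj c * w = sc (nr c) * y" by (simp add: cnj_mult_self flip: mult.assoc)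
  then show "sdvd p (cnj c * w)" using assms(2) by (simp add: asc_def sdvd_sc_mult)
next
  assume "sdvd p (cnj c * w)"
  then obtain y where y: "cnj c * w = sc p * y" by (auto simp: sdvd_def)
  obtain k where "p = nr c * k" using assms(2) by (auto simp: asc_def)
  then have "cnj c * w = cnj c * (c * (sc k * y))"
    by (simp only: y sc_mult cnj_mult_self[symmetric] mult.assoc)
  moreover have "cnj c \<noteq> 0" using assms by (metis asc_0(2) cnj_simps(1) cnj_inj nr_simps(1))
  ultimately have "w = c * (sc k * y)" by simp
  then show "w \<in> rid c" by blast
qed

text \<open>The right ideal generated by \<open>b\<close> and \<open>p\<close> has a generator
  \<open>d\<close>. Expanding the norm shows that \<open>p\<close> divides \<open>nr d\<close>,
  while \<open>nr d\<close> divides \<open>p * p\<close>. If \<open>nr d\<close> were associated to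
  \<open>p * p\<close>, then \<open>d\<close> would generate the ideal of \<open>p\<close>, which
  does not contain \<open>b\<close>. Any competitor contains \<open>d\<close> and has the same norm,
  so it equals \<open>rid d\<close>.\<close>

lemma unique_prime_rid:
  assumes p: "irreducible p" "p dvd nr b" "\<not> sdvd p b"
  shows "\<exists>!D. D \<in> rids p \<and> b \<in> D"
proof -
  have p0: "p \<noteq> 0" using p(1) by auto
  define J where "J = {b * x + sc p * y | x y. True}"
  have memJ: "b * x + sc p * y \<in> J" for x y by (auto simp: J_def)
  have "rideal J"
    unfolding rideal_def
  proof (intro conjI ballI allI)
    show "0 \<in> J" using memJ[of 0 0] by simp
    fix u assume "u \<in> J"
    then obtain x y where u: "u = b * x + sc p * y" by (auto simp: J_def)
    { fix v assume "v \<in> J"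
      then obtain x' y' where v: "v = b * x' + sc p * y'" by (auto simp: J_def)
      show "u - v \<in> J" using memJ[of "x - x'" "y - y'"] by (simp add: u v algebra_simps)
    }
    show "u * r \<in> J" for r using memJ[of "x * r" "y * r"] by (simp add: u algebra_simps)
  qed
  then obtain d where d: "J = rid d" using rideal_principal by blast
  have b: "b \<in> rid d" and pd: "sc p \<in> rid d" using memJ[of 1 0] memJ[of 0 1] d by auto
  have "d \<in> J" using d by (metis mult_1_right rangeI)
  then obtain x y where xy: "d = b * x + sc p * y" by (auto simp: J_def)
  have "nr d = nr b * nr x + p * p * nr y + p * trc (cnj (b * x) * y)"
    by (simp add: xy nr_add nr_mult sc_left_comm)
  then have "p dvd nr d" using p(2) by simp
  then obtain e where e: "nr d = p * e" by blast
  obtain y' where y': "sc p = d * y'" using pd by blast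
  have "p * p = nr d * nr y'" using arg_cong[OF y', of nr] by (simp add: nr_mult)
  then have pe: "p = e * nr y'" using p0 by (simp add: e mult.assoc)
  have nu: "\<not> is_unit (nr y')"
  proof
    assume "is_unit (nr y')"
    then have "asc (nr (sc p)) (nr d)" unfolding y' nr_mult by (rule asc_unit_mult)
    then have "rid (sc p) = rid d" using rid_eqI[OF pd] p0 by simp
    then show False using b p(3) by (simp add: sdvd_def)
  qed
  then have "is_unit e" using pe p(1) irreducibleD by blast
  then have nd: "asc (nr d) p" unfolding e by (rule asc_unit_mult)
  show ?thesis
  proof (rule ex1I[of _ "rid d"])
    show "rid d \<in> rids p \<and> b \<in> rid d" using nd b by (simp add: mem_rids)
    fix D assume D: "D \<in> rids p \<and> b \<in> D"
    then obtain c where c: "D = rid c" "asc (nr c) p" by (auto simp: rids_def)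
    then have "sc p \<in> D" by (auto simp: asc_def intro!: sc_mem_rid)
    then obtain u v where uv: "b = c * u" "sc p = c * v" using D c by blast
    have "d = c * (u * x + v * y)" by (simp add: xy uv(1) distrib_left mult.assoc)
      (simp add: uv(2) mult.assoc)
    then have "d \<in> rid c" by blast
    moreover have "asc (nr d) (nr c)" using nd c asc_sym asc_trans by blast
    moreover have "d \<noteq> 0" using nd p0 asc_0(2) by fastforce
    ultimately show "D = rid d" using rid_eqI c by blast
  qed
qed

lemma irreducible_dvd_prime:
  assumes "irreducible (p::zt)" "p dvd of_nat n" "n > 0"
  shows "\<exists>r. prime r \<and> r dvd n \<and> p dvd of_nat r"
  using assms(2,3)
proof (induction n rule: less_induct)
  case (less n)
  have "n \<noteq> 1" using less.prems assms(1) by (auto simp: irreducible_def)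
  then obtain r where r: "prime r" "r dvd n" using prime_factor_nat by blast
  then obtain m where m: "n = r * m" by blast
  show ?case
  proof (cases "p dvd of_nat r")
    case False
    then have "p dvd of_nat m" using irreducible_prime_dvd[OF assms(1)] less.prems(1) m by force
    moreover have "m < n" "m > 0" using less.prems m r(1) prime_gt_1_nat by auto
    ultimately show ?thesis using less.IH[of m] m by (meson dvd_mult dvd_refl dvd_trans)
  qed (use r in blast)
qed

text \<open>Pigeonhole: (p + 1)/2 squares and (p + 1)/2 values -1 - b^2 cannot be disjoint among p
  residues.\<close>

lemma sum_two_squares_minus_one:
  assumes "prime (p::int)" "p > 2"
  shows "\<exists>a b. p dvd a * a + b * b + 1"
proof -
  define h where "h = (p - 1) div 2"
  have "odd p" using assms prime_odd_int by blast
  then have p: "p = 2 * h + 1" by (auto simp: h_def elim: oddE)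
  define f where "f a = (a * a) mod p" for a
  define g where "g b = (- 1 - b * b) mod p" for b
  have key: "a = b" if "p dvd a * a - b * b" "a \<in> {0..h}" "b \<in> {0..h}" for a b
  proof -
    have "p dvd (a - b) * (a + b)" using that(1) by (simp add: algebra_simps)
    then have "p dvd a - b \<or> p dvd a + b" using assms(1) prime_dvd_mult_iff by blast
    moreover have "\<bar>a - b\<bar> < \<bar>p\<bar>" "\<bar>a + b\<bar> < \<bar>p\<bar>" using that p by auto
    ultimately have "a - b = 0 \<or> a + b = 0"
      using dvd_imp_le_int[of "a - b" p] dvd_imp_le_int[of "a + b" p] by linarith
    then show ?thesis using that by auto
  qed
  have "inj_on f {0..h}" by (rule inj_onI) (auto simp: f_def mod_eq_dvd_iff key)
  moreover have "inj_on g {0..h}"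
  proof (rule inj_onI)
    fix a b assume ab: "a \<in> {0..h}" "b \<in> {0..h}" "g a = g b"
    then have "p dvd - 1 - a * a - (- 1 - b * b)" by (simp add: g_def mod_eq_dvd_iff)
    then have "p dvd b * b - a * a" by (simp add: algebra_simps)
    then show "a = b" using key[of b a] ab by simp
  qed
  ultimately have c: "card (f ` {0..h}) = nat (h + 1)" "card (g ` {0..h}) = nat (h + 1)"
    by (simp_all add: card_image)
  have sub: "f ` {0..h} \<union> g ` {0..h} \<subseteq> {0..<p}"
    using assms by (auto simp: f_def g_def)
  have "f ` {0..h} \<inter> g ` {0..h} \<noteq> {}"
  proof
    assume "f ` {0..h} \<inter> g ` {0..h} = {}"
    then have "card (f ` {0..h} \<union> g ` {0..h}) = 2 * nat (h + 1)" using c by (simp add: card_Un_disjoint)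
    moreover have "card (f ` {0..h} \<union> g ` {0..h}) \<le> nat p" using card_mono[OF _ sub] by simp
    ultimately show False using p assms by linarith
  qed
  then obtain a b where "f a = g b" by blast
  then have "p dvd a * a - (- 1 - b * b)" by (simp add: f_def g_def mod_eq_dvd_iff)
  then show ?thesis by (intro exI[of _ a] exI[of _ b]) (simp add: algebra_simps)
qed

text \<open>Over 2 the witness is 1 + i, of norm 2. Over an odd prime it is 1 + a i + b j with 1 +
  a^2 + b^2 divisible by that prime; its trace 2 is prime to \<open>p\<close>.\<close>

lemma isotropic_exists:
  assumes "irreducible p"
  shows "\<exists>x. p dvd nr x \<and> \<not> sdvd p x"
proof -
  have np: "\<not> p dvd 1" using assms by (auto simp: irreducible_def)
  have "p \<noteq> 0" using assms by auto
  then obtain r where r: "prime r" "p dvd of_nat r"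
    using irreducible_dvd_prime[OF assms dvd_znm] by (metis neq0_conv znm_eq_0_iff)
  show ?thesis
  proof (cases "r = 2")
    case True
    then have "p dvd nr (Ico 1 1 0 0)" using r by (simp add: nr_def)
    moreover have "\<not> sdvd p (Ico 1 1 0 0)" using np by (simp add: sdvd_iff)
    ultimately show ?thesis by blast
  next
    case False
    then have r2: "r > 2" "odd r" using r(1) prime_gt_1_nat[of r] prime_odd_nat[of r] by auto
    obtain a b where ab: "int r dvd a * a + b * b + 1"
      using sum_two_squares_minus_one[of "int r"] r r2 by auto
    \<comment> \<open>The quaternion 1 + a i + b j in the basis 1, i, h, i h.\<close>
    define x where "x = Ico (1 - of_int b * (tau + 1)) (of_int a - of_int b * tau) (2 * of_int b * tau) 0"
    have "nr x = of_int (a * a + b * b + 1)"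
      by (simp add: x_def nr_def zt_eq_iff algebra_simps)
    moreover obtain k where "a * a + b * b + 1 = int r * k" using ab by blast
    ultimately have "nr x = of_nat r * of_int k" by (metis of_int_mult of_int_of_nat_eq)
    then have "p dvd nr x" using r(2) by simp
    moreover have "\<not> sdvd p x"
    proof
      assume "sdvd p x"
      then have "p dvd trc x" by (rule sdvd_trc)
      moreover have "trc x = 2" by (simp add: x_def trc_def zt_eq_iff algebra_simps)
      ultimately have "p dvd 2" by simp
      obtain k where "r = 2 * k + 1" using r2(2) by (auto elim: oddE)
      then have "of_nat r - 2 * of_nat k = (1::zt)" by simp
      then show False using \<open>p dvd 2\<close> r(2) np by (metis dvd_diff dvd_mult2)
    qed
    ultimately show ?thesis by blast
  qed
qed

lemma prime_rid_quotient:
  assumes "p \<noteq> 0" "asc (nr c) p"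
  shows "rid (sc p) \<subseteq> rid c" "group_index (rid c) (rid (sc p)) = znm p ^ 2"
    "group_index UNIV (rid c) = znm p ^ 2"
proof -
  show sub: "rid (sc p) \<subseteq> rid c"
    unfolding rid_subset_iff using assms(2) by (intro sc_mem_rid) (simp add: asc_def)
  have c: "c \<noteq> 0" using assms by (auto simp: asc_0)
  show 1: "group_index UNIV (rid c) = znm p ^ 2"
    using idx_ico[OF c] asc_znm[OF assms(2)] by (simp add: idx_def)
  have "znm p ^ 4 = znm p ^ 2 * group_index (rid c) (rid (sc p))"
    using group_index_tower[of UNIV "rid c" "rid (sc p)"] sub idx_sc[OF assms(1)] 1
    by (simp add: idx_def)
  moreover have "znm p ^ 4 = znm p ^ 2 * znm p ^ 2" by (simp flip: power_add)
  moreover have "znm p ^ 2 > 0" using assms(1) by (simp add: zero_less_iff_neq_zero)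
  ultimately show "group_index (rid c) (rid (sc p)) = znm p ^ 2" by (metis mult_left_cancel neq0_conv)
qed

text \<open>On \<open>rid c\<close> the norm vanishes modulo \<open>p\<close>, so on the coset of
  \<open>u\<close> it is the affine function \<open>nr u + l w\<close>. The linear part does not
  vanish on \<open>rid c\<close>, for otherwise \<open>u\<close> would lie in \<open>rid c\<close>.
  The isotropic vectors therefore form one translate of the kernel \<open>K\<close> of
  \<open>l\<close> modulo \<open>p\<close>.\<close>

lemma card_isotropic_fibre:
  assumes p: "irreducible p" and c: "asc (nr c) p" and u: "u \<notin> rid c"
  shows "card (coset (rid (sc p)) ` ({x. p dvd nr x} \<inter> coset (rid c) u)) = znm p"
proof -
  have p0: "p \<noteq> 0" using p by auto
  define l where "l w = trc (cnj u * w)" for w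
  have l: "l (x - y) = l x - l y" "l (sc a * x) = a * l x" for x y a
    by (simp_all add: l_def right_diff_distrib sc_left_comm)
  have nrD: "p dvd nr w" if "w \<in> rid c" for w
    using mem_rid_dvd[OF that] c unfolding asc_def by (meson dvd_trans)
  have "\<exists>w\<in>rid c. \<not> p dvd l w"
  proof (rule ccontr)
    assume "\<not> (\<exists>w\<in>rid c. \<not> p dvd l w)"
    then have "p dvd trc ((cnj u * c) * y)" for y by (auto simp: l_def mult.assoc)
    then have "sdvd p (cnj u * c)" by (rule sdvd_nondegenerate)
    then have "sdvd p (cnj (cnj u * c))" by (simp only: sdvd_cnj)
    then have "sdvd p (cnj c * u)" by simp
    then show False using mem_rid_iff_cnj[OF p0 c] u by blast
  qed
  then obtain w1 where w1: "w1 \<in> rid c" "\<not> p dvd l w1" by blast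
  obtain s t where st: "s * p + t * l w1 = 1" using irreducible_imp_coprime_bezout[OF p w1(2)] by blast
  have sc_rid: "sc a * w \<in> rid c" if "w \<in> rid c" for a w
    using that by (auto simp flip: sc_left_comm)
  \<comment> \<open>Since \<open>t * l w1\<close> is 1 modulo \<open>p\<close>, this solves
    \<open>l w0 = - nr u\<close> modulo \<open>p\<close>.\<close>
  define w0 where "w0 = sc (- t * nr u) * w1"
  have w0: "w0 \<in> rid c" unfolding w0_def by (rule sc_rid[OF w1(1)])
  have "l w0 = - (t * l w1) * nr u" by (simp add: w0_def l del: sc_simps)
  also have "t * l w1 = 1 - s * p" using st by (simp add: algebra_simps)
  finally have lw0: "l w0 + nr u = p * (s * nr u)" by (simp add: algebra_simps)
  define K where "K = {w \<in> rid c. l w \<in> range ((*) p)}"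
  have sub: "rid (sc p) \<subseteq> K"
  proof
    fix x assume x: "x \<in> rid (sc p)"
    then have "l x \<in> range ((*) p)" by (auto simp: l)
    then show "x \<in> K" using x prime_rid_quotient(1)[OF p0 c] by (auto simp: K_def)
  qed
  have K: "subgrp K"
    unfolding subgrp_def
  proof (intro conjI ballI)
    have "l 0 = 0" by (simp add: l_def)
    then show "0 \<in> K"
      using subgrpD(1)[OF subgrp_range_mult[of c]] subgrpD(1)[OF subgrp_range_mult[of p]]
      by (simp add: K_def)
    fix x y assume "x \<in> K" "y \<in> K"
    then have xy: "x \<in> rid c" "y \<in> rid c" "l x \<in> range ((*) p)" "l y \<in> range ((*) p)"
      unfolding K_def by blast+
    show "x - y \<in> K"
      using subgrpD(2)[OF subgrp_range_mult xy(1,2)] subgrpD(2)[OF subgrp_range_mult xy(3,4)]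
      unfolding K_def l(1)[symmetric] by blast
  qed
  have "group_index (rid c) K = group_index UNIV (range ((*) p))"
    unfolding K_def
  proof (rule group_index_hom[OF l(1)])
    fix a :: zt
    have "l (sc (a * t) * w1) = a * (t * l w1)" by (simp add: l mult.assoc)
    also have "t * l w1 = 1 - s * p" using st by (simp add: algebra_simps)
    finally have "a - l (sc (a * t) * w1) = p * (a * s)" by (simp add: algebra_simps)
    then show "\<exists>w\<in>rid c. a - l w \<in> range ((*) p)" using sc_rid[OF w1(1)] by (metis rangeI)
  qed auto
  then have "group_index (rid c) K = znm p" using idx_zt[OF p0] by (simp add: idx_def)
  moreover have "group_index (rid c) (rid (sc p)) = group_index (rid c) K * group_index K (rid (sc p))"
    by (rule group_index_tower) (use K sub in \<open>auto simp: K_def\<close>)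
  ultimately have "znm p * group_index K (rid (sc p)) = znm p * znm p"
    using prime_rid_quotient(2)[OF p0 c] by (metis power2_eq_square)
  then have KB: "group_index K (rid (sc p)) = znm p" using p0 by simp
  have "{x. p dvd nr x} \<inter> coset (rid c) u = (+) (u + w0) ` K"
  proof -
    have *: "p dvd nr (u + w) \<longleftrightarrow> w - w0 \<in> K" if "w \<in> rid c" for w
    proof -
      have "nr (u + w) = nr u + l w + nr w" by (simp add: nr_add l_def)
      then have "p dvd nr (u + w) \<longleftrightarrow> p dvd nr u + l w" using nrD[OF that] by (simp add: dvd_add_left_iff)
      also have "nr u + l w = l (w - w0) + p * (s * nr u)" using lw0 by (simp add: l algebra_simps)
      also have "p dvd \<dots> \<longleftrightarrow> p dvd l (w - w0)" by (simp add: dvd_add_left_iff)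
      also have "\<dots> \<longleftrightarrow> w - w0 \<in> K"
        using subgrpD(2)[OF subgrp_range_mult that w0] by (auto simp: K_def dvd_def)
      finally show ?thesis .
    qed
    show ?thesis
    proof (intro equalityI subsetI)
      fix x assume "x \<in> {x. p dvd nr x} \<inter> coset (rid c) u"
      then obtain w where "w \<in> rid c" "x = u + w" "p dvd nr x" by blast
      then show "x \<in> (+) (u + w0) ` K" using * by (intro image_eqI[of _ _ "w - w0"]) auto
    next
      fix x assume "x \<in> (+) (u + w0) ` K"
      then obtain k where k: "k \<in> K" "x = u + (w0 + k)" by (auto simp: add.assoc)
      then have "k \<in> rid c" by (simp add: K_def)
      then have "w0 + k \<in> rid c" by (rule subgrpD(4)[OF subgrp_range_mult w0])
      then show "x \<in> {x. p dvd nr x} \<inter> coset (rid c) u" using *[of "w0 + k"] k by auto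
    qed
  qed
  then have "card (coset (rid (sc p)) ` ({x. p dvd nr x} \<inter> coset (rid c) u))
      = card ((\<lambda>x. coset (rid (sc p)) (u + w0 + x)) ` K)" by (simp add: image_image)
  also have "\<dots> = card (coset (rid (sc p)) ` K)"
    by (rule card_image_cong) (simp add: coset_eq_iff)
  finally show ?thesis using KB by (simp add: group_index_eq)
qed

lemma znm_irreducible:
  assumes "irreducible p"
  shows "znm p > 1"
proof (rule znm_gt_1)
  show "p \<noteq> 0" using assms by auto
  show "\<not> is_unit p" using assms by (rule irreducible_not_unit)
qed

lemma rids_prime_superset:
  assumes "p \<noteq> 0" "D \<in> rids p"
  shows "rid (sc p) \<subseteq> D" "D \<subseteq> {x. p dvd nr x}" "subgrp D" "group_index D (rid (sc p)) = znm p ^ 2"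
proof -
  obtain c where c: "D = rid c" "asc (nr c) p" using assms(2) by (auto simp: rids_def)
  show "rid (sc p) \<subseteq> D" "group_index D (rid (sc p)) = znm p ^ 2"
    unfolding c(1) by (rule prime_rid_quotient[OF assms(1) c(2)])+
  show "subgrp D" using c by simp
  show "D \<subseteq> {x. p dvd nr x}"
  proof
    fix x assume "x \<in> D"
    then have "nr c dvd nr x" using c mem_rid_dvd by simp
    moreover have "p dvd nr c" using c by (simp add: asc_def)
    ultimately have "p dvd nr x" using dvd_trans[of p "nr c" "nr x"] by simp
    then show "x \<in> {x. p dvd nr x}" by simp
  qed
qed

lemma finite_cosets_sc: "p \<noteq> 0 \<Longrightarrow> finite (coset (rid (sc p)) ` S)"
proof -
  assume "p \<noteq> 0"
  then have "card (coset (rid (sc p)) ` UNIV) > 0"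
    using idx_pos[of "sc p"] by (simp add: idx_def group_index_eq)
  then have "finite (coset (rid (sc p)) ` UNIV)" by (rule card_ge_0_finite)
  then show ?thesis by (rule finite_subset[rotated]) auto
qed

text \<open>With q = \<open>znm p\<close>, sort the isotropic vectors by their coset of one ideal
  \<open>rid c\<close> of norm \<open>p\<close>: the ideal itself contributes q^2 classes, and each
  of the other q^2 - 1 cosets contributes q.\<close>

lemma card_isotropic:
  assumes p: "irreducible p"
  shows "card (coset (rid (sc p)) ` {x. p dvd nr x}) = znm p ^ 2 + (znm p ^ 2 - 1) * znm p"
proof -
  have p0: "p \<noteq> 0" using p by auto
  obtain b where "p dvd nr b" "\<not> sdvd p b" using isotropic_exists[OF p] by blast
  then obtain D where "D \<in> rids p" using unique_prime_rid[OF p] by blast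
  then obtain c where c: "asc (nr c) p" by (auto simp: rids_def)
  define B where "B = rid (sc p)"
  define S where "S = {x. p dvd nr x}"
  define Q where "Q = coset (rid c) ` UNIV"
  note c3 = prime_rid_quotient[OF p0 c]
  have cardQ: "card Q = znm p ^ 2" using c3(3) by (simp add: Q_def group_index_eq)
  have finQ: "finite Q" using cardQ p0 by (intro card_ge_0_finite) (simp add: zero_less_iff_neq_zero)
  have cD: "coset (rid c) 0 = rid c" by simp
  have DQ: "rid c \<in> Q" unfolding Q_def using cD by (metis rangeI)
  have "coset B ` S = (\<Union>K\<in>Q. coset B ` (S \<inter> K))"
  proof (intro equalityI subsetI)
    fix z assume "z \<in> coset B ` S"
    then obtain x where x: "x \<in> S" "z = coset B x" by blast
    have "x \<in> coset (rid c) x" using subgrpD(1)[OF subgrp_range_mult[of c]] by force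
    then show "z \<in> (\<Union>K\<in>Q. coset B ` (S \<inter> K))" using x by (auto simp: Q_def)
  qed auto
  also have "card \<dots> = (\<Sum>K\<in>Q. card (coset B ` (S \<inter> K)))"
  proof (rule card_UN_disjoint[OF finQ])
    show "\<forall>K\<in>Q. finite (coset B ` (S \<inter> K))" unfolding B_def using finite_cosets_sc[OF p0] by blast
    show "\<forall>K\<in>Q. \<forall>L\<in>Q. K \<noteq> L \<longrightarrow> coset B ` (S \<inter> K) \<inter> coset B ` (S \<inter> L) = {}"
    proof (intro ballI impI)
      fix K L assume KL: "K \<in> Q" "L \<in> Q" "K \<noteq> L"
      obtain u v where uv: "K = coset (rid c) u" "L = coset (rid c) v" using KL by (auto simp: Q_def)
      show "coset B ` (S \<inter> K) \<inter> coset B ` (S \<inter> L) = {}"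
      proof (rule ccontr)
        assume "\<not> ?thesis"
        then obtain x y where xy: "x \<in> K" "y \<in> L" "coset B x = coset B y" by blast
        have 1: "x - y \<in> rid c" using xy(3) coset_eq_iff[of B x y] c3(1) by (auto simp: B_def)
        have 2: "x - u \<in> rid c" and 3: "y - v \<in> rid c" using xy(1,2) by (auto simp: uv)
        have "(x - y) - (x - u) + (y - v) \<in> rid c"
          by (rule subgrpD(4)[OF subgrp_range_mult subgrpD(2)[OF subgrp_range_mult 1 2] 3])
        then have "K = L" unfolding uv by (subst coset_eq_iff) simp_all
        then show False using KL by simp
      qed
    qed
  qed
  also have "\<dots> = card (coset B ` (S \<inter> rid c)) + (\<Sum>K\<in>Q - {rid c}. card (coset B ` (S \<inter> K)))"
    using finQ DQ by (rule sum.remove)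
  also have "S \<inter> rid c = rid c" using rids_prime_superset(2)[OF p0 mem_rids[OF c]] by (auto simp: S_def)
  also have "card (coset B ` rid c) = znm p ^ 2" using c3(2) by (simp add: B_def group_index_eq)
  also have "(\<Sum>K\<in>Q - {rid c}. card (coset B ` (S \<inter> K))) = (\<Sum>K\<in>Q - {rid c}. znm p)"
  proof (rule sum.cong)
    fix K assume K: "K \<in> Q - {rid c}"
    then obtain u where u: "K = coset (rid c) u" by (auto simp: Q_def)
    have "u \<notin> rid c"
    proof
      assume "u \<in> rid c"
      then have "coset (rid c) u = coset (rid c) 0" by (subst coset_eq_iff) simp_all
      then show False using K u by simp
    qed
    then show "card (coset B ` (S \<inter> K)) = znm p"
      unfolding B_def S_def u by (rule card_isotropic_fibre[OF p c])
  qed simp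
  also have "\<dots> = (znm p ^ 2 - 1) * znm p" using cardQ finQ DQ by simp
  finally show ?thesis by (simp add: B_def S_def)
qed

text \<open>By \<open>unique_prime_rid\<close> the ideals of norm \<open>p\<close> partition the
  nonzero isotropic classes modulo \<open>p\<close>. There are (q + 1)(q^2 - 1) of these with q =
  \<open>znm p\<close>, and q^2 - 1 lie in each ideal.\<close>

theorem card_rids_prime:
  assumes p: "irreducible p"
  shows "card (rids p) = znm p + 1"
proof -
  have p0: "p \<noteq> 0" using p by auto
  define q where "q = znm p"
  define B where "B = rid (sc p)"
  define S where "S = {x. p dvd nr x}"
  have subB: "subgrp B" by (simp add: B_def)
  have q: "q > 1" using znm_irreducible[OF p] by (simp add: q_def)
  have cosB: "coset B x = B \<longleftrightarrow> x \<in> B" for x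
    using coset_eq_iff[OF subB, of x 0] by simp
  have D: "B \<subseteq> D" "D \<subseteq> S" "subgrp D" "card (coset B ` D) = q ^ 2" if "D \<in> rids p" for D
    using rids_prime_superset[OF p0 that] by (simp_all add: B_def S_def q_def group_index_eq)
  have fin: "finite (coset B ` X)" for X unfolding B_def using finite_cosets_sc[OF p0] .
  have mem: "B \<in> coset B ` X" if "B \<subseteq> X" for X
  proof (rule image_eqI)
    show "0 \<in> X" using that subgrpD(1)[OF subB] by blast
  qed simp
  have "coset B ` S - {B} = (\<Union>D\<in>rids p. coset B ` D - {B})"
  proof (intro equalityI subsetI)
    fix z assume "z \<in> coset B ` S - {B}"
    then obtain x where "x \<in> S" "z = coset B x" "z \<noteq> B" by blast
    then have x: "p dvd nr x" "z = coset B x" "x \<notin> B" by (simp_all add: S_def cosB)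
    then have "\<not> sdvd p x" by (simp add: sdvd_def B_def)
    then obtain D where "D \<in> rids p" "x \<in> D" using unique_prime_rid[OF p x(1)] by blast
    then show "z \<in> (\<Union>D\<in>rids p. coset B ` D - {B})" using x by (auto simp: cosB)
  qed (use D(2) in blast)
  also have "card \<dots> = (\<Sum>D\<in>rids p. card (coset B ` D - {B}))"
  proof (rule card_UN_disjoint[OF finite_rids[OF p0]])
    show "\<forall>D\<in>rids p. finite (coset B ` D - {B})" using fin by blast
    show "\<forall>D\<in>rids p. \<forall>E\<in>rids p. D \<noteq> E \<longrightarrow> (coset B ` D - {B}) \<inter> (coset B ` E - {B}) = {}"
    proof (intro ballI impI)
      fix D E assume DE: "D \<in> rids p" "E \<in> rids p" "D \<noteq> E"
      show "(coset B ` D - {B}) \<inter> (coset B ` E - {B}) = {}"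
      proof (rule ccontr)
        assume "\<not> ?thesis"
        then obtain x y where xy: "x \<in> D" "y \<in> E" "coset B x = coset B y" "coset B x \<noteq> B" by blast
        then have "x \<notin> B" using cosB[of x] by simp
        have "x - y \<in> B" using coset_eq_iff[OF subB, of x y] xy(3) by simp
        then have "x - y \<in> E" using D(1)[OF DE(2)] by (rule rev_subsetD)
        then have "x \<in> E" using subgrpD(4)[OF D(3)[OF DE(2)] _ xy(2), of "x - y"] by simp
        moreover have "p dvd nr x" using D(2)[OF DE(1)] xy(1) by (auto simp: S_def)
        moreover have "\<not> sdvd p x" using \<open>x \<notin> B\<close> by (simp add: sdvd_def B_def)
        ultimately have "\<exists>F. \<forall>G. G \<in> rids p \<and> x \<in> G \<longrightarrow> G = F"
          using unique_prime_rid[OF p, of x] unfolding Ex1_def by metis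
        then show False using DE xy(1) \<open>x \<in> E\<close> by metis
      qed
    qed
  qed
  also have "\<dots> = (\<Sum>D\<in>rids p. q ^ 2 - 1)"
  proof (rule sum.cong)
    fix D assume "D \<in> rids p"
    then show "card (coset B ` D - {B}) = q ^ 2 - 1"
      using card_Diff_singleton[OF mem[OF D(1)]] D(4) by simp
  qed simp
  finally have "card (coset B ` S - {B}) = card (rids p) * (q ^ 2 - 1)" by simp
  moreover have "B \<subseteq> S"
  proof
    fix x assume "x \<in> B"
    then have "p * p dvd nr x" using sdvd_nr by (simp add: B_def sdvd_def)
    then have "p dvd nr x" by (rule dvd_mult_left)
    then show "x \<in> S" by (simp add: S_def)
  qed
  ultimately have "card (coset B ` S) - 1 = card (rids p) * (q ^ 2 - 1)"
    using card_Diff_singleton[OF mem] by simp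
  then have "q ^ 2 + (q ^ 2 - 1) * q - 1 = card (rids p) * (q ^ 2 - 1)"
    using card_isotropic[OF p] by (simp add: S_def B_def q_def)
  moreover have "q ^ 2 > 1" using one_less_power[OF q, of 2] by simp
  then obtain k where k: "q ^ 2 = Suc k" "k > 0" by (cases "q ^ 2") auto
  ultimately have "(q + 1) * k = card (rids p) * k" by (simp add: mult.commute)
  then have "q + 1 = card (rids p)" using k(2) by (metis less_irrefl mult_right_cancel)
  then show ?thesis by (simp add: q_def)
qed

section \<open>The Hecke recursion for right ideals\<close>

lemma image_mult_rid: "(*) a ` rid b = rid (a * b)"
  by (auto simp: image_image mult.assoc)

lemma asc_unit: "asc x y \<Longrightarrow> y \<noteq> 0 \<Longrightarrow> \<exists>u. is_unit u \<and> x = u * y"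
  unfolding asc_def
proof -
  assume a: "x dvd y \<and> y dvd x" "y \<noteq> 0"
  then obtain u where u: "x = y * u" by blast
  then have "is_unit u" using a by simp
  then show ?thesis using u by (auto simp: mult.commute)
qed

lemma rid_sc_unit: "is_unit u \<Longrightarrow> rid (sc u * a) = rid a"
proof -
  assume "is_unit u"
  then obtain v where v: "u * v = 1" by (metis dvdE)
  have "sc u * a * sc v = sc v * (sc u * a)" by (rule sc_comm)
  also have "\<dots> = sc (u * v) * a" by (simp only: sc_mult mult.assoc mult.commute[of u v])
  finally have "a = sc u * a * sc v" using v by simp
  then have "a \<in> rid (sc u * a)" by blast
  moreover have "sc u * a = a * sc u" by (simp only: sc_comm)
  then have "sc u * a \<in> rid a" by blast
  ultimately show ?thesis by (metis rid_subset_iff subset_antisym)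
qed

lemma inj_mult_left: "(a::ico) \<noteq> 0 \<Longrightarrow> inj ((*) a)"
  by (simp add: inj_def)

text \<open>Left multiplication by a generator of \<open>I\<close> carries the ideals of norm
  \<open>p\<close> to the ideals in question.\<close>

lemma card_rids_below:
  assumes "n \<noteq> 0" "p \<noteq> 0" "I \<in> rids n"
  shows "card {J \<in> rids (p * n). J \<subseteq> I} = card (rids p)"
proof -
  obtain a where a: "I = rid a" "asc (nr a) n" using assms(3) by (auto simp: rids_def)
  have a0: "nr a \<noteq> 0" "a \<noteq> 0" using a assms(1) by (auto simp: asc_0)
  have "{J \<in> rids (p * n). J \<subseteq> I} = (`) ((*) a) ` rids p"
  proof (intro equalityI subsetI)
    fix J assume "J \<in> {J \<in> rids (p * n). J \<subseteq> I}"
    then obtain b where b: "J = rid b" "asc (nr b) (p * n)" "b \<in> rid a"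
      using a(1) by (auto simp: rids_def rid_subset_iff)
    then obtain d where d: "b = a * d" by blast
    have "asc (nr a * nr d) (n * p)" using b(2) by (simp add: d nr_mult mult.commute)
    then have "asc (nr d) p" by (rule asc_cancel2[OF a0(1) a(2)])
    then have "rid d \<in> rids p" by (rule mem_rids)
    moreover have "J = (*) a ` rid d" by (simp add: b d image_mult_rid)
    ultimately show "J \<in> (`) ((*) a) ` rids p" by blast
  next
    fix J assume "J \<in> (`) ((*) a) ` rids p"
    then obtain d where d: "J = rid (a * d)" "asc (nr d) p" by (auto simp: rids_def image_mult_rid)
    have "asc (nr (a * d)) (n * p)" unfolding nr_mult using a(2) d(2) by (rule asc_mult)
    then show "J \<in> {J \<in> rids (p * n). J \<subseteq> I}"
      using d a by (auto simp: rid_subset_iff mem_rids mult.commute[of p])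
  qed
  moreover have "inj_on ((`) ((*) a)) (rids p)"
    using inj_mult_left[OF a0(2)] by (simp add: inj_on_def inj_image_eq_iff)
  ultimately show ?thesis by (simp add: card_image)
qed

text \<open>If b = a d, the ideal \<open>rid a\<close> above \<open>rid b\<close> corresponds to the
  ideal \<open>rid (cnj d)\<close> of norm \<open>p\<close>, because b * cnj d is \<open>p\<close>
  times \<open>a\<close> up to a unit. The ideals D that occur are those with b D inside the ideal
  of \<open>p\<close>: all of them if \<open>p\<close> divides \<open>b\<close>, otherwise exactly
  the one containing \<open>cnj b\<close>.\<close>

lemma card_rids_above:
  assumes n: "n \<noteq> 0" and p: "irreducible p" and b: "asc (nr b) (p * n)"
  shows "card {I \<in> rids n. rid b \<subseteq> I} = (if sdvd p b then znm p + 1 else 1)"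
proof -
  have p0: "p \<noteq> 0" using p by auto
  have b0: "b \<noteq> 0" "nr b \<noteq> 0" using b n p0 by (auto simp: asc_0)
  have "p * n dvd nr b" using b by (simp add: asc_def)
  then have pb: "p dvd nr b" by (rule dvd_mult_left)
  \<comment> \<open>This is p^(-1) b D, an ideal whenever b D consists of multiples of
    \<open>p\<close>.\<close>
  define \<Phi> where "\<Phi> D = {z. sc p * z \<in> (*) b ` D}" for D
  define X where "X = {D \<in> rids p. (*) b ` D \<subseteq> rid (sc p)}"
  have \<Phi>: "\<Phi> (rid c) = rid z" if "b * c = sc p * z" for c z
    using that p0 by (auto simp: \<Phi>_def image_mult_rid mult.assoc image_iff)
  have Xc: "rid c \<in> X \<longleftrightarrow> asc (nr c) p \<and> sdvd p (b * c)" for c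
    by (simp add: X_def rids_mem_iff image_mult_rid rid_subset_iff sdvd_def)
  have "bij_betw \<Phi> X {I \<in> rids n. rid b \<subseteq> I}"
    unfolding bij_betw_def
  proof
    show "inj_on \<Phi> X"
    proof (rule inj_onI)
      fix D E assume DE: "D \<in> X" "E \<in> X" "\<Phi> D = \<Phi> E"
      have *: "(*) b ` D = (*) (sc p) ` \<Phi> D" if "D \<in> X" for D
      proof (intro equalityI subsetI)
        fix y assume y: "y \<in> (*) b ` D"
        then have "y \<in> rid (sc p)" using that unfolding X_def by blast
        then obtain z where "y = sc p * z" by blast
        then show "y \<in> (*) (sc p) ` \<Phi> D" using y by (auto simp: \<Phi>_def)
      qed (auto simp: \<Phi>_def)
      have "(*) b ` D = (*) b ` E" using *[OF DE(1)] *[OF DE(2)] DE(3) by simp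
      then show "D = E" using inj_mult_left[OF b0(1)] by (simp add: inj_image_eq_iff)
    qed
    show "\<Phi> ` X = {I \<in> rids n. rid b \<subseteq> I}"
    proof (intro equalityI subsetI)
      fix I assume "I \<in> \<Phi> ` X"
      then obtain c where c: "I = \<Phi> (rid c)" "rid c \<in> X"
        by (auto simp: X_def rids_def)
      then have c': "asc (nr c) p" "sdvd p (b * c)" using Xc by simp_all
      then obtain a where a: "b * c = sc p * a" by (auto simp: sdvd_def)
      obtain u where u: "is_unit u" "nr c = u * p" using asc_unit[OF c'(1) p0] by blast
      have "sc p * (sc u * b) = sc (p * u) * b" by (simp only: sc_mult mult.assoc)
      also have "\<dots> = b * (c * cnj c)" by (simp only: mult_cnj u mult.commute[of p u] sc_comm[of b])
      also have "\<dots> = sc p * (a * cnj c)" by (simp add: a flip: mult.assoc)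
      finally have ub: "sc u * b = a * cnj c" using p0 by simp
      have "sc u * b \<in> rid a" unfolding ub by blast
      then have "rid (sc u * b) \<subseteq> rid a" by (simp only: rid_subset_iff)
      then have "rid b \<subseteq> rid a" by (simp only: rid_sc_unit[OF u(1)])
      moreover have "asc (nr a) n"
      proof -
        have "p * p * nr a = nr b * nr c" using arg_cong[OF a, of nr] by (simp add: nr_mult)
        moreover have "asc (nr b * nr c) (p * n * p)" using asc_mult[OF b c'(1)] .
        ultimately have "asc (p * p * nr a) (p * p * n)" by (simp add: mult.commute mult.left_commute)
        then show ?thesis using p0 by (subst (asm) asc_cancel) simp_all
      qed
      ultimately show "I \<in> {I \<in> rids n. rid b \<subseteq> I}" using c(1) \<Phi>[OF a] by (simp add: mem_rids)
    next
      fix I assume "I \<in> {I \<in> rids n. rid b \<subseteq> I}"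
      then obtain a where a: "I = rid a" "asc (nr a) n" "b \<in> rid a"
        by (auto simp: rids_def rid_subset_iff)
      then obtain d where d: "b = a * d" by blast
      have a0: "nr a \<noteq> 0" using b0 d by (auto simp: nr_mult)
      have "asc (nr a * nr d) (n * p)" using b by (simp add: d nr_mult mult.commute)
      then have nd: "asc (nr d) p" by (rule asc_cancel2[OF a0 a(2)])
      then obtain u where u: "is_unit u" "nr d = u * p" using asc_unit[OF nd p0] by blast
      have bd: "b * cnj d = sc p * (sc u * a)"
      proof -
        have "b * cnj d = a * (d * cnj d)" by (simp only: d mult.assoc)
        also have "\<dots> = sc (p * u) * a" by (simp only: mult_cnj u mult.commute[of p u] sc_comm[of a])
        finally show ?thesis by (simp only: sc_mult mult.assoc)
      qed
      then have "rid (cnj d) \<in> X" using nd by (auto simp: Xc sdvd_def)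
      moreover have "\<Phi> (rid (cnj d)) = I" using \<Phi>[OF bd] rid_sc_unit[OF u(1)] a by simp
      ultimately show "I \<in> \<Phi> ` X" by blast
    qed
  qed
  then have "card {I \<in> rids n. rid b \<subseteq> I} = card X" using bij_betw_same_card by metis
  also have "card X = (if sdvd p b then znm p + 1 else 1)"
  proof (cases "sdvd p b")
    case True
    then have "X = rids p" by (auto simp: X_def sdvd_def[symmetric] sdvd_mult)
    then show ?thesis using True card_rids_prime[OF p] by simp
  next
    case False
    have "D \<in> X \<longleftrightarrow> D \<in> rids p \<and> cnj b \<in> D" for D
    proof (cases "D \<in> rids p")
      case True
      then obtain c where c: "D = rid c" "asc (nr c) p" by (auto simp: rids_def)
      have "D \<in> X \<longleftrightarrow> sdvd p (cnj (b * c))" using Xc c by (simp del: cnj_mult)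
      also have "\<dots> \<longleftrightarrow> cnj b \<in> D" using mem_rid_iff_cnj[OF p0 c(2)] c by simp
      finally show ?thesis using True by simp
    qed (auto simp: X_def)
    moreover have "\<exists>!D. D \<in> rids p \<and> cnj b \<in> D"
      using unique_prime_rid[OF p, of "cnj b"] pb False by simp
    ultimately obtain D where "X = {D}" by (metis (no_types, lifting) equalityI insertI1 singletonD subsetI)
    then show ?thesis using False by simp
  qed
  finally show ?thesis .
qed

lemma card_rids_divisible:
  assumes n: "n \<noteq> 0" and p: "p \<noteq> 0"
  shows "card {J \<in> rids (p * n). J \<subseteq> rid (sc p)} = (if p dvd n then card (rids (n div p)) else 0)"
proof (cases "p dvd n")
  case True
  then obtain m where m: "n = p * m" by blast
  have "{J \<in> rids (p * n). J \<subseteq> rid (sc p)} = (`) ((*) (sc p)) ` rids m"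
  proof (intro equalityI subsetI)
    fix J assume "J \<in> {J \<in> rids (p * n). J \<subseteq> rid (sc p)}"
    then obtain b where b: "J = rid b" "asc (nr b) (p * n)" "b \<in> rid (sc p)"
      by (auto simp: rids_def rid_subset_iff)
    then obtain d where d: "b = sc p * d" by blast
    have "asc (p * p * nr d) (p * p * m)" using b(2) by (simp add: d m nr_mult mult.assoc)
    then have "asc (nr d) m" using p by (subst (asm) asc_cancel) simp_all
    then have "rid d \<in> rids m" by (rule mem_rids)
    moreover have "J = (*) (sc p) ` rid d" by (simp add: b d image_mult_rid)
    ultimately show "J \<in> (`) ((*) (sc p)) ` rids m" by blast
  next
    fix J assume "J \<in> (`) ((*) (sc p)) ` rids m"
    then obtain d where d: "J = rid (sc p * d)" "asc (nr d) m" by (auto simp: rids_def image_mult_rid)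
    have "asc (nr (sc p * d)) (p * n)"
      unfolding nr_mult m using asc_mult[OF asc_refl d(2), of "p * p"] by (simp add: mult.assoc)
    then show "J \<in> {J \<in> rids (p * n). J \<subseteq> rid (sc p)}"
      using d by (auto simp: rid_subset_iff mem_rids)
  qed
  moreover have "inj_on ((`) ((*) (sc p))) (rids m)"
    using inj_mult_left[of "sc p"] p by (simp add: inj_on_def inj_image_eq_iff)
  ultimately show ?thesis using True p m by (simp add: card_image)
next
  case False
  have empty: "{J \<in> rids (p * n). J \<subseteq> rid (sc p)} = {}"
  proof (rule ccontr)
    assume "\<not> ?thesis"
    then obtain b where b: "asc (nr b) (p * n)" "b \<in> rid (sc p)"
      by (auto simp: rids_def rid_subset_iff)
    then have "p * p dvd nr b" using sdvd_nr by (simp add: sdvd_def)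
    moreover have "nr b dvd p * n" using b(1) by (simp add: asc_def)
    ultimately have "p * p dvd p * n" by (rule dvd_trans)
    then show False using False p by simp
  qed
  show ?thesis unfolding empty using False by simp
qed

text \<open>Count the pairs J \<subseteq> I, with I of norm \<open>n\<close> and J of norm
  \<open>p * n\<close>, from both sides. A J inside the ideal of \<open>p\<close> is counted
  \<open>znm p\<close> additional times, and such J are \<open>p\<close> times ideals of norm
  \<open>n div p\<close>.\<close>

theorem hecke_rids:
  assumes n: "n \<noteq> 0" and p: "irreducible p"
  shows "(znm p + 1) * card (rids n)
    = card (rids (p * n)) + znm p * (if p dvd n then card (rids (n div p)) else 0)"
proof -
  have p0: "p \<noteq> 0" using p by auto
  have pn: "p * n \<noteq> 0" using n p0 by simp
  have fin: "finite (rids n)" "finite (rids (p * n))" using n pn finite_rids by blast+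
  have "(znm p + 1) * card (rids n) = (\<Sum>I\<in>rids n. card {J \<in> rids (p * n). J \<subseteq> I})"
    using card_rids_below[OF n p0] card_rids_prime[OF p] by simp
  also have "\<dots> = (\<Sum>J\<in>rids (p * n). if J \<subseteq> rid (sc p) then znm p + 1 else 1)"
  proof (rule sum_multicount_gen[OF fin])
    show "\<forall>J\<in>rids (p * n). card {I \<in> rids n. J \<subseteq> I} = (if J \<subseteq> rid (sc p) then znm p + 1 else 1)"
    proof
      fix J assume "J \<in> rids (p * n)"
      then obtain b where "J = rid b" "asc (nr b) (p * n)" by (auto simp: rids_def)
      then show "card {I \<in> rids n. J \<subseteq> I} = (if J \<subseteq> rid (sc p) then znm p + 1 else 1)"
        using card_rids_above[OF n p] by (simp add: rid_subset_iff sdvd_def)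
    qed
  qed
  also have "\<dots> = (\<Sum>J\<in>rids (p * n). 1 + (if J \<subseteq> rid (sc p) then znm p else 0))"
    by (rule sum.cong) auto
  also have "\<dots> = card (rids (p * n)) + (\<Sum>J\<in>rids (p * n). if J \<subseteq> rid (sc p) then znm p else 0)"
    by (simp only: sum.distrib card_eq_sum)
  also have "(\<Sum>J\<in>rids (p * n). if J \<subseteq> rid (sc p) then znm p else 0)
      = znm p * card {J \<in> rids (p * n). J \<subseteq> rid (sc p)}"
    using fin by (simp add: sum.If_cases Int_def)
  finally show ?thesis by (simp only: card_rids_divisible[OF n p0])
qed

subsection \<open>Counting ideals by norm\<close>

abbreviation zid :: "zt \<Rightarrow> zt set" where "zid d \<equiv> range ((*) d)"

lemma zid_subset_iff: "zid a \<subseteq> zid b \<longleftrightarrow> b dvd a"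
proof
  assume "zid a \<subseteq> zid b"
  moreover have "a * 1 \<in> zid a" by (rule rangeI)
  ultimately show "b dvd a" by (auto simp: dvd_def)
next
  assume "b dvd a"
  then obtain k where "a = b * k" by blast
  then show "zid a \<subseteq> zid b" by (auto simp: mult.assoc)
qed

lemma zid_eq_iff: "zid a = zid b \<longleftrightarrow> asc a b"
proof -
  have "zid a = zid b \<longleftrightarrow> zid a \<subseteq> zid b \<and> zid b \<subseteq> zid a" by (rule set_eq_subset)
  also have "\<dots> \<longleftrightarrow> asc a b" unfolding zid_subset_iff asc_def by (rule conj_commute)
  finally show ?thesis .
qed

definition zids_above :: "zt \<Rightarrow> zt set set" where "zids_above n = {zid d | d. d dvd n}"

text \<open>The sum of the norms of the ideals dividing \<open>n\<close>: the coefficients of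
  zeta(s) zeta(s - 1) of the golden field, indexed by ideals instead of by norms.\<close>

definition zsigma :: "zt \<Rightarrow> nat" where
  "zsigma n = (\<Sum>X\<in>zids_above n. group_index UNIV X)"

lemma group_index_zid: "d \<noteq> 0 \<Longrightarrow> group_index UNIV (zid d) = znm d"
  using idx_zt[of d] by (simp add: idx_def)

lemma zid_mem_above: "zid d \<in> zids_above n \<longleftrightarrow> d dvd n"
proof
  assume "zid d \<in> zids_above n"
  then obtain e where "asc d e" "e dvd n" by (auto simp: zids_above_def zid_eq_iff)
  then show "d dvd n" by (simp add: asc_def dvd_trans[of d e n])
qed (auto simp: zids_above_def)

lemma finite_zids_above: "n \<noteq> 0 \<Longrightarrow> finite (zids_above n)"
proof -
  assume n: "n \<noteq> 0"
  show "finite (zids_above n)"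
  proof (rule finite_subset)
    show "zids_above n \<subseteq> {D. zid n \<subseteq> D \<and> subgrp D}"
      by (simp add: zids_above_def subset_iff zid_subset_iff) (auto simp flip: zid_subset_iff)
    have "znm n > 0" using n by (simp add: zero_less_iff_neq_zero)
    then show "finite {D. zid n \<subseteq> D \<and> subgrp D}"
      by (intro finite_supergroups) (simp_all add: group_index_zid n)
  qed
qed

lemma image_mult_zid: "(*) a ` zid b = zid (a * b)"
  by (auto simp: image_image mult.assoc)

lemma inj_image_mult: "(a::zt) \<noteq> 0 \<Longrightarrow> inj_on ((`) ((*) a)) S"
  by (simp add: inj_on_def inj_image_eq_iff inj_def)

lemma dvd_prime_mult:
  assumes p: "irreducible (p::zt)" and d: "d dvd p * n"
  shows "d dvd n \<or> (\<exists>e. d = p * e \<and> e dvd n)"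
proof (cases "p dvd d")
  case True
  have "p \<noteq> 0" using p by auto
  then show ?thesis using True d by (auto elim!: dvdE simp: mult.assoc)
next
  case False
  then obtain s t where st: "s * p + t * d = 1" using irreducible_imp_coprime_bezout[OF p] by blast
  obtain k where k: "p * n = d * k" using d by blast
  have "n = (s * p + t * d) * n" by (simp add: st)
  also have "\<dots> = s * (p * n) + d * (t * n)" by (simp add: algebra_simps)
  also have "\<dots> = d * (s * k + t * n)" unfolding k by (simp add: algebra_simps)
  finally show ?thesis by (metis dvdI)
qed

lemma zids_above_mult:
  assumes p: "irreducible p"
  shows "zids_above (p * n) = zids_above n \<union> (`) ((*) p) ` zids_above n"
proof (intro equalityI subsetI)
  fix X assume "X \<in> zids_above (p * n)"
  then obtain d where d: "X = zid d" "d dvd p * n" by (auto simp: zids_above_def)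
  show "X \<in> zids_above n \<union> (`) ((*) p) ` zids_above n"
    using dvd_prime_mult[OF p d(2)]
  proof
    assume "\<exists>e. d = p * e \<and> e dvd n"
    then obtain e where "d = p * e" "e dvd n" by blast
    then have "X = (*) p ` zid e" "zid e \<in> zids_above n"
      by (simp_all add: d image_mult_zid zid_mem_above)
    then show ?thesis by blast
  qed (simp add: d zid_mem_above)
next
  fix X assume "X \<in> zids_above n \<union> (`) ((*) p) ` zids_above n"
  then obtain d where "d dvd n" "X = zid d \<or> X = zid (p * d)"
    by (auto simp: zids_above_def image_mult_zid)
  then show "X \<in> zids_above (p * n)" using zid_mem_above by (auto intro: mult_dvd_mono dvd_mult)
qed

lemma zids_above_Int:
  assumes p: "irreducible p"
  shows "zids_above n \<inter> (`) ((*) p) ` zids_above n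
    = (if p dvd n then (`) ((*) p) ` zids_above (n div p) else {})"
proof -
  have p0: "p \<noteq> 0" using p by auto
  show ?thesis
  proof (cases "p dvd n")
    case True
    then obtain m where m: "n = p * m" by blast
    have "X \<in> zids_above n \<inter> (`) ((*) p) ` zids_above n \<longleftrightarrow> X \<in> (`) ((*) p) ` zids_above m" for X
    proof
      assume "X \<in> zids_above n \<inter> (`) ((*) p) ` zids_above n"
      then obtain Y where Y: "Y \<in> zids_above n" "X = (*) p ` Y" "X \<in> zids_above n" by blast
      then obtain d where "Y = zid d" by (auto simp: zids_above_def)
      then have d: "X = zid (p * d)" "zid (p * d) \<in> zids_above n" using Y by (simp_all add: image_mult_zid)
      then have "d dvd m" using p0 by (simp add: m zid_mem_above)
      then show "X \<in> (`) ((*) p) ` zids_above m"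
        using d(1) by (auto simp: zid_mem_above simp flip: image_mult_zid)
    next
      assume "X \<in> (`) ((*) p) ` zids_above m"
      then obtain d where d: "X = zid (p * d)" "X = (*) p ` zid d" "d dvd m"
        by (auto simp: zids_above_def image_mult_zid)
      then have "zid d \<in> zids_above n" by (simp add: zid_mem_above m)
      then have "X \<in> (`) ((*) p) ` zids_above n" unfolding d(2) by (rule imageI)
      moreover have "X \<in> zids_above n" using d(3) unfolding d(1) zid_mem_above m by (rule mult_dvd_mono[OF dvd_refl])
      ultimately show "X \<in> zids_above n \<inter> (`) ((*) p) ` zids_above n" by blast
    qed
    then show ?thesis using True p0 m by auto
  next
    case False
    have "X \<notin> zids_above n \<inter> (`) ((*) p) ` zids_above n" for X
    proof
      assume "X \<in> zids_above n \<inter> (`) ((*) p) ` zids_above n"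
      then obtain Y where Y: "Y \<in> zids_above n" "X = (*) p ` Y" "X \<in> zids_above n" by blast
      then obtain d where "Y = zid d" by (auto simp: zids_above_def)
      then have "zid (p * d) \<in> zids_above n" using Y by (simp add: image_mult_zid)
      then have "p * d dvd n" by (simp add: zid_mem_above)
      then have "p dvd n" by (rule dvd_mult_left)
      then show False using False by simp
    qed
    then show ?thesis using False by auto
  qed
qed

lemma sum_index_image:
  assumes "p \<noteq> 0" "n \<noteq> 0"
  shows "(\<Sum>X\<in>(`) ((*) p) ` zids_above n. group_index UNIV X) = znm p * zsigma n"
proof -
  have "(\<Sum>X\<in>(`) ((*) p) ` zids_above n. group_index UNIV X)
      = (\<Sum>X\<in>zids_above n. group_index UNIV ((*) p ` X))"
    by (rule sum.reindex[unfolded o_def]) (rule inj_image_mult[OF assms(1)])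
  also have "\<dots> = (\<Sum>X\<in>zids_above n. znm p * group_index UNIV X)"
  proof (rule sum.cong)
    fix X assume "X \<in> zids_above n"
    then obtain d where d: "X = zid d" "d dvd n" by (auto simp: zids_above_def)
    then have "d \<noteq> 0" using assms(2) by auto
    then show "group_index UNIV ((*) p ` X) = znm p * group_index UNIV X"
      using assms(1) by (simp add: d image_mult_zid group_index_zid znm_mult)
  qed simp
  finally show ?thesis by (simp add: zsigma_def sum_distrib_left)
qed

text \<open>Inclusion-exclusion: the divisors of \<open>p * n\<close> are the divisors of
  \<open>n\<close> together with \<open>p\<close> times those divisors.\<close>

lemma hecke_zsigma:
  assumes n: "n \<noteq> 0" and p: "irreducible p"
  shows "(znm p + 1) * zsigma n
    = zsigma (p * n) + znm p * (if p dvd n then zsigma (n div p) else 0)"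
proof -
  have p0: "p \<noteq> 0" using p by auto
  let ?A = "zids_above n" and ?B = "(`) ((*) p) ` zids_above n"
  have "sum (group_index UNIV) (?A \<union> ?B) + sum (group_index UNIV) (?A \<inter> ?B)
      = sum (group_index UNIV) ?A + sum (group_index UNIV) ?B"
    by (rule sum.union_inter) (use finite_zids_above[OF n] in auto)
  moreover have "sum (group_index UNIV) (?A \<union> ?B) = zsigma (p * n)"
    using zids_above_mult[OF p] by (simp add: zsigma_def)
  moreover have "sum (group_index UNIV) (?A \<inter> ?B) = znm p * (if p dvd n then zsigma (n div p) else 0)"
  proof (cases "p dvd n")
    case True
    then have "n div p \<noteq> 0" using n p0 by auto
    then show ?thesis using True zids_above_Int[OF p, of n] sum_index_image[OF p0] by simp
  qed (use zids_above_Int[OF p, of n] in simp)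
  moreover have "sum (group_index UNIV) ?B = znm p * zsigma n" by (rule sum_index_image[OF p0 n])
  moreover have "sum (group_index UNIV) ?A = zsigma n" by (simp add: zsigma_def)
  ultimately show ?thesis by simp
qed

text \<open>Both sides are 1 at units and satisfy the same recursion at every irreducible
  factor.\<close>

theorem card_rids: "n \<noteq> 0 \<Longrightarrow> card (rids n) = zsigma n"
proof (induction "znm n" arbitrary: n rule: less_induct)
  case less
  show ?case
  proof (cases "is_unit n")
    case True
    have "rids n = {UNIV}"
    proof (intro equalityI subsetI)
      fix D assume "D \<in> rids n"
      then obtain c where c: "D = rid c" "asc (nr c) n" by (auto simp: rids_def)
      then have "asc (nr c) (nr 1)" using True by (simp add: asc_def) (meson dvd_trans)
      then have "rid c = rid 1" using c(2) less.prems by (intro rid_eqI) (auto simp: asc_0)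
      then show "D \<in> {UNIV}" by (simp add: c(1))
    next
      fix D :: "ico set" assume "D \<in> {UNIV}"
      then have "D = rid 1" by simp
      moreover have "asc (nr 1) n" using True by (simp add: asc_def)
      ultimately show "D \<in> rids n" using mem_rids by blast
    qed
    moreover have "zids_above n = {UNIV}"
    proof (intro equalityI subsetI)
      fix X assume "X \<in> zids_above n"
      then obtain d where d: "X = zid d" "d dvd n" by (auto simp: zids_above_def)
      then have "d dvd 1" using True by (meson dvd_trans)
      then have "X = zid 1" unfolding d(1) zid_eq_iff by (simp add: asc_def)
      then show "X \<in> {UNIV}" by simp
    next
      fix X :: "zt set" assume "X \<in> {UNIV}"
      then have "X = zid 1" by simp
      then show "X \<in> zids_above n" by (simp only: zid_mem_above one_dvd)
    qed
    moreover have "group_index UNIV (UNIV :: zt set) = 1" using group_index_zid[of 1] by simp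
    ultimately show ?thesis by (simp add: zsigma_def)
  next
    case False
    then obtain p where p: "irreducible p" "p dvd n" using exists_irreducible_divisor less.prems by blast
    then obtain m where m: "n = p * m" by blast
    have m0: "m \<noteq> 0" using m less.prems by auto
    have p0: "p \<noteq> 0" using p by auto
    have zp: "znm p > 1" using znm_irreducible[OF p(1)] .
    have "znm m > 0" using m0 by (simp add: zero_less_iff_neq_zero)
    then have mn: "znm m < znm n" using zp by (simp add: m znm_mult)
    have 1: "card (rids m) = zsigma m" using less.hyps[OF mn m0] .
    have 2: "card (rids (m div p)) = zsigma (m div p)" if "p dvd m"
    proof -
      obtain k where k: "m = p * k" using \<open>p dvd m\<close> by blast
      have k0: "k \<noteq> 0" using k m0 by auto
      then have "znm k > 0" by (simp add: zero_less_iff_neq_zero)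
      then have "znm k < znm m" using zp by (simp add: k znm_mult)
      then show ?thesis using less.hyps[of k] mn k0 k p0 by simp
    qed
    have "znm p * (if p dvd m then card (rids (m div p)) else 0)
        = znm p * (if p dvd m then zsigma (m div p) else 0)"
      using 2 by simp
    then have "card (rids (p * m)) = zsigma (p * m)"
      using hecke_rids[OF m0 p(1)] hecke_zsigma[OF m0 p(1)] 1 by (metis add_right_cancel)
    then show ?thesis by (simp add: m)
  qed
qed

definition zids :: "nat \<Rightarrow> zt set set" where "zids k = {zid d | d. znm d = k}"

lemma zid_mem_zids: "zid d \<in> zids k \<longleftrightarrow> znm d = k"
proof
  assume "zid d \<in> zids k"
  then obtain e where "asc d e" "znm e = k" by (auto simp: zids_def zid_eq_iff)
  then show "znm d = k" using asc_znm by simp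
qed (auto simp: zids_def)

lemma finite_zids:
  assumes "k > 0"
  shows "finite (zids k)"
proof (rule finite_subset)
  show "zids k \<subseteq> zids_above (of_nat k)"
    using dvd_znm by (auto simp: zids_def zids_above_def)
  show "finite (zids_above (of_nat k))" using assms by (intro finite_zids_above) simp
qed

lemma card_zids_subset:
  assumes "m > 0" "X \<in> zids k" "k dvd m"
  shows "card {Y \<in> zids m. Y \<subseteq> X} = card (zids (m div k))"
proof -
  obtain d where d: "X = zid d" "znm d = k" using assms(2) by (auto simp: zids_def)
  have k: "k > 0" using assms(1,3) by (auto intro: Nat.gr0I)
  then have dual0: "d \<noteq> 0" using d by auto
  have "{Y \<in> zids m. Y \<subseteq> X} = (`) ((*) d) ` zids (m div k)"
  proof (intro equalityI subsetI)
    fix Y assume "Y \<in> {Y \<in> zids m. Y \<subseteq> X}"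
    then obtain e where e: "Y = zid (d * e)" "znm (d * e) = m"
      by (auto simp: zids_def d zid_subset_iff elim!: dvdE)
    then have "zid e \<in> zids (m div k)" using d k by (auto simp: zid_mem_zids znm_mult)
    moreover have "Y = (*) d ` zid e" using e by (simp add: image_mult_zid)
    ultimately show "Y \<in> (`) ((*) d) ` zids (m div k)" by blast
  next
    fix Y assume "Y \<in> (`) ((*) d) ` zids (m div k)"
    then obtain e where "Y = zid (d * e)" "znm e = m div k" by (auto simp: zids_def image_mult_zid)
    then show "Y \<in> {Y \<in> zids m. Y \<subseteq> X}"
      using d assms(3) by (simp add: zid_mem_zids znm_mult zid_subset_iff)
  qed
  then show ?thesis using inj_image_mult[OF dual0] by (simp add: card_image)
qed

definition rids_norm :: "nat \<Rightarrow> ico set set" where "rids_norm m = {rid c | c. znm (nr c) = m}"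

lemma rids_norm_UN: "rids_norm m = (\<Union>X\<in>zids m. {D. \<exists>n. X = zid n \<and> D \<in> rids n})"
proof (intro equalityI subsetI)
  fix D assume "D \<in> rids_norm m"
  then obtain c where c: "D = rid c" "znm (nr c) = m" by (auto simp: rids_norm_def)
  then have "zid (nr c) \<in> zids m" "D \<in> rids (nr c)" by (simp_all add: zid_mem_zids mem_rids)
  then show "D \<in> (\<Union>X\<in>zids m. {D. \<exists>n. X = zid n \<and> D \<in> rids n})" by blast
next
  fix D assume "D \<in> (\<Union>X\<in>zids m. {D. \<exists>n. X = zid n \<and> D \<in> rids n})"
  then obtain n where n: "zid n \<in> zids m" "D \<in> rids n" by blast
  then obtain c where c: "D = rid c" "asc (nr c) n" by (auto simp: rids_def)
  then have "znm (nr c) = m" using asc_znm[OF c(2)] n(1) by (simp add: zid_mem_zids)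
  then show "D \<in> rids_norm m" using c(1) by (auto simp: rids_norm_def)
qed

text \<open>Sum \<open>zsigma\<close> over the ideals X of norm \<open>m\<close> and exchange the
  summations: a divisor Y of norm k lies above exactly \<open>card (zids (m div k))\<close> ideals
  X.\<close>

theorem card_rids_norm:
  assumes m: "m > 0"
  shows "card (rids_norm m) = (\<Sum>k | k dvd m. k * card (zids k) * card (zids (m div k)))"
proof -
  define R where "R X = {D. \<exists>n. X = zid n \<and> D \<in> rids n}" for X
  have R: "R (zid n) = rids n" for n
  proof -
    have "D \<in> rids n" if a: "asc n n'" and b: "D \<in> rids n'" for n n' D
    proof -
      obtain c where "D = rid c" "asc (nr c) n'" using b by (auto simp: rids_def)
      then show ?thesis using asc_trans[OF _ asc_sym[OF a]] mem_rids by blast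
    qed
    then show ?thesis unfolding R_def zid_eq_iff using asc_refl by blast
  qed
  have U: "(\<Union>k\<in>{k. k dvd m}. zids k) = {X. \<exists>d. X = zid d \<and> znm d dvd m}"
    by (auto simp: zids_def)
  have fin: "finite {k. k dvd m}" using m by simp
  have finU: "finite (\<Union>k\<in>{k. k dvd m}. zids k)"
    using m fin by (intro finite_UN_I finite_zids) (auto intro: Nat.gr0I)
  have "card (rids_norm m) = card (\<Union>X\<in>zids m. R X)" by (simp add: rids_norm_UN R_def)
  also have "\<dots> = (\<Sum>X\<in>zids m. card (R X))"
  proof (rule card_UN_disjoint[OF finite_zids[OF m]])
    show "\<forall>X\<in>zids m. finite (R X)" using m by (auto simp: zids_def R intro!: finite_rids)
    show "\<forall>X\<in>zids m. \<forall>Y\<in>zids m. X \<noteq> Y \<longrightarrow> R X \<inter> R Y = {}"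
    proof (intro ballI impI)
      fix X Y assume XY: "X \<in> zids m" "Y \<in> zids m" "X \<noteq> Y"
      then obtain a b where ab: "X = zid a" "Y = zid b" by (auto simp: zids_def)
      show "R X \<inter> R Y = {}"
      proof (rule ccontr)
        assume "\<not> ?thesis"
        then obtain c where "asc (nr c) a" "rid c \<in> rids b" by (auto simp: ab R rids_def)
        then have "asc a b" using asc_trans[OF asc_sym, of "nr c" a b] by (simp add: rids_mem_iff)
        then show False using XY(3) ab zid_eq_iff by simp
      qed
    qed
  qed
  also have "\<dots> = (\<Sum>X\<in>zids m. \<Sum>Y | Y \<in> (\<Union>k\<in>{k. k dvd m}. zids k) \<and> X \<subseteq> Y. group_index UNIV Y)"
  proof (rule sum.cong)
    fix X assume "X \<in> zids m"
    then obtain n where n: "X = zid n" "znm n = m" by (auto simp: zids_def)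
    then have n0: "n \<noteq> 0" using m by auto
    have "{Y. Y \<in> (\<Union>k\<in>{k. k dvd m}. zids k) \<and> X \<subseteq> Y} = {Y. \<exists>d. Y = zid d \<and> znm d dvd m \<and> X \<subseteq> Y}"
      unfolding U by blast
    also have "\<dots> = {Y. \<exists>d. Y = zid d \<and> d dvd n}"
      using n(2) znm_dvd[of _ n] zid_subset_iff[of n] unfolding n(1) by metis
    finally have "{Y. Y \<in> (\<Union>k\<in>{k. k dvd m}. zids k) \<and> X \<subseteq> Y} = zids_above n"
      by (simp add: zids_above_def)
    then show "card (R X) = (\<Sum>Y | Y \<in> (\<Union>k\<in>{k. k dvd m}. zids k) \<and> X \<subseteq> Y. group_index UNIV Y)"
      using card_rids[OF n0] by (simp add: n(1) R zsigma_def)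
  qed simp
  also have "\<dots> = (\<Sum>Y\<in>(\<Union>k\<in>{k. k dvd m}. zids k). \<Sum>X | X \<in> zids m \<and> X \<subseteq> Y. group_index UNIV Y)"
    by (rule sum.swap_restrict) (use finite_zids[OF m] finU in auto)
  also have "\<dots> = (\<Sum>Y\<in>(\<Union>k\<in>{k. k dvd m}. zids k). group_index UNIV Y * card {X \<in> zids m. X \<subseteq> Y})"
    by (simp add: mult.commute)
  also have "\<dots> = (\<Sum>k | k dvd m. \<Sum>Y\<in>zids k. group_index UNIV Y * card {X \<in> zids m. X \<subseteq> Y})"
  proof (rule sum.UNION_disjoint[OF fin])
    show "\<forall>k\<in>{k. k dvd m}. finite (zids k)" using m by (auto intro!: finite_zids Nat.gr0I)
    show "\<forall>k\<in>{k. k dvd m}. \<forall>l\<in>{k. k dvd m}. k \<noteq> l \<longrightarrow> zids k \<inter> zids l = {}"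
      by (auto simp: zids_def zid_eq_iff dest: asc_znm)
  qed
  also have "\<dots> = (\<Sum>k | k dvd m. \<Sum>Y\<in>zids k. k * card (zids (m div k)))"
  proof (intro sum.cong refl)
    fix k Y assume k: "k \<in> {k. k dvd m}" and Y: "Y \<in> zids k"
    obtain d where d: "Y = zid d" "znm d = k" using Y by (auto simp: zids_def)
    have "d \<noteq> 0" using d k m by auto
    then show "group_index UNIV Y * card {X \<in> zids m. X \<subseteq> Y} = k * card (zids (m div k))"
      using card_zids_subset[OF m Y] k d by (simp add: group_index_zid)
  qed
  finally show ?thesis by (simp add: mult.commute mult.left_commute)
qed

section \<open>Dirichlet convolution\<close>

definition dconv :: "(nat \<Rightarrow> 'a::comm_semiring_1) \<Rightarrow> (nat \<Rightarrow> 'a) \<Rightarrow> nat \<Rightarrow> 'a" where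
  "dconv f g n = (\<Sum>d | d dvd n. f d * g (n div d))"

text \<open>Every number divides 0, so the sum runs over an infinite set and takes its default value
  0.\<close>

lemma dconv_0 [simp]: "dconv f g 0 = 0"
  by (simp add: dconv_def)

lemma dconv_commute: "dconv f g = dconv g f"
proof
  fix n
  show "dconv f g n = dconv g f n"
  proof (cases "n = 0")
    case False
    then show ?thesis unfolding dconv_def
      by (intro sum.reindex_bij_witness[of _ "\<lambda>d. n div d" "\<lambda>d. n div d"])
        (auto elim!: dvdE simp: mult.commute)
  qed simp
qed

lemma dconv_assoc: "dconv (dconv f g) h = dconv f (dconv g h)"
proof
  fix n
  show "dconv (dconv f g) h n = dconv f (dconv g h) n"
  proof (cases "n = 0")
    case False
    then have n: "n > 0" by simp
    have fin: "finite {e. e dvd d}" if "d dvd n" for d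
      using that n by (intro finite_divisors_nat) (auto intro: Nat.gr0I)
    have fin': "finite {k. k dvd n div e}" if "e dvd n" for e
      using fin[of "n div e"] that by (auto elim!: dvdE)
    have "dconv (dconv f g) h n = (\<Sum>d | d dvd n. \<Sum>e | e dvd d. f e * g (d div e) * h (n div d))"
      by (simp add: dconv_def sum_distrib_right)
    also have "\<dots> = (\<Sum>(d, e)\<in>(SIGMA d:{d. d dvd n}. {e. e dvd d}). f e * g (d div e) * h (n div d))"
      using n fin by (intro sum.Sigma) auto
    also have "\<dots> = (\<Sum>(e, k)\<in>(SIGMA e:{e. e dvd n}. {k. k dvd n div e}). f e * (g k * h (n div e div k)))"
    proof (rule sum.reindex_bij_witness[of _ "\<lambda>(e, k). (e * k, e)" "\<lambda>(d, e). (e, d div e)"])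
      fix p assume p: "p \<in> (SIGMA d:{d. d dvd n}. {e. e dvd d})"
      obtain d e where de: "p = (d, e)" by (cases p)
      with p obtain a b where "d = e * a" "n = e * a * b" by (auto elim!: dvdE)
      with n de show "(case case p of (d, e) \<Rightarrow> (e, d div e) of (e, k) \<Rightarrow> (e * k, e)) = p"
        "(case p of (d, e) \<Rightarrow> (e, d div e)) \<in> (SIGMA e:{e. e dvd n}. {k. k dvd n div e})"
        "(case case p of (d, e) \<Rightarrow> (e, d div e) of (e, k) \<Rightarrow> f e * (g k * h (n div e div k)))
          = (case p of (d, e) \<Rightarrow> f e * g (d div e) * h (n div d))"
        by (auto simp: mult.assoc)
    next
      fix p assume p: "p \<in> (SIGMA e:{e. e dvd n}. {k. k dvd n div e})"
      obtain e k where ek: "p = (e, k)" by (cases p)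
      with p obtain a where "n = e * a" "k dvd a" using n by (auto elim!: dvdE[of e n])
      then obtain b where "n = e * (k * b)" by blast
      with n ek show "(case case p of (e, k) \<Rightarrow> (e * k, e) of (d, e) \<Rightarrow> (e, d div e)) = p"
        "(case p of (e, k) \<Rightarrow> (e * k, e)) \<in> (SIGMA d:{d. d dvd n}. {e. e dvd d})"
        by (auto simp: mult.assoc)
    qed
    also have "\<dots> = (\<Sum>e | e dvd n. \<Sum>k | k dvd n div e. f e * (g k * h (n div e div k)))"
      using n fin' by (intro sum.Sigma[symmetric]) auto
    also have "\<dots> = dconv f (dconv g h) n"
      by (simp add: dconv_def sum_distrib_left)
    finally show ?thesis .
  qed simp
qed

text \<open>Disjointness of the \<open>F i\<close> makes the first component determine i, and j is
  then \<open>n div i\<close>.\<close>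

lemma card_pairs_dconv:
  assumes "n > 0" "\<And>i j. i \<noteq> j \<Longrightarrow> F i \<inter> F j = {}"
    "\<And>i. i > 0 \<Longrightarrow> finite (F i)" "\<And>i. i > 0 \<Longrightarrow> finite (H i)"
  shows "card {(A, B). \<exists>i j. A \<in> F i \<and> B \<in> H j \<and> i * j = n} = dconv (\<lambda>i. card (F i)) (\<lambda>j. card (H j)) n"
    "finite {(A, B). \<exists>i j. A \<in> F i \<and> B \<in> H j \<and> i * j = n}"
proof -
  have eq: "{(A, B). \<exists>i j. A \<in> F i \<and> B \<in> H j \<and> i * j = n} = (\<Union>d\<in>{d. d dvd n}. F d \<times> H (n div d))"
  proof (intro equalityI subsetI)
    fix p assume "p \<in> {(A, B). \<exists>i j. A \<in> F i \<and> B \<in> H j \<and> i * j = n}"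
    then obtain A B i j where p: "p = (A, B)" "A \<in> F i" "B \<in> H j" "i * j = n" by blast
    have "i > 0" using p(4) assms(1) by (auto intro: Nat.gr0I)
    then have "i dvd n" "n div i = j" using p(4) by auto
    then show "p \<in> (\<Union>d\<in>{d. d dvd n}. F d \<times> H (n div d))" using p by blast
  qed force
  have pos: "d > 0 \<and> n div d > 0" if "d dvd n" for d using that assms(1) by (auto elim!: dvdE)
  have fin: "finite {d. d dvd n}" using assms(1) by simp
  have fin2: "finite (F d \<times> H (n div d))" if "d dvd n" for d
    using pos[OF that] assms(3,4) by blast
  show "finite {(A, B). \<exists>i j. A \<in> F i \<and> B \<in> H j \<and> i * j = n}"
    unfolding eq using fin fin2 by blast
  have "card (\<Union>d\<in>{d. d dvd n}. F d \<times> H (n div d)) = (\<Sum>d | d dvd n. card (F d \<times> H (n div d)))"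
    using fin fin2 assms(2) by (intro card_UN_disjoint) blast+
  then show "card {(A, B). \<exists>i j. A \<in> F i \<and> B \<in> H j \<and> i * j = n} = dconv (\<lambda>i. card (F i)) (\<lambda>j. card (H j)) n"
    unfolding eq by (simp add: dconv_def card_cartesian_product)
qed

subsection \<open>Similarity submodules\<close>

definition prm :: "ico \<Rightarrow> bool" where "prm x \<longleftrightarrow> (\<forall>d. sdvd d x \<longrightarrow> is_unit d)"

lemma prm_nonzero: "prm x \<Longrightarrow> x \<noteq> 0"
  unfolding prm_def by (auto simp: sdvd_iff dest: spec[of _ 0])

lemma sdvd_sc_self: "sdvd k (sc k * x)"
  unfolding sdvd_def by (rule rangeI)

lemma sdvd_dvd_trans: "d dvd e \<Longrightarrow> sdvd e x \<Longrightarrow> sdvd d x"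
  unfolding sdvd_iff by (meson dvd_trans)

lemma sdvd_sc_cancel: "c \<noteq> 0 \<Longrightarrow> sdvd (c * d) (sc c * x) \<longleftrightarrow> sdvd d x"
  by (simp add: sdvd_iff)

lemma sdvd_irreducible_cancel: "irreducible p \<Longrightarrow> \<not> p dvd c \<Longrightarrow> sdvd p (sc c * x) \<Longrightarrow> sdvd p x"
  unfolding sdvd_iff sc_mult_sel using irreducible_prime_dvd by meson

lemma prm_decomp: "x \<noteq> 0 \<Longrightarrow> \<exists>k y. x = sc k * y \<and> prm y \<and> k \<noteq> 0"
proof (induction "znm (nr x)" arbitrary: x rule: less_induct)
  case less
  show ?case
  proof (cases "prm x")
    case True
    then show ?thesis by (intro exI[of _ 1] exI[of _ x]) simp
  next
    case False
    then obtain d where d: "sdvd d x" "\<not> is_unit d" by (auto simp: prm_def)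
    then obtain y where y: "x = sc d * y" by (auto simp: sdvd_def)
    have dual0: "d \<noteq> 0" "y \<noteq> 0" using y less.prems by auto
    have "znm d > 1" using znm_gt_1 d dual0 by blast
    then have "znm d * znm d > 1" by (intro less_1_mult)
    moreover have "znm (nr y) > 0" using dual0 by (simp add: zero_less_iff_neq_zero)
    ultimately have "znm (nr y) < znm (nr x)" by (simp add: y nr_mult znm_mult)
    from less.hyps[OF this dual0(2)] obtain k z where "y = sc k * z" "prm z" "k \<noteq> 0" by blast
    then have "x = sc (d * k) * z \<and> prm z \<and> d * k \<noteq> 0" using dual0 by (simp add: y sc_mult mult.assoc)
    then show ?thesis by blast
  qed
qed

text \<open>The dual basis identity turns the two-sided ideal generated by \<open>a\<close> into scalars \<open>trc (a y)\<close>: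
  \<open>ico / p ico\<close> is a simple ring.\<close>

lemma irreducible_two_sided:
  assumes p: "irreducible p" and ab: "\<And>y. sdvd p (a * y * b)"
  shows "sdvd p a \<or> sdvd p b"
proof (rule ccontr)
  assume n: "\<not> (sdvd p a \<or> sdvd p b)"
  then obtain y where y: "\<not> p dvd trc (a * y)" using sdvd_nondegenerate by blast
  have *: "sdvd p (u * (a * y) * v * b)" for u v
    using sdvd_mult(2)[OF ab[of "y * v"], of u] by (simp add: mult.assoc)
  have "sc (trc (a * y)) * b = (1 * (a * y) * dual0 + bas1 * (a * y) * dual1 + bas2 * (a * y) * dual2 + bas3 * (a * y) * dual3) * b"
    by (simp only: dual_basis_trc)
  then have "sdvd p (sc (trc (a * y)) * b)"
    by (simp only: distrib_right) (intro sdvd_add *)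
  then show False using sdvd_irreducible_cancel[OF p y] n by blast
qed

text \<open>A Gauss lemma for two-sided products: modulo an irreducible \<open>p\<close> the
  products \<open>u * y * v\<close> do not all vanish when \<open>u\<close> and \<open>v\<close> are
  primitive. So every irreducible factor of \<open>d\<close> can be split off from
  \<open>c\<close>.\<close>

lemma content_dvd:
  assumes "prm u" "prm v"
  shows "(\<And>y. sdvd d (sc c * (u * y * v))) \<Longrightarrow> d dvd c"
proof (induction "znm d" arbitrary: d c rule: less_induct)
  case less
  show ?case
  proof (cases "d = 0")
    case True
    then have "sc c * (u * 1 * v) = 0" using less.prems[of 1] by (auto simp: sdvd_def)
    then show ?thesis using prm_nonzero assms by simp
  next
    case False
    show ?thesis
    proof (cases "is_unit d")
      case nu: False
      then obtain p where p: "irreducible p" "p dvd d" using exists_irreducible_divisor False by blast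
      then obtain e where e: "d = p * e" by blast
      have p0: "p \<noteq> 0" "e \<noteq> 0" using e False by auto
      have "sdvd p (sc c * (u * y * v))" for y using sdvd_dvd_trans[OF p(2) less.prems] .
      moreover have "\<not> (\<forall>y. sdvd p (u * y * v))"
      proof
        assume "\<forall>y. sdvd p (u * y * v)"
        then have "sdvd p u \<or> sdvd p v" using irreducible_two_sided[OF p(1)] by simp
        then have "is_unit p" using assms by (auto simp: prm_def)
        then show False using p(1) irreducible_not_unit by blast
      qed
      ultimately have "p dvd c" using sdvd_irreducible_cancel[OF p(1)] by blast
      then obtain k where k: "c = p * k" by blast
      have "sdvd e (sc k * (u * y * v))" for y
        using less.prems[of y] p0 by (simp add: e k sc_mult mult.assoc sdvd_sc_cancel)
      moreover have "znm e < znm d"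
      proof -
        have "znm e > 0" using p0 by (simp add: zero_less_iff_neq_zero)
        then show ?thesis using znm_irreducible[OF p(1)] by (simp add: e znm_mult)
      qed
      ultimately have "e dvd k" using less.hyps by blast
      then show ?thesis by (simp add: e k)
    qed auto
  qed
qed

lemma prm_content: "prm x \<Longrightarrow> sdvd d (sc c * x) \<Longrightarrow> d dvd c"
proof -
  assume x: "prm x" and d: "sdvd d (sc c * x)"
  have "prm 1" by (simp add: prm_def sdvd_iff)
  moreover have "sdvd d (sc c * (x * y * 1))" for y using sdvd_mult(1)[OF d, of y] by (simp add: mult.assoc)
  ultimately show "d dvd c" using content_dvd[OF x] by blast
qed

lemma prm_cnj [simp]: "prm (cnj x) \<longleftrightarrow> prm x" by (simp add: prm_def)

lemma unit_nr_inverse: "is_unit (nr u) \<Longrightarrow> \<exists>w. u * w = 1"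
proof -
  assume "is_unit (nr u)"
  then obtain k where k: "nr u * k = 1" by (metis dvdE)
  have "u * (cnj u * sc k) = sc (nr u * k)" by (simp only: sc_mult mult_cnj mult.assoc[symmetric])
  then show ?thesis using k by auto
qed

lemma rid_mult_unit: "is_unit (nr u) \<Longrightarrow> rid (a * u) = rid a"
proof -
  assume "is_unit (nr u)"
  then obtain w where w: "u * w = 1" using unit_nr_inverse by blast
  have "a = a * u * w" by (simp add: w mult.assoc)
  then have "a \<in> rid (a * u)" by blast
  moreover have "a * u \<in> rid a" by blast
  ultimately have "rid a \<subseteq> rid (a * u)" "rid (a * u) \<subseteq> rid a" by (simp_all only: rid_subset_iff)
  then show "rid (a * u) = rid a" by blast
qed

lemma prm_rid: "rid a = rid b \<Longrightarrow> prm a \<Longrightarrow> prm b"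
proof -
  assume "rid a = rid b" "prm a"
  then obtain x where "a = b * x" using mem_rid_self[of a] by auto
  then show "prm b" using \<open>prm a\<close> sdvd_mult(1) unfolding prm_def by blast
qed

text \<open>Multiplying by \<open>a1\<close> gives \<open>sc (nr a1) * a = sc k * (a1 * u)\<close>.
  Both \<open>a\<close> and \<open>a1 * u\<close> are primitive, so the two scalars are associated
  and cancel up to a unit.\<close>

lemma rid_eq_of_cnj_mult:
  assumes "prm a" "prm a1" "cnj a1 * a = sc k * u" "is_unit (nr u)"
  shows "rid a = rid a1"
proof -
  have "sc (nr a1) * a = a1 * (cnj a1 * a)" by (simp only: mult_cnj mult.assoc[symmetric])
  also have "\<dots> = sc k * (a1 * u)" by (simp only: assms(3) sc_left_comm)
  finally have eq: "sc (nr a1) * a = sc k * (a1 * u)" .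
  have "prm (a1 * u)" using prm_rid rid_mult_unit[OF assms(4)] assms(2) by metis
  moreover have "sdvd (nr a1) (sc k * (a1 * u))" unfolding eq[symmetric] by (rule sdvd_sc_self)
  ultimately have "nr a1 dvd k" by (rule prm_content)
  then obtain e where e: "k = nr a1 * e" by blast
  have "sdvd k (sc (nr a1) * a)" unfolding eq by (rule sdvd_sc_self)
  then have kd: "k dvd nr a1" using prm_content[OF assms(1)] by blast
  have n0: "nr a1 \<noteq> 0" using prm_nonzero[OF assms(2)] by simp
  have ue: "is_unit e" using kd n0 by (simp add: e)
  have "sc (nr a1) * a = sc (nr a1) * (sc e * (a1 * u))" unfolding eq e by (simp add: sc_mult mult.assoc)
  then have "a = sc e * (a1 * u)" using n0 by simp
  then show ?thesis using rid_sc_unit[OF ue] rid_mult_unit[OF assms(4)] by simp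
qed

definition simsub :: "zt \<Rightarrow> ico \<Rightarrow> ico \<Rightarrow> ico set" where
  "simsub c a b = range (\<lambda>y. sc c * (a * y * b))"

lemma simsub_mem: "sc c * (a * y * b) \<in> simsub c a b"
  unfolding simsub_def by (rule rangeI)

lemma simsub_mono:
  assumes "zid c \<subseteq> zid c'" "rid a \<subseteq> rid a'" "rid (cnj b) \<subseteq> rid (cnj b')"
  shows "simsub c a b \<subseteq> simsub c' a' b'"
proof
  fix z assume "z \<in> simsub c a b"
  then obtain y where y: "z = sc c * (a * y * b)" by (auto simp: simsub_def)
  obtain k where k: "c = c' * k" using assms(1) by (auto simp: zid_subset_iff)
  obtain u where u: "a = a' * u" using assms(2) by (auto simp: rid_subset_iff)
  obtain v where "cnj b = cnj b' * v" using assms(3) by (auto simp: rid_subset_iff)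
  then have "cnj (cnj b) = cnj v * b'" by simp
  then have v: "b = cnj v * b'" by simp
  have "z = sc c' * (sc k * (a' * (u * (y * (cnj v * b')))))"
    by (simp only: y k u v sc_mult mult.assoc)
  also have "\<dots> = sc c' * (a' * (sc k * (u * (y * (cnj v * b')))))"
    by (simp only: sc_left_comm[of a'])
  finally have "z = sc c' * (a' * (sc k * (u * y * cnj v)) * b')"
    by (simp only: mult.assoc)
  then show "z \<in> simsub c' a' b'" by (auto simp: simsub_def)
qed

text \<open>Multiplying by \<open>cnj a1\<close> on the left and \<open>cnj bb\<close> on the right
  turns the second module into the multiples of the scalar \<open>c1 * n\<close>, and the first into
  a scalar multiple of u I v with I = \<open>ico\<close> and primitive \<open>u\<close>,
  \<open>v\<close>. Comparing contents and hitting the scalar itself forces \<open>u\<close> and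
  \<open>v\<close> to have unit norm. The left ideal I b is represented by the right ideal
  \<open>rid (cnj b)\<close>.\<close>

lemma simsub_eq_iff:
  assumes "c \<noteq> 0" "prm a" "prm b" "c1 \<noteq> 0" "prm a1" "prm bb"
  shows "simsub c a b = simsub c1 a1 bb \<longleftrightarrow> zid c = zid c1 \<and> rid a = rid a1 \<and> rid (cnj b) = rid (cnj bb)"
proof
  assume "zid c = zid c1 \<and> rid a = rid a1 \<and> rid (cnj b) = rid (cnj bb)"
  then show "simsub c a b = simsub c1 a1 bb"
    using simsub_mono[of c c1 a a1 b bb] simsub_mono[of c1 c a1 a bb b] by blast
next
  assume eq: "simsub c a b = simsub c1 a1 bb"
  have *: "c' dvd c" if "simsub c a b \<subseteq> simsub c' a' b'" "prm a" "prm b" for c a b c' a' b'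
  proof (rule content_dvd[OF that(2,3)])
    fix y
    have "sc c * (a * y * b) \<in> simsub c' a' b'" using that(1) simsub_mem by (rule subsetD)
    then show "sdvd c' (sc c * (a * y * b))" by (auto simp: simsub_def sdvd_def)
  qed
  have "zid c = zid c1" using *[of c a b c1 a1 bb] *[of c1 a1 bb c a b] eq assms by (simp add: zid_eq_iff asc_def)
  define n where "n = nr a1 * nr bb"
  have nz: "a \<noteq> 0" "b \<noteq> 0" "a1 \<noteq> 0" "bb \<noteq> 0" using assms prm_nonzero by blast+
  have "cnj a1 \<noteq> 0" "cnj bb \<noteq> 0" using nz by (metis cnj_inj cnj_simps(1))+
  then have uv0: "cnj a1 * a \<noteq> 0" "b * cnj bb \<noteq> 0" using nz by simp_all
  obtain k u where u: "cnj a1 * a = sc k * u" "prm u" "k \<noteq> 0" using prm_decomp[OF uv0(1)] by blast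
  obtain l v where v: "b * cnj bb = sc l * v" "prm v" "l \<noteq> 0" using prm_decomp[OF uv0(2)] by blast
  have 1: "cnj a1 * (sc c * (a * y * b)) * cnj bb = sc (c * k * l) * (u * y * v)" for y
  proof -
    have "cnj a1 * (sc c * (a * y * b)) * cnj bb = sc c * ((cnj a1 * a) * y * (b * cnj bb))"
      by (simp only: mult.assoc sc_left_comm[of "cnj a1"])
    also have "\<dots> = sc c * (sc k * (sc l * (u * y * v)))"
      unfolding u(1) v(1) by (simp only: mult.assoc sc_left_comm[of u] sc_left_comm[of y])
    finally show ?thesis by (simp only: sc_mult mult.assoc)
  qed
  have 2: "cnj a1 * (sc c1 * (a1 * y * bb)) * cnj bb = sc (c1 * n) * y" for y
  proof -
    have "cnj a1 * (sc c1 * (a1 * y * bb)) * cnj bb = sc c1 * ((cnj a1 * a1) * y * (bb * cnj bb))"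
      by (simp only: mult.assoc sc_left_comm[of "cnj a1"])
    also have "\<dots> = sc c1 * (sc (nr a1) * (sc (nr bb) * y))"
      unfolding cnj_mult_self mult_cnj by (simp only: mult.assoc sc_comm[of y])
    finally show ?thesis by (simp only: sc_mult mult.assoc n_def)
  qed
  have n0: "c1 * n \<noteq> 0" using nz assms by (simp add: n_def)
  have "c1 * n dvd c * k * l"
  proof (rule content_dvd[OF u(2) v(2)])
    fix y
    have "sc c * (a * y * b) \<in> simsub c1 a1 bb" unfolding eq[symmetric] by (rule simsub_mem)
    then obtain z where "sc c * (a * y * b) = sc c1 * (a1 * z * bb)" by (auto simp: simsub_def)
    then have "sc (c * k * l) * (u * y * v) = sc (c1 * n) * z" using 1[of y] 2[of z] by simp
    then show "sdvd (c1 * n) (sc (c * k * l) * (u * y * v))" by (simp only: sdvd_sc_self)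
  qed
  then obtain e where e: "c * k * l = c1 * n * e" by blast
  have "sc c1 * (a1 * 1 * bb) \<in> simsub c a b" unfolding eq by (rule simsub_mem)
  then obtain y where y: "sc c1 * (a1 * 1 * bb) = sc c * (a * y * b)" by (auto simp: simsub_def)
  have "sc (c1 * n) = sc (c * k * l) * (u * y * v)" using 1[of y] 2[of 1] y by simp
  also have "\<dots> = sc (c1 * n) * (sc e * (u * y * v))" unfolding e by (simp only: sc_mult mult.assoc)
  finally have "sc (c1 * n) * 1 = sc (c1 * n) * (sc e * (u * y * v))" by simp
  moreover have "sc (c1 * n) \<noteq> 0" using n0 by (simp only: sc_eq_0_iff not_False_eq_True)
  ultimately have "1 = sc e * (u * y * v)" using mult_left_cancel by blast
  then have "nr 1 = nr (sc e * (u * y * v))" by simp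
  then have "1 = e * e * (nr u * nr y * nr v)" by (simp only: nr_mult nr_simps)
  then have un: "1 = nr u * (e * e * nr y * nr v)" "1 = nr v * (e * e * nr u * nr y)"
    by (simp_all only: ac_simps)
  have uu: "is_unit (nr u)" by (rule dvdI[OF un(1)])
  have uv: "is_unit (nr v)" by (rule dvdI[OF un(2)])
  have "rid a = rid a1" using rid_eq_of_cnj_mult[OF assms(2,5) u(1) uu] .
  moreover have "rid (cnj b) = rid (cnj bb)"
  proof (rule rid_eq_of_cnj_mult)
    have "cnj (b * cnj bb) = cnj (sc l * v)" by (simp only: v(1))
    then have "bb * cnj b = cnj v * sc l" by simp
    then show "cnj (cnj bb) * cnj b = sc l * cnj v" by (simp only: cnj_simps sc_comm)
  qed (use assms uv in simp_all)
  ultimately show "zid c = zid c1 \<and> rid a = rid a1 \<and> rid (cnj b) = rid (cnj bb)"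
    using \<open>zid c = zid c1\<close> by blast
qed

definition prids :: "nat \<Rightarrow> ico set set" where "prids n = {rid a | a. prm a \<and> znm (nr a) = n}"
text \<open>A scalar c enters the norm of \<open>sc c * a\<close> through the square of
  \<open>znm c\<close>. The counts are therefore the coefficients of zeta(2 s).\<close>

definition zids_sq :: "nat \<Rightarrow> zt set set" where "zids_sq i = {X. \<exists>k. i = k\<^sup>2 \<and> X \<in> zids k}"
definition simsubs :: "nat \<Rightarrow> ico set set" where
  "simsubs m = {simsub c a b | c a b. prm a \<and> prm b \<and> (znm c)\<^sup>2 * (znm (nr a) * znm (nr b)) = m}"

lemma prids_disjoint: "i \<noteq> j \<Longrightarrow> prids i \<inter> prids j = {}"
proof (rule ccontr)
  assume "i \<noteq> j" "prids i \<inter> prids j \<noteq> {}"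
  then obtain a b where "rid a = rid b" "znm (nr a) = i" "znm (nr b) = j" by (auto simp: prids_def)
  then show False using asc_znm[OF rid_eq_asc] \<open>i \<noteq> j\<close> by blast
qed

lemma zids_sq_disjoint: "i \<noteq> j \<Longrightarrow> zids_sq i \<inter> zids_sq j = {}"
proof (rule ccontr)
  assume "i \<noteq> j" "zids_sq i \<inter> zids_sq j \<noteq> {}"
  then obtain X k l where X: "X \<in> zids k" "X \<in> zids l" "i = k\<^sup>2" "j = l\<^sup>2" by (auto simp: zids_sq_def)
  then obtain d where "X = zid d" "znm d = k" by (auto simp: zids_def)
  then show False using X zid_mem_zids \<open>i \<noteq> j\<close> by simp
qed

lemma finite_zids_sq: "i > 0 \<Longrightarrow> finite (zids_sq i)"
proof -
  assume "i > 0"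
  have "zids_sq i \<subseteq> (\<Union>k\<in>{0<..i}. zids k)"
  proof
    fix X assume "X \<in> zids_sq i"
    then obtain k where k: "i = k\<^sup>2" "X \<in> zids k" by (auto simp: zids_sq_def)
    moreover have "k > 0" using k \<open>i > 0\<close> by (cases k) auto
    moreover have "k \<le> k\<^sup>2" by (simp add: power2_eq_square)
    ultimately show "X \<in> (\<Union>k\<in>{0<..i}. zids k)" by auto
  qed
  then show ?thesis by (rule finite_subset) (auto intro: finite_zids)
qed

lemma finite_rids_norm: "n > 0 \<Longrightarrow> finite (rids_norm n)"
  unfolding rids_norm_UN
proof (rule finite_UN_I)
  assume n: "n > 0"
  show "finite (zids n)" by (rule finite_zids[OF n])
  fix X assume "X \<in> zids n"
  then obtain d where d: "X = zid d" "znm d = n" by (auto simp: zids_def)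
  have "{D. \<exists>e. X = zid e \<and> D \<in> rids e} \<subseteq> rids d"
  proof
    fix D assume "D \<in> {D. \<exists>e. X = zid e \<and> D \<in> rids e}"
    then obtain e c where "asc d e" "D = rid c" "asc (nr c) e" by (auto simp: d zid_eq_iff rids_def)
    then show "D \<in> rids d" using mem_rids[OF asc_trans[OF _ asc_sym]] by simp
  qed
  moreover have "finite (rids d)" using d n by (intro finite_rids) auto
  ultimately show "finite {D. \<exists>e. X = zid e \<and> D \<in> rids e}" by (rule finite_subset)
qed

lemma finite_prids: "n > 0 \<Longrightarrow> finite (prids n)"
  by (rule finite_subset[OF _ finite_rids_norm]) (auto simp: prids_def rids_norm_def)

lemma zid_sq_mem: "zid c \<in> zids_sq i \<longleftrightarrow> i = (znm c)\<^sup>2"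
  by (auto simp: zids_sq_def zid_mem_zids)

text \<open>A nonzero right ideal is uniquely a scalar ideal times a primitive right ideal.\<close>

lemma card_rids_norm_prids:
  assumes "n > 0"
  shows "card (rids_norm n) = dconv (\<lambda>i. card (zids_sq i)) (\<lambda>i. card (prids i)) n"
proof -
  define T where "T = {(c, a). prm a \<and> (znm c)\<^sup>2 * znm (nr a) = n}"
  define f where "f = (\<lambda>(c, a). rid (sc c * a))"
  define g where "g = (\<lambda>(c, a). (zid c, rid a))"
  have "rids_norm n = f ` T"
  proof (intro equalityI subsetI)
    fix D assume "D \<in> rids_norm n"
    then obtain x where x: "D = rid x" "znm (nr x) = n" by (auto simp: rids_norm_def)
    then have "x \<noteq> 0" using assms by auto
    then obtain c a where "x = sc c * a" "prm a" using prm_decomp by blast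
    then have "(c, a) \<in> T" "D = f (c, a)" using x by (auto simp: T_def f_def nr_mult znm_mult power2_eq_square)
    then show "D \<in> f ` T" by blast
  next
    fix D assume "D \<in> f ` T"
    then obtain c a where "(znm c)\<^sup>2 * znm (nr a) = n" "D = rid (sc c * a)" by (auto simp: T_def f_def)
    then show "D \<in> rids_norm n" by (auto simp: rids_norm_def nr_mult znm_mult power2_eq_square)
  qed
  moreover have "card (f ` T) = card (g ` T)"
  proof (rule card_image_cong)
    fix s t assume st: "s \<in> T" "t \<in> T"
    obtain c a c' a' where ca: "s = (c, a)" "t = (c', a')" by (metis surj_pair)
    have pr: "prm a" "prm a'" "c \<noteq> 0" "c' \<noteq> 0" using st assms by (auto simp: T_def ca)
    show "f s = f t \<longleftrightarrow> g s = g t"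
    proof
      assume "f s = f t"
      then have eq: "rid (sc c * a) = rid (sc c' * a')" by (simp add: f_def ca)
      have *: "c' dvd c" if "rid (sc c * a) = rid (sc c' * a')" "prm a" for c a c' a'
      proof -
        have "sc c * a \<in> rid (sc c' * a')" using that(1) mem_rid_self by blast
        then have "sdvd c' (sc c * a)" by (auto simp: sdvd_def mult.assoc)
        then show ?thesis using prm_content that(2) by blast
      qed
      have cc: "c' dvd c" "c dvd c'" using *[OF eq pr(1)] *[OF eq[symmetric] pr(2)] .
      then have "asc c c'" by (simp add: asc_def)
      then obtain u where u: "is_unit u" "c = u * c'" using asc_unit pr(4) by blast
      have "sc c * a = sc c' * (sc u * a)" by (simp only: u(2) mult.commute[of u c'] sc_mult mult.assoc)
      then have "(*) (sc c') ` rid (sc u * a) = (*) (sc c') ` rid a'"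
        using eq by (simp only: image_mult_rid)
      then have "rid (sc u * a) = rid a'"
        using inj_mult_left[of "sc c'"] pr(4) by (simp add: inj_image_eq_iff)
      then have "rid a = rid a'" using rid_sc_unit[OF u(1)] by simp
      then show "g s = g t" using \<open>asc c c'\<close> by (simp add: g_def ca zid_eq_iff)
    next
      assume "g s = g t"
      then have z: "zid c = zid c'" and r: "rid a = rid a'"
        unfolding g_def ca prod.case prod.inject by blast+
      have "asc c c'" using z by (simp only: zid_eq_iff)
      then obtain u where u: "is_unit u" "c = u * c'" using asc_unit pr(4) by blast
      have "rid (sc c * a) = rid (sc u * (sc c' * a))" by (simp only: u(2) sc_mult mult.assoc)
      also have "\<dots> = rid (sc c' * a)" by (rule rid_sc_unit[OF u(1)])
      also have "\<dots> = rid (sc c' * a')" by (simp only: image_mult_rid[symmetric] r)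
      finally show "f s = f t" by (simp add: f_def ca)
    qed
  qed
  moreover have "g ` T = {(X, A). \<exists>i j. X \<in> zids_sq i \<and> A \<in> prids j \<and> i * j = n}"
  proof (intro equalityI subsetI)
    fix z assume "z \<in> {(X, A). \<exists>i j. X \<in> zids_sq i \<and> A \<in> prids j \<and> i * j = n}"
    then obtain X A i j where z: "z = (X, A)" "X \<in> zids_sq i" "A \<in> prids j" "i * j = n" by blast
    then obtain c a where "X = zid c" "i = (znm c)\<^sup>2" "A = rid a" "prm a" "znm (nr a) = j"
      by (auto simp: zids_sq_def zids_def prids_def)
    then have "(c, a) \<in> T" "z = g (c, a)" using z by (auto simp: T_def g_def)
    then show "z \<in> g ` T" by blast
  next
    fix z assume "z \<in> g ` T"
    then obtain c a where ca: "z = (zid c, rid a)" "prm a" "(znm c)\<^sup>2 * znm (nr a) = n"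
      by (auto simp: T_def g_def)
    then have "zid c \<in> zids_sq ((znm c)\<^sup>2)" "rid a \<in> prids (znm (nr a))"
      by (auto simp: zid_sq_mem prids_def)
    then show "z \<in> {(X, A). \<exists>i j. X \<in> zids_sq i \<and> A \<in> prids j \<and> i * j = n}" using ca by blast
  qed
  ultimately show ?thesis
    using card_pairs_dconv(1)[OF assms zids_sq_disjoint finite_zids_sq finite_prids] by simp
qed

text \<open>By \<open>simsub_eq_iff\<close> a submodule is the same as a triple of one scalar ideal
  and two primitive right ideals, the second one being that of \<open>cnj b\<close>.\<close>

lemma card_simsubs:
  assumes "n > 0"
  shows "card (simsubs n) = dconv (\<lambda>i. card (zids_sq i)) (dconv (\<lambda>i. card (prids i)) (\<lambda>i. card (prids i))) n"
proof -
  define T where "T = {(c, a, b). prm a \<and> prm b \<and> (znm c)\<^sup>2 * (znm (nr a) * znm (nr b)) = n}"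
  define f where "f = (\<lambda>(c, a, b). simsub c a b)"
  define g where "g = (\<lambda>(c, a, b). (zid c, rid a, rid (cnj b)))"
  define PP where "PP k = {(A, B). \<exists>i j. A \<in> prids i \<and> B \<in> prids j \<and> i * j = k}" for k
  have PP: "card (PP k) = dconv (\<lambda>i. card (prids i)) (\<lambda>i. card (prids i)) k" "finite (PP k)" if "k > 0" for k
    unfolding PP_def using card_pairs_dconv[OF that prids_disjoint finite_prids finite_prids] by simp_all
  have "simsubs n = f ` T" by (force simp: simsubs_def f_def T_def)
  moreover have "card (f ` T) = card (g ` T)"
  proof (rule card_image_cong)
    fix s t assume st: "s \<in> T" "t \<in> T"
    obtain c a b c' a' b' where e: "s = (c, a, b)" "t = (c', a', b')" by (metis surj_pair)
    have P: "prm a" "prm b" "prm a'" "prm b'"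
      "(znm c)\<^sup>2 * (znm (nr a) * znm (nr b)) = n" "(znm c')\<^sup>2 * (znm (nr a') * znm (nr b')) = n"
      using st by (simp_all add: T_def e)
    have c: "c \<noteq> 0" "c' \<noteq> 0" using P(5,6) assms by auto
    show "f s = f t \<longleftrightarrow> g s = g t"
      by (simp only: f_def g_def e prod.case prod.inject simsub_eq_iff[OF c(1) P(1,2) c(2) P(3,4)])
  qed
  moreover have "g ` T = {(X, Q). \<exists>i j. X \<in> zids_sq i \<and> Q \<in> PP j \<and> i * j = n}"
  proof (intro equalityI subsetI)
    fix z assume "z \<in> {(X, Q). \<exists>i j. X \<in> zids_sq i \<and> Q \<in> PP j \<and> i * j = n}"
    then obtain X A B i j k where z: "z = (X, A, B)" "X \<in> zids_sq i" "A \<in> prids j" "B \<in> prids k" "i * (j * k) = n"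
      by (auto simp: PP_def)
    then obtain c a b where "X = zid c" "i = (znm c)\<^sup>2" "A = rid a" "prm a" "znm (nr a) = j"
      "B = rid b" "prm b" "znm (nr b) = k"
      by (auto simp: zids_sq_def zids_def prids_def)
    then have "(c, a, cnj b) \<in> T" "z = g (c, a, cnj b)" using z by (auto simp: T_def g_def)
    then show "z \<in> g ` T" by blast
  next
    fix z assume "z \<in> g ` T"
    then obtain c a b where ca: "z = (zid c, rid a, rid (cnj b))" "prm a" "prm b"
      "(znm c)\<^sup>2 * (znm (nr a) * znm (nr b)) = n"
      by (auto simp: T_def g_def)
    have 1: "zid c \<in> zids_sq ((znm c)\<^sup>2)" by (simp add: zid_sq_mem)
    have "rid a \<in> prids (znm (nr a))" using ca(2) by (auto simp: prids_def)
    moreover have "rid (cnj b) \<in> prids (znm (nr b))" using ca(3) unfolding prids_def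
      by (metis (mono_tags, lifting) mem_Collect_eq nr_simps(4) prm_cnj)
    ultimately have 2: "(rid a, rid (cnj b)) \<in> PP (znm (nr a) * znm (nr b))" by (auto simp: PP_def)
    show "z \<in> {(X, Q). \<exists>i j. X \<in> zids_sq i \<and> Q \<in> PP j \<and> i * j = n}" using ca(1,4) 1 2 by blast
  qed
  ultimately have "card (simsubs n) = dconv (\<lambda>i. card (zids_sq i)) (\<lambda>i. card (PP i)) n"
    using card_pairs_dconv(1)[OF assms zids_sq_disjoint finite_zids_sq PP(2)] by simp
  also have "\<dots> = dconv (\<lambda>i. card (zids_sq i)) (dconv (\<lambda>i. card (prids i)) (\<lambda>i. card (prids i))) n"
    unfolding dconv_def[of "\<lambda>i. card (zids_sq i)"]
    by (intro sum.cong refl arg_cong2[of _ _ _ _ "(*)"] PP(1)) (use assms in \<open>auto elim!: dvdE\<close>)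
  finally show ?thesis .
qed

text \<open>The generating function with its denominator zeta(2 s) cleared, so that the identity
  stays among natural numbers.\<close>

lemma dconv_rids_norm:
  assumes "n > 0"
  shows "dconv (\<lambda>i. card (zids_sq i)) (\<lambda>i. card (simsubs i)) n
    = dconv (\<lambda>i. card (rids_norm i)) (\<lambda>i. card (rids_norm i)) n"
proof -
  let ?z = "\<lambda>i. card (zids_sq i)" and ?p = "\<lambda>i. card (prids i)"
  have pos: "d > 0 \<and> n div d > 0" if "d dvd n" for d using that assms by (auto elim!: dvdE)
  have "dconv ?z (\<lambda>i. card (simsubs i)) n = dconv ?z (dconv ?z (dconv ?p ?p)) n"
    unfolding dconv_def[of ?z] by (intro sum.cong refl) (use pos card_simsubs in \<open>simp add: dconv_def[of ?z]\<close>)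
  also have "dconv ?z (dconv ?z (dconv ?p ?p)) = dconv (dconv ?z ?p) (dconv ?z ?p)"
    by (metis dconv_assoc dconv_commute)
  also have "dconv (dconv ?z ?p) (dconv ?z ?p) n = dconv (\<lambda>i. card (rids_norm i)) (\<lambda>i. card (rids_norm i)) n"
    unfolding dconv_def[of "dconv ?z ?p"] dconv_def[of "\<lambda>i. card (rids_norm i)"]
    by (intro sum.cong refl) (use pos card_rids_norm_prids in simp)
  finally show ?thesis .
qed

section \<open>Similarities as two-sided multiplications\<close>

definition qi :: ico where "qi = Ico 0 1 0 0"
definition qj :: ico where "qj = Ico (- tau - 1) (- tau) (2 * tau) 0"
definition qk :: ico where "qk = Ico tau (- tau - 1) 0 (2 * tau)"

lemmas q_defs = qi_def qj_def qk_def

lemma q_table [simp]: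
  "qi * qi = - 1" "qj * qj = - 1" "qk * qk = - 1" "qi * qj = qk" "qj * qi = - qk"
  "qj * qk = qi" "qk * qj = - qi" "qk * qi = qj" "qi * qk = - qj"
  "cnj qi = - qi" "cnj qj = - qj" "cnj qk = - qk"
  by (simp_all add: q_defs ico_eq_iff ico_mult_sel zt_eq_iff)

lemma double_expand: "sc 2 * x = sc (Y1 x) + sc (Y2 x) * qi + sc (Y3 x) * qj + sc (Y4 x) * qk"
  by (simp add: ico_eq_iff Y_defs q_defs zt_eq_iff algebra_simps)

text \<open>The factor \<open>l\<close> is the square of the real scaling factor. The scaling factor
  itself may lie outside the golden field, whereas \<open>l\<close> is a norm from
  \<open>ico\<close>.\<close>

locale similarity =
  fixes \<phi> :: "ico \<Rightarrow> ico" and l :: zt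
  assumes add: "\<phi> (x + y) = \<phi> x + \<phi> y" and scale: "\<phi> (sc a * x) = sc a * \<phi> x"
    and nr: "nr (\<phi> x) = l * nr x" and l: "l \<noteq> 0"
begin

lemma uminus: "\<phi> (- x) = - \<phi> x"
  using scale[of "- 1" x] by simp

lemma cnj_similarity: "similarity (\<lambda>x. \<phi> (cnj x)) l"
proof
  show "\<phi> (cnj (sc a * x)) = sc a * \<phi> (cnj x)" for a x
    using scale[of a "cnj x"] by (simp add: sc_comm[of "cnj x"])
qed (simp_all add: add nr l)

text \<open>Normalised to send 1 to the scalar \<open>l\<close>; dividing by \<open>l\<close> would
  give an isometry fixing 1. Left multiplication by \<open>\<phi> 1\<close> recovers
  \<open>sc l * \<phi> x\<close>.\<close>

definition A where "A x = cnj (\<phi> 1) * \<phi> x"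

lemma A_add: "A (x + y) = A x + A y" and A_scale: "A (sc a * x) = sc a * A x"
  by (simp_all add: A_def add scale distrib_left sc_left_comm[of "cnj (\<phi> 1)"])

lemma A_uminus: "A (- x) = - A x" by (simp add: A_def uminus)

lemma A_1: "A 1 = sc l" using nr[of 1] by (simp add: A_def cnj_mult_self)

lemma nr_A: "nr (A x) = l * l * nr x"
  using nr[of 1] nr[of x] by (simp add: A_def nr_mult)

lemma trc_A_mult: "trc (cnj (A x) * A y) = l * l * trc (cnj x * y)"
proof -
  have *: "trc (cnj u * v) = nr (u + v) - nr u - nr v" for u v by (simp add: nr_add)
  have "trc (cnj (A x) * A y) = nr (A (x + y)) - nr (A x) - nr (A y)" by (simp only: *[of "A x"] A_add)
  also have "\<dots> = l * l * trc (cnj x * y)" by (simp only: nr_A right_diff_distrib *[of x])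
  finally show ?thesis .
qed

lemma trc_A: "trc (A x) = l * trc x"
proof -
  have "l * trc (A x) = l * (l * trc x)" using trc_A_mult[of 1 x] by (simp add: A_1 mult.assoc)
  then show ?thesis using l by simp
qed

lemma A_pure:
  assumes "trc x = 0"
  shows "cnj (A x) = - A x" "A x * A x = - sc (l * l * nr x)"
proof -
  show 1: "cnj (A x) = - A x" using trc_A[of x] assms by (simp add: cnj_eq_trc)
  have "A x * cnj (A x) = sc (l * l * nr x)" by (simp only: mult_cnj nr_A)
  then have "- (A x * A x) = sc (l * l * nr x)" by (simp only: 1 mult_minus_right)
  then show "A x * A x = - sc (l * l * nr x)" by (metis minus_minus)
qed

lemma A_anticommute:
  assumes "trc x = 0" "trc y = 0" "trc (x * y) = 0"
  shows "A x * A y = - (A y * A x)"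
proof -
  have "cnj x = - x" using assms(1) by (simp add: cnj_eq_trc)
  then have "trc (cnj (A x) * A y) = 0" using trc_A_mult[of x y] assms(3) by simp
  then have "trc (A x * A y) = 0" using A_pure(1)[OF assms(1)] by simp
  then have "cnj (A x * A y) = - (A x * A y)" by (simp add: cnj_eq_trc)
  then have "A y * A x = - (A x * A y)" using A_pure(1)[OF assms(1)] A_pure(1)[OF assms(2)] by simp
  then show ?thesis by simp
qed

lemma q_pure: "trc qi = 0" "trc qj = 0" "trc qk = 0" "nr qi = 1" "nr qj = 1" "nr qk = 1"
  by (simp_all add: q_defs trc_def nr_def zt_eq_iff)

lemma sq: "A qi * A qi = - sc (l * l)" "A qj * A qj = - sc (l * l)" "A qk * A qk = - sc (l * l)"
  using A_pure(2)[OF q_pure(1)] A_pure(2)[OF q_pure(2)] A_pure(2)[OF q_pure(3)] by (simp_all add: q_pure)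

lemma anti: "A qj * A qi = - (A qi * A qj)" "A qk * A qi = - (A qi * A qk)" "A qk * A qj = - (A qj * A qk)"
  by (rule A_anticommute; simp add: q_pure)+

lemma sq_left: "A qi * (A qi * x) = - (sc (l * l) * x)" "A qj * (A qj * x) = - (sc (l * l) * x)"
    "A qk * (A qk * x) = - (sc (l * l) * x)"
  by (simp_all add: sq flip: mult.assoc)

lemma anti_left: "A qj * (A qi * x) = - (A qi * (A qj * x))" "A qk * (A qi * x) = - (A qi * (A qk * x))"
    "A qk * (A qj * x) = - (A qj * (A qk * x))"
  by (simp_all add: anti flip: mult.assoc)

text \<open>The product of the images of the three units has the same square as the scalar l^3 and
  commutes with it. Without zero divisors it is plus or minus that scalar: the two signs are
  rotations and reflections of the pure quaternions.\<close>

lemma orientation: "A qi * A qj = sc l * A qk \<or> A qi * A qj = - (sc l * A qk)"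
proof -
  define z where "z = A qk * (A qi * A qj)"
  define t where "t = sc (l * l * l)"
  have K: "A qk * (A qi * A qj) = A qi * (A qj * A qk)"
    by (simp add: anti_left anti)
  have z: "z = A qi * (A qj * A qk)" by (simp only: z_def K)
  have "z * z = A qk * (A qi * (A qj * (A qi * (A qj * A qk))))"
    using arg_cong[OF z, of "\<lambda>w. z * w"] by (simp only: z_def mult.assoc)
  also have "\<dots> = A qk * (- (A qi * (A qi * (A qj * (A qj * A qk)))))"
    by (simp only: anti_left(1) mult_minus_right)
  also have "\<dots> = - (A qk * (sc (l * l) * (sc (l * l) * A qk)))"
    by (simp only: sq_left mult_minus_right minus_minus)
  also have "\<dots> = - (sc (l * l) * (sc (l * l) * (A qk * A qk)))"
    by (simp only: sc_left_comm[of "A qk"])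
  also have "\<dots> = t * t" by (simp add: sq t_def flip: sc_mult)
  finally have zz: "z * z = t * t" .
  have "t * z = z * t" by (simp add: t_def sc_comm[of z])
  then have "(z - t) * (z + t) = z * z - t * t" by (simp add: algebra_simps)
  then have "z = t \<or> z = - t" using zz by (simp add: eq_neg_iff_add_eq_0)
  moreover have "A qk * z = - (sc (l * l) * (A qi * A qj))" by (simp only: z_def sq_left)
  moreover have "A qk * t = sc (l * l) * (sc l * A qk)"
    unfolding t_def sc_comm[of "A qk"] by (simp only: sc_mult mult.assoc)
  ultimately have "sc (l * l) * (sc l * A qk) = - (sc (l * l) * (A qi * A qj))
      \<or> - (sc (l * l) * (sc l * A qk)) = - (sc (l * l) * (A qi * A qj))"
    by (metis mult_minus_right)
  then have "sc (l * l) * (- (sc l * A qk)) = sc (l * l) * (A qi * A qj)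
      \<or> sc (l * l) * (sc l * A qk) = sc (l * l) * (A qi * A qj)"
    by (metis minus_equation_iff mult_minus_right neg_equal_iff_equal)
  moreover have "sc (l * l) \<noteq> 0" using l by simp
  ultimately have "- (sc l * A qk) = A qi * A qj \<or> sc l * A qk = A qi * A qj"
    using mult_left_cancel by blast
  then show ?thesis by metis
qed

text \<open>An explicit Skolem-Noether argument: find \<open>q\<close> with
  \<open>A y * q = sc l * (q * y)\<close>, then multiply by \<open>cnj q\<close>.\<close>

lemma two_sided_form:
  assumes ij: "A qi * A qj = sc l * A qk"
  shows "\<exists>q. q \<noteq> 0 \<and> (\<forall>y. sc (nr q) * \<phi> y = \<phi> 1 * q * y * cnj q)"
proof -
  let ?I = "A qi" and ?J = "A qj" and ?K = "A qk"
  have sl: "sc l \<noteq> 0" using l by simp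
  have jk: "?J * ?K = sc l * ?I"
  proof -
    have "sc l * (?J * ?K) = ?J * (?I * ?J)" by (simp only: ij sc_left_comm[of ?J])
    also have "\<dots> = sc (l * l) * ?I"
      by (simp only: anti_left sq mult_minus_right minus_minus sc_comm[of ?I])
    also have "\<dots> = sc l * (sc l * ?I)" by (simp only: sc_mult mult.assoc)
    finally show ?thesis by (rule mult_left_cancel[OF sl, THEN iffD1])
  qed
  have ki: "?I * ?K = - (sc l * ?J)"
  proof -
    have "sc l * (?I * ?K) = ?I * (?I * ?J)" by (simp only: ij sc_left_comm[of ?I])
    also have "\<dots> = sc l * (- (sc l * ?J))"
      by (simp only: sq_left mult_minus_right sc_mult mult.assoc)
    finally show ?thesis by (rule mult_left_cancel[OF sl, THEN iffD1])
  qed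
  have ij': "?I * (?J * x) = sc l * (?K * x)" and jk': "?J * (?K * x) = sc l * (?I * x)"
    and ki': "?I * (?K * x) = - (sc l * (?J * x))" for x
    by (simp_all add: ij jk ki flip: mult.assoc)
  \<comment> \<open>The sum of A(e) x e^(-1) over e = 1, i, j, k. Multiplying e by a unit permutes
    the summands up to the factor \<open>l\<close>, so \<open>Q x\<close> intertwines
    \<open>A\<close> with left multiplication by \<open>l\<close>.\<close>
  define Q where "Q x = sc l * x - ?I * (x * qi) - ?J * (x * qj) - ?K * (x * qk)" for x
  have Qi: "?I * Q x = sc l * (Q x * qi)" and Qj: "?J * Q x = sc l * (Q x * qj)"
    and Qk: "?K * Q x = sc l * (Q x * qk)" for x
    by (simp_all add: Q_def right_diff_distrib left_diff_distrib mult.assoc sq_left ij' jk' ki' anti_left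
        sc_mult sc_left_comm[of ?I] sc_left_comm[of ?J] sc_left_comm[of ?K])
      (simp_all add: algebra_simps)
  \<comment> \<open>A combination of values of \<open>Q\<close> that is a nonzero scalar; hence
    \<open>Q\<close> does not vanish identically.\<close>
  have "Q 1 * cnj 1 + Q qi * cnj qi + Q qj * cnj qj + Q qk * cnj qk = sc (4 * l)"
    by (simp add: Q_def left_diff_distrib right_diff_distrib distrib_left distrib_right mult.assoc)
      (simp add: ico_eq_iff)
  moreover have "sc (4 * l) \<noteq> 0" using l by simp
  ultimately obtain x where x: "Q x \<noteq> 0" by (metis add.right_neutral mult_zero_left)
  define q where "q = Q x"
  have main: "A y * q = sc l * (q * y)" for y
  proof -
    have e: "sc 2 * y = sc (Y1 y) * 1 + sc (Y2 y) * qi + sc (Y3 y) * qj + sc (Y4 y) * qk"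
      by (simp only: double_expand mult_1_right)
    have h: "sc s * (sc l * (q * z)) = sc l * (q * (sc s * z))" for s z
      by (simp only: sc_left_comm[of q] sc_left_comm[of "sc l" s])
    have "sc 2 * (A y * q) = A (sc 2 * y) * q" by (simp only: A_scale mult.assoc)
    also have "A (sc 2 * y) = sc (Y1 y) * A 1 + sc (Y2 y) * ?I + sc (Y3 y) * ?J + sc (Y4 y) * ?K"
      by (simp only: e A_add A_scale)
    also have "\<dots> * q = sc (Y1 y) * (sc l * (q * 1)) + sc (Y2 y) * (sc l * (q * qi))
        + sc (Y3 y) * (sc l * (q * qj)) + sc (Y4 y) * (sc l * (q * qk))"
      by (simp only: distrib_right mult.assoc A_1 q_def Qi Qj Qk mult_1_right)
    also have "\<dots> = sc l * (q * (sc 2 * y))" by (simp only: h e distrib_left)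
    also have "\<dots> = sc 2 * (sc l * (q * y))" by (rule h[symmetric])
    finally have "sc 2 * (A y * q) = sc 2 * (sc l * (q * y))" .
    moreover have "sc 2 \<noteq> 0" by simp
    ultimately show ?thesis using mult_left_cancel by blast
  qed
  have "\<phi> y * q = \<phi> 1 * q * y" for y
  proof -
    have "sc l * (\<phi> y * q) = \<phi> 1 * (A y * q)"
      using nr[of 1] by (simp add: A_def mult_cnj flip: mult.assoc)
    also have "\<dots> = sc l * (\<phi> 1 * q * y)" by (simp only: main sc_left_comm[of "\<phi> 1"] mult.assoc)
    finally show ?thesis using sl by simp
  qed
  then have "sc (nr q) * \<phi> y = \<phi> 1 * q * y * cnj q" for y
    by (metis mult.assoc mult_cnj sc_comm)
  then show ?thesis using x q_def by blast
qed

end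

text \<open>Split the contents off \<open>\<phi> 1 * q\<close> and \<open>cnj q\<close>; by
  \<open>content_dvd\<close> the denominator \<open>nr q\<close> divides the resulting scalar. A
  reflection is first composed with \<open>cnj\<close>, which permutes \<open>ico\<close> and
  therefore keeps the range.\<close>

theorem similarity_simsub:
  assumes "similarity \<phi> l"
  shows "\<exists>c a b. prm a \<and> prm b \<and> range \<phi> = simsub c a b"
proof -
  have *: "\<exists>c a b. prm a \<and> prm b \<and> range \<psi> = simsub c a b"
    if sim: "similarity \<psi> l" and or: "similarity.A \<psi> qi * similarity.A \<psi> qj = sc l * similarity.A \<psi> qk" for \<psi>
  proof -
    obtain q where q: "q \<noteq> 0" "\<And>y. sc (nr q) * \<psi> y = \<psi> 1 * q * y * cnj q"
      using similarity.two_sided_form[OF sim or] by blast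
    have "nr (\<psi> 1) = l" using similarity.nr[OF sim, of 1] by simp
    then have "\<psi> 1 \<noteq> 0" using similarity.l[OF sim] by auto
    then have "\<psi> 1 * q \<noteq> 0" using q by simp
    then obtain k a where a: "\<psi> 1 * q = sc k * a" "prm a" "k \<noteq> 0" using prm_decomp by blast
    have "cnj q \<noteq> 0" using q(1) by (metis cnj_inj cnj_simps(1))
    then obtain m b where b: "cnj q = sc m * b" "prm b" "m \<noteq> 0" using prm_decomp by blast
    have eq: "sc (nr q) * \<psi> y = sc (k * m) * (a * y * b)" for y
    proof -
      have "sc (nr q) * \<psi> y = sc k * (a * (y * (sc m * b)))" using q(2)[of y] a(1) b(1) by (simp only: mult.assoc)
      also have "\<dots> = sc k * (sc m * (a * (y * b)))" by (simp only: sc_left_comm[of y] sc_left_comm[of a])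
      finally show ?thesis by (simp only: sc_mult mult.assoc)
    qed
    have "nr q dvd k * m"
    proof (rule content_dvd[OF a(2) b(2)])
      show "sdvd (nr q) (sc (k * m) * (a * y * b))" for y unfolding eq[symmetric] by (rule sdvd_sc_self)
    qed
    then obtain c where c: "k * m = nr q * c" by blast
    have "\<psi> y = sc c * (a * y * b)" for y
    proof -
      have "sc (nr q) * \<psi> y = sc (nr q) * (sc c * (a * y * b))" unfolding eq c by (simp only: sc_mult mult.assoc)
      then show ?thesis using q(1) by simp
    qed
    then have "range \<psi> = simsub c a b" by (simp add: simsub_def)
    then show ?thesis using a b by blast
  qed
  interpret similarity \<phi> l by fact
  show ?thesis
  proof (cases "A qi * A qj = sc l * A qk")
    case True
    then show ?thesis using *[OF assms] by blast
  next
    case False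
    then have o: "A qi * A qj = - (sc l * A qk)" using orientation by blast
    interpret c: similarity "\<lambda>x. \<phi> (cnj x)" l by (rule cnj_similarity)
    have cA: "c.A x = A (cnj x)" for x by (simp add: c.A_def A_def)
    have "c.A qi * c.A qj = sc l * c.A qk" using o by (simp add: cA A_uminus)
    then have "\<exists>c a b. prm a \<and> prm b \<and> range (\<lambda>x. \<phi> (cnj x)) = simsub c a b"
      using *[OF cnj_similarity] by blast
    moreover have "range (\<lambda>x. \<phi> (cnj x)) = range \<phi>"
    proof -
      have "\<phi> x \<in> range (\<lambda>x. \<phi> (cnj x))" for x by (rule range_eqI[of _ _ "cnj x"]) simp
      then show ?thesis by blast
    qed
    ultimately show ?thesis by simp
  qed
qed

section \<open>The embedding onto the icosian ring in real 4-space\<close>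

definition yc :: "ico \<Rightarrow> 4 \<Rightarrow> zt" where
  "yc x i = (if i = 1 then Y1 x else if i = 2 then Y2 x else if i = 3 then Y3 x else Y4 x)"

lemma yc_sel [simp]: "yc x 1 = Y1 x" "yc x 2 = Y2 x" "yc x 3 = Y3 x" "yc x 4 = Y4 x"
  by (simp_all add: yc_def)

lemma yc_simps: "yc (x + y) i = yc x i + yc y i" "yc (x - y) i = yc x i - yc y i" "yc (sc a * x) i = a * yc x i"
  by (simp_all add: yc_def Y_defs algebra_simps)

definition emb :: "ico \<Rightarrow> real ^ 4" where "emb x = (\<chi> i. zreal (yc x i) / 2)"

lemma emb_nth: "emb x $ i = zreal (yc x i) / 2"
  by (simp add: emb_def)

lemma emb_add: "emb (x + y) = emb x + emb y" and emb_diff: "emb (x - y) = emb x - emb y"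
  and emb_scale: "emb (sc a * x) = zreal a *\<^sub>R emb x"
  by (simp_all add: vec_eq_iff emb_nth yc_simps add_divide_distrib diff_divide_distrib)

lemma emb_0: "emb 0 = 0"
  using emb_diff[of 0 0] by simp

lemma inj_emb: "inj emb"
proof (rule injI)
  fix x y assume "emb x = emb y"
  then have "\<forall>i. yc x i = yc y i" by (simp add: vec_eq_iff emb_nth)
  then show "x = y" by (simp add: forall_4 Y_eq_iff)
qed

lemma inner_emb: "inner (emb x) (emb y) = zreal (trc (cnj x * y)) / 2"
proof -
  have *: "trc (cnj x * y) = nr (x + y) - nr x - nr y" by (simp add: nr_add)
  have "4 * trc (cnj x * y) = 4 * nr (x + y) - 4 * nr x - 4 * nr y" by (simp add: *)
  also have "\<dots> = 2 * (Y1 x * Y1 y + Y2 x * Y2 y + Y3 x * Y3 y + Y4 x * Y4 y)"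
    by (simp only: Y_nr) (simp add: Y_defs algebra_simps)
  finally have "zreal (4 * trc (cnj x * y))
      = zreal (2 * (Y1 x * Y1 y + Y2 x * Y2 y + Y3 x * Y3 y + Y4 x * Y4 y))" by simp
  then show ?thesis by (simp add: inner_vec_def sum_4 emb_nth field_simps)
qed

lemma norm_emb: "(norm (emb x))\<^sup>2 = zreal (nr x)"
  unfolding power2_norm_eq_inner inner_emb cnj_mult_self by simp

text \<open>Membership of the icosian ring in half-integer coordinates \<open>t i / 2\<close>; interchanging the roles of
  \<open>a\<close> and \<open>b\<close> gives the image of the ring under an odd permutation of the coordinates.\<close>

definition hc :: "zt \<Rightarrow> zt \<Rightarrow> (4 \<Rightarrow> zt) \<Rightarrow> bool" where
  "hc a b t \<longleftrightarrow> 2 dvd t 1 - a * t 3 - b * t 4 \<and> 2 dvd t 2 - b * t 3 - a * t 4"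

lemma hc_transpose:
  assumes "a \<noteq> b"
  shows "hc (tau + 1) tau t \<Longrightarrow> hc tau (tau + 1) (t \<circ> Transposition.transpose a b)"
    "hc tau (tau + 1) t \<Longrightarrow> hc (tau + 1) tau (t \<circ> Transposition.transpose a b)"
  using exhaust_4[of a] exhaust_4[of b] assms
  by (elim disjE; simp add: hc_def zt_two_dvd Transposition.transpose_def; argo)+

text \<open>Every transposition exchanges the two forms of \<open>hc\<close>, so the induction over
  transpositions has to carry both forms for both parities.\<close>

lemma hc_permute:
  assumes "p permutes (UNIV :: 4 set)"
  shows "if evenperm p
    then \<forall>t. (hc (tau + 1) tau t \<longrightarrow> hc (tau + 1) tau (t \<circ> p)) \<and> (hc tau (tau + 1) t \<longrightarrow> hc tau (tau + 1) (t \<circ> p))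
    else \<forall>t. (hc (tau + 1) tau t \<longrightarrow> hc tau (tau + 1) (t \<circ> p)) \<and> (hc tau (tau + 1) t \<longrightarrow> hc (tau + 1) tau (t \<circ> p))"
  using assms finite
proof (induction rule: permutes_induct)
  case id
  have "t \<circ> id = t" for t :: "4 \<Rightarrow> zt" by simp
  then show ?case by (simp add: evenperm_id)
next
  case (swap a b p)
  have "permutation p" using swap.hyps by (intro permutes_imp_permutation[OF finite])
  then have ev: "evenperm (Transposition.transpose a b \<circ> p) \<longleftrightarrow> \<not> evenperm p"
    using swap.hyps by (simp add: evenperm_comp permutation_swap_id evenperm_swap)
  have co: "t \<circ> (Transposition.transpose a b \<circ> p) = (t \<circ> Transposition.transpose a b) \<circ> p" for t :: "4 \<Rightarrow> zt"
    by (simp add: comp_assoc)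
  show ?case
  proof (cases "evenperm p")
    case True
    then have n: "\<not> evenperm (Transposition.transpose a b \<circ> p)" using ev by blast
    show ?thesis unfolding if_not_P[OF n] co
      using swap.IH[unfolded if_P[OF True]] hc_transpose[OF \<open>a \<noteq> b\<close>] by blast
  next
    case False
    then have n: "evenperm (Transposition.transpose a b \<circ> p)" using ev by blast
    show ?thesis unfolding if_P[OF n] co
      using swap.IH[unfolded if_not_P[OF False]] hc_transpose[OF \<open>a \<noteq> b\<close>] by blast
  qed
qed

text \<open>Signs are 1 modulo 2.\<close>

lemma hc_sign:
  assumes "hc a b t" "\<And>i. e i = 1 \<or> e i = - 1"
  shows "hc a b (\<lambda>i. e i * t i)"
proof -
  have e: "2 dvd e i - 1" for i using assms(2)[of i] by auto
  have "e 1 * t 1 - a * (e 3 * t 3) - b * (e 4 * t 4) = (t 1 - a * t 3 - b * t 4)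
      + ((e 1 - 1) * t 1 - (e 3 - 1) * (a * t 3) - (e 4 - 1) * (b * t 4))"
    by (simp add: algebra_simps)
  moreover have "e 2 * t 2 - b * (e 3 * t 3) - a * (e 4 * t 4) = (t 2 - b * t 3 - a * t 4)
      + ((e 2 - 1) * t 2 - (e 3 - 1) * (b * t 3) - (e 4 - 1) * (a * t 4))"
    by (simp add: algebra_simps)
  ultimately show ?thesis
    using assms(1) e unfolding hc_def by (metis dvd_add dvd_diff dvd_mult2)
qed

lemma hc_range:
  assumes "hc (tau + 1) tau t" "\<And>i. v $ i = zreal (t i) / 2"
  shows "v \<in> range emb"
proof -
  \<comment> \<open>\<open>Y_exists\<close> has the opposite sign at \<open>tau * t 4\<close>, which
    makes no difference modulo 2.\<close>
  have e: "t 1 - (tau + 1) * t 3 + tau * t 4 = (t 1 - (tau + 1) * t 3 - tau * t 4) + 2 * (tau * t 4)"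
    by (simp add: algebra_simps)
  have "2 dvd t 1 - (tau + 1) * t 3 + tau * t 4"
    unfolding e using assms(1) unfolding hc_def by (intro dvd_add dvd_triv_left) blast
  then obtain x where "Y1 x = t 1" "Y2 x = t 2" "Y3 x = t 3" "Y4 x = t 4"
    using Y_exists[of "t 1" "t 3" "t 4" "t 2"] assms(1) by (auto simp: hc_def)
  then have "yc x i = t i" for i using exhaust_4[of i] by auto
  then have "v = emb x" using assms(2) by (simp add: vec_eq_iff emb_nth)
  then show ?thesis by blast
qed

lemma golden_inv: "1 / golden = golden - 1"
  using golden_gt_1 golden_sq by (simp add: field_simps)

text \<open>Twice the coordinates of the three generating vectors, where -1 / \<open>tau\<close> is
  written as \<open>1 - tau\<close>.\<close>

definition seed :: "nat \<Rightarrow> 4 \<Rightarrow> zt" where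
  "seed n i = (if n = 0 then (if i = 1 then 2 else 0)
    else if n = 1 then 1
    else (if i = 1 then tau else if i = 2 then 1 else if i = 3 then 1 - tau else 0))"

lemma seeds_coord:
  assumes "v \<in> icosian_seeds"
  shows "\<exists>n. hc (tau + 1) tau (seed n) \<and> (\<forall>i. v $ i = zreal (seed n i) / 2)"
proof -
  have hc: "hc (tau + 1) tau (seed n)" for n
    by (cases "n = 0 \<or> n = 1") (auto simp: hc_def seed_def zt_two_dvd)
  have "\<exists>n. \<forall>i. v $ i = zreal (seed n i) / 2"
  proof -
    consider "v = vector [1, 0, 0, 0]" | "v = vector [1/2, 1/2, 1/2, 1/2]"
      | "v = vector [golden / 2, 1/2, - (1 / golden) / 2, 0]"
      using assms by (auto simp: icosian_seeds_def)
    then show ?thesis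
    proof cases
      case 1
      then show ?thesis by (intro exI[of _ 0]) (simp add: forall_4 seed_def vector_4_nth)
    next
      case 2
      then show ?thesis by (intro exI[of _ 1]) (simp add: forall_4 seed_def vector_4_nth)
    next
      case 3
      then show ?thesis by (intro exI[of _ 2]) (simp add: forall_4 seed_def vector_4_nth golden_inv)
    qed
  qed
  then show ?thesis using hc by blast
qed

lemma icosian_group_subset: "icosian_group \<subseteq> range emb"
proof
  fix u assume "u \<in> icosian_group"
  then obtain \<epsilon> v \<pi> where u: "u = (\<chi> i. \<epsilon> i * v $ \<pi> i)" "v \<in> icosian_seeds" "\<pi> permutes UNIV" "evenperm \<pi>"
    "\<forall>i. \<epsilon> i \<in> {1, -1}" unfolding icosian_group_def by blast
  obtain n where n: "hc (tau + 1) tau (seed n)" "\<And>i. v $ i = zreal (seed n i) / 2"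
    using seeds_coord[OF u(2)] by blast
  define e :: "4 \<Rightarrow> zt" where "e i = (if \<epsilon> i = 1 then 1 else - 1)" for i
  have "hc (tau + 1) tau (seed n \<circ> \<pi>)" using hc_permute[OF u(3)] u(4) n(1) by simp
  then have "hc (tau + 1) tau (\<lambda>i. e i * (seed n \<circ> \<pi>) i)" by (rule hc_sign) (simp add: e_def)
  moreover have "u $ i = zreal (e i * (seed n \<circ> \<pi>) i) / 2" for i
    using u(5)[rule_format, of i] by (auto simp: u(1) n(2) e_def)
  ultimately show "u \<in> range emb" by (rule hc_range)
qed

interpretation zmod: Modules.module "\<lambda>(k::int) (x::real ^ 4). of_int k *\<^sub>R x"
  by (rule int_scaleR_module)

lemma icosian_ring_subset: "icosian_ring \<subseteq> range emb"
  unfolding icosian_ring_def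
proof (rule zmod.span_minimal[OF icosian_group_subset])
  have "of_int k *\<^sub>R emb x = emb (sc (of_int k) * x)" for k x by (simp add: emb_scale)
  then show "zmod.subspace (range emb)"
    unfolding zmod.subspace_def by (auto simp flip: emb_add) (metis emb_0 rangeI)
qed

lemma icosian_groupI:
  assumes "v \<in> icosian_seeds" "\<pi> permutes UNIV" "evenperm \<pi>" "\<forall>i. \<epsilon> i = 1 \<or> \<epsilon> i = - 1"
    "\<forall>i. u $ i = \<epsilon> i * v $ \<pi> i"
  shows "u \<in> icosian_ring"
proof -
  have "u = (\<chi> i. \<epsilon> i * v $ \<pi> i)" using assms(5) by (simp add: vec_eq_iff)
  then have "u \<in> icosian_group" unfolding icosian_group_def using assms(1-4) by blast
  then show ?thesis unfolding icosian_ring_def by (rule zmod.span_base)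
qed

lemma transpose_comp:
  assumes "a \<noteq> (b::4)" "c \<noteq> d"
  shows "(Transposition.transpose a b \<circ> Transposition.transpose c d) permutes UNIV"
    "evenperm (Transposition.transpose a b \<circ> Transposition.transpose c d)"
  using assms by (simp_all add: permutes_compose permutes_swap_id evenperm_comp permutation_swap_id evenperm_swap)

lemma icosian_ring_add: "u \<in> icosian_ring \<Longrightarrow> v \<in> icosian_ring \<Longrightarrow> u + v \<in> icosian_ring"
  unfolding icosian_ring_def by (rule zmod.span_add)

lemma icosian_ring_scale: "u \<in> icosian_ring \<Longrightarrow> of_int k *\<^sub>R u \<in> icosian_ring"
  unfolding icosian_ring_def by (rule zmod.span_scale)

definition sgn4 :: "real \<Rightarrow> real \<Rightarrow> real \<Rightarrow> real \<Rightarrow> 4 \<Rightarrow> real" where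
  "sgn4 a b c d i = (if i = 1 then a else if i = 2 then b else if i = 3 then c else d)"

text \<open>Enough group elements to reach 1, i, h, i h and their multiples by \<open>tau\<close>.
  The sign \<open>s\<close> supplies pairs whose sums are \<open>golden\<close> and
  \<open>golden\<close> times i.\<close>

lemma generators_mem:
  fixes s :: real
  assumes "s = 1 \<or> s = -1"
  shows "vector [1, 0, 0, 0] \<in> icosian_ring" "vector [0, 1, 0, 0] \<in> icosian_ring"
    "vector [golden / 2, s / 2, s * (golden - 1) / 2, 0] \<in> icosian_ring"
    "vector [s / 2, golden / 2, 0, s * (golden - 1) / 2] \<in> icosian_ring"
    "vector [(golden - 1) / 2, golden / 2, 1 / 2, 0] \<in> icosian_ring"
    "vector [- golden / 2, (golden - 1) / 2, 0, 1 / 2] \<in> icosian_ring"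
proof -
  have seeds: "vector [1, 0, 0, 0] \<in> icosian_seeds"
    "vector [golden / 2, 1/2, - (1 / golden) / 2, 0] \<in> icosian_seeds"
    by (simp_all add: icosian_seeds_def)
  note defs = forall_4 vector_4_nth golden_inv sgn4_def Transposition.transpose_def
  show "vector [1, 0, 0, 0] \<in> icosian_ring"
    by (rule icosian_groupI[OF seeds(1) permutes_id, of "\<lambda>_. 1"]) simp_all
  show "vector [0, 1, 0, 0] \<in> icosian_ring"
    by (rule icosian_groupI[OF seeds(1) transpose_comp[of 1 2 3 4], of "\<lambda>_. 1"])
      (auto simp: defs)
  show "vector [golden / 2, s / 2, s * (golden - 1) / 2, 0] \<in> icosian_ring"
    by (rule icosian_groupI[OF seeds(2) permutes_id, of "sgn4 1 s (- s) 1"])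
      (use assms in \<open>auto simp: defs\<close>)
  show "vector [s / 2, golden / 2, 0, s * (golden - 1) / 2] \<in> icosian_ring"
    by (rule icosian_groupI[OF seeds(2) transpose_comp[of 1 2 3 4], of "sgn4 s 1 1 (- s)"])
      (use assms in \<open>auto simp: defs\<close>)
  show "vector [(golden - 1) / 2, golden / 2, 1 / 2, 0] \<in> icosian_ring"
    by (rule icosian_groupI[OF seeds(2) transpose_comp[of 1 2 1 3], of "sgn4 (- 1) 1 1 1"])
      (auto simp: defs)
  show "vector [- golden / 2, (golden - 1) / 2, 0, 1 / 2] \<in> icosian_ring"
    by (rule icosian_groupI[OF seeds(2) transpose_comp[of 2 4 2 3], of "sgn4 (- 1) (- 1) 1 1"])
      (auto simp: defs)
qed

theorem range_emb: "range emb = icosian_ring"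
proof (intro equalityI subsetI)
  fix v assume "v \<in> range emb"
  then obtain x where v: "v = emb x" by blast
  note g = generators_mem
  \<comment> \<open>A coefficient a + b \<open>tau\<close> becomes two integer coefficients, one for
    a basis vector and one for its multiple by \<open>golden\<close>.\<close>
  let ?z = "\<lambda>i j. of_int (zfst (i x)) *\<^sub>R (fst j :: real ^ 4) + of_int (zsnd (i x)) *\<^sub>R snd j"
  have t1: "vector [golden, 0, 0, 0] \<in> icosian_ring"
  proof -
    have "vector [golden, 0, 0, 0] = (vector [golden / 2, 1 / 2, 1 * (golden - 1) / 2, 0]
        + vector [golden / 2, - 1 / 2, - 1 * (golden - 1) / 2, 0] :: real ^ 4)"
      by (simp add: vec_eq_iff forall_4 vector_4_nth field_simps)
    then show ?thesis using icosian_ring_add g(3)[of 1] g(3)[of "- 1"] by metis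
  qed
  have t2: "vector [0, golden, 0, 0] \<in> icosian_ring"
  proof -
    have "vector [0, golden, 0, 0] = (vector [1 / 2, golden / 2, 0, 1 * (golden - 1) / 2]
        + vector [- 1 / 2, golden / 2, 0, - 1 * (golden - 1) / 2] :: real ^ 4)"
      by (simp add: vec_eq_iff forall_4 vector_4_nth field_simps)
    then show ?thesis using icosian_ring_add g(4)[of 1] g(4)[of "- 1"] by metis
  qed
  have t3: "vector [(golden + 1) / 2, golden / 2, 1 / 2, 0] \<in> icosian_ring"
  proof -
    have "vector [(golden + 1) / 2, golden / 2, 1 / 2, 0] = (vector [(golden - 1) / 2, golden / 2, 1 / 2, 0]
        + vector [1, 0, 0, 0] :: real ^ 4)"
      by (simp add: vec_eq_iff forall_4 vector_4_nth field_simps)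
    then show ?thesis using icosian_ring_add g(5)[of 1] g(1)[of 1] by metis
  qed
  have t4: "vector [- golden / 2, (golden + 1) / 2, 0, 1 / 2] \<in> icosian_ring"
  proof -
    have "vector [- golden / 2, (golden + 1) / 2, 0, 1 / 2] = (vector [- golden / 2, (golden - 1) / 2, 0, 1 / 2]
        + vector [0, 1, 0, 0] :: real ^ 4)"
      by (simp add: vec_eq_iff forall_4 vector_4_nth field_simps)
    then show ?thesis using icosian_ring_add g(6)[of 1] g(2)[of 1] by metis
  qed
  have "v = ?z q0 (vector [1, 0, 0, 0], vector [golden, 0, 0, 0])
      + ?z q1 (vector [0, 1, 0, 0], vector [0, golden, 0, 0])
      + ?z q2 (vector [golden / 2, 1 / 2, 1 * (golden - 1) / 2, 0], vector [(golden + 1) / 2, golden / 2, 1 / 2, 0])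
      + ?z q3 (vector [- 1 / 2, golden / 2, 0, - (- 1) * (golden - 1) / 2], vector [- golden / 2, (golden + 1) / 2, 0, 1 / 2])"
    by (simp add: v vec_eq_iff forall_4 vector_4_nth emb_nth Y_defs zreal_def)
      (simp add: field_simps golden_sq)
  moreover have "vector [- 1 / 2, golden / 2, 0, - (- 1) * (golden - 1) / 2] \<in> icosian_ring"
  proof -
    have "(vector [- 1 / 2, golden / 2, 0, - (- 1) * (golden - 1) / 2] :: real ^ 4)
      = vector [0, golden, 0, 0] + of_int (- 1) *\<^sub>R vector [1 / 2, golden / 2, 0, - 1 * (golden - 1) / 2]"
      by (simp add: vec_eq_iff forall_4 vector_4_nth field_simps)
    moreover have "vector [1 / 2, golden / 2, 0, - 1 * (golden - 1) / 2] \<in> icosian_ring"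
      by (rule icosian_groupI[OF _ transpose_comp[of 1 2 3 4], of "vector [golden / 2, 1/2, - (1 / golden) / 2, 0]" "\<lambda>_. 1"])
        (auto simp: icosian_seeds_def forall_4 vector_4_nth golden_inv Transposition.transpose_def)
    ultimately show ?thesis using icosian_ring_add icosian_ring_scale t2 by metis
  qed
  ultimately show "v \<in> icosian_ring"
    using icosian_ring_add icosian_ring_scale t1 t2 t3 t4 g(1)[of 1] g(2)[of 1] g(3)[of 1]
    by (simp only: fst_conv snd_conv) (intro icosian_ring_add icosian_ring_scale; simp)
qed (use icosian_ring_subset in blast)

lemma trc_similarity: "similarity \<phi> l \<Longrightarrow> trc (cnj (\<phi> x) * \<phi> y) = l * trc (cnj x * y)"
proof -
  assume "similarity \<phi> l"
  then interpret similarity \<phi> l .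
  have *: "trc (cnj u * v) = nr (u + v) - nr u - nr v" for u v by (simp add: nr_add)
  have "trc (cnj (\<phi> x) * \<phi> y) = nr (\<phi> (x + y)) - nr (\<phi> x) - nr (\<phi> y)" by (simp only: *[of "\<phi> x"] add)
  also have "\<dots> = l * trc (cnj x * y)" by (simp only: nr right_diff_distrib *[of x])
  finally show ?thesis .
qed

lemma emb_coords: "emb x $ 1 = zreal (Y1 x) / 2" "emb x $ 2 = zreal (Y2 x) / 2"
    "emb x $ 3 = zreal (Y3 x) / 2" "emb x $ 4 = zreal (Y4 x) / 2"
  by (simp_all add: emb_nth)

text \<open>The values at 1, i, j, k extend the map linearly to the real space, where it scales
  squared norms by \<open>zreal l\<close>. This number is the norm of \<open>\<phi> 1\<close>, hence
  positive, and its square root is the scaling factor.\<close>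

lemma similarity_imp_orthogonal:
  assumes "similarity \<phi> l"
  shows "\<exists>\<alpha> R. \<alpha> \<noteq> 0 \<and> orthogonal_transformation R \<and> emb ` range \<phi> = (\<lambda>x. \<alpha> *\<^sub>R R x) ` range emb"
proof -
  interpret similarity \<phi> l by fact
  define L where "L v = v $ 1 *\<^sub>R emb (\<phi> 1) + v $ 2 *\<^sub>R emb (\<phi> qi) + v $ 3 *\<^sub>R emb (\<phi> qj) + v $ 4 *\<^sub>R emb (\<phi> qk)" for v :: "real ^ 4"
  have lin: "linear L"
    by (rule linearI) (simp_all add: L_def algebra_simps)
  have L: "L (emb x) = emb (\<phi> x)" for x
  proof -
    have "2 *\<^sub>R emb (\<phi> x) = emb (\<phi> (sc 2 * x))" by (simp add: scale emb_scale)
    also have "sc 2 * x = sc (Y1 x) * 1 + sc (Y2 x) * qi + sc (Y3 x) * qj + sc (Y4 x) * qk"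
      by (simp only: double_expand mult_1_right)
    also have "emb (\<phi> \<dots>) = 2 *\<^sub>R L (emb x)"
      by (simp only: add scale emb_add emb_scale) (simp add: L_def emb_coords scaleR_right_distrib)
    finally show ?thesis by simp
  qed
  have "zreal (nr (\<phi> 1)) = (norm (emb (\<phi> 1)))\<^sup>2" by (simp add: norm_emb)
  then have "zreal l \<ge> 0" using nr[of 1] by simp
  moreover have "zreal l \<noteq> 0" using l by simp
  ultimately have lpos: "zreal l > 0" by (metis order_le_less)
  have inn: "inner (emb (\<phi> x)) (emb (\<phi> y)) = zreal l * (zreal (trc (cnj x * y)) / 2)" for x y
    unfolding inner_emb trc_similarity[OF assms] by simp
  have t: "trc (- qi) = 0" "trc (- qj) = 0" "trc (- qk) = 0" "trc qi = 0" "trc qj = 0" "trc qk = 0" "trc (- 1) = - 2"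
    by (simp_all add: q_defs trc_def zt_eq_iff)
  have nL: "(norm (L v))\<^sup>2 = zreal l * (norm v)\<^sup>2" for v
    unfolding power2_norm_eq_inner L_def inner_add_left inner_add_right inner_scaleR_left inner_scaleR_right inn
    by (simp add: t inner_vec_def sum_4) (simp add: algebra_simps)
  define \<alpha> where "\<alpha> = sqrt (zreal l)"
  have \<alpha>: "\<alpha> > 0" "\<alpha>\<^sup>2 = zreal l" using lpos by (simp_all add: \<alpha>_def)
  define R where "R v = (1 / \<alpha>) *\<^sub>R L v" for v
  have "norm (R v) = norm v" for v
  proof -
    have "(norm (L v))\<^sup>2 = (\<alpha> * norm v)\<^sup>2" by (simp only: nL power_mult_distrib \<alpha>(2))
    then have "norm (L v) = \<alpha> * norm v" using \<alpha>(1) by (subst (asm) power2_eq_iff_nonneg) simp_all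
    then show ?thesis using \<alpha>(1) by (simp add: R_def)
  qed
  moreover have "linear R" unfolding R_def by (rule linear_compose_scale_right[OF lin])
  ultimately have "orthogonal_transformation R" by (simp add: orthogonal_transformation)
  moreover have "emb ` range \<phi> = (\<lambda>x. \<alpha> *\<^sub>R R x) ` range emb"
    using \<alpha>(1) by (simp add: R_def image_image L)
  ultimately show ?thesis using \<alpha>(1) by (intro exI[of _ \<alpha>] exI[of _ R]) simp
qed

lemma orthogonal_imp_similarity:
  assumes "\<alpha> \<noteq> 0" "orthogonal_transformation R" "(\<lambda>x. \<alpha> *\<^sub>R R x) ` range emb \<subseteq> range emb"
  shows "\<exists>\<phi> l. similarity \<phi> l \<and> (\<lambda>x. \<alpha> *\<^sub>R R x) ` range emb = emb ` range \<phi>"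
proof -
  have "\<forall>x. \<exists>y. emb y = \<alpha> *\<^sub>R R (emb x)" using assms(3) by (metis (mono_tags, lifting) image_subset_iff rangeE rangeI)
  then obtain \<phi> where \<phi>: "\<And>x. emb (\<phi> x) = \<alpha> *\<^sub>R R (emb x)" by metis
  have lin: "linear R" and n: "\<And>v. norm (R v) = norm v" using assms(2) by (auto simp: orthogonal_transformation)
  have nz: "zreal (nr (\<phi> x)) = \<alpha>\<^sup>2 * zreal (nr x)" for x
    by (simp add: norm_emb[symmetric] \<phi> n power_mult_distrib)
  have "similarity \<phi> (nr (\<phi> 1))"
  proof
    fix x y :: ico and a :: zt
    have "emb (\<phi> (x + y)) = emb (\<phi> x + \<phi> y)"
      by (simp add: \<phi> emb_add linear_add[OF lin] scaleR_right_distrib)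
    then show "\<phi> (x + y) = \<phi> x + \<phi> y" by (rule injD[OF inj_emb])
    have "emb (\<phi> (sc a * x)) = emb (sc a * \<phi> x)" by (simp add: \<phi> emb_scale linear_scale[OF lin])
    then show "\<phi> (sc a * x) = sc a * \<phi> x" by (rule injD[OF inj_emb])
    have "zreal (nr (\<phi> x)) = zreal (nr (\<phi> 1) * nr x)" using nz[of 1] nz[of x] by simp
    then show "nr (\<phi> x) = nr (\<phi> 1) * nr x" by (simp only: zreal_inj)
    have "zreal (nr (\<phi> 1)) \<noteq> 0" using nz[of 1] assms(1) by simp
    then show "nr (\<phi> 1) \<noteq> 0" by auto
  qed
  moreover have "(\<lambda>x. \<alpha> *\<^sub>R R x) ` range emb = emb ` range \<phi>" by (simp add: image_image \<phi>)
  ultimately show ?thesis by blast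
qed

lemma similarity_submodule_iff:
  "similarity_submodule M \<longleftrightarrow> (\<exists>\<phi> l. similarity \<phi> l \<and> M = emb ` range \<phi>)"
proof
  assume "similarity_submodule M"
  then obtain \<alpha> R where "\<alpha> \<noteq> 0" "orthogonal_transformation R" "M = (\<lambda>x. \<alpha> *\<^sub>R R x) ` range emb" "M \<subseteq> range emb"
    unfolding similarity_submodule_def range_emb by blast
  then show "\<exists>\<phi> l. similarity \<phi> l \<and> M = emb ` range \<phi>" using orthogonal_imp_similarity[of \<alpha> R] by simp
next
  assume "\<exists>\<phi> l. similarity \<phi> l \<and> M = emb ` range \<phi>"
  then obtain \<phi> l where \<phi>: "similarity \<phi> l" "M = emb ` range \<phi>" by blast
  have "M \<subseteq> range emb" unfolding \<phi>(2) by blast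
  then show "similarity_submodule M"
    using similarity_imp_orthogonal[OF \<phi>(1)] unfolding similarity_submodule_def range_emb \<phi>(2) by blast
qed

lemma simsub_similarity:
  assumes "c \<noteq> 0" "a \<noteq> 0" "b \<noteq> 0"
  shows "similarity (\<lambda>y. sc c * (a * y * b)) (c * c * (nr a * nr b))"
proof
  show "sc c * (a * (sc d * x) * b) = sc d * (sc c * (a * x * b))" for d x
    by (simp only: mult.assoc sc_left_comm[of a] sc_left_comm[of "sc c" d])
  show "nr (sc c * (a * x * b)) = c * c * (nr a * nr b) * nr x" for x
    by (simp add: nr_mult)
qed (use assms in \<open>simp_all add: distrib_left distrib_right\<close>)

text \<open>Tower through the right ideal of \<open>sc c * a\<close>. The remaining step is the
  index of a left ideal, which \<open>cnj\<close> turns into the right ideal of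
  \<open>cnj b\<close>.\<close>

lemma group_index_simsub:
  assumes "c \<noteq> 0" "a \<noteq> 0" "b \<noteq> 0"
  shows "group_index UNIV (simsub c a b) = ((znm c)\<^sup>2 * (znm (nr a) * znm (nr b)))\<^sup>2"
proof -
  define L where "L = range (\<lambda>y. y * b)"
  define d where "d = sc c * a"
  have d: "d \<noteq> 0" using assms by (simp add: d_def)
  have "0 \<in> L" unfolding L_def by (rule range_eqI[of _ _ 0]) simp
  moreover have "x - y \<in> L" if xy: "x \<in> L" "y \<in> L" for x y
  proof -
    obtain u v where "x = u * b" "y = v * b" using xy by (auto simp: L_def)
    then have "x - y = (u - v) * b" by (simp add: left_diff_distrib)
    then show ?thesis unfolding L_def by (rule range_eqI)
  qed
  ultimately have L: "subgrp L" by (simp add: subgrp_def)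
  have injc: "inj cnj" by (simp add: inj_def)
  have "cnj ` UNIV = UNIV" by (rule surjI[of cnj cnj]) simp
  moreover have "cnj ` L = rid (cnj b)"
  proof (intro equalityI subsetI)
    fix z assume "z \<in> rid (cnj b)"
    then obtain y where "z = cnj b * y" by blast
    then have "z = cnj (cnj y * b)" by simp
    moreover have "cnj y * b \<in> L" unfolding L_def by (rule rangeI)
    ultimately show "z \<in> cnj ` L" by (rule image_eqI)
  qed (auto simp: L_def)
  ultimately have "group_index UNIV L = idx (cnj b)"
    using group_index_inj_hom[of cnj UNIV L] injc L by (simp add: idx_def)
  moreover have "group_index ((*) d ` UNIV) ((*) d ` L) = group_index UNIV L"
    using d L by (intro group_index_inj_hom) (simp_all add: right_diff_distrib inj_mult_left)
  moreover have "(*) d ` L = simsub c a b"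
    by (simp add: L_def simsub_def d_def image_image mult.assoc)
  ultimately have "group_index (range ((*) d)) (simsub c a b) = idx (cnj b)" by simp
  moreover have sub: "simsub c a b \<subseteq> range ((*) d)" by (auto simp: simsub_def d_def mult.assoc)
  moreover have "subgrp (simsub c a b)"
  proof -
    interpret similarity "\<lambda>y. sc c * (a * y * b)" "c * c * (nr a * nr b)" by (rule simsub_similarity[OF assms])
    show ?thesis unfolding subgrp_def simsub_def
    proof (intro conjI ballI)
      show "0 \<in> range (\<lambda>y. sc c * (a * y * b))" by (rule range_eqI[of _ _ 0]) simp
      fix x y assume "x \<in> range (\<lambda>y. sc c * (a * y * b))" "y \<in> range (\<lambda>y. sc c * (a * y * b))"
      then obtain u v where "x = sc c * (a * u * b)" "y = sc c * (a * v * b)" by blast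
      then have "x - y = sc c * (a * (u - v) * b)" by (simp add: left_diff_distrib right_diff_distrib)
      then show "x - y \<in> range (\<lambda>y. sc c * (a * y * b))" by blast
    qed
  qed
  ultimately have "group_index UNIV (simsub c a b) = idx d * idx (cnj b)"
    using group_index_tower[of UNIV "range ((*) d)" "simsub c a b"] by (simp add: idx_def)
  also have "\<dots> = (znm (nr d))\<^sup>2 * (znm (nr b))\<^sup>2"
    using idx_ico[OF d] idx_ico[of b] assms by (simp add: idx_cnj)
  also have "\<dots> = ((znm c)\<^sup>2 * (znm (nr a) * znm (nr b)))\<^sup>2"
    by (simp add: d_def nr_mult znm_mult power2_eq_square mult.assoc)
  finally show ?thesis .
qed

text \<open>The index of a submodule c a I b is the square of its parameter in
  \<open>simsubs\<close>, which is why the count is organised by \<open>m\<close> and not by the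
  index itself.\<close>

theorem f_icosian_eq:
  assumes "m > 0"
  shows "f_icosian m = card (simsubs m)"
proof -
  have index: "group_index icosian_ring (emb ` X) = group_index UNIV X" if "subgrp X" for X
    using group_index_inj_hom[of emb UNIV X] inj_emb that by (simp add: emb_diff range_emb)
  have "{M. similarity_submodule M \<and> group_index icosian_ring M = m\<^sup>2} = (`) emb ` simsubs m"
  proof (intro equalityI subsetI)
    fix M assume "M \<in> {M. similarity_submodule M \<and> group_index icosian_ring M = m\<^sup>2}"
    then obtain \<phi> l where \<phi>: "similarity \<phi> l" "M = emb ` range \<phi>" "group_index icosian_ring M = m\<^sup>2"
      by (auto simp: similarity_submodule_iff)
    obtain c a b where cab: "prm a" "prm b" "range \<phi> = simsub c a b" using similarity_simsub[OF \<phi>(1)] by blast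
    have ab: "a \<noteq> 0" "b \<noteq> 0" using cab prm_nonzero by blast+
    have "\<phi> 1 \<noteq> 0" using similarity.nr[OF \<phi>(1), of 1] similarity.l[OF \<phi>(1)] by auto
    moreover have "\<phi> 1 \<in> simsub c a b" using cab(3) by blast
    ultimately have c: "c \<noteq> 0" by (auto simp: simsub_def)
    have "subgrp (range \<phi>)"
    proof -
      interpret similarity \<phi> l by (rule \<phi>(1))
      have d: "\<phi> (x - y) = \<phi> x - \<phi> y" for x y using add[of "x - y" y] by simp
      have "\<phi> 0 = 0" using d[of 0 0] by simp
      then show ?thesis unfolding subgrp_def by (auto simp flip: d intro: range_eqI[of _ _ 0])
    qed
    then have "((znm c)\<^sup>2 * (znm (nr a) * znm (nr b)))\<^sup>2 = m\<^sup>2"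
      using index \<phi>(2,3) group_index_simsub[OF c ab] by (simp add: cab(3))
    then have "(znm c)\<^sup>2 * (znm (nr a) * znm (nr b)) = m" by (simp add: power2_eq_iff_nonneg)
    then have "range \<phi> \<in> simsubs m" unfolding simsubs_def using cab by blast
    then show "M \<in> (`) emb ` simsubs m" unfolding \<phi>(2) by blast
  next
    fix M assume "M \<in> (`) emb ` simsubs m"
    then obtain c a b where cab: "M = emb ` simsub c a b" "prm a" "prm b"
      "(znm c)\<^sup>2 * (znm (nr a) * znm (nr b)) = m" by (auto simp: simsubs_def)
    have ab: "a \<noteq> 0" "b \<noteq> 0" using cab prm_nonzero by blast+
    have c: "c \<noteq> 0" using cab(4) assms by auto
    have sim: "similarity (\<lambda>y. sc c * (a * y * b)) (c * c * (nr a * nr b))"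
      by (rule simsub_similarity[OF c ab])
    have M: "M = emb ` range (\<lambda>y. sc c * (a * y * b))" using cab(1) by (simp only: simsub_def)
    have "similarity_submodule M" unfolding similarity_submodule_iff using sim M by blast
    moreover have "subgrp (simsub c a b)"
    proof -
      interpret similarity "\<lambda>y. sc c * (a * y * b)" "c * c * (nr a * nr b)" by (rule sim)
      have d: "sc c * (a * (x - y) * b) = sc c * (a * x * b) - sc c * (a * y * b)" for x y
        by (simp add: left_diff_distrib right_diff_distrib)
      have "0 \<in> simsub c a b" using simsub_mem[of c a 0 b] by simp
      then show ?thesis unfolding subgrp_def simsub_def by (auto simp flip: d)
    qed
    then have "group_index icosian_ring M = m\<^sup>2"
      using index group_index_simsub[OF c ab] cab(1,4) by simp
    ultimately show "M \<in> {M. similarity_submodule M \<and> group_index icosian_ring M = m\<^sup>2}" by simp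
  qed
  moreover have "inj_on ((`) emb) (simsubs m)" using inj_emb by (simp add: inj_on_def inj_image_eq_iff)
  ultimately show ?thesis unfolding f_icosian_def by (simp add: card_image)
qed

subsection \<open>Ideals of the golden field and quadratic residues modulo 5\<close>

text \<open>The quadratic character modulo 5, which belongs to the golden field.\<close>

definition chi5 :: "nat \<Rightarrow> int" where
  "chi5 n = (if n mod 5 = 1 \<or> n mod 5 = 4 then 1 else if n mod 5 = 2 \<or> n mod 5 = 3 then - 1 else 0)"

lemma mod5_cases: "(n::nat) mod 5 = 0 \<or> n mod 5 = 1 \<or> n mod 5 = 2 \<or> n mod 5 = 3 \<or> n mod 5 = 4"
  by presburger

lemma chi5_mult: "chi5 (m * n) = chi5 m * chi5 n"
proof -
  have "m * n mod 5 = (m mod 5) * (n mod 5) mod 5" by (simp add: mod_mult_eq)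
  then show ?thesis
    using mod5_cases[of m] mod5_cases[of n] unfolding chi5_def by (elim disjE) simp_all
qed

definition chi5_sum :: "nat \<Rightarrow> int" where "chi5_sum n = (\<Sum>d | d dvd n. chi5 d)"

lemma dvd_prime_mult_nat:
  assumes "prime (p::nat)"
  shows "{d. d dvd p * n} = {d. d dvd n} \<union> (*) p ` {d. d dvd n}"
proof (intro equalityI subsetI)
  fix d assume d: "d \<in> {d. d dvd p * n}"
  show "d \<in> {d. d dvd n} \<union> (*) p ` {d. d dvd n}"
  proof (cases "p dvd d")
    case True
    then obtain e where e: "d = p * e" by blast
    then have "e dvd n" using d assms by (simp add: prime_gt_0_nat)
    then show ?thesis using e by blast
  next
    case False
    then have "coprime d p" using prime_imp_coprime[OF assms] by (simp add: coprime_commute)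
    then show ?thesis using d by (simp add: coprime_dvd_mult_right_iff)
  qed
qed (auto intro: dvd_mult)

text \<open>Inclusion-exclusion on the divisors of \<open>p * n\<close>; \<open>zids_prime\<close>
  gives the same recursion for the number of ideals.\<close>

lemma chi5_sum_prime:
  assumes p: "prime p" and n: "n > 0"
  shows "chi5_sum (p * n) = (1 + chi5 p) * chi5_sum n - chi5 p * (if p dvd n then chi5_sum (n div p) else 0)"
proof -
  have p0: "p > 0" using p prime_gt_0_nat by blast
  have inj: "inj_on ((*) p) A" for A using p0 by (simp add: inj_on_def)
  have im: "sum chi5 ((*) p ` {d. d dvd k}) = chi5 p * chi5_sum k" for k
    using inj by (simp add: sum.reindex chi5_mult chi5_sum_def sum_distrib_left)
  have fin: "finite {d. d dvd n}" using n by simp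
  have "sum chi5 ({d. d dvd n} \<union> (*) p ` {d. d dvd n}) + sum chi5 ({d. d dvd n} \<inter> (*) p ` {d. d dvd n})
      = sum chi5 {d. d dvd n} + sum chi5 ((*) p ` {d. d dvd n})"
    using fin by (intro sum.union_inter) auto
  moreover have "sum chi5 ({d. d dvd n} \<inter> (*) p ` {d. d dvd n})
      = chi5 p * (if p dvd n then chi5_sum (n div p) else 0)"
  proof (cases "p dvd n")
    case True
    then obtain m where m: "n = p * m" by blast
    have "{d. d dvd n} \<inter> (*) p ` {d. d dvd n} = (*) p ` {d. d dvd m}"
      using p0 by (auto simp: m intro: dvd_mult)
    then show ?thesis using True p0 im[of m] by (simp add: m)
  next
    case False
    then have "{d. d dvd n} \<inter> (*) p ` {d. d dvd n} = {}" by (auto dest: dvd_mult_left)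
    then show ?thesis using False by simp
  qed
  ultimately show ?thesis
    using im[of n] dvd_prime_mult_nat[OF p, of n] by (simp add: chi5_sum_def algebra_simps)
qed

lemma irreducible_of_znm_prime:
  assumes "prime (znm x)"
  shows "irreducible x"
proof (rule irreducibleI)
  show "x \<noteq> 0" using assms by auto
  show "\<not> is_unit x" using assms by (auto simp flip: znm_eq_1_iff)
  fix a b assume "x = a * b"
  then have "znm a * znm b = znm x" by (simp add: znm_mult)
  then have "prime (znm a * znm b)" using assms by simp
  then have "znm a = 1 \<or> znm b = 1" by (rule prime_product)
  then show "is_unit a \<or> is_unit b" using znm_eq_1_iff by blast
qed

lemma zids_divisible:
  assumes "x \<noteq> 0" "n > 0"
  shows "card {X \<in> zids (znm x * n). X \<subseteq> zid x} = card (zids n)"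
proof -
  have "znm x > 0" using assms(1) by (simp add: zero_less_iff_neq_zero)
  moreover have "zid x \<in> zids (znm x)" by (simp add: zid_mem_zids)
  ultimately show ?thesis using card_zids_subset[of "znm x * n" "zid x" "znm x"] assms(2) by simp
qed

lemma zids_not_divisible: "x \<noteq> 0 \<Longrightarrow> \<not> znm x dvd m \<Longrightarrow> {X \<in> zids m. X \<subseteq> zid x} = {}"
  by (auto simp: zids_def zid_subset_iff dest: znm_dvd)

lemma zcnj_of_nat [simp]: "zcnj (of_nat n) = of_nat n"
  by (simp add: zt_eq_iff)

lemma mod5_cases_int: "(x::int) mod 5 = 0 \<or> x mod 5 = 1 \<or> x mod 5 = 2 \<or> x mod 5 = 3 \<or> x mod 5 = 4"
proof -
  have "0 \<le> x mod 5" "x mod 5 < 5" by simp_all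
  then show ?thesis by arith
qed

lemma square_mod_5: "(x::int)\<^sup>2 mod 5 = 0 \<or> x\<^sup>2 mod 5 = 1 \<or> x\<^sup>2 mod 5 = 4"
proof -
  have "x\<^sup>2 mod 5 = (x mod 5)\<^sup>2 mod 5" by (simp add: power_mod)
  then show ?thesis using mod5_cases_int[of x] by (elim disjE) simp_all
qed

text \<open>Four times a norm is a square modulo 5, and both 4 and the nonzero squares are 1 or -1
  there.\<close>

lemma znm_mod_5: "znm x mod 5 \<noteq> 2 \<and> znm x mod 5 \<noteq> 3"
proof -
  have gen: "(a - 5 * b) mod 5 = a mod 5" for a b :: int by presburger
  have "4 * znorm x = (2 * zfst x + zsnd x)\<^sup>2 - 5 * (zsnd x)\<^sup>2"
    by (simp add: znorm_def power2_eq_square algebra_simps)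
  then have "(4 * znorm x) mod 5 = (2 * zfst x + zsnd x)\<^sup>2 mod 5" by (simp only: gen)
  then have "(4 * znorm x) mod 5 = 0 \<or> (4 * znorm x) mod 5 = 1 \<or> (4 * znorm x) mod 5 = 4"
    using square_mod_5[of "2 * zfst x + zsnd x"] by simp
  moreover have "int (znm x) = znorm x \<or> int (znm x) = - znorm x" by (simp add: znm_def abs_if)
  moreover have "n mod 5 \<noteq> 2 \<and> n mod 5 \<noteq> 3"
    if z: "(4 * z) mod 5 = 0 \<or> (4 * z) mod 5 = 1 \<or> (4 * z) mod 5 = 4" and n: "int n = z \<or> int n = - z" for n z
  proof -
    have m: "4 * z mod 5 = 4 * (z mod 5) mod 5" "(- z) mod 5 = - (z mod 5) mod 5"
      by (simp_all only: mod_mult_right_eq mod_minus_eq)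
    have 1: "z mod 5 = 0 \<or> z mod 5 = 1 \<or> z mod 5 = 4"
      using z mod5_cases_int[of z] unfolding m by (elim disjE) simp_all
    then have 2: "(- z) mod 5 = 0 \<or> (- z) mod 5 = 1 \<or> (- z) mod 5 = 4"
      unfolding m by (elim disjE) simp_all
    from n have "int n mod 5 = 0 \<or> int n mod 5 = 1 \<or> int n mod 5 = 4"
    proof
      assume "int n = z"
      then show ?thesis using 1 by (simp only:)
    next
      assume "int n = - z"
      then show ?thesis using 2 by (simp only:)
    qed
    moreover have "int n mod 5 = int (n mod 5)" by (simp add: zmod_int)
    ultimately show ?thesis by auto
  qed
  ultimately show ?thesis by iprover
qed

lemma chi5_5:
  assumes "prime p" "chi5 p = 0"
  shows "p = 5"
proof -
  have "p mod 5 = 0" using assms(2) mod5_cases[of p] by (elim disjE) (simp_all add: chi5_def)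
  then have "5 dvd p" by (simp add: dvd_eq_mod_eq_0)
  moreover have "prime (5::nat)" by simp
  ultimately show ?thesis using primes_dvd_imp_eq[of 5 p] assms(1) by simp
qed

text \<open>No element has norm \<open>p\<close> by \<open>znm_mod_5\<close>, so \<open>p\<close>
  stays irreducible in \<open>zt\<close>. An element whose norm is divisible by \<open>p\<close> is
  then divisible by \<open>p\<close>.\<close>

lemma zids_inert:
  assumes p: "prime p" "chi5 p = - 1" and n: "n > 0"
  shows "card (zids (p * n)) = (if p dvd n then card (zids (n div p)) else 0)"
proof -
  have pm: "p mod 5 = 2 \<or> p mod 5 = 3" using p(2) by (auto simp: chi5_def split: if_splits)
  have p0: "p > 0" using p prime_gt_0_nat by blast
  have znp: "znm (of_nat p) = p * p" by (simp add: power2_eq_square)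
  have irr: "irreducible (of_nat p :: zt)"
  proof (rule irreducibleI)
    show "(of_nat p :: zt) \<noteq> 0" using p0 by simp
    show "\<not> is_unit (of_nat p :: zt)"
      using znp prime_gt_1_nat[OF p(1)] by (auto simp flip: znm_eq_1_iff)
    fix a b :: zt assume "of_nat p = a * b"
    then have ab: "znm a * znm b = p * p" using znp by (simp flip: znm_mult)
    then have "znm a dvd p ^ 2" by (metis dvd_triv_left power2_eq_square)
    then obtain i where "i \<le> 2" "znm a = p ^ i" using divides_primepow_nat[OF p(1)] by blast
    then consider "znm a = 1" | "znm a = p" | "znm a = p * p" by (cases i) (auto simp: power2_eq_square le_Suc_eq numeral_2_eq_2)
    then show "is_unit a \<or> is_unit b"
    proof cases
      case 2
      then show ?thesis using znm_mod_5[of a] pm by auto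
    next
      case 3
      then have "znm b = 1" using ab p0 by simp
      then show ?thesis using znm_eq_1_iff by blast
    qed (use znm_eq_1_iff in blast)
  qed
  have sub: "X \<subseteq> zid (of_nat p)" if xm: "X \<in> zids (p * n)" for X
  proof -
    obtain d where d: "X = zid d" "znm d = p * n" using xm by (auto simp: zids_def)
    have "d * zcnj d = of_nat (p * n) \<or> d * - zcnj d = of_nat (p * n)" using znm_mult_self[of d] d by auto
    moreover have "of_nat p dvd (of_nat (p * n) :: zt)" by simp
    ultimately have "of_nat p dvd d * zcnj d \<or> of_nat p dvd d * - zcnj d" by metis
    then have "of_nat p dvd d \<or> of_nat p dvd zcnj d" using irreducible_prime_dvd[OF irr] by auto
    then have "of_nat p dvd d"
    proof
      assume "of_nat p dvd zcnj d"
      then obtain k where "zcnj d = of_nat p * k" by blast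
      then have "zcnj (zcnj d) = of_nat p * zcnj k" by simp
      then have "d = of_nat p * zcnj k" by simp
      then show ?thesis by (rule dvdI)
    qed
    then show ?thesis by (simp add: d zid_subset_iff)
  qed
  then have eq: "{X \<in> zids (p * n). X \<subseteq> zid (of_nat p)} = zids (p * n)" by blast
  show ?thesis
  proof (cases "p dvd n")
    case True
    then obtain m where m: "n = p * m" by blast
    then have "m > 0" using n by auto
    then show ?thesis
      using zids_divisible[of "of_nat p" m] eq p0 by (simp add: m znp mult.assoc[symmetric] del: znm_simps)
  next
    case False
    then have "\<not> p * p dvd p * n" using p0 by simp
    then have "zids (p * n) = {}" using zids_not_divisible[of "of_nat p" "p * n"] eq p0 znp by simp
    then show ?thesis using False by simp
  qed
qed

text \<open>All ideals whose norm is divisible by 5 lie below the single ideal generated by the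
  square root of 5.\<close>

lemma zids_ramified:
  assumes n: "n > 0"
  shows "card (zids (5 * n)) = card (zids n)"
proof -
  \<comment> \<open>The square root of 5; it is minus its own conjugate.\<close>
  define x where "x = 2 * tau - 1"
  have zx: "znm x = 5" "x \<noteq> 0" "zcnj x = - x" by (simp_all add: x_def znm_def znorm_def zt_eq_iff)
  have irr: "irreducible x" by (rule irreducible_of_znm_prime) (simp add: zx)
  have "X \<subseteq> zid x" if xm: "X \<in> zids (5 * n)" for X
  proof -
    obtain d where d: "X = zid d" "znm d = 5 * n" using xm by (auto simp: zids_def)
    have "d * zcnj d = of_nat (5 * n) \<or> d * - zcnj d = of_nat (5 * n)" using znm_mult_self[of d] d by auto
    moreover have "(of_nat (5 * n) :: zt) = x * (x * of_nat n)" by (simp add: x_def zt_eq_iff)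
    then have "x dvd (of_nat (5 * n) :: zt)" by (rule dvdI)
    ultimately have "x dvd d * zcnj d \<or> x dvd d * - zcnj d" by metis
    then have "x dvd d \<or> x dvd zcnj d" using irreducible_prime_dvd[OF irr] by auto
    then have "x dvd d"
    proof
      assume "x dvd zcnj d"
      then obtain k where "zcnj d = x * k" by blast
      then have "zcnj (zcnj d) = - x * zcnj k" using zx(3) by simp
      then have "d = x * - zcnj k" by simp
      then show ?thesis by (rule dvdI)
    qed
    then show ?thesis by (simp add: d zid_subset_iff)
  qed
  then have "{X \<in> zids (5 * n). X \<subseteq> zid x} = zids (5 * n)" by blast
  then show ?thesis using zids_divisible[OF zx(2) n] zx(1) by simp
qed

text \<open>Quadratic reciprocity makes 5 a square y^2 modulo \<open>p\<close>, and (1 + y)/2 is a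
  root of the minimal polynomial of \<open>tau\<close>.\<close>

lemma chi5_split_root:
  assumes p: "prime p" "chi5 p = 1"
  shows "\<exists>a::int. int p dvd a * a - a - 1"
proof -
  have pm: "p mod 5 = 1 \<or> p mod 5 = 4" using p(2) by (auto simp: chi5_def split: if_splits)
  have p2: "p > 2" using p(1) prime_gt_1_nat[of p] pm by (cases "p = 2") auto
  have p5: "p \<noteq> 5" using pm by auto
  have odd: "odd p" using p(1) p2 prime_odd_nat by blast
  have pr: "prime (int p)" using p(1) by simp
  have "Legendre (int p) 5 * Legendre 5 (int p) = (- 1 :: int) ^ ((p - 1) div 2 * ((5 - 1) div 2))"
    using Quadratic_Reciprocity[of p 5] p p2 p5 by simp
  also have "(- 1 :: int) ^ ((p - 1) div 2 * ((5 - 1) div 2)) = 1" by (simp add: power_mult mult.commute)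
  finally have L: "Legendre (int p) 5 * Legendre 5 (int p) = 1" .
  have "QuadRes 5 (int p)"
  proof -
    have "[1\<^sup>2 = int p] (mod 5) \<or> [2\<^sup>2 = int p] (mod 5)"
      using pm unfolding cong_def by (auto simp: zmod_int[of p 5, simplified, symmetric])
    then show ?thesis unfolding QuadRes_def by blast
  qed
  moreover have "\<not> [int p = 0] (mod 5)" using pm unfolding cong_def by presburger
  ultimately have "Legendre (int p) 5 = 1" by (simp add: Legendre_def)
  then have "Legendre 5 (int p) = 1" using L by simp
  then have "QuadRes (int p) 5" by (auto simp: Legendre_def split: if_splits)
  then obtain y where y: "int p dvd y\<^sup>2 - 5" by (auto simp: QuadRes_def cong_iff_dvd_diff)
  obtain k where k: "int p = 2 * k + 1" using odd by (metis even_of_nat oddE)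
  \<comment> \<open>\<open>k + 1\<close> is the inverse of 2 modulo \<open>p\<close>.\<close>
  define a where "a = (k + 1) * (1 + y)"
  have "4 * (a * a - a - 1) = (2 * a - 1)\<^sup>2 - 5" by (simp add: power2_eq_square algebra_simps)
  also have "2 * a - 1 = y + int p * (1 + y)" by (simp add: a_def k algebra_simps)
  also have "(y + int p * (1 + y))\<^sup>2 - 5 = (y\<^sup>2 - 5) + int p * (2 * y * (1 + y) + int p * (1 + y)\<^sup>2)"
    by (simp add: power2_eq_square algebra_simps)
  finally have e: "4 * (a * a - a - 1) = (y\<^sup>2 - 5) + int p * (2 * y * (1 + y) + int p * (1 + y)\<^sup>2)" .
  have "int p dvd 4 * (a * a - a - 1)" unfolding e using y by (intro dvd_add dvd_triv_left)
  moreover have "coprime (int p) 4"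
  proof -
    have "coprime (int p) (2 ^ 2)" using odd by (subst coprime_power_right_iff) (simp add: coprime_right_2_iff_odd)
    then show ?thesis by simp
  qed
  ultimately have "int p dvd a * a - a - 1" using coprime_dvd_mult_right_iff by blast
  then show ?thesis by blast
qed

text \<open>The common divisor \<open>x\<close> of \<open>p\<close> and \<open>a - tau\<close> has
  norm \<open>p\<close>. Every ideal whose norm is divisible by \<open>p\<close> lies below that of
  \<open>x\<close> or of its conjugate \<open>y\<close>, and inclusion-exclusion over the two gives
  the recursion.\<close>

lemma zids_split:
  assumes p: "prime p" "chi5 p = 1" and n: "n > 0"
  shows "card (zids (p * n)) + (if p dvd n then card (zids (n div p)) else 0) = 2 * card (zids n)"
proof -
  have p0: "p > 0" using p prime_gt_0_nat by blast
  obtain a :: int where a: "int p dvd a * a - a - 1" using chi5_split_root[OF p] by blast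
  define w where "w = of_int a - tau"
  have nw: "znorm w = a * a - a - 1" by (simp add: w_def znorm_def algebra_simps)
  obtain x s t where x: "x = s * of_nat p + t * w" "x dvd of_nat p" "x dvd w" using zt_bezout by blast
  have p0': "(of_nat p :: zt) \<noteq> 0" using p0 by simp
  have x0: "x \<noteq> 0" using x(2) p0' by auto
  have np: "\<not> of_nat p dvd w"
  proof
    assume "of_nat p dvd w"
    then have "int p dvd zsnd w" by (simp add: zt_of_nat_dvd_iff)
    then have "int p dvd 1" by (simp add: w_def)
    then show False using p(1) prime_gt_1_nat[of p] by simp
  qed
  have pz: "of_nat p dvd x * zcnj x"
  proof -
    obtain k where k: "a * a - a - 1 = int p * k" using a by blast
    have "w * zcnj w = of_int (int p * k)" by (simp only: mult_zcnj nw k)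
    then have w: "w * zcnj w = of_nat p * of_int k" by simp
    have "x * zcnj x = of_nat p * (s * zcnj s * of_nat p + s * zcnj t * zcnj w + t * w * zcnj s + t * zcnj t * of_int k)"
      unfolding x(1) using w by (simp add: algebra_simps)
    then show ?thesis by (rule dvdI)
  qed
  have zx: "znm x = p"
  proof -
    have "znm x dvd p ^ 2" using znm_dvd[OF x(2)] by simp
    then obtain i where i: "i \<le> 2" "znm x = p ^ i" using divides_primepow_nat[OF p(1)] by blast
    moreover have "i \<noteq> 0"
    proof
      assume "i = 0"
      then have "is_unit x" using i(2) znm_eq_1_iff by simp
      then have "is_unit (x * zcnj x)" using znm_eq_1_iff[of x] znm_eq_1_iff[of "x * zcnj x"] by (simp add: znm_mult)
      then have "is_unit (of_nat p :: zt)" using pz dvd_trans by blast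
      then have "p\<^sup>2 = 1" using znm_eq_1_iff[of "of_nat p"] by simp
      then show False using p(1) by simp
    qed
    moreover have "i \<noteq> 2"
    proof
      assume "i = 2"
      then have "asc x (of_nat p)" using dvd_znm_asc[OF x(2)] i(2) p0' by simp
      then have "of_nat p dvd w" using x(3) unfolding asc_def using dvd_trans by blast
      then show False using np by simp
    qed
    ultimately have "i = 1" by linarith
    then show ?thesis using i(2) by simp
  qed
  have irr: "irreducible x" by (rule irreducible_of_znm_prime) (simp add: zx p)
  define y where "y = zcnj x"
  have "znm y = p" using zx by (simp add: y_def)
  moreover from this have "y \<noteq> 0" using p0 by auto
  ultimately have zy: "znm y = p" "y \<noteq> 0" by simp_all
  have irr': "irreducible y" by (rule irreducible_of_znm_prime) (simp add: zy p)
  \<comment> \<open>Otherwise \<open>y\<close> would divide \<open>a - tau\<close> and its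
    conjugate, hence their difference, a square root of 5.\<close>
  have nxy: "\<not> y dvd x"
  proof
    assume "y dvd x"
    have "y dvd zcnj w" using x(3) by (auto simp: y_def elim!: dvdE)
    moreover have "y dvd w" using \<open>y dvd x\<close> x(3) by (rule dvd_trans)
    ultimately have "y dvd zcnj w - w" by simp
    also have "zcnj w - w = 2 * tau - 1" by (simp add: w_def zt_eq_iff)
    finally have "znm y dvd znm (2 * tau - 1)" by (rule znm_dvd)
    moreover have "znm (2 * tau - 1) = 5" by (simp add: znm_def znorm_def)
    ultimately have "p dvd 5" using zy by simp
    then have "p = 5" using p(1) primes_dvd_imp_eq[of p 5] by simp
    then show False using p(2) by (simp add: chi5_def)
  qed
  have sub: "X \<subseteq> zid x \<or> X \<subseteq> zid y" if xm: "X \<in> zids (p * n)" for X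
  proof -
    obtain d where d: "X = zid d" "znm d = p * n" using xm by (auto simp: zids_def)
    have "d * zcnj d = of_nat (p * n) \<or> d * - zcnj d = of_nat (p * n)" using znm_mult_self[of d] d by auto
    moreover have "x dvd (of_nat (p * n) :: zt)" using x(2) by simp
    ultimately have "x dvd d * zcnj d \<or> x dvd d * - zcnj d" by metis
    then have "x dvd d \<or> x dvd zcnj d" using irreducible_prime_dvd[OF irr] by auto
    then have "x dvd d \<or> y dvd d"
    proof
      assume "x dvd zcnj d"
      then obtain k where "zcnj d = x * k" by blast
      then have "zcnj (zcnj d) = y * zcnj k" by (simp add: y_def)
      then have "d = y * zcnj k" by simp
      then show ?thesis by (metis dvdI)
    qed simp
    then show ?thesis by (simp add: d zid_subset_iff)
  qed
  let ?A = "{X \<in> zids (p * n). X \<subseteq> zid x}" and ?B = "{X \<in> zids (p * n). X \<subseteq> zid y}"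
  have AB: "?A \<union> ?B = zids (p * n)" using sub by blast
  have fin: "finite (zids (p * n))" using n p0 by (intro finite_zids) simp
  have "?A \<inter> ?B = {X \<in> zids (p * n). X \<subseteq> zid (x * y)}"
  proof -
    have xy: "x dvd d \<and> y dvd d \<longleftrightarrow> x * y dvd d" for d
    proof
      assume d: "x dvd d \<and> y dvd d"
      then obtain k where k: "d = x * k" by blast
      then have "y dvd k" using d irreducible_prime_dvd[OF irr'] nxy by blast
      then show "x * y dvd d" by (simp add: k)
    qed (meson dvd_mult_left dvd_mult_right)
    have "X \<subseteq> zid x \<and> X \<subseteq> zid y \<longleftrightarrow> X \<subseteq> zid (x * y)" if xm: "X \<in> zids (p * n)" for X
    proof -
      obtain d where d: "X = zid d" using xm by (auto simp: zids_def)
      show ?thesis unfolding d zid_subset_iff by (rule xy)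
    qed
    then show ?thesis by blast
  qed
  moreover have "card {X \<in> zids (p * n). X \<subseteq> zid (x * y)} = (if p dvd n then card (zids (n div p)) else 0)"
  proof (cases "p dvd n")
    case True
    then obtain m where m: "n = p * m" by blast
    then have "m > 0" using n by auto
    then show ?thesis
      using zids_divisible[of "x * y" m] x0 zy p0 by (simp add: m znm_mult zx mult.assoc)
  next
    case False
    then have "\<not> znm (x * y) dvd p * n" using p0 by (simp add: znm_mult zx zy)
    then have "{X \<in> zids (p * n). X \<subseteq> zid (x * y)} = {}" using x0 zy by (intro zids_not_divisible) auto
    then show ?thesis using False by (simp only: card.empty if_False)
  qed
  moreover have "card ?A = card (zids n)" using zids_divisible[OF x0 n] by (simp add: zx)
  moreover have "card ?B = card (zids n)" using zids_divisible[OF zy(2) n] by (simp add: zy)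
  moreover have "card ?A + card ?B = card (?A \<union> ?B) + card (?A \<inter> ?B)"
    using fin by (intro card_Un_Int) auto
  ultimately show ?thesis using AB by simp
qed

lemma zids_prime:
  assumes p: "prime p" and n: "n > 0"
  shows "int (card (zids (p * n))) = (1 + chi5 p) * int (card (zids n))
    - chi5 p * (if p dvd n then int (card (zids (n div p))) else 0)"
proof -
  have "chi5 p = 1 \<or> chi5 p = - 1 \<or> chi5 p = 0" by (simp add: chi5_def)
  then consider "chi5 p = 1" | "chi5 p = - 1" | "chi5 p = 0" by blast
  then show ?thesis
  proof cases
    case 1
    then show ?thesis using zids_split[OF p 1 n] by (simp split: if_splits)
  next
    case 2
    then show ?thesis using zids_inert[OF p 2 n] by simp
  next
    case 3
    then show ?thesis using chi5_5[OF p] zids_ramified[OF n] by simp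
  qed
qed

theorem card_zids: "n > 0 \<Longrightarrow> int (card (zids n)) = chi5_sum n"
proof (induction n rule: less_induct)
  case (less n)
  show ?case
  proof (cases "n = 1")
    case True
    have "zids 1 = {zid 1}"
    proof (intro equalityI subsetI)
      fix X assume "X \<in> zids 1"
      then obtain d where "X = zid d" "is_unit d" using znm_eq_1_iff by (auto simp: zids_def)
      then show "X \<in> {zid 1}" by (simp only: zid_eq_iff asc_def singleton_iff) simp
    next
      fix X assume "X \<in> {zid 1}"
      then show "X \<in> zids 1" by (simp only: singleton_iff zid_mem_zids znm_simps)
    qed
    moreover have "chi5_sum 1 = 1" by (simp add: chi5_sum_def chi5_def)
    ultimately show ?thesis using True by simp
  next
    case False
    then obtain p where p: "prime p" "p dvd n" using prime_factor_nat by blast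
    then obtain m where m: "n = p * m" by blast
    have m0: "m > 0" using less.prems m by (cases m) auto
    have p1: "p > 1" using p prime_gt_1_nat by blast
    have mn: "m < n" using m m0 p1 by simp
    have 1: "int (card (zids m)) = chi5_sum m" using less.IH[OF mn m0] .
    have 2: "int (card (zids (m div p))) = chi5_sum (m div p)" if "p dvd m"
    proof -
      have "m div p < n" using mn by (meson div_le_dividend le_less_trans)
      moreover have "m div p > 0" using that m0 p1 by (simp add: dvd_imp_le div_greater_zero_iff)
      ultimately show ?thesis using less.IH by blast
    qed
    show ?thesis unfolding m zids_prime[OF p(1) m0] chi5_sum_prime[OF p(1) m0] 1 using 2 by simp
  qed
qed

subsection \<open>Special values of Dirichlet series\<close>

text \<open>Differentiates an identity between functions. Four applications lead from the logarithm
  of the reflection formula of \<open>Gamma\<close> to that of \<open>Polygamma 3\<close>.\<close>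

lemma deriv_eq_on_unit_interval:
  fixes f g :: "real \<Rightarrow> real"
  assumes "\<And>x. 0 < x \<Longrightarrow> x < 1 \<Longrightarrow> f x = g x"
    "\<And>x. 0 < x \<Longrightarrow> x < 1 \<Longrightarrow> (f has_real_derivative f' x) (at x)"
    "\<And>x. 0 < x \<Longrightarrow> x < 1 \<Longrightarrow> (g has_real_derivative g' x) (at x)"
    "0 < x" "x < 1"
  shows "f' x = g' x"
proof -
  have "(g has_real_derivative f' x) (at x)"
    by (rule has_field_derivative_transform_within_open[OF assms(2)[OF assms(4,5)], of "{0<..<1}"])
      (use assms(1,4,5) in auto)
  then show ?thesis using assms(3)[OF assms(4,5)] DERIV_unique by blast
qed

lemma sin_pi_pos: "0 < x \<Longrightarrow> x < 1 \<Longrightarrow> sin (pi * x) > 0"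
  by (rule sin_gt_zero) auto

lemma ln_Gamma_reflection_real:
  assumes "0 < (x::real)" "x < 1"
  shows "ln_Gamma x + ln_Gamma (1 - x) = ln pi - ln (sin (pi * x))"
proof -
  have "complex_of_real (Gamma x * Gamma (1 - x)) = complex_of_real (pi / sin (pi * x))"
    using Gamma_reflection_complex[of "complex_of_real x"]
    by (simp add: Gamma_complex_of_real[symmetric] sin_of_real[symmetric])
  then have eq: "Gamma x * Gamma (1 - x) = pi / sin (pi * x)" by (simp only: of_real_eq_iff)
  have g: "Gamma x > 0" "Gamma (1 - x) > 0" using assms by (simp_all add: Gamma_real_pos)
  have "ln_Gamma x + ln_Gamma (1 - x) = ln (Gamma x) + ln (Gamma (1 - x))"
    using assms by (simp add: ln_Gamma_real_pos)
  also have "\<dots> = ln (Gamma x * Gamma (1 - x))"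
    using g by (simp add: ln_mult)
  also have "\<dots> = ln pi - ln (sin (pi * x))"
    unfolding eq using sin_pi_pos[OF assms] by (simp add: ln_div)
  finally show ?thesis .
qed

lemma Polygamma_deriv_real [derivative_intros]:
  assumes "(f has_real_derivative f') (at x)" "f x > 0"
  shows "((\<lambda>x. Polygamma n (f x)) has_real_derivative Polygamma (Suc n) (f x) * f') (at x)"
proof -
  have "f x \<notin> \<int>\<^sub>\<le>\<^sub>0" using assms(2) by (auto elim!: nonpos_Ints_cases)
  then show ?thesis by (rule DERIV_chain2[OF has_field_derivative_Polygamma assms(1)])
qed

lemma Digamma_reflection:
  assumes "0 < (x::real)" "x < 1"
  shows "Digamma x - Digamma (1 - x) = - (pi * cos (pi * x) / sin (pi * x))"
proof -
  have "Digamma x + Digamma (1 - x) * - 1 = 0 - cos (pi * x) * pi / sin (pi * x)"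
  proof (rule deriv_eq_on_unit_interval[where f = "\<lambda>x. ln_Gamma x + ln_Gamma (1 - x)" and
        g = "\<lambda>x. ln pi - ln (sin (pi * x))" and
        f' = "\<lambda>x. Digamma x + Digamma (1 - x) * - 1" and g' = "\<lambda>x. 0 - cos (pi * x) * pi / sin (pi * x)"])
    fix x :: real assume x: "0 < x" "x < 1"
    show "ln_Gamma x + ln_Gamma (1 - x) = ln pi - ln (sin (pi * x))" by (rule ln_Gamma_reflection_real[OF x])
    have "((\<lambda>x. ln_Gamma (1 - x)) has_real_derivative Digamma (1 - x) * - 1) (at x)"
      by (rule DERIV_chain2[OF has_field_derivative_ln_Gamma_real]) (use x in \<open>auto intro!: derivative_eq_intros\<close>)
    then show "((\<lambda>x. ln_Gamma x + ln_Gamma (1 - x)) has_real_derivative Digamma x + Digamma (1 - x) * - 1) (at x)"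
      using has_field_derivative_ln_Gamma_real[OF x(1)] by (rule DERIV_add[rotated])
    show "((\<lambda>x. ln pi - ln (sin (pi * x))) has_real_derivative 0 - cos (pi * x) * pi / sin (pi * x)) (at x)"
      using sin_pi_pos[OF x] by (auto intro!: derivative_eq_intros)
  qed (use assms in auto)
  then show ?thesis by (simp add: mult.commute)
qed

lemma cos_sq: "cos (t::real) * cos t = 1 - sin t * sin t"
  using sin_cos_squared_add[of t] by (simp add: power2_eq_square algebra_simps)

lemma Polygamma1_reflection:
  assumes "0 < (x::real)" "x < 1"
  shows "Polygamma 1 x + Polygamma 1 (1 - x) = pi ^ 2 / sin (pi * x) ^ 2"
proof -
  have "Polygamma (Suc 0) x * 1 - Polygamma (Suc 0) (1 - x) * - 1 = pi ^ 2 / sin (pi * x) ^ 2"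
  proof (rule deriv_eq_on_unit_interval[where f = "\<lambda>x. Digamma x - Digamma (1 - x)" and
        g = "\<lambda>x. - (pi * cos (pi * x) / sin (pi * x))" and
        f' = "\<lambda>x. Polygamma (Suc 0) x * 1 - Polygamma (Suc 0) (1 - x) * - 1" and
        g' = "\<lambda>x. pi ^ 2 / sin (pi * x) ^ 2"])
    fix x :: real assume x: "0 < x" "x < 1"
    show "Digamma x - Digamma (1 - x) = - (pi * cos (pi * x) / sin (pi * x))" by (rule Digamma_reflection[OF x])
    show "((\<lambda>x. Digamma x - Digamma (1 - x)) has_real_derivative
        Polygamma (Suc 0) x * 1 - Polygamma (Suc 0) (1 - x) * - 1) (at x)"
      using x by (auto intro!: derivative_eq_intros)
    show "((\<lambda>x. - (pi * cos (pi * x) / sin (pi * x))) has_real_derivative pi ^ 2 / sin (pi * x) ^ 2) (at x)"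
      using sin_pi_pos[OF x]
      by (auto intro!: derivative_eq_intros simp: power2_eq_square field_simps cos_sq)
  qed (use assms in auto)
  then show ?thesis by simp
qed

lemma Polygamma2_reflection:
  assumes "0 < (x::real)" "x < 1"
  shows "Polygamma 2 x - Polygamma 2 (1 - x) = - (2 * pi ^ 3 * cos (pi * x) / sin (pi * x) ^ 3)"
proof -
  have "Polygamma (Suc 1) x * 1 + Polygamma (Suc 1) (1 - x) * - 1 = - (2 * pi ^ 3 * cos (pi * x) / sin (pi * x) ^ 3)"
  proof (rule deriv_eq_on_unit_interval[where f = "\<lambda>x. Polygamma 1 x + Polygamma 1 (1 - x)" and
        g = "\<lambda>x. pi ^ 2 / sin (pi * x) ^ 2" and
        f' = "\<lambda>x. Polygamma (Suc 1) x * 1 + Polygamma (Suc 1) (1 - x) * - 1" and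
        g' = "\<lambda>x. - (2 * pi ^ 3 * cos (pi * x) / sin (pi * x) ^ 3)"])
    fix x :: real assume x: "0 < x" "x < 1"
    show "Polygamma 1 x + Polygamma 1 (1 - x) = pi ^ 2 / sin (pi * x) ^ 2" by (rule Polygamma1_reflection[OF x])
    show "((\<lambda>x. Polygamma 1 x + Polygamma 1 (1 - x)) has_real_derivative
        Polygamma (Suc 1) x * 1 + Polygamma (Suc 1) (1 - x) * - 1) (at x)"
      using x by (auto intro!: derivative_eq_intros)
    show "((\<lambda>x. pi ^ 2 / sin (pi * x) ^ 2) has_real_derivative - (2 * pi ^ 3 * cos (pi * x) / sin (pi * x) ^ 3)) (at x)"
      using sin_pi_pos[OF x]
      by (auto intro!: derivative_eq_intros simp: power2_eq_square power3_eq_cube field_simps)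
  qed (use assms in auto)
  then show ?thesis by (simp add: numeral_2_eq_2)
qed

lemma Polygamma3_reflection:
  assumes "0 < (x::real)" "x < 1"
  shows "Polygamma 3 x + Polygamma 3 (1 - x) = pi ^ 4 * (6 / sin (pi * x) ^ 4 - 4 / sin (pi * x) ^ 2)"
proof -
  have "Polygamma (Suc 2) x * 1 - Polygamma (Suc 2) (1 - x) * - 1
      = pi ^ 4 * (6 / sin (pi * x) ^ 4 - 4 / sin (pi * x) ^ 2)"
  proof (rule deriv_eq_on_unit_interval[where f = "\<lambda>x. Polygamma 2 x - Polygamma 2 (1 - x)" and
        g = "\<lambda>x. - (2 * pi ^ 3 * cos (pi * x) / sin (pi * x) ^ 3)" and
        f' = "\<lambda>x. Polygamma (Suc 2) x * 1 - Polygamma (Suc 2) (1 - x) * - 1" and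
        g' = "\<lambda>x. pi ^ 4 * (6 / sin (pi * x) ^ 4 - 4 / sin (pi * x) ^ 2)"])
    fix x :: real assume x: "0 < x" "x < 1"
    show "Polygamma 2 x - Polygamma 2 (1 - x) = - (2 * pi ^ 3 * cos (pi * x) / sin (pi * x) ^ 3)"
      by (rule Polygamma2_reflection[OF x])
    show "((\<lambda>x. Polygamma 2 x - Polygamma 2 (1 - x)) has_real_derivative
        Polygamma (Suc 2) x * 1 - Polygamma (Suc 2) (1 - x) * - 1) (at x)"
      using x by (auto intro!: derivative_eq_intros)
    let ?s = "sin (pi * x)" and ?c = "cos (pi * x)"
    have "((\<lambda>x. - (2 * pi ^ 3 * cos (pi * x) / sin (pi * x) ^ 3)) has_real_derivative
        - ((2 * pi ^ 3 * (- ?s * pi)) * ?s ^ 3 - (2 * pi ^ 3 * ?c) * (3 * ?s ^ 2 * (?c * pi))) / (?s ^ 3 * ?s ^ 3)) (at x)"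
      using sin_pi_pos[OF x] by (auto intro!: derivative_eq_intros simp: divide_simps)
    also have "- ((2 * pi ^ 3 * (- ?s * pi)) * ?s ^ 3 - (2 * pi ^ 3 * ?c) * (3 * ?s ^ 2 * (?c * pi))) / (?s ^ 3 * ?s ^ 3)
        = pi ^ 4 * (2 * ?s ^ 4 + 6 * (?c * ?c) * ?s ^ 2) / ?s ^ 6"
      by (simp add: power2_eq_square power3_eq_cube power4_eq_xxxx numeral_eq_Suc algebra_simps)
    also have "\<dots> = pi ^ 4 * (6 / ?s ^ 4 - 4 / ?s ^ 2)"
      unfolding cos_sq using sin_pi_pos[OF x] by (simp add: field_simps numeral_eq_Suc)
    finally show "((\<lambda>x. - (2 * pi ^ 3 * cos (pi * x) / sin (pi * x) ^ 3)) has_real_derivative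
      pi ^ 4 * (6 / sin (pi * x) ^ 4 - 4 / sin (pi * x) ^ 2)) (at x)" .
  qed (use assms in auto)
  then show ?thesis by (simp add: numeral_3_eq_3 numeral_2_eq_2)
qed

text \<open>For even \<open>k\<close> the sign in the series of \<open>Polygamma (k - 1)\<close> is
  positive.\<close>

lemma Polygamma_odd_sums:
  assumes "(x::real) > 0" "k \<ge> 2" "even k"
  shows "(\<lambda>n. 1 / (x + n) ^ k) sums (Polygamma (k - 1) x / fact (k - 1))"
proof -
  have "summable (\<lambda>n. inverse ((x + of_nat n) ^ k))"
    using Polygamma_converges'[of x k] assms by auto
  moreover have "Polygamma (k - 1) x = fact (k - 1) * (\<Sum>n. inverse ((x + of_nat n) ^ k))"
    using assms by (simp add: Polygamma_def)
  ultimately show ?thesis by (simp add: sums_iff inverse_eq_divide)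
qed

text \<open>cos(3 pi/5) = - cos(2 pi/5) is a cubic equation for c = cos(pi/5). Dividing out c + 1
  leaves 4 c^2 - 2 c - 1 = 0, whose positive root is c.\<close>

lemma pi_fifth:
  "sin (pi * (1/5)) ^ 2 = (5 - sqrt 5) / 8" "sin (pi * (2/5)) ^ 2 = (5 + sqrt 5) / 8"
proof -
  define c where "c = cos (pi / 5)"
  have c0: "c > 0" unfolding c_def by (rule cos_gt_zero) auto
  have "cos (3 * (pi / 5)) = - cos (2 * (pi / 5))"
    using cos_pi_minus[of "2 * (pi / 5)"] by (simp add: field_simps)
  then have "4 * c ^ 3 - 3 * c = - (2 * c ^ 2 - 1)"
    unfolding cos_treble_cos cos_double_cos c_def .
  then have "(c + 1) * (4 * c ^ 2 - 2 * c - 1) = 0" by (simp add: algebra_simps power2_eq_square power3_eq_cube)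
  then have q: "4 * c ^ 2 - 2 * c - 1 = 0" using c0 by simp
  then have "(4 * c - 1) ^ 2 = 5" by (simp add: power2_eq_square algebra_simps)
  then have "\<bar>4 * c - 1\<bar> = sqrt 5" by (metis real_sqrt_abs)
  moreover have "4 * c - 1 > 0"
  proof (rule ccontr)
    assume "\<not> 4 * c - 1 > 0"
    then have "c * c \<le> (1/4) * (1/4)" using c0 by (intro mult_mono) auto
    then show False using q c0 by (simp add: power2_eq_square)
  qed
  ultimately have c: "c = (1 + sqrt 5) / 4" by simp
  have c2: "c ^ 2 = (3 + sqrt 5) / 8" unfolding c by (simp add: power2_eq_square field_simps)
  have s: "sin (pi / 5) ^ 2 = 1 - c ^ 2" by (simp add: c_def sin_squared_eq)
  show "sin (pi * (1/5)) ^ 2 = (5 - sqrt 5) / 8"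
    using s unfolding c2 by (simp add: field_simps)
  have "sin (pi * (2/5)) = 2 * sin (pi / 5) * cos (pi / 5)"
    using sin_double[of "pi / 5"] by (simp add: field_simps)
  then have "sin (pi * (2/5)) ^ 2 = 4 * (1 - c ^ 2) * c ^ 2" by (simp add: power_mult_distrib s c_def)
  also have "\<dots> = (5 + sqrt 5) / 8" unfolding c2 by (simp add: field_simps)
  finally show "sin (pi * (2/5)) ^ 2 = (5 + sqrt 5) / 8" .
qed

lemma chi5_block: "chi5 (5 * n) = 0" "chi5 (5 * n + 1) = 1" "chi5 (5 * n + 2) = -1"
  "chi5 (5 * n + 3) = -1" "chi5 (5 * n + 4) = 1"
proof -
  have m: "(5 * n) mod 5 = 0" "(5 * n + 1) mod 5 = 1" "(5 * n + 2) mod 5 = 2" "(5 * n + 3) mod 5 = 3"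
    "(5 * n + 4) mod 5 = 4" by presburger+
  show "chi5 (5 * n) = 0" "chi5 (5 * n + 1) = 1" "chi5 (5 * n + 2) = -1"
    "chi5 (5 * n + 3) = -1" "chi5 (5 * n + 4) = 1"
    unfolding chi5_def m by simp_all
qed

lemma sum_block5: "sum f {n * 5..<n * 5 + 5} = f (5 * n) + f (5 * n + 1) + f (5 * n + 2) + f (5 * n + 3) + f (5 * n + (4::nat))"
  by (simp add: sum.atLeastLessThan_Suc numeral_eq_Suc mult.commute add.commute)

lemma abs_chi5: "\<bar>chi5 n\<bar> \<le> 1" by (simp add: chi5_def)

lemma summable_power: "k \<ge> 2 \<Longrightarrow> summable (\<lambda>n. 1 / real n ^ k)"
  using inverse_power_summable[of k, where ?'a = real] by (simp add: inverse_eq_divide)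

text \<open>Terms are grouped in blocks of five; each residue class j is a series at j/5, which
  \<open>Polygamma_odd_sums\<close> evaluates. The block positions 0 drop out because
  \<open>chi5\<close> vanishes there.\<close>

lemma chi5_L_sums:
  assumes "k \<ge> 2" "even k"
  shows "(\<lambda>n. of_int (chi5 n) / real n ^ k) sums
    ((Polygamma (k - 1) (1/5) - Polygamma (k - 1) (2/5) - Polygamma (k - 1) (3/5) + Polygamma (k - 1) (4/5))
      / (fact (k - 1) * 5 ^ k))"
proof -
  let ?f = "\<lambda>n. of_int (chi5 n) / real n ^ k"
  have "summable ?f"
  proof (rule summable_comparison_test'[OF summable_power[OF assms(1)]])
    fix n
    have "\<bar>real_of_int (chi5 n)\<bar> \<le> 1" using abs_chi5[of n] by linarith
    then show "norm (?f n) \<le> 1 / real n ^ k" by (simp add: divide_right_mono)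
  qed
  then obtain s where s: "?f sums s" by (auto simp: summable_def)
  then have "(\<lambda>n. sum ?f {n * 5..<n * 5 + 5}) sums s" by (rule sums_group) simp
  moreover have "sum ?f {n * 5..<n * 5 + 5}
      = (1 / (1/5 + real n) ^ k - 1 / (2/5 + real n) ^ k - 1 / (3/5 + real n) ^ k + 1 / (4/5 + real n) ^ k) / 5 ^ k" for n
  proof -
    have "1 / real (5 * n + j) ^ k = (1 / (real j / 5 + real n) ^ k) / 5 ^ k" for j
    proof -
      have "real (5 * n + j) = 5 * (real j / 5 + real n)" by simp
      then show ?thesis by (simp only: power_mult_distrib) simp
    qed
    from this[of 1] this[of 2] this[of 3] this[of 4] show ?thesis
      unfolding sum_block5 chi5_block by (simp add: add_divide_distrib diff_divide_distrib)
  qed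
  moreover have "(\<lambda>n. (1 / (1/5 + real n) ^ k - 1 / (2/5 + real n) ^ k - 1 / (3/5 + real n) ^ k + 1 / (4/5 + real n) ^ k) / 5 ^ k)
      sums ((Polygamma (k - 1) (1/5) / fact (k - 1) - Polygamma (k - 1) (2/5) / fact (k - 1)
        - Polygamma (k - 1) (3/5) / fact (k - 1) + Polygamma (k - 1) (4/5) / fact (k - 1)) / 5 ^ k)"
    by (intro sums_divide sums_add sums_diff Polygamma_odd_sums) (use assms in simp_all)
  ultimately have "s = (Polygamma (k - 1) (1/5) / fact (k - 1) - Polygamma (k - 1) (2/5) / fact (k - 1)
        - Polygamma (k - 1) (3/5) / fact (k - 1) + Polygamma (k - 1) (4/5) / fact (k - 1)) / 5 ^ k"
    using sums_unique2 by simp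
  then show ?thesis using s by (simp add: add_divide_distrib diff_divide_distrib)
qed

lemma inv_sines: "1 / sin (pi * (1/5)) ^ 2 = 2 * (5 + sqrt 5) / 5" "1 / sin (pi * (2/5)) ^ 2 = 2 * (5 - sqrt 5) / 5"
proof -
  have "sqrt 5 < 5" by (rule real_less_lsqrt) simp_all
  moreover have "sqrt 5 > 0" by simp
  ultimately have "5 - sqrt 5 \<noteq> 0" "5 + sqrt 5 \<noteq> 0" by linarith+
  then show "1 / sin (pi * (1/5)) ^ 2 = 2 * (5 + sqrt 5) / 5" "1 / sin (pi * (2/5)) ^ 2 = 2 * (5 - sqrt 5) / 5"
    unfolding pi_fifth by (simp_all add: field_simps)
qed

lemma sqrt5_inv: "sqrt 5 = 5 / sqrt 5"
  by (simp add: field_simps)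

text \<open>\<open>chi5\<close> is even, so 1/5 pairs with 4/5 and 2/5 with 3/5 under
  reflection.\<close>

lemma chi5_L2: "(\<lambda>n. of_int (chi5 n) / real n ^ 2) sums (4 * pi ^ 2 / (25 * sqrt 5))"
proof -
  have a: "Polygamma 1 (1/5) + Polygamma 1 (4/5) = pi ^ 2 * (1 / sin (pi * (1/5)) ^ 2)"
    using Polygamma1_reflection[of "1/5"] by simp
  have b: "Polygamma 1 (2/5) + Polygamma 1 (3/5) = pi ^ 2 * (1 / sin (pi * (2/5)) ^ 2)"
    using Polygamma1_reflection[of "2/5"] by simp
  have "Polygamma 1 (1/5) - Polygamma 1 (2/5) - Polygamma 1 (3/5) + Polygamma 1 (4/5)
      = (Polygamma 1 (1/5) + Polygamma 1 (4/5)) - (Polygamma 1 (2/5) + Polygamma 1 (3/5))" by simp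
  also have "\<dots> = pi ^ 2 * (4 * sqrt 5 / 5)" unfolding a b inv_sines by (simp add: field_simps)
  also have "4 * sqrt 5 / 5 = 4 / sqrt 5" by (subst sqrt5_inv) simp
  finally have "(Polygamma 1 (1/5) - Polygamma 1 (2/5) - Polygamma 1 (3/5) + Polygamma 1 (4/5)) / 25
      = 4 * pi ^ 2 / (25 * sqrt 5)" by simp
  then show ?thesis using chi5_L_sums[of 2] by (simp add: mult.commute)
qed

lemma chi5_L4: "(\<lambda>n. of_int (chi5 n) / real n ^ 4) sums (8 * pi ^ 4 / (375 * sqrt 5))"
proof -
  have *: "6 / s ^ 4 - 4 / s ^ 2 = 6 * (1 / s ^ 2) ^ 2 - 4 * (1 / s ^ 2)" for s :: real
    by (simp add: power_divide flip: power_mult)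
  have a: "Polygamma 3 (1/5) + Polygamma 3 (4/5)
      = pi ^ 4 * (6 * (1 / sin (pi * (1/5)) ^ 2) ^ 2 - 4 * (1 / sin (pi * (1/5)) ^ 2))"
    using Polygamma3_reflection[of "1/5"] unfolding * by simp
  have b: "Polygamma 3 (2/5) + Polygamma 3 (3/5)
      = pi ^ 4 * (6 * (1 / sin (pi * (2/5)) ^ 2) ^ 2 - 4 * (1 / sin (pi * (2/5)) ^ 2))"
    using Polygamma3_reflection[of "2/5"] unfolding * by simp
  have "Polygamma 3 (1/5) - Polygamma 3 (2/5) - Polygamma 3 (3/5) + Polygamma 3 (4/5)
      = (Polygamma 3 (1/5) + Polygamma 3 (4/5)) - (Polygamma 3 (2/5) + Polygamma 3 (3/5))" by simp
  also have "\<dots> = pi ^ 4 * (16 * sqrt 5)" unfolding a b inv_sines by (simp add: field_simps power2_eq_square)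
  also have "16 * sqrt 5 = 80 / sqrt 5" by (subst sqrt5_inv) simp
  finally have "(Polygamma 3 (1/5) - Polygamma 3 (2/5) - Polygamma 3 (3/5) + Polygamma 3 (4/5)) / (6 * 625)
      = 8 * pi ^ 4 / (375 * sqrt 5)" by simp
  moreover have "fact 3 = (6::real)" by (simp add: fact_numeral)
  ultimately show ?thesis using chi5_L_sums[of 4] by simp
qed

text \<open>The shift of the index adds only the term at 0, which is 0 because division by zero
  gives 0.\<close>

lemma zeta2_sums: "(\<lambda>n. 1 / real n ^ 2) sums (pi ^ 2 / 6)"
  using inverse_squares_sums by (subst sums_Suc_iff[symmetric, of "\<lambda>n. 1 / real n ^ 2", simplified]) simp

text \<open>Reflection at 1/2 gives the sum over odd n, and the even n reproduce the whole sum s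
  with factor 1/16: s = s/16 + pi^4/96.\<close>

lemma zeta4_sums: "(\<lambda>n. 1 / real n ^ 4) sums (pi ^ 4 / 90)"
proof -
  have P: "Polygamma 3 (1/2 :: real) = pi ^ 4"
    using Polygamma3_reflection[of "1/2"] by simp
  have P': "(\<lambda>n. 1 / (1/2 + real n) ^ 4) sums (pi ^ 4 / 6)"
    using Polygamma_odd_sums[of "1/2" 4] P by (simp add: fact_numeral)
  obtain s where s: "(\<lambda>n. 1 / real n ^ 4) sums s" using summable_power[of 4] by (auto simp: summable_def)
  then have "(\<lambda>n. sum (\<lambda>n. 1 / real n ^ 4) {n * 2..<n * 2 + 2}) sums s" by (rule sums_group) simp
  moreover have "sum (\<lambda>n. 1 / real n ^ 4) {n * 2..<n * 2 + 2} = (1 / real n ^ 4) / 16 + (1 / (1/2 + real n) ^ 4) / 16" for n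
  proof -
    have "real (n * 2) = 2 * real n" "real (Suc (n * 2)) = 2 * (1/2 + real n)" by simp_all
    then have "1 / real (n * 2) ^ 4 = (1 / real n ^ 4) / 16" "1 / real (Suc (n * 2)) ^ 4 = (1 / (1/2 + real n) ^ 4) / 16"
      by (simp_all only: power_mult_distrib) simp_all
    then show ?thesis by (simp add: sum.atLeastLessThan_Suc numeral_eq_Suc)
  qed
  moreover have "(\<lambda>n. (1 / real n ^ 4) / 16 + (1 / (1/2 + real n) ^ 4) / 16) sums (s / 16 + (pi ^ 4 / 6) / 16)"
    by (intro sums_add sums_divide s P')
  ultimately have "s = s / 16 + (pi ^ 4 / 6) / 16" using sums_unique2 by simp
  then have "s = pi ^ 4 / 90" by simp
  with s show ?thesis by (simp only:)
qed

section \<open>The value at 1 of the L-series of the character modulo 5\<close>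

definition rho :: real where "rho = 2 * ln golden / sqrt 5"

text \<open>An antiderivative of \<open>\<Sum>n. chi5 (n + 1) * x ^ n\<close>, so that \<open>LG 1 = L(1, chi5)\<close>.\<close>

definition LG :: "real \<Rightarrow> real" where
  "LG x = (ln (x\<^sup>2 + golden * x + 1) - ln (x\<^sup>2 + (1 - golden) * x + 1)) / sqrt 5"

lemma golden_bounds: "golden > 1" "golden < 2"
proof -
  have "sqrt 5 < 3" by (rule real_less_lsqrt) simp_all
  then show "golden < 2" by (simp add: golden_def)
qed (rule golden_gt_1)

text \<open>The two quadratics multiply to the fifth cyclotomic polynomial. Extending the quotient
  by 1 - x turns its numerator into 1 - x - x^2 + x^3, whose signs are those of
  \<open>chi5\<close>.\<close>

lemma LG_deriv:
  assumes "0 \<le> x" "x \<le> 1"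
  shows "(LG has_real_derivative (1 - x\<^sup>2) / (x ^ 4 + x ^ 3 + x\<^sup>2 + x + 1)) (at x)"
proof -
  let ?a = "x\<^sup>2 + golden * x + 1" and ?b = "x\<^sup>2 + (1 - golden) * x + 1"
  have a: "?a > 0" using assms golden_bounds by (intro add_nonneg_pos add_nonneg_nonneg) auto
  have "(golden - 1) * x \<le> 1 * x" using assms golden_bounds by (intro mult_right_mono) auto
  moreover have "x\<^sup>2 - x + 1 = (x - 1/2)\<^sup>2 + 3/4" by (simp add: power2_eq_square algebra_simps)
  moreover have "(x - 1/2)\<^sup>2 \<ge> 0" by simp
  moreover have "?b = (x\<^sup>2 - x + 1) + (1 * x - (golden - 1) * x)" by (simp add: algebra_simps)
  ultimately have b: "?b > 0" by linarith
  have ab: "?a * ?b = x ^ 4 + x ^ 3 + x\<^sup>2 + x + 1"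
  proof -
    have "?a * ?b = x ^ 4 + x ^ 3 + (2 + golden - golden * golden) * x\<^sup>2 + x + 1"
      by (simp add: algebra_simps power2_eq_square power3_eq_cube power4_eq_xxxx)
    then show ?thesis by (simp add: golden_sq)
  qed
  have "(LG has_real_derivative ((2 * x + golden) / ?a - (2 * x + (1 - golden)) / ?b) / sqrt 5) (at x)"
  proof -
    have "((\<lambda>x. ln (x\<^sup>2 + golden * x + 1)) has_real_derivative (2 * x + golden) / ?a) (at x)"
      using a by (auto intro!: derivative_eq_intros)
    moreover have "((\<lambda>x. ln (x\<^sup>2 + (1 - golden) * x + 1)) has_real_derivative (2 * x + (1 - golden)) / ?b) (at x)"
      using b by (auto intro!: derivative_eq_intros)
    ultimately show ?thesis unfolding LG_def[abs_def] by (rule DERIV_cdivide[OF DERIV_diff])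
  qed
  also have "(2 * x + golden) / ?a - (2 * x + (1 - golden)) / ?b
      = ((2 * x + golden) * ?b - (2 * x + (1 - golden)) * ?a) / (?a * ?b)"
    using a b by (simp add: diff_frac_eq)
  also have "(2 * x + golden) * ?b - (2 * x + (1 - golden)) * ?a = (2 * golden - 1) * (1 - x\<^sup>2)"
    by (simp add: algebra_simps power2_eq_square)
  also have "2 * golden - 1 = sqrt 5" by (simp add: golden_def field_simps)
  finally show ?thesis unfolding ab by simp
qed

lemma LG_values: "LG 0 = 0" "LG 1 = rho"
proof -
  \<comment> \<open>\<open>LG 1\<close> is the logarithm of (2 + \<open>golden\<close>)/(3 -
    \<open>golden\<close>) divided by \<open>sqrt 5\<close>, and this quotient is the square of
    \<open>golden\<close>.\<close>
  have "golden * golden * (3 - golden) = 2 + golden"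
    by (simp only: golden_sq) (simp add: algebra_simps golden_sq)
  then have "ln (2 + golden) = ln (golden * golden * (3 - golden))" by simp
  also have "\<dots> = 2 * ln golden + ln (3 - golden)"
    using golden_bounds by (simp add: ln_mult)
  finally show "LG 1 = rho" by (simp add: LG_def rho_def algebra_simps)
qed (simp add: LG_def)

text \<open>Abel's theorem with an explicit error: \<open>LG\<close> minus the truncated primitive
  \<open>H N\<close> has derivative \<open>g x * x ^ (5 * N)\<close> with \<open>g\<close> between 0
  and 1. The difference therefore grows from 0 by at most the integral of \<open>x ^ (5 * N)\<close>
  over the unit interval.\<close>

lemma chi5_partial_bound:
  "0 \<le> rho - (\<Sum>n<N. 1 / real (5 * n + 1) - 1 / real (5 * n + 2) - 1 / real (5 * n + 3) + 1 / real (5 * n + 4))"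
  "rho - (\<Sum>n<N. 1 / real (5 * n + 1) - 1 / real (5 * n + 2) - 1 / real (5 * n + 3) + 1 / real (5 * n + 4)) \<le> 1 / real (5 * N + 1)"
proof -
  define H where "H N x = (\<Sum>n<N. x ^ (5 * n + 1) / real (5 * n + 1) - x ^ (5 * n + 2) / real (5 * n + 2)
    - x ^ (5 * n + 3) / real (5 * n + 3) + x ^ (5 * n + 4) / real (5 * n + 4))" for N and x :: real
  define g where "g x = (1 - x\<^sup>2) / (x ^ 4 + x ^ 3 + x\<^sup>2 + x + 1)" for x :: real
  have H: "(H N has_real_derivative g x * (1 - x ^ (5 * N))) (at x)" if "0 \<le> x" for x
  proof -
    have \<Phi>: "x ^ 4 + x ^ 3 + x\<^sup>2 + x + 1 > 0" using that by (intro add_nonneg_pos add_nonneg_nonneg) auto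
    have key: "x ^ (5 * n) - x ^ (5 * n + 1) - x ^ (5 * n + 2) + x ^ (5 * n + 3)
        = g x * (x ^ (5 * n) - x ^ (5 * n + 5))" for n
    proof -
      have "(x ^ (5 * n) - x ^ (5 * n + 1) - x ^ (5 * n + 2) + x ^ (5 * n + 3)) * (x ^ 4 + x ^ 3 + x\<^sup>2 + x + 1)
          = (1 - x\<^sup>2) * (x ^ (5 * n) - x ^ (5 * n + 5))"
        by (simp add: power_add algebra_simps numeral_eq_Suc)
      then show ?thesis using \<Phi> by (simp add: g_def field_simps)
    qed
    have d: "((\<lambda>x. x ^ Suc m / real (Suc m)) has_real_derivative x ^ m) (at x)" for m
      by (rule DERIV_cong[OF DERIV_cdivide[OF DERIV_pow]]) (simp del: of_nat_Suc)
    have "(H N has_real_derivative (\<Sum>n<N. x ^ (5 * n) - x ^ (5 * n + 1) - x ^ (5 * n + 2) + x ^ (5 * n + 3))) (at x)"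
      unfolding H_def
      by (intro DERIV_sum DERIV_add DERIV_diff)
        (use d[of "5 * n" for n] d[of "5 * n + 1" for n] d[of "5 * n + 2" for n] d[of "5 * n + 3" for n] in \<open>simp_all add: numeral_eq_Suc\<close>)
    also have "(\<Sum>n<N. x ^ (5 * n) - x ^ (5 * n + 1) - x ^ (5 * n + 2) + x ^ (5 * n + 3))
        = (\<Sum>n<N. g x * (x ^ (5 * n) - x ^ (5 * n + 5)))" by (simp only: key)
    also have "\<dots> = g x * (1 - x ^ (5 * N))"
    proof -
      have "(\<Sum>n<N. x ^ (5 * n) - x ^ (5 * n + 5)) = 1 - x ^ (5 * N)"
        by (induction N) (simp_all add: add.commute)
      then show ?thesis by (simp add: sum_distrib_left[symmetric])
    qed
    finally show ?thesis .
  qed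
  define D where "D x = LG x - H N x" for x
  have D: "(D has_real_derivative g x * x ^ (5 * N)) (at x)" if "0 \<le> x" "x \<le> 1" for x
  proof -
    have "g x - g x * (1 - x ^ (5 * N)) = g x * x ^ (5 * N)" by (simp add: right_diff_distrib)
    then show ?thesis
      using DERIV_diff[OF LG_deriv[OF that, folded g_def] H[OF that(1)]] by (simp add: D_def[abs_def])
  qed
  have g: "0 \<le> g x" "g x \<le> 1" if "0 \<le> x" "x \<le> 1" for x
  proof -
    have d: "x ^ 4 + x ^ 3 + x\<^sup>2 + x + 1 \<ge> 1" using that by simp
    have n: "0 \<le> 1 - x\<^sup>2" "1 - x\<^sup>2 \<le> 1" using that by (simp_all add: power_le_one)
    show "0 \<le> g x" unfolding g_def using d n by (intro divide_nonneg_nonneg) auto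
    have "1 - x\<^sup>2 \<le> x ^ 4 + x ^ 3 + x\<^sup>2 + x + 1" using d n(2) by (rule order_trans[rotated])
    then show "g x \<le> 1" unfolding g_def using d by (subst divide_le_eq_1_pos) auto
  qed
  have "H N 0 = 0" by (simp add: H_def power_0_left)
  then have D0: "D 0 = 0" by (simp add: D_def LG_values)
  have "D 0 \<le> D 1"
  proof (rule DERIV_nonneg_imp_nondecreasing[where f = D])
    show "\<exists>y. (D has_real_derivative y) (at x) \<and> 0 \<le> y" if "0 \<le> x" "x \<le> 1" for x
      using D[OF that] g[OF that] that by (intro exI[of _ "g x * x ^ (5 * N)"]) simp
  qed simp
  moreover have "1 / real (5 * N + 1) * 0 ^ (5 * N + 1) - D 0 \<le> 1 / real (5 * N + 1) * 1 ^ (5 * N + 1) - D 1"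
  proof (rule DERIV_nonneg_imp_nondecreasing[where f = "\<lambda>x. 1 / real (5 * N + 1) * x ^ (5 * N + 1) - D x"])
    fix x :: real assume x: "0 \<le> x" "x \<le> 1"
    have "((\<lambda>x. x ^ Suc (5 * N) / real (Suc (5 * N))) has_real_derivative x ^ (5 * N)) (at x)"
      by (rule DERIV_cong[OF DERIV_cdivide[OF DERIV_pow]]) (simp del: of_nat_Suc)
    then have "((\<lambda>x. 1 / real (5 * N + 1) * x ^ (5 * N + 1)) has_real_derivative x ^ (5 * N)) (at x)"
      by simp
    then have "((\<lambda>x. 1 / real (5 * N + 1) * x ^ (5 * N + 1) - D x) has_real_derivative x ^ (5 * N) - g x * x ^ (5 * N)) (at x)"
      using D[OF x] by (rule DERIV_diff)
    moreover have "g x * x ^ (5 * N) \<le> 1 * x ^ (5 * N)" using g[OF x] x by (intro mult_right_mono) auto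
    ultimately show "\<exists>y. ((\<lambda>x. 1 / real (5 * N + 1) * x ^ (5 * N + 1) - D x) has_real_derivative y) (at x) \<and> 0 \<le> y"
      by (intro exI[of _ "x ^ (5 * N) - g x * x ^ (5 * N)"]) simp
  qed simp
  moreover have "D 1 = rho - (\<Sum>n<N. 1 / real (5 * n + 1) - 1 / real (5 * n + 2) - 1 / real (5 * n + 3) + 1 / real (5 * n + 4))"
    by (simp add: D_def LG_values H_def)
  ultimately show
    "0 \<le> rho - (\<Sum>n<N. 1 / real (5 * n + 1) - 1 / real (5 * n + 2) - 1 / real (5 * n + 3) + 1 / real (5 * n + 4))"
    "rho - (\<Sum>n<N. 1 / real (5 * n + 1) - 1 / real (5 * n + 2) - 1 / real (5 * n + 3) + 1 / real (5 * n + 4)) \<le> 1 / real (5 * N + 1)"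
    using D0 by simp_all
qed

subsection \<open>Asymptotics of summatory functions\<close>

definition chi :: "nat \<Rightarrow> real" where "chi n = of_int (chi5 n)"

definition rr :: "nat \<Rightarrow> real" where "rr = dconv chi (\<lambda>_. 1)"

lemma rr_eq_card:
  assumes "n > 0"
  shows "rr n = real (card (zids n))"
proof -
  have "rr n = real_of_int (chi5_sum n)" by (simp add: rr_def dconv_def chi_def chi5_sum_def)
  then show ?thesis using card_zids[OF assms] by (metis of_int_of_nat_eq)
qed

lemma rr_nonneg: "rr n \<ge> 0"
proof (cases "n = 0")
  case True
  then show ?thesis by (simp add: rr_def)
qed (simp add: rr_eq_card)

lemma sum_dconv:
  fixes f g :: "nat \<Rightarrow> real"
  shows "(\<Sum>n=1..N. dconv f g n) = (\<Sum>d=1..N. f d * (\<Sum>k=1..N div d. g k))"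
proof -
  have "(\<Sum>n=1..N. dconv f g n) = (\<Sum>(n, d)\<in>(SIGMA n:{1..N}. {d. d dvd n}). f d * g (n div d))"
    unfolding dconv_def by (rule sum.Sigma) auto
  also have "\<dots> = (\<Sum>(d, k)\<in>(SIGMA d:{1..N}. {1..N div d}). f d * g k)"
  proof (rule sum.reindex_bij_witness[of _ "\<lambda>(d, k). (d * k, d)" "\<lambda>(n, d). (d, n div d)"])
    fix p assume "p \<in> (SIGMA n:{1..N}. {d. d dvd n})"
    then obtain n d k where p: "p = (n, d)" "n = d * k" "1 \<le> n" "n \<le> N" by (auto elim!: dvdE)
    then have "d > 0" "k > 0" by (auto intro: Nat.gr0I)
    moreover have "d \<le> N" using p calculation by (meson dvd_imp_le dvd_triv_left le_trans less_le_trans zero_less_one)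
    moreover have "k \<le> N div d" using p calculation by (simp add: less_eq_div_iff_mult_less_eq mult.commute)
    ultimately show "(case case p of (n, d) \<Rightarrow> (d, n div d) of (d, k) \<Rightarrow> (d * k, d)) = p"
      "(case p of (n, d) \<Rightarrow> (d, n div d)) \<in> (SIGMA d:{1..N}. {1..N div d})"
      "(case case p of (n, d) \<Rightarrow> (d, n div d) of (d, k) \<Rightarrow> f d * g k) = (case p of (n, d) \<Rightarrow> f d * g (n div d))"
      using p by auto
  next
    fix p assume "p \<in> (SIGMA d:{1..N}. {1..N div d})"
    then obtain d k where p: "p = (d, k)" "1 \<le> d" "d \<le> N" "1 \<le> k" "k \<le> N div d" by auto
    then have "d * k \<le> N" by (simp add: less_eq_div_iff_mult_less_eq mult.commute)
    then show "(case case p of (d, k) \<Rightarrow> (d * k, d) of (n, d) \<Rightarrow> (d, n div d)) = p"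
      "(case p of (d, k) \<Rightarrow> (d * k, d)) \<in> (SIGMA n:{1..N}. {d. d dvd n})"
      using p by auto
  qed
  also have "\<dots> = (\<Sum>d=1..N. \<Sum>k=1..N div d. f d * g k)"
    by (rule sum.Sigma[symmetric]) auto
  finally show ?thesis by (simp add: sum_distrib_left)
qed

lemma chi_partial_sum: "(\<Sum>d=1..n. chi d) = (if n mod 5 = 1 then 1 else if n mod 5 = 3 then - 1 else 0)"
  by (induction n) (auto simp: chi_def chi5_def mod_Suc split: if_splits)

lemma chi_interval_bound: "\<bar>\<Sum>d=m..n. chi d\<bar> \<le> 2"
proof (cases "1 \<le> m \<and> m \<le> n")
  case True
  then have "{1..n} = {1..m - 1} \<union> {m..n}" "{1..m - 1} \<inter> {m..n} = {}" by auto
  then have "(\<Sum>d=1..n. chi d) = (\<Sum>d=1..m - 1. chi d) + (\<Sum>d=m..n. chi d)"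
    by (simp add: sum.union_disjoint)
  then show ?thesis unfolding chi_partial_sum by (auto split: if_splits)
next
  case False
  then consider "m = 0" | "m > n" by linarith
  then show ?thesis
  proof cases
    case 1
    have "(\<Sum>d=0..n. chi d) = chi 0 + (\<Sum>d=1..n. chi d)" by (simp add: sum.atLeast_Suc_atMost)
    then show ?thesis using 1 unfolding chi_partial_sum by (auto simp: chi_def chi5_def)
  qed simp
qed

text \<open>Summation by parts: sums of \<open>chi\<close> over intervals are bounded by 2, and the
  decreasing weights telescope.\<close>

lemma chi_weighted_bound:
  assumes "m \<le> M" "\<And>i j. m \<le> i \<Longrightarrow> i \<le> j \<Longrightarrow> c j \<le> c i" "\<And>i. (c i :: real) \<ge> 0"
  shows "\<bar>\<Sum>d=m..M. chi d * c d\<bar> \<le> 2 * c m"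
proof -
  have "\<bar>(\<Sum>d=m..M. chi d * c d) - (\<Sum>d=m..M. chi d) * c M\<bar> \<le> 2 * (c m - c M)"
    using assms(1)
  proof (induction M rule: dec_induct)
    case (step M)
    have tri: "A = B + D \<Longrightarrow> \<bar>D\<bar> \<le> 2 * (p - q) \<Longrightarrow> \<bar>B\<bar> \<le> 2 * (r - p) \<Longrightarrow> \<bar>A\<bar> \<le> 2 * (r - q)"
      for A B D p q r :: real unfolding abs_le_iff by (simp add: right_diff_distrib)
    have *: "(\<Sum>d=m..Suc M. f d) = (\<Sum>d=m..M. f d) + f (Suc M)" for f :: "nat \<Rightarrow> real"
      using step.hyps by simp
    have "(\<Sum>d=m..Suc M. chi d * c d) - (\<Sum>d=m..Suc M. chi d) * c (Suc M)
        = ((\<Sum>d=m..M. chi d * c d) - (\<Sum>d=m..M. chi d) * c M) + (\<Sum>d=m..M. chi d) * (c M - c (Suc M))"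
      unfolding * by (simp add: algebra_simps)
    moreover have "\<bar>(\<Sum>d=m..M. chi d) * (c M - c (Suc M))\<bar> \<le> 2 * (c M - c (Suc M))"
    proof -
      have "c M - c (Suc M) \<ge> 0" using assms(2)[of M "Suc M"] step.hyps by simp
      then show ?thesis using chi_interval_bound[of m M] unfolding abs_mult by (intro mult_mono) auto
    qed
    ultimately show ?case using step.IH by (rule tri)
  qed simp
  moreover have "\<bar>(\<Sum>d=m..M. chi d) * c M\<bar> \<le> 2 * c M"
    unfolding abs_mult using chi_interval_bound[of m M] assms(3)[of M] by (intro mult_mono) auto
  moreover have "\<bar>X - Y\<bar> \<le> 2 * (p - q) \<Longrightarrow> \<bar>Y\<bar> \<le> 2 * q \<Longrightarrow> \<bar>X\<bar> \<le> 2 * p" for X Y p q :: real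
    unfolding abs_le_iff by (simp add: right_diff_distrib)
  ultimately show ?thesis by blast
qed

lemma chi_L1: "(\<lambda>K. \<Sum>d=1..K. chi d / d) \<longlonglongrightarrow> rho"
proof -
  define S where "S K = (\<Sum>d=1..K. chi d / d)" for K
  have block: "S (5 * N) = (\<Sum>n<N. 1 / real (5 * n + 1) - 1 / real (5 * n + 2) - 1 / real (5 * n + 3) + 1 / real (5 * n + 4))" for N
  proof (induction N)
    case (Suc N)
    have st: "S (Suc k) = S k + chi (Suc k) / real (Suc k)" for k
      by (simp add: S_def)
    have nums: "5 * N + 1 = Suc (5 * N)" "5 * N + 2 = Suc (5 * N + 1)" "5 * N + 3 = Suc (5 * N + 2)"
      "5 * N + 4 = Suc (5 * N + 3)" "5 * Suc N = Suc (5 * N + 4)" by simp_all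
    have "S (5 * Suc N) = S (5 * N) + chi (5 * N + 1) / real (5 * N + 1) + chi (5 * N + 2) / real (5 * N + 2)
        + chi (5 * N + 3) / real (5 * N + 3) + chi (5 * N + 4) / real (5 * N + 4) + chi (5 * Suc N) / real (5 * Suc N)"
      by (simp only: nums st)
    also have "\<dots> = S (5 * N) + (1 / real (5 * N + 1) - 1 / real (5 * N + 2) - 1 / real (5 * N + 3) + 1 / real (5 * N + 4))"
      unfolding chi_def chi5_block by simp
    finally show ?case by (simp only: Suc.IH sum.lessThan_Suc)
  qed (simp add: S_def)
  \<comment> \<open>One part of the error comes from the last full block and two from the incomplete
    one. With K + 1 \<le> 5 (5 N + 1) the constant is 3 * 5 = 15.\<close>
  have bound: "\<bar>S K - rho\<bar> \<le> 15 / real (K + 1)" for K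
  proof -
    define N where "N = K div 5"
    have N: "5 * N \<le> K" "K < 5 * N + 5" by (auto simp: N_def)
    have "\<bar>S (5 * N) - rho\<bar> \<le> 1 / real (5 * N + 1)"
      using chi5_partial_bound[where N = N] unfolding block by linarith
    moreover have "\<bar>S K - S (5 * N)\<bar> \<le> 2 * (1 / real (5 * N + 1))"
    proof (cases "5 * N + 1 \<le> K")
      case True
      have "{1..K} = {1..5 * N} \<union> {5 * N + 1..K}" "{1..5 * N} \<inter> {5 * N + 1..K} = {}" using N by auto
      then have "S K = S (5 * N) + (\<Sum>d=5 * N + 1..K. chi d / d)"
        unfolding S_def by (simp add: sum.union_disjoint)
      moreover have "\<bar>\<Sum>d=5 * N + 1..K. chi d * (1 / d)\<bar> \<le> 2 * (1 / real (5 * N + 1))"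
        using True by (rule chi_weighted_bound) (auto intro!: frac_le)
      ultimately show ?thesis by simp
    next
      case False
      then have "K = 5 * N" using N by simp
      then show ?thesis by simp
    qed
    moreover have "1 / real (5 * N + 1) \<le> 5 / real (K + 1)"
      using N by (simp add: divide_simps)
    ultimately show ?thesis by linarith
  qed
  have "(\<lambda>K. 15 / real (K + 1)) \<longlonglongrightarrow> 0" by real_asymp
  then have "(\<lambda>K. S K - rho) \<longlonglongrightarrow> 0"
    by (rule Lim_null_comparison[rotated]) (use bound in auto)
  then show ?thesis unfolding S_def using LIM_zero_iff by blast
qed

definition RR :: "nat \<Rightarrow> real" where "RR N = (\<Sum>n=1..N. rr n)"

lemma RR_eq: "RR N = (\<Sum>d=1..N. chi d * real (N div d))"
  unfolding RR_def rr_def by (subst sum_dconv) simp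

lemma real_of_nat_div_le: "real (n div d) \<le> real n / real d"
  using floor_divide_of_nat_eq[of n d, where ?'a = real] of_int_floor_le[of "real n / real d"]
  by (metis of_int_of_nat_eq)

text \<open>Up to \<open>K\<close> the floor is replaced by the quotient at a cost of at most 1 per
  term. Beyond \<open>K\<close> the cancellation in \<open>chi\<close> leaves twice the first weight
  \<open>N div (K + 1)\<close>.\<close>

lemma RR_bound:
  assumes "K \<le> N"
  shows "\<bar>RR N - N * (\<Sum>d=1..K. chi d / d)\<bar> \<le> real K + 2 * real N / real (K + 1)"
proof -
  have chi1: "\<bar>chi d\<bar> \<le> 1" for d using abs_chi5[of d] unfolding chi_def by linarith
  have "{1..N} = {1..K} \<union> {K + 1..N}" "{1..K} \<inter> {K + 1..N} = {}" using assms by auto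
  then have "RR N = (\<Sum>d=1..K. chi d * real (N div d)) + (\<Sum>d=K + 1..N. chi d * real (N div d))"
    unfolding RR_eq by (simp add: sum.union_disjoint)
  moreover have "\<bar>(\<Sum>d=1..K. chi d * real (N div d)) - N * (\<Sum>d=1..K. chi d / d)\<bar> \<le> K"
  proof -
    have "(\<Sum>d=1..K. chi d * real (N div d)) - N * (\<Sum>d=1..K. chi d / d) = (\<Sum>d=1..K. chi d * (real (N div d) - real N / d))"
      by (simp add: sum_distrib_left sum_subtractf algebra_simps)
    also have "\<bar>\<dots>\<bar> \<le> (\<Sum>d=1..K. 1)"
    proof (rule order_trans[OF sum_abs sum_mono])
      fix d assume "d \<in> {1..K}"
      then have d: "d > 0" by simp
      have "\<bar>real (N div d) - real N / d\<bar> \<le> 1"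
      proof -
        have "real N = d * real (N div d) + real (N mod d)" by (metis of_nat_add of_nat_mult mult_div_mod_eq)
        then have "real N / d = real (N div d) + real (N mod d) / d" using d by (simp add: field_simps)
        moreover have "real (N mod d) / d \<le> 1" "real (N mod d) / d \<ge> 0" using d by (simp_all add: divide_le_eq less_imp_le)
        ultimately show ?thesis by linarith
      qed
      then have "\<bar>chi d\<bar> * \<bar>real (N div d) - real N / d\<bar> \<le> 1 * 1" using chi1 by (intro mult_mono) auto
      then show "\<bar>chi d * (real (N div d) - real N / d)\<bar> \<le> 1" by (simp add: abs_mult)
    qed
    finally show ?thesis by simp
  qed
  moreover have "\<bar>\<Sum>d=K + 1..N. chi d * real (N div d)\<bar> \<le> 2 * N / (K + 1)"
  proof (cases "K + 1 \<le> N")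
    case True
    then have "\<bar>\<Sum>d=K + 1..N. chi d * real (N div d)\<bar> \<le> 2 * real (N div (K + 1))"
      by (rule chi_weighted_bound) (auto intro: div_le_mono2)
    also have "\<dots> \<le> 2 * (real N / real (K + 1))" by (intro mult_left_mono real_of_nat_div_le) auto
    finally show ?thesis by simp
  qed simp
  ultimately show ?thesis by linarith
qed

lemma RR_lim: "(\<lambda>N. RR N / N) \<longlonglongrightarrow> rho"
proof (rule LIMSEQ_I)
  fix e :: real assume e: "e > 0"
  obtain K0 where K0: "\<And>K. K \<ge> K0 \<Longrightarrow> \<bar>(\<Sum>d=1..K. chi d / d) - rho\<bar> < e / 3"
    using LIMSEQ_D[OF chi_L1, of "e / 3"] e by auto
  obtain K1 :: nat where K1: "6 / e < K1" using reals_Archimedean2 by blast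
  define K where "K = max K0 K1"
  obtain N1 :: nat where N1: "3 * K / e < N1" using reals_Archimedean2 by blast
  show "\<exists>no. \<forall>N\<ge>no. norm (RR N / N - rho) < e"
  proof (intro exI allI impI)
    fix N assume "N \<ge> max (max K N1) 1"
    then have N: "K \<le> N" "N1 \<le> N" "N > 0" by auto
    let ?S = "\<Sum>d=1..K. chi d / d"
    have "RR N / N - ?S = (RR N - N * ?S) / N" using N(3) by (simp add: field_simps)
    then have "\<bar>RR N / N - ?S\<bar> = \<bar>RR N - N * ?S\<bar> / N" by (simp only: abs_divide abs_of_nat)
    also have "\<dots> \<le> (real K + 2 * real N / real (K + 1)) / real N"
      by (rule divide_right_mono[OF RR_bound[OF N(1)]]) simp
    also have "\<dots> = real K / real N + 2 / real (K + 1)" using N(3) by (simp add: field_simps)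
    also have "real K / real N < e / 3"
    proof -
      have "3 * K / e < N" using N1 N(2) by linarith
      then show ?thesis using e N(3) by (simp add: field_simps)
    qed
    also have "2 / real (K + 1) < e / 3"
    proof -
      have "6 / e < K + 1" using K1 by (simp add: K_def)
      then show ?thesis using e by (simp add: field_simps)
    qed
    finally have "\<bar>RR N / N - ?S\<bar> < e / 3 + e / 3" by simp
    moreover have "\<bar>?S - rho\<bar> < e / 3" by (rule K0) (simp add: K_def)
    ultimately have "\<bar>RR N / N - rho\<bar> < e" by linarith
    then show "norm (RR N / N - rho) < e" by simp
  qed
qed

lemma stolz_cesaro:
  fixes a b :: "nat \<Rightarrow> real"
  assumes lim: "(\<lambda>n. a n / b n) \<longlonglongrightarrow> c" and b: "\<And>n. n > 0 \<Longrightarrow> b n > 0"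
    and B: "filterlim (\<lambda>N. \<Sum>n=1..N. b n) at_top sequentially"
  shows "(\<lambda>N. (\<Sum>n=1..N. a n) / (\<Sum>n=1..N. b n)) \<longlonglongrightarrow> c"
proof (rule LIMSEQ_I)
  fix e :: real assume e: "e > 0"
  obtain n1 where n1: "\<And>n. n \<ge> n1 \<Longrightarrow> \<bar>a n / b n - c\<bar> < e / 2"
    using LIMSEQ_D[OF lim, of "e / 2"] e by auto
  define n0 where "n0 = max n1 1"
  have ab: "\<bar>a n - c * b n\<bar> \<le> e / 2 * b n" if "n \<ge> n0" for n
  proof -
    have bn: "b n > 0" using that b by (simp add: n0_def)
    have "a n - c * b n = (a n / b n - c) * b n" using bn by (simp add: field_simps)
    then show ?thesis using n1[of n] that bn by (simp add: abs_mult n0_def)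
  qed
  define C where "C = (\<Sum>n=1..n0. \<bar>a n - c * b n\<bar>)"
  obtain N0 where N0: "\<And>N. N \<ge> N0 \<Longrightarrow> (\<Sum>n=1..N. b n) \<ge> 2 * C / e + 1"
    using B unfolding filterlim_at_top eventually_sequentially by blast
  show "\<exists>no. \<forall>N\<ge>no. norm ((\<Sum>n=1..N. a n) / (\<Sum>n=1..N. b n) - c) < e"
  proof (intro exI allI impI)
    fix N assume "N \<ge> max N0 n0"
    then have N: "N \<ge> N0" "N \<ge> n0" by auto
    let ?B = "\<Sum>n=1..N. b n"
    have C0: "C \<ge> 0" by (simp add: C_def sum_nonneg)
    have B1: "?B \<ge> 2 * C / e + 1" using N0[OF N(1)] .
    then have B0: "?B > 0" using C0 e by (smt (verit) divide_nonneg_pos)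
    have "\<bar>\<Sum>n=1..N. a n - c * b n\<bar> \<le> (\<Sum>n=1..N. \<bar>a n - c * b n\<bar>)" by (rule sum_abs)
    also have "(\<Sum>n=1..N. \<bar>a n - c * b n\<bar>) = (\<Sum>n\<in>{1..n0} \<union> {n0 + 1..N}. \<bar>a n - c * b n\<bar>)"
      using N by (intro sum.cong) auto
    also have "\<dots> = C + (\<Sum>n=n0 + 1..N. \<bar>a n - c * b n\<bar>)"
      unfolding C_def by (rule sum.union_disjoint) auto
    also have "(\<Sum>n=n0 + 1..N. \<bar>a n - c * b n\<bar>) \<le> (\<Sum>n=n0 + 1..N. e / 2 * b n)"
      by (rule sum_mono) (use ab in auto)
    also have "\<dots> \<le> (\<Sum>n=1..N. e / 2 * b n)"
      by (rule sum_mono2) (use e b in \<open>auto intro!: mult_nonneg_nonneg less_imp_le\<close>)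
    finally have "\<bar>\<Sum>n=1..N. a n - c * b n\<bar> \<le> C + e / 2 * ?B" by (simp add: sum_distrib_left)
    moreover have "C < e / 2 * ?B"
    proof -
      have "e / 2 * ?B \<ge> e / 2 * (2 * C / e + 1)" using B1 e by (intro mult_left_mono) auto
      also have "e / 2 * (2 * C / e + 1) = C + e / 2" using e by (simp add: field_simps)
      finally show ?thesis using e by simp
    qed
    ultimately have "\<bar>\<Sum>n=1..N. a n - c * b n\<bar> < e * ?B" by simp
    moreover have "(\<Sum>n=1..N. a n) / ?B - c = (\<Sum>n=1..N. a n - c * b n) / ?B"
      using B0 by (simp add: sum_subtractf sum_distrib_left[symmetric] field_simps)
    ultimately show "norm ((\<Sum>n=1..N. a n) / ?B - c) < e" using B0 by (simp add: divide_less_eq)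
  qed
qed

definition R1 :: "nat \<Rightarrow> real" where "R1 N = (\<Sum>n=1..N. n * rr n)"

text \<open>Summation by parts, which reduces \<open>R1_lim\<close> to
  \<open>RR_lim\<close>.\<close>

lemma R1_eq: "R1 N = (N + 1) * RR N - (\<Sum>n=1..N. RR n)"
  by (induction N) (simp_all add: R1_def RR_def algebra_simps)

lemma sum_real_atMost: "(\<Sum>n=1..N. real n) = real N * (real N + 1) / 2"
  by (induction N) (simp_all add: field_simps)

lemma R1_lim: "(\<lambda>N. R1 N / (real N)\<^sup>2) \<longlonglongrightarrow> rho / 2"
proof -
  have "(\<lambda>N. (\<Sum>n=1..N. RR n) / (\<Sum>n=1..N. real n)) \<longlonglongrightarrow> rho"
  proof (rule stolz_cesaro[OF RR_lim])
    show "filterlim (\<lambda>N. \<Sum>n=1..N. real n) at_top sequentially"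
      unfolding sum_real_atMost by real_asymp
  qed simp
  moreover have "(\<lambda>N. (real N * (real N + 1) / 2) / (real N)\<^sup>2) \<longlonglongrightarrow> 1 / 2" by real_asymp
  ultimately have "(\<lambda>N. (\<Sum>n=1..N. RR n) / (\<Sum>n=1..N. real n) * ((real N * (real N + 1) / 2) / (real N)\<^sup>2)) \<longlonglongrightarrow> rho * (1 / 2)"
    by (rule tendsto_mult)
  moreover have "(\<lambda>N. (RR N / N) * ((real N + 1) / real N)) \<longlonglongrightarrow> rho * 1"
    by (intro tendsto_mult RR_lim) real_asymp
  ultimately have "(\<lambda>N. (RR N / N) * ((real N + 1) / real N)
      - (\<Sum>n=1..N. RR n) / (\<Sum>n=1..N. real n) * ((real N * (real N + 1) / 2) / (real N)\<^sup>2)) \<longlonglongrightarrow> rho * 1 - rho * (1 / 2)"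
    by (intro tendsto_diff)
  moreover have "eventually (\<lambda>N. (RR N / N) * ((real N + 1) / real N)
      - (\<Sum>n=1..N. RR n) / (\<Sum>n=1..N. real n) * ((real N * (real N + 1) / 2) / (real N)\<^sup>2) = R1 N / (real N)\<^sup>2) sequentially"
    using eventually_gt_at_top[of 0]
  proof eventually_elim
    case (elim N)
    then have "real N > 0" "real N + 1 > 0" by simp_all
    moreover have "a / x * ((x + 1) / x) - t / (x * (x + 1) / 2) * (x * (x + 1) / 2 / x\<^sup>2) = ((x + 1) * a - t) / x\<^sup>2"
      if "x > 0" for x a t :: real using that by (simp add: power2_eq_square diff_divide_distrib)
    ultimately show ?case unfolding R1_eq sum_real_atMost by simp
  qed
  ultimately show ?thesis by (simp add: tendsto_cong)
qed

text \<open>The main term of \<open>HH\<close> is a multiple of this sum, arising from the weights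
  \<open>d * rr d / d ^ 2\<close>.\<close>

definition S3 :: "nat \<Rightarrow> real" where "S3 N = (\<Sum>n=1..N. rr n / n)"

lemma S3_eq: "S3 N = RR N / (real N + 1) + (\<Sum>n=1..N. RR n / (real n * (real n + 1)))"
proof (induction N)
  case (Suc N)
  have "RR (Suc N) = RR N + rr (Suc N)" by (simp add: RR_def)
  then have "RR (Suc N) / (real (Suc N) + 1) + RR (Suc N) / (real (Suc N) * (real (Suc N) + 1)) = RR N / (real N + 1) + rr (Suc N) / real (Suc N)"
    by (simp add: divide_simps) (simp add: algebra_simps)
  then show ?case using Suc.IH by (simp add: S3_def)
qed (simp add: S3_def RR_def)

lemma harm_sum: "harm N = (\<Sum>n=1..N. 1 / real n)"
  by (simp add: harm_def inverse_eq_divide)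

lemma S3_lim: "(\<lambda>N. S3 N / harm N) \<longlonglongrightarrow> rho"
proof -
  have "(\<lambda>n. (RR n / n) * (real n / (real n + 1))) \<longlonglongrightarrow> rho * 1"
    by (intro tendsto_mult RR_lim) real_asymp
  moreover have "eventually (\<lambda>n. (RR n / n) * (real n / (real n + 1)) = (RR n / (real n * (real n + 1))) / (1 / real n)) sequentially"
    using eventually_gt_at_top[of 0] by eventually_elim (simp add: divide_inverse)
  ultimately have "(\<lambda>n. (RR n / (real n * (real n + 1))) / (1 / real n)) \<longlonglongrightarrow> rho" by (simp add: tendsto_cong)
  then have "(\<lambda>N. (\<Sum>n=1..N. RR n / (real n * (real n + 1))) / (\<Sum>n=1..N. 1 / real n)) \<longlonglongrightarrow> rho"
  proof (rule stolz_cesaro)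
    show "filterlim (\<lambda>N. \<Sum>n=1..N. 1 / real n) at_top sequentially"
      using harm_at_top unfolding harm_sum[abs_def] .
  qed simp
  then have 1: "(\<lambda>N. (\<Sum>n=1..N. RR n / (real n * (real n + 1))) / harm N) \<longlonglongrightarrow> rho" by (simp only: harm_sum)
  have "(\<lambda>n. (RR n / n) * (real n / (real n + 1))) \<longlonglongrightarrow> rho * 1"
    by (intro tendsto_mult RR_lim) real_asymp
  moreover have "(\<lambda>n. inverse (harm n :: real)) \<longlonglongrightarrow> 0"
    by (rule tendsto_inverse_0_at_top[OF harm_at_top])
  ultimately have "(\<lambda>n. (RR n / n) * (real n / (real n + 1)) * inverse (harm n)) \<longlonglongrightarrow> rho * 1 * 0"
    by (rule tendsto_mult)
  moreover have "eventually (\<lambda>n. (RR n / n) * (real n / (real n + 1)) * inverse (harm n) = (RR n / (real n + 1)) / harm n) sequentially"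
    using eventually_gt_at_top[of 0] by eventually_elim (simp add: divide_inverse)
  ultimately have 2: "(\<lambda>n. (RR n / (real n + 1)) / harm n) \<longlonglongrightarrow> 0" by (simp add: tendsto_cong)
  from tendsto_add[OF 2 1] show ?thesis by (simp add: S3_eq add_divide_distrib)
qed

text \<open>A limit as an estimate valid for all \<open>N\<close>, the constant absorbing the
  finitely many exceptions. This form can be used at \<open>N div d\<close> for all d at
  once.\<close>

lemma lim_imp_linear_error:
  fixes f g :: "nat \<Rightarrow> real"
  assumes "(\<lambda>N. f N / g N) \<longlonglongrightarrow> c" "\<And>N. g N \<ge> 0" "\<And>N. N > 0 \<Longrightarrow> g N > 0" "e > 0"
  shows "\<exists>C. \<forall>N. \<bar>f N - c * g N\<bar> \<le> e * g N + C"
proof -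
  obtain n0 where n0: "\<And>N. N \<ge> n0 \<Longrightarrow> \<bar>f N / g N - c\<bar> < e"
    using LIMSEQ_D[OF assms(1,4)] by auto
  define C where "C = (\<Sum>n\<le>n0. \<bar>f n - c * g n\<bar>)"
  have "\<bar>f N - c * g N\<bar> \<le> e * g N + C" for N
  proof (cases "N > n0")
    case True
    then have "g N > 0" using assms(3) by simp
    then have "\<bar>f N - c * g N\<bar> = \<bar>f N / g N - c\<bar> * g N" by (simp add: abs_mult_pos' field_simps abs_divide flip: abs_mult)
    also have "\<dots> \<le> e * g N" using n0[of N] True \<open>g N > 0\<close> by (intro mult_right_mono) auto
    also have "\<dots> \<le> e * g N + C" by (simp add: C_def sum_nonneg)
    finally show ?thesis .
  next
    case False
    then have "\<bar>f N - c * g N\<bar> \<le> C" unfolding C_def by (intro member_le_sum) auto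
    moreover have "e * g N \<ge> 0" using assms by simp
    ultimately show ?thesis by linarith
  qed
  then show ?thesis by blast
qed

text \<open>The coefficients of zeta(s - 1)^2.\<close>

definition hh :: "nat \<Rightarrow> real" where "hh = dconv (\<lambda>n. n * rr n) (\<lambda>n. n * rr n)"

definition HH :: "nat \<Rightarrow> real" where "HH N = (\<Sum>n=1..N. hh n)"

text \<open>\<open>HH N\<close> is the sum of \<open>d * rr d * R1 (N div d)\<close>. Inserting
  \<open>R1 M\<close>, about rho/2 * M^2, gives rho/2 * N^2 * \<open>S3 N\<close>, and
  \<open>S3 N\<close> is about rho * \<open>harm N\<close>. The other errors are of order N^2, so
  they vanish against \<open>harm N\<close>.\<close>

lemma HH_lim: "(\<lambda>N. HH N / ((real N)\<^sup>2 * harm N)) \<longlonglongrightarrow> rho\<^sup>2 / 2"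
proof -
  have rho0: "rho \<ge> 0" using golden_bounds by (simp add: rho_def)
  have key: "\<exists>C. \<forall>N. \<bar>HH N - rho / 2 * ((real N)\<^sup>2 * S3 N)\<bar>
      \<le> e * ((real N)\<^sup>2 * S3 N) + C * R1 N + rho * (N * RR N)" if e: "e > 0" for e
  proof -
    obtain C where C: "\<And>N. \<bar>R1 N - rho / 2 * (real N)\<^sup>2\<bar> \<le> e * (real N)\<^sup>2 + C"
      using lim_imp_linear_error[OF R1_lim _ _ e] by auto
    \<comment> \<open>Replacing \<open>N div d\<close> by y = N/d changes the square by at most 2 y;
      this is the term with the factor \<open>rho\<close>.\<close>
    have *: "\<bar>R1 (N div d) - rho / 2 * (real N / d)\<^sup>2\<bar> \<le> e * (real N / d)\<^sup>2 + C + rho * (real N / d)" if "d > 0" for N d :: nat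
    proof -
      define M where "M = N div d"
      define y where "y = real N / d"
      have My: "real M \<le> y" unfolding M_def y_def by (rule real_of_nat_div_le)
      have yM: "y \<le> real M + 1"
        unfolding M_def y_def using floor_divide_of_nat_eq[of N d, where ?'a = real] real_of_int_floor_add_one_ge[of "real N / real d"]
        by (metis of_int_of_nat_eq)
      have "y\<^sup>2 - (real M)\<^sup>2 = (y - M) * (y + M)" by (simp add: power2_eq_square algebra_simps)
      also have "\<dots> \<le> 1 * (2 * y)" using My yM by (intro mult_mono) auto
      finally have d1: "y\<^sup>2 - (real M)\<^sup>2 \<le> 2 * y" by simp
      have d2: "(real M)\<^sup>2 \<le> y\<^sup>2" using My by (intro power_mono) auto
      have "rho / 2 * (y\<^sup>2 - (real M)\<^sup>2) \<le> rho / 2 * (2 * y)" "rho / 2 * (y\<^sup>2 - (real M)\<^sup>2) \<ge> 0"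
        using d1 d2 rho0 by (intro mult_left_mono mult_nonneg_nonneg; simp)+
      moreover have "e * (real M)\<^sup>2 \<le> e * y\<^sup>2" using d2 e by simp
      moreover have "rho / 2 * (y\<^sup>2 - (real M)\<^sup>2) = rho / 2 * y\<^sup>2 - rho / 2 * (real M)\<^sup>2" by (simp add: algebra_simps)
      ultimately have "\<bar>R1 M - rho / 2 * y\<^sup>2\<bar> \<le> e * y\<^sup>2 + C + rho * y"
        using C[of M] by (simp add: abs_le_iff)
      then show ?thesis by (simp add: M_def y_def)
    qed
    have "\<bar>HH N - rho / 2 * ((real N)\<^sup>2 * S3 N)\<bar> \<le> e * ((real N)\<^sup>2 * S3 N) + C * R1 N + rho * (N * RR N)" for N
    proof -
      have H: "HH N = (\<Sum>d=1..N. (d * rr d) * R1 (N div d))"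
        unfolding HH_def hh_def R1_def by (rule sum_dconv)
      have T: "a * ((real N)\<^sup>2 * S3 N) = (\<Sum>d=1..N. (d * rr d) * (a * (real N / d)\<^sup>2))" for a
        unfolding S3_def sum_distrib_left by (rule sum.cong) (auto simp: power2_eq_square)
      have "HH N - rho / 2 * ((real N)\<^sup>2 * S3 N) = (\<Sum>d=1..N. (d * rr d) * (R1 (N div d) - rho / 2 * (real N / d)\<^sup>2))"
        unfolding H T by (simp add: sum_subtractf right_diff_distrib)
      also have "\<bar>\<dots>\<bar> \<le> (\<Sum>d=1..N. (d * rr d) * (e * (real N / d)\<^sup>2 + C + rho * (real N / d)))"
      proof (rule order_trans[OF sum_abs sum_mono])
        fix d assume "d \<in> {1..N}"
        then have "d > 0" by simp
        then show "\<bar>(d * rr d) * (R1 (N div d) - rho / 2 * (real N / d)\<^sup>2)\<bar>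
            \<le> (d * rr d) * (e * (real N / d)\<^sup>2 + C + rho * (real N / d))"
          using *[of d N] rr_nonneg[of d] by (simp add: abs_mult mult_left_mono)
      qed
      also have "\<dots> = e * ((real N)\<^sup>2 * S3 N) + C * R1 N + rho * (N * RR N)"
        unfolding T R1_def RR_def sum_distrib_left sum.distrib[symmetric]
        by (rule sum.cong) (auto simp: field_simps)
      finally show ?thesis .
    qed
    then show ?thesis by blast
  qed
  have inv0: "(\<lambda>n. inverse (harm n :: real)) \<longlonglongrightarrow> 0"
    by (rule tendsto_inverse_0_at_top[OF harm_at_top])
  show ?thesis
  proof (rule LIMSEQ_I)
    fix e :: real assume e: "e > 0"
    define e' where "e' = e / (2 * (rho + 1))"
    have e': "e' > 0" using e rho0 by (simp add: e'_def)
    obtain C where C: "\<And>N. \<bar>HH N - rho / 2 * ((real N)\<^sup>2 * S3 N)\<bar>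
      \<le> e' * ((real N)\<^sup>2 * S3 N) + C * R1 N + rho * (N * RR N)" using key[OF e'] by blast
    have lim: "(\<lambda>N. e' * (S3 N / harm N) + C * (R1 N / (real N)\<^sup>2) * inverse (harm N)
        + rho * (RR N / N) * inverse (harm N) + \<bar>rho / 2 * (S3 N / harm N) - rho\<^sup>2 / 2\<bar>)
        \<longlonglongrightarrow> e' * rho + C * (rho / 2) * 0 + rho * rho * 0 + \<bar>rho / 2 * rho - rho\<^sup>2 / 2\<bar>"
      by (intro tendsto_add tendsto_mult tendsto_const tendsto_rabs tendsto_diff S3_lim R1_lim RR_lim inv0)
    have "e' * rho + C * (rho / 2) * 0 + rho * rho * 0 + \<bar>rho / 2 * rho - rho\<^sup>2 / 2\<bar> = e' * rho"
      by (simp add: power2_eq_square)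
    also have "\<dots> < e"
    proof -
      have "e' * rho \<le> e' * (rho + 1)" using e' by simp
      also have "\<dots> = e / 2" using rho0 by (simp add: e'_def field_simps)
      finally show ?thesis using e by simp
    qed
    finally have "eventually (\<lambda>N. e' * (S3 N / harm N) + C * (R1 N / (real N)\<^sup>2) * inverse (harm N)
        + rho * (RR N / N) * inverse (harm N) + \<bar>rho / 2 * (S3 N / harm N) - rho\<^sup>2 / 2\<bar> < e) sequentially"
      using order_tendstoD(2)[OF lim] by blast
    then obtain n0 where n0: "\<And>N. N \<ge> n0 \<Longrightarrow> e' * (S3 N / harm N) + C * (R1 N / (real N)\<^sup>2) * inverse (harm N)
        + rho * (RR N / N) * inverse (harm N) + \<bar>rho / 2 * (S3 N / harm N) - rho\<^sup>2 / 2\<bar> < e"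
      unfolding eventually_sequentially by blast
    show "\<exists>no. \<forall>N\<ge>no. norm (HH N / ((real N)\<^sup>2 * harm N) - rho\<^sup>2 / 2) < e"
    proof (intro exI allI impI)
      fix N assume N: "N \<ge> max n0 1"
      define D where "D = (real N)\<^sup>2 * harm N"
      have h: "harm N > (0::real)" using N by (simp add: harm_pos)
      have n: "real N > 0" using N by simp
      have D: "D > 0" using h n by (simp add: D_def)
      have "\<bar>HH N / D - rho / 2 * (S3 N / harm N)\<bar> = \<bar>HH N - rho / 2 * ((real N)\<^sup>2 * S3 N)\<bar> / D"
      proof -
        have "HH N / D - rho / 2 * (S3 N / harm N) = (HH N - rho / 2 * ((real N)\<^sup>2 * S3 N)) / D"
          using n unfolding D_def by (simp add: diff_divide_distrib)
        then show ?thesis using D by (simp add: abs_divide)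
      qed
      also have "\<dots> \<le> (e' * ((real N)\<^sup>2 * S3 N) + C * R1 N + rho * (N * RR N)) / D"
        using C[of N] D by (intro divide_right_mono) auto
      also have "\<dots> = e' * (S3 N / harm N) + C * (R1 N / (real N)\<^sup>2) * inverse (harm N) + rho * (RR N / N) * inverse (harm N)"
      proof -
        have "(a * (x\<^sup>2 * t) + b * u + c * (x * v)) / (x\<^sup>2 * y) = a * (t / y) + b * (u / x\<^sup>2) * inverse y + c * (v / x) * inverse y"
          if "x > 0" "y > 0" for a b c t u v x y :: real
          using that by (simp add: field_simps power2_eq_square)
        from this[OF n h] show ?thesis unfolding D_def .
      qed
      finally have "\<bar>HH N / D - rho / 2 * (S3 N / harm N)\<bar> \<le> \<dots>" .
      then show "norm (HH N / ((real N)\<^sup>2 * harm N) - rho\<^sup>2 / 2) < e"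
        using n0[of N] N unfolding D_def[symmetric] by simp
    qed
  qed
qed

section \<open>Convolution with an absolutely summable weight\<close>

lemma filterlim_div_at_top:
  assumes "d > 0"
  shows "filterlim (\<lambda>N :: nat. N div d) at_top sequentially"
  unfolding filterlim_at_top eventually_sequentially
  using assms by (metis div_le_mono div_mult_self1_is_m mult.commute nonzero_mult_div_cancel_left less_numeral_extra(3))

lemma div_ratio_lim:
  assumes "d > 0"
  shows "(\<lambda>N. real (N div d) / real N) \<longlonglongrightarrow> 1 / real d"
proof (rule tendsto_sandwich)
  show "eventually (\<lambda>N. 1 / real d - 1 / real N \<le> real (N div d) / real N) sequentially"
    using eventually_gt_at_top[of 0]
  proof eventually_elim
    case (elim N)
    have "real N / d \<le> real (N div d) + 1"
      using floor_divide_of_nat_eq[of N d, where ?'a = real] real_of_int_floor_add_one_ge[of "real N / real d"]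
      by (metis of_int_of_nat_eq)
    then have "(real N / d - 1) / N \<le> real (N div d) / N" by (intro divide_right_mono) auto
    then show ?case using elim by (simp add: diff_divide_distrib)
  qed
  show "eventually (\<lambda>N. real (N div d) / real N \<le> 1 / real d) sequentially"
    using eventually_gt_at_top[of 0]
  proof eventually_elim
    case (elim N)
    have "real (N div d) / N \<le> (real N / d) / N" by (intro divide_right_mono real_of_nat_div_le) auto
    then show ?case using elim by simp
  qed
  show "(\<lambda>N. 1 / real d - 1 / real N) \<longlonglongrightarrow> 1 / real d"
    using tendsto_diff[OF tendsto_const[of "1 / real d"] lim_1_over_n] by simp
qed simp

lemma harm_div_ratio_lim:
  assumes d: "d > 0"
  shows "(\<lambda>N. harm (N div d) / harm N :: real) \<longlonglongrightarrow> 1"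
proof (rule tendsto_sandwich)
  have *: "harm N - harm (N div d) \<le> real d" for N
  proof -
    define M where "M = N div d"
    have "M \<le> N" by (simp add: M_def)
    then have "{1..N} = {1..M} \<union> {M + 1..N}" by auto
    then have "harm N = (\<Sum>n\<in>{1..M} \<union> {M + 1..N}. 1 / real n)" by (simp add: harm_sum)
    also have "\<dots> = harm M + (\<Sum>n=M + 1..N. 1 / real n)"
      unfolding harm_sum by (rule sum.union_disjoint) auto
    finally have "harm N - harm M = (\<Sum>n=M + 1..N. 1 / real n)" by simp
    also have "\<dots> \<le> (\<Sum>n=M + 1..N. 1 / real (M + 1))"
      by (intro sum_mono divide_left_mono) auto
    also have "\<dots> = real (N - M) / real (M + 1)" by simp
    also have "\<dots> \<le> d"
    proof -
      have "N < d * (M + 1)" using d by (simp add: M_def dividend_less_times_div)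
      then have "N - M \<le> d * (M + 1)" by simp
      then have "real (N - M) \<le> real d * real (M + 1)" by (metis of_nat_le_iff of_nat_mult)
      then show ?thesis by (simp add: divide_le_eq)
    qed
    finally show ?thesis by (simp add: M_def)
  qed
  show "eventually (\<lambda>N. 1 - real d * inverse (harm N) \<le> harm (N div d) / harm N) sequentially"
    using eventually_gt_at_top[of 0]
  proof eventually_elim
    case (elim N)
    then have h: "harm N > (0::real)" by (simp add: harm_pos)
    then have h0: "harm N \<noteq> (0::real)" by (rule less_imp_neq[symmetric])
    have "(harm N - real d) / harm N \<le> harm (N div d) / harm N"
      by (rule divide_right_mono) (use *[of N] in simp, rule less_imp_le[OF h])
    also have "(harm N - real d) / harm N = 1 - real d * inverse (harm N)"
      by (simp only: diff_divide_distrib divide_self[OF h0] divide_inverse[of "real d"])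
    finally show ?case .
  qed
  show "eventually (\<lambda>N. harm (N div d) / harm N \<le> (1::real)) sequentially"
    using eventually_gt_at_top[of 0]
  proof eventually_elim
    case (elim N)
    then have "harm N > (0::real)" by (simp add: harm_pos)
    moreover have "harm (N div d) \<le> (harm N :: real)" by (rule harm_mono) simp
    ultimately show ?case by simp
  qed
  have "(\<lambda>N. inverse (harm N :: real)) \<longlonglongrightarrow> 0"
    by (rule tendsto_inverse_0_at_top[OF harm_at_top])
  from tendsto_diff[OF tendsto_const tendsto_mult[OF tendsto_const this], of 1 "real d"]
  show "(\<lambda>N. 1 - real d * inverse (harm N)) \<longlonglongrightarrow> 1" by simp
qed simp

text \<open>Tannery's theorem: the d-th term is \<open>w d * H (N div d) / g N\<close>. It tends to
  \<open>w d / d ^ 2 * c\<close> and is dominated by a constant times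
  \<open>\<bar>w d\<bar> / d ^ 2\<close>, uniformly in N.\<close>

lemma dconv_sum_lim:
  fixes w h :: "nat \<Rightarrow> real"
  assumes lim: "(\<lambda>N. (\<Sum>n=1..N. h n) / ((real N)\<^sup>2 * harm N)) \<longlonglongrightarrow> c"
    and w: "summable (\<lambda>n. \<bar>w n\<bar> / (real n)\<^sup>2)"
  shows "(\<lambda>N. (\<Sum>n=1..N. dconv w h n) / ((real N)\<^sup>2 * harm N)) \<longlonglongrightarrow> c * (\<Sum>n. w n / (real n)\<^sup>2)"
proof -
  define g where "g N = (real N)\<^sup>2 * harm N" for N
  define H where "H N = (\<Sum>n=1..N. h n)" for N
  have g_pos: "g N > 0" if "N > 0" for N using that by (simp add: g_def harm_pos)
  have "Bseq (\<lambda>N. H N / g N)" unfolding H_def g_def by (rule convergent_imp_Bseq) (use lim in \<open>auto simp: convergent_def\<close>)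
  then obtain B where B: "B > 0" "\<And>N. \<bar>H N / g N\<bar> \<le> B" unfolding Bseq_def by auto
  have HB: "\<bar>H N\<bar> \<le> B * g N" for N
  proof (cases "N = 0")
    case False
    then show ?thesis using B(2)[of N] g_pos[of N] by (simp add: abs_divide divide_le_eq)
  qed (simp add: H_def g_def)
  define a where "a d N = (if d \<in> {1..N} then w d * H (N div d) / g N else 0)" for d N
  have "(\<Sum>n=1..N. dconv w h n) / g N = (\<Sum>d. a d N)" for N
  proof -
    have "(\<Sum>d. a d N) = (\<Sum>d\<in>{1..N}. a d N)" by (rule suminf_finite) (auto simp: a_def)
    also have "\<dots> = (\<Sum>d\<in>{1..N}. w d * H (N div d)) / g N" by (simp add: a_def sum_divide_distrib)
    finally show ?thesis unfolding sum_dconv H_def ..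
  qed
  moreover have "(\<lambda>N. \<Sum>d. a d N) \<longlonglongrightarrow> (\<Sum>d. w d / (real d)\<^sup>2 * c)"
  proof (rule tannerys_theorem[THEN conjunct2, THEN conjunct2])
    show "(\<lambda>N. a d N) \<longlonglongrightarrow> w d / (real d)\<^sup>2 * c" for d
    proof (cases "d = 0")
      case False
      then have d: "d > 0" by simp
      have "(\<lambda>N. H (N div d) / g (N div d)) \<longlonglongrightarrow> c"
        using filterlim_compose[OF lim filterlim_div_at_top[OF d]] unfolding H_def g_def .
      moreover have "(\<lambda>N. (real (N div d) / real N)\<^sup>2 * (harm (N div d) / harm N)) \<longlonglongrightarrow> (1 / real d)\<^sup>2 * 1"
        by (intro tendsto_mult tendsto_power div_ratio_lim harm_div_ratio_lim d)
      ultimately have "(\<lambda>N. w d * (H (N div d) / g (N div d) * ((real (N div d) / real N)\<^sup>2 * (harm (N div d) / harm N))))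
          \<longlonglongrightarrow> w d * (c * ((1 / real d)\<^sup>2 * 1))"
        by (rule tendsto_mult[OF tendsto_const tendsto_mult])
      moreover have "eventually (\<lambda>N. w d * (H (N div d) / g (N div d) * ((real (N div d) / real N)\<^sup>2 * (harm (N div d) / harm N))) = a d N) sequentially"
        using eventually_ge_at_top[of d]
      proof eventually_elim
        case (elim N)
        then have "N div d > 0" using d by (simp add: div_greater_zero_iff)
        then have gM: "g (N div d) \<noteq> 0" by (rule less_imp_neq[OF g_pos, symmetric])
        then have "H (N div d) / g (N div d) * (g (N div d) / g N) = H (N div d) / g N" by simp
        moreover have "(real (N div d) / real N)\<^sup>2 * (harm (N div d) / harm N) = g (N div d) / g N"
          by (simp add: g_def power_divide)
        ultimately have "H (N div d) / g (N div d) * ((real (N div d) / real N)\<^sup>2 * (harm (N div d) / harm N)) = H (N div d) / g N"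
          by (simp only:)
        then show ?case using elim d by (simp only: a_def) simp
      qed
      ultimately have "(\<lambda>N. a d N) \<longlonglongrightarrow> w d * (c * ((1 / real d)\<^sup>2 * 1))" by (simp only: tendsto_cong)
      then show ?thesis by (simp add: power_divide mult.commute)
    qed (simp add: a_def)
    have "norm (a d N) \<le> B * (\<bar>w d\<bar> / (real d)\<^sup>2)" for d N
    proof (cases "d \<in> {1..N}")
      case True
      then have d: "d > 0" and gN: "g N > 0" using g_pos by auto
      have "g (N div d) \<le> (real N / d)\<^sup>2 * harm N"
        unfolding g_def by (intro mult_mono power_mono real_of_nat_div_le harm_mono) (auto simp: harm_nonneg)
      also have "\<dots> = g N / (real d)\<^sup>2" by (simp add: g_def power_divide)
      finally have "B * g (N div d) \<le> B * (g N / (real d)\<^sup>2)" using B by (intro mult_left_mono) auto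
      with HB[of "N div d"] have "\<bar>H (N div d)\<bar> \<le> B * (g N / (real d)\<^sup>2)" by linarith
      then have "\<bar>w d\<bar> * \<bar>H (N div d)\<bar> / g N \<le> \<bar>w d\<bar> * (B * (g N / (real d)\<^sup>2)) / g N"
        using gN by (intro divide_right_mono mult_left_mono) auto
      then show ?thesis using True gN by (simp add: a_def abs_mult abs_divide mult_ac)
    next
      case False
      then have "a d N = 0" by (simp only: a_def if_False)
      then show ?thesis using B(1) by simp
    qed
    then show "eventually (\<lambda>(d, N). norm (a d N) \<le> B * (\<bar>w d\<bar> / (real d)\<^sup>2)) (at_top \<times>\<^sub>F sequentially)"
      by (intro always_eventually) auto
    show "summable (\<lambda>d. B * (\<bar>w d\<bar> / (real d)\<^sup>2))" using w by (rule summable_mult)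
  qed simp
  moreover have "(\<Sum>d. w d / (real d)\<^sup>2 * c) = c * (\<Sum>n. w n / (real n)\<^sup>2)"
  proof -
    have "summable (\<lambda>n. w n / (real n)\<^sup>2)"
      by (rule summable_rabs_cancel) (use w in \<open>simp add: abs_divide\<close>)
    then show ?thesis by (subst suminf_mult[symmetric]) (auto simp: mult.commute)
  qed
  ultimately show ?thesis by (simp add: g_def)
qed

section \<open>Absolutely convergent Dirichlet series\<close>

lemma has_sum_times_real:
  fixes f :: "'a \<Rightarrow> real" and g :: "'b \<Rightarrow> real"
  assumes f: "(f has_sum a) A" and g: "(g has_sum b) B"
  shows "((\<lambda>(i, j). f i * g j) has_sum (a * b)) (A \<times> B)"
proof (rule has_sum_SigmaI[where g = "\<lambda>i. f i * b"])
  show "((\<lambda>j. case (i, j) of (i, j) \<Rightarrow> f i * g j) has_sum f i * b) B" for i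
    using has_sum_cmult_right[OF g] by simp
  show "((\<lambda>i. f i * b) has_sum a * b) A" using has_sum_cmult_left[OF f] by simp
  have "(\<lambda>i. \<bar>f i\<bar>) summable_on A"
    using f summable_on_iff_abs_summable_on_real[of f A] by (auto simp: summable_on_def)
  moreover obtain b' where b': "((\<lambda>j. \<bar>g j\<bar>) has_sum b') B"
    using g summable_on_iff_abs_summable_on_real[of g B] by (auto simp: summable_on_def)
  ultimately have "(\<lambda>(i, j). \<bar>f i\<bar> * \<bar>g j\<bar>) summable_on (A \<times> B)"
    by (intro summable_on_SigmaI[where g = "\<lambda>i. \<bar>f i\<bar> * b'"])
      (auto intro: has_sum_cmult_right summable_on_cmult_left)
  then have "(\<lambda>p. norm (case p of (i, j) \<Rightarrow> f i * g j)) summable_on (A \<times> B)"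
    by (simp add: case_prod_unfold abs_mult)
  then show "(\<lambda>(i, j). f i * g j) summable_on (A \<times> B)"
    using summable_on_iff_abs_summable_on_real by blast
qed

text \<open>The product series over pairs is regrouped by the product of the indices. The term at 0
  is 0 because its denominator is \<open>0 ^ k\<close> with positive \<open>k\<close>.\<close>

lemma has_sum_dconv:
  fixes f g :: "nat \<Rightarrow> real"
  assumes f: "((\<lambda>n. f n / real n ^ k) has_sum a) UNIV" and g: "((\<lambda>n. g n / real n ^ k) has_sum b) UNIV"
    and k: "k > 0"
  shows "((\<lambda>n. dconv f g n / real n ^ k) has_sum (a * b)) UNIV"
proof -
  have pos: "((\<lambda>n. f n / real n ^ k) has_sum a) {0<..} \<longleftrightarrow> ((\<lambda>n. f n / real n ^ k) has_sum a) UNIV" for f :: "nat \<Rightarrow> real" and a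
    using k by (intro has_sum_cong_neutral) auto
  have "((\<lambda>(i, j). (f i / real i ^ k) * (g j / real j ^ k)) has_sum (a * b)) ({0<..} \<times> {0<..})"
    using has_sum_times_real f g pos by blast
  also have "?this \<longleftrightarrow> ((\<lambda>(n, d). f d * g (n div d) / real n ^ k) has_sum (a * b)) (SIGMA n:{0<..}. {d. d dvd n})"
    by (rule has_sum_reindex_bij_witness[of _ "\<lambda>(n, d). (d, n div d)" "\<lambda>(i, j). (i * j, i)"])
      (auto elim!: dvdE simp: power_mult_distrib)
  finally have "((\<lambda>n. \<Sum>d | d dvd n. f d * g (n div d) / real n ^ k) has_sum (a * b)) {0<..}"
    by (rule has_sum_SigmaD) (auto intro!: has_sum_finiteI)
  then have "((\<lambda>n. dconv f g n / real n ^ k) has_sum (a * b)) {0<..}"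
    by (simp add: dconv_def sum_divide_distrib)
  then show ?thesis using pos by blast
qed

text \<open>The Dirichlet series of \<open>sqf f\<close> at \<open>s\<close> is that of \<open>f\<close> at \<open>2 s\<close>.\<close>

definition sqf :: "(nat \<Rightarrow> real) \<Rightarrow> nat \<Rightarrow> real" where
  "sqf f n = (\<Sum>i | i\<^sup>2 = n. f i)"

lemma sqf_square [simp]: "sqf f (n\<^sup>2) = f n"
proof -
  have "{i. i\<^sup>2 = n\<^sup>2} = {n}" by auto
  then show ?thesis by (simp add: sqf_def)
qed

lemma sqf_nonsquare: "n \<notin> range (\<lambda>i. i\<^sup>2) \<Longrightarrow> sqf f n = 0"
  unfolding sqf_def by (rule sum.neutral) auto

text \<open>For square \<open>n\<close> only square divisors contribute, and they correspond to the
  divisors of the root.\<close>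

lemma dconv_sqf: "dconv (sqf f) (sqf g) n = sqf (dconv f g) n"
proof (cases "n \<in> range (\<lambda>i. i\<^sup>2)")
  case True
  then obtain i where i: "n = i\<^sup>2" by blast
  show ?thesis
  proof (cases "i = 0")
    case False
    then have i0: "i > 0" by simp
    have "dconv (sqf f) (sqf g) n = (\<Sum>d\<in>(\<lambda>e. e\<^sup>2) ` {e. e dvd i}. sqf f d * sqf g (n div d))"
      unfolding dconv_def
    proof (rule sum.mono_neutral_right)
      show "finite {d. d dvd n}" using i i0 by simp
      show "(\<lambda>e. e\<^sup>2) ` {e. e dvd i} \<subseteq> {d. d dvd n}" using i by (auto simp: dvd_power_same)
      show "\<forall>d\<in>{d. d dvd n} - (\<lambda>e. e\<^sup>2) ` {e. e dvd i}. sqf f d * sqf g (n div d) = 0"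
      proof (intro ballI, rule ccontr)
        fix d assume d: "d \<in> {d. d dvd n} - (\<lambda>e. e\<^sup>2) ` {e. e dvd i}" and "sqf f d * sqf g (n div d) \<noteq> 0"
        then obtain e where "d = e\<^sup>2" using sqf_nonsquare[of d f] by auto
        moreover have "e dvd i" using d i \<open>d = e\<^sup>2\<close> by (auto simp: pow_divides_pow_iff)
        ultimately show False using d by blast
      qed
    qed
    also have "\<dots> = (\<Sum>e | e dvd i. sqf f (e\<^sup>2) * sqf g (n div e\<^sup>2))"
      by (subst sum.reindex) (auto simp: inj_on_def)
    also have "\<dots> = (\<Sum>e | e dvd i. f e * g (i div e))"
    proof (rule sum.cong[OF refl])
      fix e assume "e \<in> {e. e dvd i}"
      then have "n div e\<^sup>2 = (i div e)\<^sup>2" unfolding i by (simp add: div_power)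
      then show "sqf f (e\<^sup>2) * sqf g (n div e\<^sup>2) = f e * g (i div e)" by simp
    qed
    finally show ?thesis by (simp add: i dconv_def)
  qed (use sqf_square[of "dconv f g" 0] in \<open>simp add: i\<close>)
next
  case False
  have "sqf f d * sqf g (n div d) = 0" if "d dvd n" for d
  proof (rule ccontr)
    assume "sqf f d * sqf g (n div d) \<noteq> 0"
    then obtain e k where "d = e\<^sup>2" "n div d = k\<^sup>2"
      using sqf_nonsquare[of d f] sqf_nonsquare[of "n div d" g] by auto
    then have "n = (e * k)\<^sup>2" using that by (metis dvd_mult_div_cancel power_mult_distrib)
    then show False using False by blast
  qed
  then have "dconv (sqf f) (sqf g) n = 0" unfolding dconv_def by (intro sum.neutral) blast
  then show ?thesis using False by (simp add: sqf_nonsquare)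
qed

lemma has_sum_sqf:
  assumes "((\<lambda>n. f n / real n ^ (2 * k)) has_sum a) UNIV"
  shows "((\<lambda>n. sqf f n / real n ^ k) has_sum a) UNIV"
proof -
  have inj: "inj (\<lambda>i::nat. i\<^sup>2)" by (auto simp: inj_on_def)
  have "((\<lambda>n. sqf f n / real n ^ k) has_sum a) (range (\<lambda>i. i\<^sup>2))"
    unfolding has_sum_reindex[OF inj] using assms by (simp add: o_def power_mult)
  then show ?thesis
    by (rule has_sum_cong_neutral[THEN iffD1, rotated -1]) (auto simp: sqf_nonsquare)
qed

definition dunit :: "nat \<Rightarrow> real" where "dunit n = (if n = 1 then 1 else 0)"

lemma dconv_dunit:
  assumes "f 0 = 0" shows "dconv dunit f = f"
proof
  fix n show "dconv dunit f n = f n"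
  proof (cases "n = 0")
    case False
    have "dconv dunit f n = (\<Sum>d\<in>{1}. dunit d * f (n div d))"
      unfolding dconv_def by (rule sum.mono_neutral_right) (use False in \<open>auto simp: dunit_def\<close>)
    then show ?thesis by (simp add: dunit_def)
  qed (use assms in simp)
qed

text \<open>The recursion for the Dirichlet inverse of a function with value 1 at 1.\<close>

function dinv :: "(nat \<Rightarrow> real) \<Rightarrow> nat \<Rightarrow> real" where
  "dinv f n = (if n = 1 then 1 else - (\<Sum>d\<in>{d. d dvd n \<and> d < n}. dinv f d * f (n div d)))"
  by pat_completeness auto
termination by (relation "Wellfounded.measure snd") auto

declare dinv.simps [simp del]

lemma dinv_0 [simp]: "dinv f 0 = 0"
  by (subst dinv.simps) simp

lemma dinv_1 [simp]: "dinv f (Suc 0) = 1"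
  by (subst dinv.simps) simp

lemma dconv_dinv:
  assumes "f 1 = 1"
  shows "dconv (dinv f) f = dunit"
proof
  fix n show "dconv (dinv f) f n = dunit n"
  proof (cases "n > 1")
    case True
    have "{d. d dvd n} = insert n {d. d dvd n \<and> d < n}"
      using True by (auto dest: dvd_imp_le intro: le_neq_implies_less)
    then have "dconv (dinv f) f n = dinv f n * f (n div n) + (\<Sum>d\<in>{d. d dvd n \<and> d < n}. dinv f d * f (n div d))"
      unfolding dconv_def by (simp add: sum.insert)
    also have "\<dots> = 0" using True assms by (simp add: dinv.simps[of f n])
    finally show ?thesis using True by (simp add: dunit_def)
  next
    case False
    then have "n = 0 \<or> n = 1" by linarith
    then show ?thesis by (auto simp: dunit_def dconv_def assms[simplified])
  qed
qed

text \<open>By induction the recursive sum is at most n^k times the sum of f(e) / e^k over the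
  divisors e > 1. That sum is at most S - 1 \<le> 1.\<close>

lemma dinv_bound:
  assumes f: "\<And>n. f n \<ge> 0" "f 1 = 1" and S: "((\<lambda>n. f n / real n ^ k) has_sum S) UNIV" "S \<le> 2"
  shows "\<bar>dinv f n\<bar> \<le> real n ^ k"
proof (induction n rule: less_induct)
  case (less n)
  consider "n = 0" | "n = 1" | "n > 1" by linarith
  then show ?case
  proof cases
    case 3
    let ?D = "{d. d dvd n \<and> d < n}"
    have "\<bar>dinv f n\<bar> = \<bar>\<Sum>d\<in>?D. dinv f d * f (n div d)\<bar>" using 3 by (simp add: dinv.simps[of f n])
    also have "\<dots> \<le> (\<Sum>d\<in>?D. real d ^ k * f (n div d))"
      by (rule order_trans[OF sum_abs sum_mono]) (use less.IH f(1) in \<open>auto simp: abs_mult mult_right_mono\<close>)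
    also have "\<dots> = (\<Sum>e\<in>{e. e dvd n \<and> 1 < e}. real n ^ k * (f e / real e ^ k))"
    proof (rule sum.reindex_bij_witness[of _ "\<lambda>e. n div e" "\<lambda>d. n div d"])
      fix d assume "d \<in> ?D"
      then obtain e where e: "n = d * e" "d < d * e" by auto
      then show "n div (n div d) = d" "n div d \<in> {e. e dvd n \<and> 1 < e}"
        "real n ^ k * (f (n div d) / real (n div d) ^ k) = real d ^ k * f (n div d)"
        by (auto simp: power_mult_distrib)
    next
      fix e assume "e \<in> {e. e dvd n \<and> 1 < e}"
      then obtain d where "n = d * e" "1 < e" by (auto elim!: dvdE simp: mult.commute)
      moreover from this 3 have "d > 0" by (auto intro: Nat.gr0I)
      ultimately show "n div (n div e) = e" "n div e \<in> ?D" by auto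
    qed
    also have "\<dots> = real n ^ k * (\<Sum>e\<in>{e. e dvd n \<and> 1 < e}. f e / real e ^ k)" by (simp add: sum_distrib_left)
    also have "\<dots> \<le> real n ^ k * 1"
    proof (rule mult_left_mono)
      have fin: "finite {e. e dvd n \<and> 1 < e}" using 3 by simp
      have "(\<Sum>e\<in>insert 1 {e. e dvd n \<and> 1 < e}. f e / real e ^ k) \<le> S"
        by (rule has_sum_mono2[OF has_sum_finite S(1)]) (use fin f(1) in auto)
      then show "(\<Sum>e\<in>{e. e dvd n \<and> 1 < e}. f e / real e ^ k) \<le> 1"
        using fin S(2) f(2) by simp
    qed simp
    finally show ?thesis by simp
  qed simp_all
qed

lemma has_sum_zeta2: "((\<lambda>n. 1 / real n ^ 2) has_sum (pi\<^sup>2 / 6)) UNIV"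
  using zeta2_sums by (rule sums_nonneg_imp_has_sum) auto

lemma has_sum_zeta4: "((\<lambda>n. 1 / real n ^ 4) has_sum (pi ^ 4 / 90)) UNIV"
  using zeta4_sums by (rule sums_nonneg_imp_has_sum) auto

lemma has_sum_chi:
  assumes "(\<lambda>n. of_int (chi5 n) / real n ^ k) sums S" "k \<ge> 2"
  shows "((\<lambda>n. chi n / real n ^ k) has_sum S) UNIV"
proof (rule norm_summable_imp_has_sum)
  show "(\<lambda>n. chi n / real n ^ k) sums S" using assms by (simp add: chi_def)
  have "\<bar>chi n\<bar> \<le> 1" for n using abs_chi5[of n] unfolding chi_def by linarith
  then show "summable (\<lambda>n. norm (chi n / real n ^ k))"
    by (intro summable_comparison_test'[OF summable_power[OF assms(2)], where N = 0])
      (simp add: abs_divide divide_right_mono)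
qed

definition zeta_K2 :: real where "zeta_K2 = 4 * pi\<^sup>2 / (25 * sqrt 5) * (pi\<^sup>2 / 6)"
definition zeta_K4 :: real where "zeta_K4 = 8 * pi ^ 4 / (375 * sqrt 5) * (pi ^ 4 / 90)"

lemma has_sum_zeta_K2: "((\<lambda>n. rr n / real n ^ 2) has_sum zeta_K2) UNIV"
  unfolding rr_def zeta_K2_def
  by (rule has_sum_dconv[OF has_sum_chi[OF chi5_L2] has_sum_zeta2]) auto

lemma has_sum_zeta_K4: "((\<lambda>n. rr n / real n ^ 4) has_sum zeta_K4) UNIV"
  unfolding rr_def zeta_K4_def
  by (rule has_sum_dconv[OF has_sum_chi[OF chi5_L4] has_sum_zeta4]) auto

lemma rr_1: "rr 1 = 1"
  by (simp add: rr_def dconv_def chi_def chi5_def)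

text \<open>The bound required by \<open>dinv_bound\<close>. The telescoping estimate pi^2/6 \<le> 2
  is sharp enough, since 4 * 144 = 576 is below 300 * 2.\<close>

lemma zeta_K2_le: "zeta_K2 \<le> 2"
proof -
  have partial: "(\<Sum>n<Suc (Suc N). 1 / real n ^ 2) \<le> 2 - 1 / real (Suc N)" for N
  proof (induction N)
    case (Suc N)
    have "1 / real (Suc (Suc N)) ^ 2 \<le> 1 / (real (Suc N) * real (Suc (Suc N)))"
      by (intro divide_left_mono) (auto simp: power2_eq_square)
    also have "\<dots> = 1 / real (Suc N) - 1 / real (Suc (Suc N))"
      by (simp add: field_simps)
    finally show ?case using Suc.IH by (simp del: of_nat_Suc)
  qed simp
  have "(\<Sum>n<N. 1 / real n ^ 2) \<le> 2" for N
  proof -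
    have "(\<Sum>n<N. 1 / real n ^ 2) \<le> (\<Sum>n<Suc (Suc N). 1 / real n ^ 2)" by (rule sum_mono2) auto
    also have "\<dots> \<le> 2" using partial[of N] by (rule order_trans) simp
    finally show ?thesis .
  qed
  then have "pi\<^sup>2 / 6 \<le> 2"
    using zeta2_sums unfolding sums_def by (intro LIMSEQ_le_const2) auto
  then have p: "pi\<^sup>2 \<le> 12" by simp
  have "sqrt 5 \<ge> 2" by (rule real_le_rsqrt) simp
  have "pi\<^sup>2 * pi\<^sup>2 \<le> 12 * 12" using p by (intro mult_mono) auto
  then have "4 * pi\<^sup>2 * pi\<^sup>2 \<le> 2 * (25 * sqrt 5 * 6)" using \<open>sqrt 5 \<ge> 2\<close> by linarith
  then show ?thesis by (simp add: zeta_K2_def divide_le_eq)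
qed

lemma zeta_K_ratio: "zeta_K2\<^sup>2 / zeta_K4 = 3 / sqrt 5"
proof -
  have "sqrt 5 ^ 2 = 5" by simp
  then show ?thesis
    by (simp add: zeta_K2_def zeta_K4_def power_mult_distrib power_divide power_mult[symmetric] divide_simps)
qed

lemma dconv_left_commute: "dconv f (dconv g h) = dconv g (dconv f h)"
  by (simp only: dconv_assoc[symmetric] dconv_commute[of f g])

text \<open>Inverting \<open>sqf rr\<close> turns the identity into a convolution of
  \<open>hh\<close> with \<open>w\<close>, the coefficients of zeta(s)^2 / zeta(2 s). Their series
  at 2 converges absolutely, and \<open>dconv_sum_lim\<close> applies.\<close>

lemma dirichlet_identity_asymptotics:
  assumes id: "\<And>n. n > 0 \<Longrightarrow> dconv (sqf rr) s n = dconv (dconv (\<lambda>k. real k * rr k) rr) (dconv (\<lambda>k. real k * rr k) rr) n"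
  shows "(\<lambda>N. (\<Sum>n=1..N. s n) / ((real N)\<^sup>2 * harm N)) \<longlonglongrightarrow> rho\<^sup>2 / 2 * (3 / sqrt 5)"
proof -
  define v where "v = dinv rr"
  define w where "w = dconv (sqf v) (dconv rr rr)"
  \<comment> \<open>Every convolution vanishes at 0. Setting the value there to 0 lets the
    identities hold between functions, so that associativity can be used.\<close>
  define s' where "s' n = (if n = 0 then 0 else s n)" for n
  let ?g = "\<lambda>k. real k * rr k"
  have "dconv (sqf rr) s' n = dconv (dconv ?g rr) (dconv ?g rr) n" for n
  proof (cases "n = 0")
    case False
    then have "dconv (sqf rr) s' n = dconv (sqf rr) s n"
      unfolding dconv_def by (intro sum.cong) (auto simp: s'_def dvd_div_eq_0_iff)
    then show ?thesis using id False by simp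
  qed simp
  then have 1: "dconv (sqf rr) s' = dconv (dconv ?g rr) (dconv ?g rr)" by (rule ext)
  have 2: "dconv (sqf v) (sqf rr) = dunit"
  proof
    fix n
    have "sqf dunit n = dunit n"
    proof (cases "n \<in> range (\<lambda>i. i\<^sup>2)")
      case True
      then obtain i where "n = i\<^sup>2" by blast
      then show ?thesis by (simp add: dunit_def)
    qed (auto simp: sqf_nonsquare dunit_def intro: range_eqI[of _ _ 1])
    then show "dconv (sqf v) (sqf rr) n = dunit n"
      by (simp add: dconv_sqf v_def dconv_dinv[where f = rr, OF rr_1])
  qed
  have "s' = dconv dunit s'" by (simp add: dconv_dunit s'_def)
  also have "\<dots> = dconv (sqf v) (dconv (dconv ?g rr) (dconv ?g rr))" by (simp only: 2[symmetric] dconv_assoc 1)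
  also have "dconv (dconv ?g rr) (dconv ?g rr) = dconv (dconv rr rr) hh"
    unfolding hh_def by (simp only: dconv_assoc dconv_commute dconv_left_commute)
  finally have s': "s' = dconv w hh" by (simp only: w_def dconv_assoc)
  \<comment> \<open>The inverse coefficients are at most n^2, so at 4 they are dominated by 1 /
    n^2.\<close>
  have "summable (\<lambda>n. norm (v n / real n ^ 4))"
  proof (rule summable_comparison_test'[OF summable_power[of 2], where N = 0])
    fix n :: nat
    have "\<bar>v n\<bar> \<le> real n ^ 2" unfolding v_def
      by (rule dinv_bound[where f = rr, OF rr_nonneg rr_1 has_sum_zeta_K2 zeta_K2_le])
    then have "\<bar>v n\<bar> / real n ^ 4 \<le> real n ^ 2 / real n ^ 4" by (intro divide_right_mono) auto
    also have "\<dots> = 1 / real n ^ 2" by (simp add: power2_eq_square power4_eq_xxxx)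
    finally show "norm (norm (v n / real n ^ 4)) \<le> 1 / real n ^ 2" by (simp add: abs_divide)
  qed simp
  then have "(\<lambda>n. v n / real n ^ 4) summable_on UNIV" by (rule norm_summable_imp_summable_on)
  then obtain V where V: "((\<lambda>n. v n / real n ^ 4) has_sum V) UNIV" by (auto simp: summable_on_def)
  have "((\<lambda>n. dconv v rr n / real n ^ 4) has_sum (V * zeta_K4)) UNIV"
    by (rule has_sum_dconv[OF V has_sum_zeta_K4]) simp
  moreover have "((\<lambda>n. dunit n / real n ^ 4) has_sum 1) UNIV"
    using has_sum_cong_neutral[of UNIV "{1}" "\<lambda>n. dunit n / real n ^ 4" "\<lambda>n. dunit n / real n ^ 4" 1]
      has_sum_finiteI[of "{1}" 1 "\<lambda>n. dunit n / real n ^ 4"] by (auto simp: dunit_def)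
  ultimately have VZ: "V * zeta_K4 = 1"
    unfolding v_def dconv_dinv[where f = rr, OF rr_1] by (rule has_sum_unique)
  have W: "((\<lambda>n. w n / real n ^ 2) has_sum (V * (zeta_K2 * zeta_K2))) UNIV"
    unfolding w_def by (intro has_sum_dconv has_sum_sqf has_sum_zeta_K2) (use V in simp_all)
  have "(\<lambda>n. \<bar>w n / real n ^ 2\<bar>) summable_on UNIV"
    using W summable_on_iff_abs_summable_on_real[of "\<lambda>n. w n / real n ^ 2"] by (auto simp: summable_on_def)
  then have "summable (\<lambda>n. \<bar>w n\<bar> / (real n)\<^sup>2)"
    using summable_on_imp_summable by (fastforce simp: abs_divide)
  then have lim: "(\<lambda>N. (\<Sum>n=1..N. dconv w hh n) / ((real N)\<^sup>2 * harm N)) \<longlonglongrightarrow> rho\<^sup>2 / 2 * (\<Sum>n. w n / (real n)\<^sup>2)"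
    by (rule dconv_sum_lim[OF HH_lim[unfolded HH_def]])
  have "(\<Sum>n. w n / (real n)\<^sup>2) = V * (zeta_K2 * zeta_K2)"
    using sums_unique[OF has_sum_imp_sums[OF W]] by simp
  also have "\<dots> = zeta_K2\<^sup>2 / zeta_K4"
  proof -
    have "zeta_K4 \<noteq> 0" using VZ by auto
    then show ?thesis using VZ by (simp add: field_simps power2_eq_square)
  qed
  finally have "(\<lambda>N. (\<Sum>n=1..N. s' n) / ((real N)\<^sup>2 * harm N)) \<longlonglongrightarrow> rho\<^sup>2 / 2 * (3 / sqrt 5)"
    using lim by (simp only: s' zeta_K_ratio)
  moreover have "(\<Sum>n=1..N. s' n) = (\<Sum>n=1..N. s n)" for N by (rule sum.cong) (auto simp: s'_def)
  ultimately show ?thesis by simp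
qed

text \<open>Passes from integers to real x. The Euler-Mascheroni limit replaces \<open>harm\<close>
  by \<open>ln\<close>, and rounding x down changes neither factor asymptotically.\<close>

lemma summatory_asymp_equiv:
  fixes s :: "nat \<Rightarrow> real"
  assumes lim: "(\<lambda>N. (\<Sum>n=1..N. s n) / ((real N)\<^sup>2 * harm N)) \<longlonglongrightarrow> c" and c: "c \<noteq> 0"
  shows "(\<lambda>x::real. \<Sum>m | 1 \<le> m \<and> real m \<le> x. s m) \<sim>[at_top] (\<lambda>x. c * x\<^sup>2 * ln x)"
proof (rule asymp_equivI')
  define N where "N x = nat \<lfloor>x\<rfloor>" for x :: real
  define S where "S M = (\<Sum>n=1..M. s n)" for M
  have N_top: "filterlim N sequentially at_top"
    unfolding N_def by (rule filterlim_compose[OF filterlim_nat_sequentially filterlim_floor_sequentially])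
  have N_real: "real (N x) = real_of_int \<lfloor>x\<rfloor>" if "x \<ge> 0" for x using that by (simp add: N_def)
  have "((\<lambda>x. S (N x) / ((real (N x))\<^sup>2 * harm (N x))) \<longlongrightarrow> c) at_top"
    using filterlim_compose[OF lim N_top] unfolding S_def .
  moreover have ratio: "((\<lambda>x. real (N x) / x) \<longlongrightarrow> 1) at_top"
  proof -
    have "((\<lambda>x::real. real_of_int \<lfloor>x\<rfloor> / x) \<longlongrightarrow> 1) at_top" by real_asymp
    moreover have "eventually (\<lambda>x. real_of_int \<lfloor>x\<rfloor> / x = real (N x) / x) at_top"
      using eventually_ge_at_top[of "0::real"] by eventually_elim (simp only: N_real)
    ultimately show ?thesis by (rule Lim_transform_eventually)
  qed
  moreover have "((\<lambda>x. harm (N x) / ln x) \<longlongrightarrow> 1) at_top"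
  proof -
    have "((\<lambda>x. harm (N x) - ln (real (N x)) :: real) \<longlongrightarrow> euler_mascheroni) at_top"
      using filterlim_compose[OF euler_mascheroni_LIMSEQ N_top] by simp
    moreover have "((\<lambda>x::real. inverse (ln x)) \<longlongrightarrow> 0) at_top" by real_asymp
    ultimately have "((\<lambda>x. (harm (N x) - ln (real (N x))) * inverse (ln x)) \<longlongrightarrow> euler_mascheroni * 0) at_top"
      by (rule tendsto_mult)
    moreover have "((\<lambda>x::real. ln (real_of_int \<lfloor>x\<rfloor>) / ln x) \<longlongrightarrow> 1) at_top" by real_asymp
    ultimately have "((\<lambda>x. (harm (N x) - ln (real (N x))) * inverse (ln x) + ln (real_of_int \<lfloor>x\<rfloor>) / ln x)
        \<longlongrightarrow> euler_mascheroni * 0 + 1) at_top" by (rule tendsto_add)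
    moreover have "eventually (\<lambda>x. (harm (N x) - ln (real (N x))) * inverse (ln x) + ln (real_of_int \<lfloor>x\<rfloor>) / ln x = harm (N x) / ln x) at_top"
      using eventually_ge_at_top[of "0::real"]
      by eventually_elim (simp add: N_real divide_inverse left_diff_distrib)
    ultimately show ?thesis by (simp add: tendsto_cong)
  qed
  ultimately have "((\<lambda>x. S (N x) / ((real (N x))\<^sup>2 * harm (N x)) * ((real (N x) / x)\<^sup>2 * (harm (N x) / ln x)) / c)
      \<longlongrightarrow> c * (1\<^sup>2 * 1) / c) at_top"
    by (intro tendsto_divide tendsto_mult tendsto_power tendsto_const c)
  moreover have "eventually (\<lambda>x. S (N x) / ((real (N x))\<^sup>2 * harm (N x)) * ((real (N x) / x)\<^sup>2 * (harm (N x) / ln x)) / c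
      = (\<Sum>m | 1 \<le> m \<and> real m \<le> x. s m) / (c * x\<^sup>2 * ln x)) at_top"
    using eventually_ge_at_top[of "1::real"]
  proof eventually_elim
    case (elim x)
    have "real m \<le> x \<longleftrightarrow> m \<le> N x" for m
      using elim by (simp add: N_def le_nat_iff le_floor_iff)
    then have "{m. 1 \<le> m \<and> real m \<le> x} = {m. 1 \<le> m \<and> m \<le> N x}" by (simp only:)
    also have "\<dots> = {1..N x}" by auto
    finally have "{m. 1 \<le> m \<and> real m \<le> x} = {1..N x}" .
    moreover have "N x \<noteq> 0" using elim by (simp add: N_def)
    moreover from this have "harm (N x) \<noteq> (0::real)"
      by (intro less_imp_neq[OF harm_pos, symmetric]) simp
    ultimately show ?case by (simp add: S_def power_divide)
  qed
  ultimately show "((\<lambda>x. (\<Sum>m | 1 \<le> m \<and> real m \<le> x. s m) / (c * x\<^sup>2 * ln x)) \<longlongrightarrow> 1) at_top"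
    using c by (simp add: tendsto_cong)
qed

section \<open>Numerical value of the constant\<close>

lemma sqrt5_bounds: "22360678 / 10000000 \<le> sqrt 5" "sqrt 5 \<le> 2236068 / 1000000"
  by (rule real_le_rsqrt, simp add: power2_eq_square) (rule real_le_lsqrt, simp_all add: power2_eq_square)

lemma ln_golden_bounds: "4812116 / 10000000 \<le> ln golden" "ln golden \<le> 481213 / 1000000"
proof -
  \<comment> \<open>The arguments of \<open>ln\<close> here and below are the bounds of
    \<open>golden\<close> that follow from \<open>sqrt5_bounds\<close>.\<close>
  have "(4812116 / 10000000 :: real) \<le> ln (16180339 / 10000000)"
    using ln_approx_bounds[of "16180339 / 10000000" "Suc (Suc (Suc (Suc (Suc 0))))"] by (simp add: power_divide)
  also have "\<dots> \<le> ln golden" using sqrt5_bounds by (simp add: golden_def)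
  finally show "4812116 / 10000000 \<le> ln golden" .
  have "ln golden \<le> ln (1618034 / 1000000)" using sqrt5_bounds by (simp add: golden_def)
  also have "\<dots> \<le> 481213 / 1000000"
    using ln_approx_bounds[of "1618034 / 1000000" "Suc (Suc (Suc (Suc (Suc 0))))"] by (simp add: power_divide)
  finally show "ln golden \<le> 481213 / 1000000" .
qed

text \<open>The tolerance is half a unit of the sixth decimal, which dictates the precision of the
  brackets for \<open>sqrt 5\<close> and \<open>ln golden\<close>.\<close>

lemma constant_approx: "\<bar>6 * (ln golden)\<^sup>2 / (5 * sqrt 5) - 0.124271\<bar> \<le> 0.0000005"
proof -
  have abs_bound: "1242705 / 10000000 \<le> C \<Longrightarrow> C \<le> 1242715 / 10000000 \<Longrightarrow> \<bar>C - 0.124271\<bar> \<le> 0.0000005" for C :: real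
    unfolding abs_le_iff by auto
  have "(4812116 / 10000000)\<^sup>2 \<le> (ln golden)\<^sup>2" "(ln golden)\<^sup>2 \<le> (481213 / 1000000)\<^sup>2"
    using ln_golden_bounds by (intro power_mono; simp)+
  then have l: "23156460 / 100000000 \<le> (ln golden)\<^sup>2" "(ln golden)\<^sup>2 \<le> 23156596 / 100000000"
    by (simp_all add: power2_eq_square)
  have "1242705 / 10000000 * (5 * sqrt 5) \<le> 6 * (ln golden)\<^sup>2" using l(1) sqrt5_bounds(2) by simp
  then have "1242705 / 10000000 \<le> 6 * (ln golden)\<^sup>2 / (5 * sqrt 5)" by (subst pos_le_divide_eq) simp_all
  moreover have "6 * (ln golden)\<^sup>2 \<le> 1242715 / 10000000 * (5 * sqrt 5)" using l(2) sqrt5_bounds(1) by simp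
  then have "6 * (ln golden)\<^sup>2 / (5 * sqrt 5) \<le> 1242715 / 10000000" by (subst pos_divide_le_eq) simp_all
  ultimately show ?thesis
    using abs_bound[of "6 * (ln golden)\<^sup>2 / (5 * sqrt 5)"] by blast
qed

lemma dconv_cong:
  assumes "\<And>d. d > 0 \<Longrightarrow> f d = f' d" "\<And>d. d > 0 \<Longrightarrow> g d = g' d"
  shows "dconv f g n = dconv f' g' n"
proof (cases "n = 0")
  case False
  show ?thesis unfolding dconv_def
  proof (rule sum.cong[OF refl])
    fix d assume "d \<in> {d. d dvd n}"
    then have "d > 0" "n div d > 0" using False by (auto elim!: dvdE)
    then show "f d * g (n div d) = f' d * g' (n div d)" using assms by simp
  qed
qed simp

lemma of_nat_dconv: "real (dconv f g n) = dconv (\<lambda>k. real (f k)) (\<lambda>k. real (g k)) n"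
  by (simp add: dconv_def)

lemma sqf_rr_eq_card: "n > 0 \<Longrightarrow> sqf rr n = real (card (zids_sq n))"
proof (cases "n \<in> range (\<lambda>i. i\<^sup>2)")
  case True
  assume "n > 0"
  with True obtain k where k: "n = k\<^sup>2" "k > 0" by (auto intro: Nat.gr0I)
  have "zids_sq n = zids k" by (auto simp: zids_sq_def k)
  then show ?thesis using k by (simp add: rr_eq_card)
next
  case False
  then have "zids_sq n = {}" by (auto simp: zids_sq_def)
  then show ?thesis using False by (simp add: sqf_nonsquare)
qed

lemma card_rids_norm_rr:
  assumes "n > 0"
  shows "dconv (\<lambda>k. real k * rr k) rr n = real (card (rids_norm n))"
proof -
  have "dconv (\<lambda>k. real k * rr k) rr n = dconv (\<lambda>k. real (k * card (zids k))) (\<lambda>k. real (card (zids k))) n"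
    by (rule dconv_cong) (simp_all add: rr_eq_card)
  also have "\<dots> = real (dconv (\<lambda>k. k * card (zids k)) (\<lambda>k. card (zids k)) n)" by (simp only: of_nat_dconv)
  finally show ?thesis using card_rids_norm[OF assms] by (simp add: dconv_def)
qed

theorem corollary4:
  shows "(\<lambda>x::real. \<Sum>m | 1 \<le> m \<and> real m \<le> x. real (f_icosian m))
           \<sim>[at_top] (\<lambda>x. 6 * (ln golden)\<^sup>2 / (5 * sqrt 5) * x\<^sup>2 * ln x)
       \<and> \<bar>6 * (ln golden)\<^sup>2 / (5 * sqrt 5) - 0.124271\<bar> \<le> 0.0000005"
proof
  have "dconv (sqf rr) (\<lambda>m. real (f_icosian m)) n
      = dconv (dconv (\<lambda>k. real k * rr k) rr) (dconv (\<lambda>k. real k * rr k) rr) n" if "n > 0" for n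
  proof -
    have "dconv (sqf rr) (\<lambda>m. real (f_icosian m)) n = dconv (\<lambda>i. real (card (zids_sq i))) (\<lambda>i. real (card (simsubs i))) n"
      by (rule dconv_cong) (simp_all add: sqf_rr_eq_card f_icosian_eq)
    also have "\<dots> = dconv (\<lambda>i. real (card (rids_norm i))) (\<lambda>i. real (card (rids_norm i))) n"
      by (simp only: of_nat_dconv[symmetric] dconv_rids_norm[OF that])
    also have "\<dots> = dconv (dconv (\<lambda>k. real k * rr k) rr) (dconv (\<lambda>k. real k * rr k) rr) n"
      by (rule dconv_cong) (simp_all only: card_rids_norm_rr)
    finally show ?thesis .
  qed
  then have lim: "(\<lambda>N. (\<Sum>m=1..N. real (f_icosian m)) / ((real N)\<^sup>2 * harm N)) \<longlonglongrightarrow> rho\<^sup>2 / 2 * (3 / sqrt 5)"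
    by (rule dirichlet_identity_asymptotics)
  have const: "rho\<^sup>2 / 2 * (3 / sqrt 5) = 6 * (ln golden)\<^sup>2 / (5 * sqrt 5)"
    by (simp add: rho_def power_divide power_mult_distrib)
  have "golden > 1" using golden_bounds by simp
  then have "6 * (ln golden)\<^sup>2 / (5 * sqrt 5) \<noteq> 0" by simp
  then show "(\<lambda>x::real. \<Sum>m | 1 \<le> m \<and> real m \<le> x. real (f_icosian m))
      \<sim>[at_top] (\<lambda>x. 6 * (ln golden)\<^sup>2 / (5 * sqrt 5) * x\<^sup>2 * ln x)"
    using lim unfolding const by (rule summatory_asymp_equiv[rotated])
  show "\<bar>6 * (ln golden)\<^sup>2 / (5 * sqrt 5) - 0.124271\<bar> \<le> 0.0000005"
    by (rule constant_approx)
qed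

end
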